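(* Let $B=(0,1)$. Assume that $G:\mathbb{R}\to\mathbb{R}$ is a nondecreasing, Lipschitz continuous function, that $k\in C^1([0,1])$ is a strictly positive function, and that $u_0\in BV([0,1])\cap L^\infty([0,1])$. For a positive integer $N$ let $\Delta x=1/(N+1)$, let $\Delta t>0$, and let $u_{\Delta t}$ be the piecewise constant function produced by the implicit difference scheme described in the context, with $\mu=\Delta t/\Delta x^2$ bounded from below by a positive constant. Then, as $\Delta t\to0$, the sequence $\{u_{\Delta t}\}_{\Delta t>0}$ converges, uniformly in $t\in[0,T]$ with values in $L^1(B)$ for every $T>0$, to an entropy solution $u$ of $$\partial_t u=\partial_x\left(k(x)\partial_x G(u)\right)\ \text{in }(0,\infty)\times(0,1),\qquad k(x)\partial_xG(u)\big|_{x=0,1}=0,\qquad u(0,x)=u_0(x).$$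
   Context: Scheme: put $x_j=(j+1/2)\Delta x$, so $x_{j-1/2}=j\Delta x$, $t_n=n\Delta t$, $k_{j-1/2}=k(x_{j-1/2})$, and $\Delta_\pm a_j=\pm(a_{j\pm1}-a_j)$. Set $u^0_j=\frac1{\Delta x}\int_{x_{j-1/2}}^{x_{j+1/2}}u_0(x)\,dx$ for $j=0,\dots,N$. For $n\ge0$, $u^{n+1}=(u^{n+1}_0,\dots,u^{n+1}_N)$ is the unique solution of $$u^{n+1}_j-\mu\,\Delta_+\left(k_{j-1/2}\,\Delta_-G(u^{n+1}_j)\right)=u^n_j,\qquad j=0,\dots,N,$$ i.e. $u^{n+1}_j-\mu\left[k_{j+1/2}(G(u^{n+1}_{j+1})-G(u^{n+1}_j))-k_{j-1/2}(G(u^{n+1}_j)-G(u^{n+1}_{j-1}))\right]=u^n_j$, with boundary conditions $\Delta_-u^{n+1}_0=\Delta_+u^{n+1}_N=0$ (i.e. $u^{n+1}_{-1}=u^{n+1}_0$ and $u^{n+1}_{N+1}=u^{n+1}_N$). Define $u_{\Delta t}:[0,\infty)\times B\to\mathbb{R}$ by $u_{\Delta t}(t,x)=u^n_j$ for $(t,x)\in[t_n,t_{n+1})\times[x_{j-1/2},x_{j+1/2})$. Notation: $\Omega=[0,\infty)\times B$, $\Omega_T=[0,T]\times B$, and $g(u)=\int^u\sqrt{G'(\xi)}\,d\xi$ (an antiderivative of $\sqrt{G'}$). Test functions in $C_0^\infty(\Omega)$ are smooth with compact support in $[0,\infty)\times B$ (they need not vanish at $t=0$). Weak solution: a function $u\in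 C([0,\infty);L^1(B))$ is a weak solution with initial data $u_0$ if $u\in L^\infty(\Omega)$; $\partial_xG(u)\in L^2(\Omega_T)$ for every $T>0$; $k\,\partial_xG(u)=0$ in the sense of traces at $x=0,1$ for a.e. $t$; and for every $\varphi\in C_0^\infty(\Omega)$ $$\int_\Omega\left[u\,\partial_t\varphi-k(x)\,\partial_xG(u)\,\partial_x\varphi\right]dt\,dx+\int_B u_0(x)\varphi(0,x)\,dx=0.$$ Entropy solution: a function $u\in C([0,\infty);L^1(B))$ that is a weak solution with initial data $u_0$ and such that for every convex $\eta\in C^2(\mathbb{R})$, every nonnegative $\varphi\in C_0^\infty(\Omega)$ and every $T>0$ $$\int_{\Omega_T}\left[\eta(u)\partial_t\varphi-\eta'(u)\,k(x)\,\partial_xG(u)\,\partial_x\varphi\right]dx\,dt-\int_B\eta(u(T,x))\varphi(T,x)\,dx+\int_B\eta(u_0(x))\varphi(0,x)\,dx\ \ge\ \int_{\Omega_T}\eta''(u)\,k(x)\left(\partial_xg(u)\right)^2\varphi\,dx\,dt.$$ *)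

theory Defs
  imports "HOL-Analysis.Analysis"
begin

text \<open>Points of space-time are pairs \<open>(t, x) :: real \<times> real\<close>.  All integrals and all
  almost-everywhere statements are with respect to Lebesgue measure.\<close>

abbreviation B :: "real set" where
  "B \<equiv> {0<..<1}"

definition Om :: "(real \<times> real) set" where
  "Om = {0..} \<times> B"

definition OmT :: "real \<Rightarrow> (real \<times> real) set" where
  "OmT T = {0..T} \<times> B"


definition L2_on :: "'a::euclidean_space set \<Rightarrow> ('a \<Rightarrow> real) \<Rightarrow> bool" where
  "L2_on A f \<longleftrightarrow> set_borel_measurable lebesgue A f \<and> set_integrable lebesgue A (\<lambda>z. (f z)\<^sup>2)"

definition Linf_on :: "'a::euclidean_space set \<Rightarrow> ('a \<Rightarrow> real) \<Rightarrow> bool" where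
  "Linf_on A f \<longleftrightarrow> set_borel_measurable lebesgue A f \<and>
     (\<exists>M. AE z in lebesgue. z \<in> A \<longrightarrow> \<bar>f z\<bar> \<le> M)"

definition L1loc_on :: "'a::euclidean_space set \<Rightarrow> ('a \<Rightarrow> real) \<Rightarrow> bool" where
  "L1loc_on A f \<longleftrightarrow> (\<forall>K. compact K \<and> K \<subseteq> A \<longrightarrow> set_integrable lebesgue K f)"

text \<open>\<open>BV([0,1])\<close> for Lebesgue classes of functions: integrable, with finite essential variation
  \<open>sup {\<integral> f \<phi>' | \<phi> \<in> C\<^sub>c\<^sup>1(0,1), \<bar>\<phi>\<bar> \<le> 1}\<close>.  In particular every function of bounded pointwise
  variation on \<open>[0,1]\<close> is included.\<close>

definition BV01 :: "(real \<Rightarrow> real) \<Rightarrow> bool" where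
  "BV01 f \<longleftrightarrow> set_integrable lebesgue {0..1} f \<and>
     (\<exists>V. \<forall>\<phi>. (\<forall>x. \<phi> differentiable (at x)) \<and> continuous_on UNIV (deriv \<phi>) \<and>
              (\<exists>K. compact K \<and> K \<subseteq> B \<and> (\<forall>x. x \<notin> K \<longrightarrow> \<phi> x = 0)) \<and> (\<forall>x. \<bar>\<phi> x\<bar> \<le> 1)
        \<longrightarrow> (LINT x:{0..1}|lebesgue. f x * deriv \<phi> x) \<le> V)"

definition C1_01 :: "(real \<Rightarrow> real) \<Rightarrow> bool" where
  "C1_01 f \<longleftrightarrow> (\<exists>f'. (\<forall>x\<in>{0..1}. (f has_real_derivative f' x) (at x within {0..1})) \<and>
                     continuous_on {0..1} f')"

definition C2 :: "(real \<Rightarrow> real) \<Rightarrow> bool" where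
  "C2 f \<longleftrightarrow> (\<forall>x. f differentiable (at x)) \<and> (\<forall>x. deriv f differentiable (at x)) \<and>
            continuous_on UNIV (deriv (deriv f))"

definition Dt :: "(real \<times> real \<Rightarrow> real) \<Rightarrow> real \<times> real \<Rightarrow> real" where
  "Dt f = (\<lambda>(t, x). deriv (\<lambda>s. f (s, x)) t)"

definition Dx :: "(real \<times> real \<Rightarrow> real) \<Rightarrow> real \<times> real \<Rightarrow> real" where
  "Dx f = (\<lambda>(t, x). deriv (\<lambda>y. f (t, y)) x)"

text \<open>\<open>C\<^sup>\<infinity>\<close> on the plane: all iterated partial derivatives exist and are (Frechet) differentiable.\<close>

coinductive smooth2 :: "(real \<times> real \<Rightarrow> real) \<Rightarrow> bool" where
  "(\<forall>z. f differentiable (at z)) \<Longrightarrow> smooth2 (Dt f) \<Longrightarrow> smooth2 (Dx f) \<Longrightarrow> smooth2 f"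

text \<open>\<open>C\<^sub>0\<^sup>\<infinity>(W)\<close> for open \<open>W\<close>, as functions on the plane vanishing off a compact subset of \<open>W\<close>.\<close>

definition test_on :: "(real \<times> real) set \<Rightarrow> (real \<times> real \<Rightarrow> real) \<Rightarrow> bool" where
  "test_on W \<phi> \<longleftrightarrow> smooth2 \<phi> \<and> (\<exists>K. compact K \<and> K \<subseteq> W \<and> (\<forall>z. z \<notin> K \<longrightarrow> \<phi> z = 0))"

text \<open>The elements of \<open>C\<^sub>0\<^sup>\<infinity>([0,\<infinity>) \<times> B)\<close>, which need not vanish at \<open>t = 0\<close>, are the
  restrictions to \<open>t \<ge> 0\<close> of smooth functions with compact support in \<open>\<real> \<times> B\<close>; only
  their values on \<open>t \<ge> 0\<close> are used below.\<close>

abbreviation test_Om :: "(real \<times> real \<Rightarrow> real) \<Rightarrow> bool" where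
  "test_Om \<equiv> test_on (UNIV \<times> B)"

definition test_time :: "(real \<Rightarrow> real) \<Rightarrow> bool" where
  "test_time \<psi> \<longleftrightarrow> (\<forall>n t. ((deriv ^^ n) \<psi>) differentiable (at t)) \<and>
     (\<exists>K. compact K \<and> K \<subseteq> {0<..} \<and> (\<forall>t. t \<notin> K \<longrightarrow> \<psi> t = 0))"

text \<open>\<open>w\<close> is the weak derivative \<open>\<partial>\<^sub>x v\<close> in \<open>(0,\<infinity>) \<times> B\<close>.\<close>

definition weak_Dx :: "(real \<times> real \<Rightarrow> real) \<Rightarrow> (real \<times> real \<Rightarrow> real) \<Rightarrow> bool" where
  "weak_Dx v w \<longleftrightarrow> L1loc_on ({0<..} \<times> B) v \<and> L1loc_on ({0<..} \<times> B) w \<and>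
     (\<forall>\<phi>. test_on ({0<..} \<times> B) \<phi> \<longrightarrow>
        (LINT z:Om|lebesgue. v z * Dx \<phi> z) = - (LINT z:Om|lebesgue. w z * \<phi> z))"

text \<open>Trace of a flux \<open>f\<close> at the endpoint \<open>a \<in> {0,1}\<close>.  The flux \<open>f = k \<partial>\<^sub>xG(u)\<close> of a weak solution
  is only an \<open>L\<^sup>2\<close> function for which the field \<open>(u, -f)\<close> is divergence free, so its trace on the
  lateral boundary is the normal trace: \<open>f\<close> averaged over a layer of width \<open>\<epsilon>\<close> at \<open>a\<close> converges to
  the trace function \<open>\<tau>\<close> of \<open>t\<close> in the sense of distributions in \<open>t\<close>.\<close>

definition has_trace :: "(real \<times> real \<Rightarrow> real) \<Rightarrow> real \<Rightarrow> (real \<Rightarrow> real) \<Rightarrow> bool" where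
  "has_trace f a \<tau> \<longleftrightarrow> L1loc_on {0<..} \<tau> \<and>
     (\<forall>\<psi>. test_time \<psi> \<longrightarrow>
        ((\<lambda>\<epsilon>. (1 / \<epsilon>) * (LINT z:{0..} \<times> (B \<inter> ball a \<epsilon>)|lebesgue. f z * \<psi> (fst z)))
          \<longlongrightarrow> (LINT t:{0..}|lebesgue. \<tau> t * \<psi> t)) (at_right 0))"

text \<open>The antiderivative \<open>g\<close> of \<open>sqrt G'\<close> normalized by \<open>g 0 = 0\<close>; a Lipschitz \<open>G\<close> is
  differentiable almost everywhere, so the junk values of \<^const>\<open>deriv\<close> do not matter.\<close>

definition gfun :: "(real \<Rightarrow> real) \<Rightarrow> real \<Rightarrow> real" where
  "gfun G u = (LINT \<xi>=0..ereal u|lebesgue. sqrt (deriv G \<xi>))"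

definition C_L1 :: "(real \<times> real \<Rightarrow> real) \<Rightarrow> bool" where
  "C_L1 u \<longleftrightarrow> (\<forall>t\<ge>0. set_integrable lebesgue B (\<lambda>x. u (t, x))) \<and>
     (\<forall>t\<ge>0. ((\<lambda>s. LINT x:B|lebesgue. \<bar>u (s, x) - u (t, x)\<bar>) \<longlongrightarrow> 0) (at t within {0..}))"

text \<open>\<open>q\<close> plays the role of \<open>\<partial>\<^sub>x G(u)\<close>.\<close>

definition weak_solution_with ::
  "(real \<Rightarrow> real) \<Rightarrow> (real \<Rightarrow> real) \<Rightarrow> (real \<Rightarrow> real) \<Rightarrow> (real \<times> real \<Rightarrow> real) \<Rightarrow> (real \<times> real \<Rightarrow> real) \<Rightarrow> bool"
  where
  "weak_solution_with G k u0 u q \<longleftrightarrow>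
     C_L1 u \<and> Linf_on Om u \<and>
     weak_Dx (\<lambda>z. G (u z)) q \<and> (\<forall>T>0. L2_on (OmT T) q) \<and>
     (\<forall>a\<in>{0, 1}. \<exists>\<tau>. has_trace (\<lambda>z. k (snd z) * q z) a \<tau> \<and>
                    (AE t in lebesgue. 0 < t \<longrightarrow> \<tau> t = 0)) \<and>
     (\<forall>\<phi>. test_Om \<phi> \<longrightarrow>
        (LINT z:Om|lebesgue. u z * Dt \<phi> z - k (snd z) * q z * Dx \<phi> z)
        + (LINT x:B|lebesgue. u0 x * \<phi> (0, x)) = 0)"

definition weak_solution ::
  "(real \<Rightarrow> real) \<Rightarrow> (real \<Rightarrow> real) \<Rightarrow> (real \<Rightarrow> real) \<Rightarrow> (real \<times> real \<Rightarrow> real) \<Rightarrow> bool" where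
  "weak_solution G k u0 u \<longleftrightarrow> (\<exists>q. weak_solution_with G k u0 u q)"

text \<open>\<open>p\<close> plays the role of \<open>\<partial>\<^sub>x g(u)\<close>; it is required to be square integrable on every
  \<open>\<Omega>\<^sub>T\<close>, so that the right-hand side of the entropy inequality is a convergent integral.\<close>

definition entropy_solution ::
  "(real \<Rightarrow> real) \<Rightarrow> (real \<Rightarrow> real) \<Rightarrow> (real \<Rightarrow> real) \<Rightarrow> (real \<times> real \<Rightarrow> real) \<Rightarrow> bool" where
  "entropy_solution G k u0 u \<longleftrightarrow>
     (\<exists>q p. weak_solution_with G k u0 u q \<and>
        weak_Dx (\<lambda>z. gfun G (u z)) p \<and> (\<forall>T>0. L2_on (OmT T) p) \<and>
        (\<forall>\<eta> \<phi> T. C2 \<eta> \<and> convex_on UNIV \<eta> \<and> test_Om \<phi> \<and> (\<forall>z\<in>Om. 0 \<le> \<phi> z) \<and> 0 < T \<longrightarrow>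
           (LINT z:OmT T|lebesgue. \<eta> (u z) * Dt \<phi> z - deriv \<eta> (u z) * k (snd z) * q z * Dx \<phi> z)
           - (LINT x:B|lebesgue. \<eta> (u (T, x)) * \<phi> (T, x))
           + (LINT x:B|lebesgue. \<eta> (u0 x) * \<phi> (0, x))
           \<ge> (LINT z:OmT T|lebesgue. deriv (deriv \<eta>) (u z) * k (snd z) * (p z)\<^sup>2 * \<phi> z)))"


definition dx :: "nat \<Rightarrow> real" where
  "dx N = 1 / (real N + 1)"

text \<open>One implicit step from \<open>w\<close> to \<open>v\<close>.  Grid functions are indexed by \<open>int\<close>, with the ghost
  cells \<open>-1\<close> and \<open>N + 1\<close> carrying the boundary conditions; the last clause only normalizes the
  indices that do not belong to the scheme, so that \<open>v\<close> can be unique as a function.\<close>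

definition implicit_step ::
  "(real \<Rightarrow> real) \<Rightarrow> (real \<Rightarrow> real) \<Rightarrow> nat \<Rightarrow> real \<Rightarrow> (int \<Rightarrow> real) \<Rightarrow> (int \<Rightarrow> real) \<Rightarrow> bool" where
  "implicit_step G k N dt w v \<longleftrightarrow>
     (\<forall>j\<in>{0..int N}.
        v j - dt / (dx N)\<^sup>2 *
          (k (of_int (j + 1) * dx N) * (G (v (j + 1)) - G (v j))
           - k (of_int j * dx N) * (G (v j) - G (v (j - 1)))) = w j) \<and>
     v (-1) = v 0 \<and> v (int N + 1) = v (int N) \<and>
     (\<forall>j. j < -1 \<or> int N + 1 < j \<longrightarrow> v j = 0)"

primrec scheme ::
  "(real \<Rightarrow> real) \<Rightarrow> (real \<Rightarrow> real) \<Rightarrow> (real \<Rightarrow> real) \<Rightarrow> nat \<Rightarrow> real \<Rightarrow> nat \<Rightarrow> int \<Rightarrow> real" where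
  "scheme G k u0 N dt 0 =
     (\<lambda>j. 1 / dx N * (LINT x:{of_int j * dx N..of_int (j + 1) * dx N}|lebesgue. u0 x))"
| "scheme G k u0 N dt (Suc n) = (THE v. implicit_step G k N dt (scheme G k u0 N dt n) v)"

text \<open>\<open>(t, x)\<close> lies in \<open>[n \<Delta>t, (n+1) \<Delta>t) \<times> [j \<Delta>x, (j+1) \<Delta>x)\<close> for the \<open>n\<close>, \<open>j\<close> given by the floors.\<close>

definition u_dt ::
  "(real \<Rightarrow> real) \<Rightarrow> (real \<Rightarrow> real) \<Rightarrow> (real \<Rightarrow> real) \<Rightarrow> nat \<Rightarrow> real \<Rightarrow> real \<times> real \<Rightarrow> real" where
  "u_dt G k u0 N dt = (\<lambda>(t, x). scheme G k u0 N dt (nat \<lfloor>t / dt\<rfloor>) \<lfloor>x / dx N\<rfloor>)"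

end

theory Submission
  imports Defs
begin

text \<open>
 One implicit step is conservative, monotone and solvable, so the scheme obeys a maximum principle and
 does not increase the total variation (\<open>nat_step_bounds\<close>, \<open>nat_step_total_variation\<close>). Its discrete flux
 is therefore bounded in \<open>L\<^sup>1\<close>, which makes the approximations \<open>1/2\<close>-Hoelder in time with values in
 \<open>L\<^sup>1\<close>, up to the time step (\<open>L1_time\<close>).

 Convergence of the whole family, uniformly in time, comes from comparing two discretizations with each
 other. For exact solutions the primitives \<open>U\<close> in \<open>x\<close> satisfy \<open>\<partial>\<^sub>t U = k \<partial>\<^sub>x G(u)\<close>, hence
 \<open>d/dt \<integral> (U - U')\<^sup>2 / (2 k) = - \<integral> (G(u) - G(u')) (u - u') \<le> 0\<close>. For two discretizations the same computation
 holds up to an error that vanishes with the mesh sizes (\<open>E_cell\<close>, \<open>E_growth\<close>); the lower bound on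
 \<open>\<Delta>t / \<Delta>x\<^sup>2\<close> forces \<open>\<Delta>x\<close> to zero with \<open>\<Delta>t\<close>. So the primitives are close, and since the
 functions themselves have bounded variation, an interpolation inequality (\<open>L1_interpolation\<close>) turns this
 into closeness in \<open>L\<^sup>1\<close> (\<open>L1_distance\<close>). The approximations are a Cauchy family; their limit is \<open>u\<close>.

 For the equation, the scheme is multiplied by \<open>\<eta>'(u) \<phi>\<close>. Summation by parts gives a discrete entropy
 inequality whose dissipation contains \<open>(\<Delta>g(u))\<^sup>2\<close>, because \<open>(g b - g a)\<^sup>2 \<le> (b - a) (G b - G a)\<close> by
 Cauchy-Schwarz (\<open>gfun_diff_square_le\<close>, \<open>discrete_entropy\<close>); this needs that a monotone Lipschitz function is
 differentiable almost everywhere (\<open>mono_lipschitz_differentiable_AE\<close>). With \<open>\<eta>(u) = u\<^sup>2/2\<close> it bounds the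
 difference quotients of \<open>G(u)\<close> and \<open>g(u)\<close> in \<open>L\<^sup>2\<close>. Convex combinations of them converge strongly by Mazur's
 argument to limits \<open>q\<close> and \<open>p\<close>, and inequalities that are convex in the quotients survive
 (\<open>weak_limit_exists\<close>). The outcome is \<open>limit_inequality\<close>, valid for Lipschitz test functions that need not
 vanish on the lateral boundary. Everything else is a choice of \<open>\<eta>\<close> and \<open>\<phi>\<close> in it: \<open>\<eta>(u) = \<plusminus>u\<close> gives the
 weak formulation, the same \<open>\<eta>\<close> with a hat function over an endpoint shows that the flux has trace zero
 (\<open>layer_flux_bound\<close>), and a convex \<open>\<eta>\<close> gives the entropy inequality. That \<open>q = \<partial>\<^sub>x G(u)\<close> and
 \<open>p = \<partial>\<^sub>x g(u)\<close> weakly is summation by parts again (\<open>weak_derivative\<close>).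
\<close>

lemmas lint_cong = Bochner_Integration.integral_cong
lemmas dominated_integrable = Bochner_Integration.integrable_bound

section \<open>Differentiability of monotone Lipschitz functions\<close>

text \<open>Vitali covering: inside an open set \<open>U \<supseteq> E\<close> of almost the same measure, the intervals of slope at most
 \<open>r\<close> contain a disjoint sequence that covers \<open>E\<close> up to a Lebesgue null set, which \<open>ac\<close> makes null
 for the Stieltjes measure too; on each interval the Stieltjes measure is at most \<open>r\<close> times its length.\<close>

lemma emeasure_le_of_fine_intervals:
 fixes F :: "real => real" and r :: real
 assumes F: "mono F" "continuous_on UNIV F" and r: "0 <= r"
  and ac: "!!A. A \<in> sets borel ==> emeasure lborel A = 0 ==> emeasure (interval_measure F) A = 0"
  and E: "E \<in> sets borel" "emeasure lborel E < \<infinity>"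
  and fine: "!!x d. x \<in> E ==> 0 < d ==>
     \<exists>u v. u <= x \<and> x <= v \<and> u < v \<and> v - u < d \<and> F v - F u <= r * (v - u)"
 shows "emeasure (interval_measure F) E <= ennreal r * emeasure lborel E"
proof (rule ennreal_le_epsilon)
 fix e :: real assume "0 < e"
 let ?\<nu> = "interval_measure F"
 define e' where "e' = e / (r + 1)"
 have e': "0 < e'" "r * e' <= e" using \<open>0 < e\<close> r by (auto simp: e'_def field_simps)
 obtain U where U: "open U" "E \<subseteq> U" "emeasure lborel (U - E) < e'"
  using outer_regular_lborel[OF E(1) e'(1)] by blast
 define K where "K = {(u, v). u < v \<and> {u..v} \<subseteq> U \<and> F v - F u <= r * (v - u)}"
 define ctr where "ctr = (%p::real\<times>real. (fst p + snd p) / 2)"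
 define rad where "rad = (%p::real\<times>real. (snd p - fst p) / 2)"
 have cb: "cball (ctr p) (rad p) = {fst p..snd p}" if "p \<in> K" for p
  using that by (auto simp: cball_eq_atLeastAtMost ctr_def rad_def K_def field_simps)
 have radpos: "0 < rad p" if "p \<in> K" for p using that by (auto simp: K_def rad_def)
 have S: "\<exists>i. i \<in> K \<and> x \<in> cball (ctr i) (rad i) \<and> rad i < d" if "x \<in> E" "0 < d" for x d
 proof -
  have "x \<in> U" using that U by auto
  then obtain d' where d': "0 < d'" "ball x d' \<subseteq> U" using U(1) by (meson open_contains_ball)
  obtain u v where uv: "u <= x" "x <= v" "u < v" "v - u < min d d'" "F v - F u <= r * (v - u)"
   using fine[of x "min d d'"] \<open>x \<in> E\<close> \<open>0 < d\<close> d'(1) min_less_iff_conj by metis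
  have "{u..v} \<subseteq> ball x d'" using uv by (auto simp: dist_real_def)
  then have K: "(u, v) \<in> K" using uv d' by (auto simp: K_def)
  show ?thesis
   by (rule exI[of _ "(u,v)"]) (use K cb[OF K] uv in \<open>auto simp: rad_def\<close>)
 qed
 obtain C where C: "countable C" "C \<subseteq> K"
   "pairwise (%i j. disjnt (cball (ctr i) (rad i)) (cball (ctr j) (rad j))) C"
   "negligible (E - (\<Union>i \<in> C. cball (ctr i) (rad i)))"
  using Vitali_covering_theorem_cballs[of K rad E ctr, OF radpos S] by blast
 define W where "W = (\<Union>i\<in>C. {fst i..snd i})"
 have W: "W = (\<Union>i \<in> C. cball (ctr i) (rad i))" unfolding W_def using cb C(2) by (intro SUP_cong) auto
 have Wb[measurable]: "W \<in> sets borel" unfolding W_def using C(1) by (intro sets.countable_UN'') auto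
 have dis: "disjoint_family_on (%i. {fst i..snd i}) C"
  unfolding disjoint_family_on_def
 proof (intro ballI impI)
  fix i j assume ij: "i \<in> C" "j \<in> C" "i \<noteq> j"
  then have "cball (ctr i) (rad i) \<inter> cball (ctr j) (rad j) = {}"
   using C(3) by (auto simp: pairwise_def disjnt_def)
  moreover have "i \<in> K" "j \<in> K" using ij C(2) by auto
  ultimately show "{fst i..snd i} \<inter> {fst j..snd j} = {}" using cb by simp
 qed
 have "emeasure lborel (E - W) = 0"
 proof -
  have "E - W \<in> null_sets lebesgue" using C(4) by (simp add: W negligible_iff_null_sets)
  moreover have "E - W \<in> sets lborel" using E(1) Wb by simp
  ultimately show ?thesis using null_sets_completion_iff[of "E - W" lborel] by blast
 qed
 then have nuEW: "emeasure ?\<nu> (E - W) = 0" using ac E(1) by auto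
 have mono': "!!x y. x <= y ==> F x <= F y" using F(1) by (auto simp: mono_def)
 have "emeasure ?\<nu> E <= emeasure ?\<nu> ((E - W) \<union> W)"
  using E(1) by (intro emeasure_mono) auto
 also have "... <= emeasure ?\<nu> (E - W) + emeasure ?\<nu> W"
  using E(1) by (intro emeasure_subadditive) auto
 also have "... = emeasure ?\<nu> W" using nuEW by simp
 also have "... = (\<integral>\<^sup>+i. emeasure ?\<nu> {fst i..snd i} \<partial>count_space C)"
  unfolding W_def by (rule emeasure_UN_countable) (use C(1) dis in auto)
 also have "... <= (\<integral>\<^sup>+i. ennreal r * emeasure lborel {fst i..snd i} \<partial>count_space C)"
 proof (rule nn_integral_mono)
  fix i assume "i \<in> space (count_space C)"
  then have i: "i \<in> K" using C(2) by auto
  then have lt: "fst i < snd i" "F (snd i) - F (fst i) <= r * (snd i - fst i)" by (auto simp: K_def)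
  have "emeasure ?\<nu> {fst i..snd i} = ennreal (F (snd i) - F (fst i))"
   using emeasure_interval_measure_Icc[of "fst i" "snd i" F] lt mono' F(2) by auto
  also have "... <= ennreal (r * (snd i - fst i))" using lt by (intro ennreal_leI)
  finally show "emeasure ?\<nu> {fst i..snd i} <= ennreal r * emeasure lborel {fst i..snd i}"
   using lt r by (simp add: ennreal_mult)
 qed
 also have "... = ennreal r * (\<integral>\<^sup>+i. emeasure lborel {fst i..snd i} \<partial>count_space C)"
  by (rule nn_integral_cmult) auto
 also have "(\<integral>\<^sup>+i. emeasure lborel {fst i..snd i} \<partial>count_space C) = emeasure lborel W"
  unfolding W_def by (rule emeasure_UN_countable[symmetric]) (use C(1) dis in auto)
 also have "ennreal r * emeasure lborel W <= ennreal r * (emeasure lborel E + ennreal e')"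
 proof -
  have "W \<subseteq> U" using C(2) by (force simp: W_def K_def)
  then have "emeasure lborel W <= emeasure lborel (E \<union> (U - E))"
   using U E by (intro emeasure_mono) (auto intro: borel_open)
  also have "... <= emeasure lborel E + emeasure lborel (U - E)"
   using U E by (intro emeasure_subadditive) (auto intro: borel_open)
  also have "... <= emeasure lborel E + ennreal e'" using U(3) by (intro add_left_mono) auto
  finally show ?thesis by (rule mult_left_mono) simp
 qed
 also have "... = ennreal r * emeasure lborel E + ennreal (r * e')"
  using e'(1) r by (simp add: distrib_left ennreal_mult)
 also have "... <= ennreal r * emeasure lborel E + ennreal e"
  using e' by (intro add_left_mono ennreal_leI)
 finally show "emeasure ?\<nu> E <= ennreal r * emeasure lborel E + ennreal e" .
qed

lemma interval_measure_add_lborel: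
 fixes F :: "real => real"
 assumes F: "mono F" "mono (%x. L * x - F x)" "continuous_on UNIV F" and L: "0 < L" and A: "A \<in> sets borel"
 shows "emeasure (interval_measure F) A + emeasure (interval_measure (%x. L * x - F x)) A
    = ennreal L * emeasure lborel A"
proof -
 let ?\<nu> = "interval_measure F" and ?\<nu>' = "interval_measure (%x. L * x - F x)"
 define f where "f = (%A. ennreal (1 / L) * (emeasure ?\<nu> A + emeasure ?\<nu>' A))"
 define M where "M = measure_of UNIV (sets (borel :: real measure)) f"
 have setsM: "sets M = sets borel" unfolding M_def
  by (metis sets.sets_measure_of_eq space_borel)
 have M: "emeasure M A = f A" if "A \<in> sets borel" for A
  unfolding M_def
 proof (rule emeasure_measure_of[OF refl])
  show "sets borel \<subseteq> Pow UNIV" by simp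
  show "A \<in> sets (measure_of UNIV (sets borel) f)" using setsM that unfolding M_def by auto
  show "positive (sets (measure_of UNIV (sets borel) f)) f" by (simp add: positive_def f_def)
  show "countably_additive (sets (measure_of UNIV (sets borel) f)) f"
  proof (rule countably_additiveI)
   fix X :: "nat => real set"
   assume X: "range X \<subseteq> sets (measure_of UNIV (sets borel) f)" "disjoint_family X"
   then have Xb: "range X \<subseteq> sets borel" using setsM unfolding M_def by auto
   have "(\<Sum>i. f (X i)) = ennreal (1 / L) * (\<Sum>i. (emeasure ?\<nu> (X i) + emeasure ?\<nu>' (X i)))"
    unfolding f_def by (rule ennreal_suminf_cmult)
   also have "(\<Sum>i. (emeasure ?\<nu> (X i) + emeasure ?\<nu>' (X i)))
     = (\<Sum>i. emeasure ?\<nu> (X i)) + (\<Sum>i. emeasure ?\<nu>' (X i))"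
    by (rule suminf_add[symmetric]) auto
   also have "... = emeasure ?\<nu> (\<Union>i. X i) + emeasure ?\<nu>' (\<Union>i. X i)"
    using X(2) Xb by (simp add: suminf_emeasure)
   finally show "(\<Sum>i. f (X i)) = f (\<Union>i. X i)" by (simp add: f_def)
  qed
 qed
 have m1: "!!x y. x <= y ==> F x <= F y" and m2: "!!x y. x <= y ==> L * x - F x <= L * y - F y"
  using F by (auto simp: mono_def)
 have "lborel = M"
 proof (rule lborel_eqI)
  show "sets M = sets borel" by (rule setsM)
  fix l u :: real assume "!!b. b \<in> Basis ==> l \<bullet> b <= u \<bullet> b"
  then have lu: "l <= u" by simp
  have one: "emeasure (interval_measure H) {l<..<u} = ennreal (H u - H l)"
   if H: "!!x y. x <= y ==> H x <= H y" "continuous_on UNIV H" for H :: "real => real"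
  proof (cases "l < u")
   case True
   have "emeasure (interval_measure H) {u} = 0"
    using emeasure_interval_measure_Icc[of u u H] H by auto
   then have "emeasure (interval_measure H) {l<..<u} = emeasure (interval_measure H) ({l<..<u} \<union> {u})"
    by (intro emeasure_Un_null_set[symmetric]) (auto simp: null_sets_def)
   also have "{l<..<u} \<union> {u} = {l<..u}" using True by auto
   also have "emeasure (interval_measure H) {l<..u} = ennreal (H u - H l)"
    using H True by (intro emeasure_interval_measure_Ioc)
      (auto intro: continuous_on_imp_continuous_within[where s=UNIV] simp: continuous_on_eq_continuous_at continuous_at_imp_continuous_within)
   finally show ?thesis .
  next
   case False then show ?thesis using lu by auto
  qed
  have "emeasure M (box l u) = ennreal (1 / L) * (ennreal (F u - F l) + ennreal ((L * u - F u) - (L * l - F l)))"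
  proof -
   have "continuous_on UNIV (%x. L * x - F x)" by (intro continuous_intros F(3))
   then show ?thesis
    using M[of "{l<..<u}"] one[of F, OF m1 F(3)] one[of "%x. L * x - F x", OF m2]
    by (simp add: f_def)
  qed
  also have "... = ennreal (1 / L * ((F u - F l) + ((L * u - F u) - (L * l - F l))))"
   using m1[OF lu] m2[OF lu] L lu by (subst ennreal_plus[symmetric], simp, simp) (rule ennreal_mult[symmetric]; simp)
  also have "1 / L * ((F u - F l) + ((L * u - F u) - (L * l - F l))) = u - l"
   using L by (simp add: field_simps)
  finally show "emeasure M (box l u) = ennreal (\<Prod>b\<in>Basis. (u - l) \<bullet> b)" by simp
 qed
 then have "emeasure lborel A = f A" using M[OF A] by simp
 then have "ennreal L * emeasure lborel A = ennreal L * ennreal (1/L) * (emeasure ?\<nu> A + emeasure ?\<nu>' A)"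
  by (simp add: f_def mult.assoc)
 also have "ennreal L * ennreal (1/L) = 1" using L by (simp flip: ennreal_mult)
 finally show ?thesis by simp
qed

text \<open>Let \<open>E\<close> be a bounded set where the lower derivative is below \<open>r\<close> and the upper one above \<open>s > r\<close>. The
 covering lemma applies to \<open>F\<close> with slope \<open>r\<close> and to the monotone function \<open>L x - F x\<close> with slope
 \<open>L - s\<close>. The two Stieltjes measures add up to \<open>L\<close> times Lebesgue measure, so
 \<open>L |E| <= (r + L - s) |E|\<close> and \<open>|E| = 0\<close>.\<close>

lemma mono_lipschitz_differentiable_AE:
 fixes F :: "real => real"
 assumes mono: "mono F" and lip: "L-lipschitz_on UNIV F"
 shows "AE x in lborel. F differentiable (at x)"
proof -
 define L' where "L' = L + 1"
 have L': "0 < L'" using lipschitz_on_nonneg[OF lip] by (simp add: L'_def)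
 have lipd: "\<bar>F x - F y\<bar> <= L' * \<bar>x - y\<bar>" for x y
  using lipschitz_onD[OF lip, of x y] by (simp add: dist_real_def L'_def algebra_simps)
 define F2 where "F2 = (%x. L' * x - F x)"
 have mono2: "mono F2"
 proof (rule monoI)
  fix x y :: real assume "x <= y"
  then show "F2 x <= F2 y" using lipd[of y x] by (simp add: F2_def algebra_simps)
 qed
 have cont: "continuous_on UNIV F" using lip lipschitz_on_continuous_on by blast
 have cont2: "continuous_on UNIV F2" unfolding F2_def by (intro continuous_intros cont)
 have add: "emeasure (interval_measure F) A + emeasure (interval_measure F2) A = ennreal L' * emeasure lborel A"
  if "A \<in> sets borel" for A
  using interval_measure_add_lborel[OF mono mono2[unfolded F2_def] cont L' that] by (simp add: F2_def)
 have ac: "emeasure (interval_measure F) A = 0" "emeasure (interval_measure F2) A = 0"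
  if "A \<in> sets borel" "emeasure lborel A = 0" for A
  using add[OF that(1)] that(2) by (auto simp: add_eq_0_iff_both_eq_0)
 define quot where "quot = (%x h. (F (x + h) - F x) / h)"
 have [measurable]: "F \<in> borel_measurable borel" by (rule borel_measurable_continuous_onI[OF cont])
 have quot[measurable]: "(%x. quot x h) \<in> borel_measurable borel" for h
  unfolding quot_def by measurable
 define low where "low = (%r. {x. \<forall>n::nat. \<exists>h\<in>\<rat>. h \<noteq> 0 \<and> \<bar>h\<bar> < 1 / Suc n \<and> quot x h < r})"
 define upp where "upp = (%s. {x. \<forall>n::nat. \<exists>h\<in>\<rat>. h \<noteq> 0 \<and> \<bar>h\<bar> < 1 / Suc n \<and> s < quot x h})"
 have lowm: "low r \<in> sets borel" for r
 proof -
  have "low r = (\<Inter>n::nat. \<Union>h\<in>{h\<in>\<rat>. h \<noteq> 0 \<and> \<bar>h\<bar> < 1 / Suc n}. {x\<in>space borel. quot x h < r})"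
   by (auto simp: low_def)
  also have "... \<in> sets borel"
   by (intro sets.countable_INT'' sets.countable_UN'' countable_subset[OF _ countable_rat]) auto
  finally show ?thesis .
 qed
 have uppm: "upp s \<in> sets borel" for s
 proof -
  have "upp s = (\<Inter>n::nat. \<Union>h\<in>{h\<in>\<rat>. h \<noteq> 0 \<and> \<bar>h\<bar> < 1 / Suc n}. {x\<in>space borel. s < quot x h})"
   by (auto simp: upp_def)
  also have "... \<in> sets borel"
   by (intro sets.countable_INT'' sets.countable_UN'' countable_subset[OF _ countable_rat]) auto
  finally show ?thesis .
 qed
 have null: "low r \<inter> upp s \<in> null_sets lborel" if rs: "r < s" for r s
 proof -
  have "low r \<inter> upp s \<inter> {-real m..real m} \<in> null_sets lborel" for m :: nat
  proof -
   define E where "E = low r \<inter> upp s \<inter> {-real m..real m}"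
   have Eb: "E \<in> sets borel" unfolding E_def using lowm uppm by auto
   have "emeasure lborel E <= emeasure lborel {-real m..real m}" unfolding E_def by (intro emeasure_mono) auto
   also have "... < \<infinity>" by simp
   finally have Efin: "emeasure lborel E < \<infinity>" .
   show ?thesis
   proof (cases "E = {}")
    case True then show ?thesis by (simp flip: E_def)
   next
    case False
    then obtain x0 where x0: "x0 \<in> low r" "x0 \<in> upp s" by (auto simp: E_def)
    have q: "0 <= quot x h \<and> quot x h <= L'" if "h \<noteq> 0" for x h
    proof -
     have "0 <= quot x h"
     proof (cases "h > 0")
      case True then show ?thesis using monoD[OF mono, of x "x+h"] by (simp add: quot_def)
     next
      case False then show ?thesis using monoD[OF mono, of "x+h" x] that
       by (auto simp: quot_def divide_nonpos_neg)
     qed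
     moreover have "\<bar>quot x h\<bar> <= L'" using lipd[of "x+h" x] that by (simp add: quot_def abs_divide field_simps)
     ultimately show ?thesis by auto
    qed
    obtain h1 where "h1 \<noteq> 0" "quot x0 h1 < r" using x0(1) unfolding low_def by blast
    then have r0: "0 <= r" using q[of h1 x0] by simp
    obtain h2 where "h2 \<noteq> 0" "s < quot x0 h2" using x0(2) unfolding upp_def by blast
    then have sL: "s <= L'" using q[of h2 x0] by simp
    have f1: "\<exists>u v. u <= x \<and> x <= v \<and> u < v \<and> v - u < d \<and> F v - F u <= r * (v - u)" if "x \<in> E" "0 < d" for x d
    proof -
     obtain n :: nat where n: "1 / Suc n < d" using nat_approx_posE[OF \<open>0 < d\<close>] .
     have "\<forall>n::nat. \<exists>h\<in>\<rat>. h \<noteq> 0 \<and> \<bar>h\<bar> < 1 / Suc n \<and> quot x h < r" using that(1) by (simp add: E_def low_def)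
     from this[THEN spec, of n] obtain h where h: "h \<noteq> 0" "\<bar>h\<bar> < 1 / Suc n" "quot x h < r" by blast
     have hd: "\<bar>h\<bar> < d" using h(2) n by linarith
     show ?thesis
     proof (cases "h > 0")
      case True
      then show ?thesis using h(1,3) hd by (intro exI[of _ x] exI[of _ "x+h"]) (auto simp: quot_def field_simps)
     next
      case False
      then show ?thesis using h(1,3) hd by (intro exI[of _ "x+h"] exI[of _ x]) (auto simp: quot_def field_simps)
     qed
    qed
    have f2: "\<exists>u v. u <= x \<and> x <= v \<and> u < v \<and> v - u < d \<and> F2 v - F2 u <= (L' - s) * (v - u)" if "x \<in> E" "0 < d" for x d
    proof -
     obtain n :: nat where n: "1 / Suc n < d" using nat_approx_posE[OF \<open>0 < d\<close>] .
     have "\<forall>n::nat. \<exists>h\<in>\<rat>. h \<noteq> 0 \<and> \<bar>h\<bar> < 1 / Suc n \<and> s < quot x h" using that(1) by (simp add: E_def upp_def)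
     from this[THEN spec, of n] obtain h where h: "h \<noteq> 0" "\<bar>h\<bar> < 1 / Suc n" "s < quot x h" by blast
     have hd: "\<bar>h\<bar> < d" using h(2) n by linarith
     show ?thesis
     proof (cases "h > 0")
      case True
      then show ?thesis using h(1,3) hd by (intro exI[of _ x] exI[of _ "x+h"]) (auto simp: quot_def F2_def field_simps)
     next
      case False
      then show ?thesis using h(1,3) hd by (intro exI[of _ "x+h"] exI[of _ x]) (auto simp: quot_def F2_def field_simps)
     qed
    qed
    have "emeasure (interval_measure F) E <= ennreal r * emeasure lborel E"
     by (rule emeasure_le_of_fine_intervals[OF mono cont r0 ac(1) Eb Efin f1])
    moreover have "emeasure (interval_measure F2) E <= ennreal (L' - s) * emeasure lborel E"
     by (rule emeasure_le_of_fine_intervals[OF mono2 cont2 _ ac(2) Eb Efin f2]) (use sL in auto)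
    ultimately have "ennreal L' * emeasure lborel E <= (ennreal r + ennreal (L' - s)) * emeasure lborel E"
     using add[OF Eb] by (metis add_mono distrib_right)
    then have *: "ennreal L' * emeasure lborel E <= ennreal (r + (L' - s)) * emeasure lborel E"
     using r0 sL by simp
    obtain e where e: "emeasure lborel E = ennreal e" "0 <= e" using Efin by (cases "emeasure lborel E") auto
    have "ennreal (L' * e) <= ennreal ((r + (L' - s)) * e)"
     using * r0 sL L' e by (metis (no_types, lifting) add_nonneg_nonneg diff_ge_0_iff_ge ennreal_mult less_imp_le)
    then have "L' * e <= (r + (L' - s)) * e"
     using r0 sL e(2) by (subst (asm) ennreal_le_iff) auto
    then have "e = 0" using rs e(2) by (smt (verit, best) mult_right_le_imp_le mult_strict_right_mono)
    then show ?thesis using e Eb by (simp add: null_sets_def flip: E_def)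
   qed
  qed
  then have "(\<Union>m::nat. low r \<inter> upp s \<inter> {-real m..real m}) \<in> null_sets lborel" by (intro null_sets_UN) auto
  also have "(\<Union>m::nat. low r \<inter> upp s \<inter> {-real m..real m}) = low r \<inter> upp s"
  proof -
   have "\<exists>m::nat. - real m <= x \<and> x <= real m" for x :: real
    by (metis abs_le_iff minus_le_iff real_arch_simple)
   then show ?thesis by auto
  qed
  finally show ?thesis .
 qed
 have nullU: "(\<Union>p\<in>{p\<in>\<rat>\<times>\<rat>. fst p < snd p}. low (fst p) \<inter> upp (snd p)) \<in> null_sets lborel"
  by (intro null_sets_UN' countable_subset[OF _ countable_SIGMA[OF countable_rat countable_rat]])
    (auto intro: null)
 show ?thesis
 proof (rule AE_I'[OF nullU], rule subsetI)
  fix x assume "x \<in> {x \<in> space lborel. \<not> F differentiable at x}"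
  then have nd: "\<not> F differentiable at x" by simp
  have bnd: "\<bar>quot x h\<bar> <= L'" if "h \<noteq> 0" for h
   using lipd[of "x+h" x] that by (simp add: quot_def abs_divide field_simps)
  \<comment> \<open>rational increments suffice, because the quotient is continuous in the increment\<close>
  have rat: "\<exists>h'\<in>\<rat>. h' \<noteq> 0 \<and> \<bar>h'\<bar> < d \<and> a < quot x h' \<and> quot x h' < b"
   if "h \<noteq> 0" "\<bar>h\<bar> < d" "a < quot x h" "quot x h < b" for h d a b
  proof -
   have "isCont (%h. quot x h) h" unfolding quot_def using that(1) cont
    by (auto intro!: continuous_intros simp: continuous_on_eq_continuous_at intro: isCont_o2[where g=F])
   then have "((%h. quot x h) \<longlongrightarrow> quot x h) (at h)" by (simp add: isCont_def)
   then have ev: "eventually (%h'. a < quot x h' \<and> quot x h' < b) (at h)"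
    using that(3,4) by (auto intro: eventually_conj order_tendstoD)
   obtain d1 where d1: "0 < d1" "!!h'. h' \<noteq> h ==> \<bar>h' - h\<bar> < d1 ==> a < quot x h' \<and> quot x h' < b"
    using ev unfolding eventually_at by (auto simp: dist_real_def)
   define d2 where "d2 = min d1 (min \<bar>h\<bar> (d - \<bar>h\<bar>))"
   have "0 < d2" using d1 that by (auto simp: d2_def)
   then obtain h' where h': "h' \<in> \<rat>" "h < h'" "h' < h + d2" using Rats_dense_in_real[of h "h + d2"] by auto
   show ?thesis using h' d1(2)[of h'] that(1,2) by (intro bexI[of _ h']) (auto simp: d2_def)
  qed
  define l where "l = Liminf (at 0) (%h. ereal (quot x h))"
  define u where "u = Limsup (at 0) (%h. ereal (quot x h))"
  have evb: "eventually (%h. ereal (quot x h) <= ereal L' \<and> ereal (-L') <= ereal (quot x h)) (at 0)"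
   unfolding eventually_at using abs_le_D1[OF bnd] abs_le_D2[OF bnd]
  by (intro exI[of _ 1]) (auto simp: minus_le_iff)
  have "u <= L'" unfolding u_def by (rule Limsup_bounded) (use evb in \<open>auto elim: eventually_mono\<close>)
  moreover have "-L' <= l" unfolding l_def by (rule Liminf_bounded) (use evb in \<open>auto elim: eventually_mono\<close>)
  moreover have lu: "l <= u" unfolding l_def u_def by (rule Liminf_le_Limsup) simp
  ultimately have fin: "\<bar>l\<bar> \<noteq> \<infinity>" "\<bar>u\<bar> \<noteq> \<infinity>"
   by (cases l; cases u; auto)+
  have "l \<noteq> u"
  proof
   assume "l = u"
   then have "((%h. ereal (quot x h)) \<longlongrightarrow> l) (at 0)"
    unfolding l_def u_def by (intro Liminf_eq_Limsup) auto
   moreover obtain y where "l = ereal y" using fin by (cases l) auto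
   ultimately have "((%h. quot x h) \<longlongrightarrow> y) (at 0)" by simp
   then have "(F has_real_derivative y) (at x)" unfolding DERIV_def quot_def by simp
   then show False using nd real_differentiable_def by blast
  qed
  then have "l < u" using lu by simp
  then obtain s' where s': "l < ereal s'" "ereal s' < u"
   by (metis ereal_dense2)
  then obtain r' where r': "l < ereal r'" "r' < s'" by (metis ereal_dense2 ereal_less(4) less_ereal.simps(1))
  obtain l' u' where lu': "l = ereal l'" "u = ereal u'" using fin by (cases l; cases u) auto
  obtain r where r: "r \<in> \<rat>" "l' < r" "r < r'" using Rats_dense_in_real[of l' r'] r' lu' by auto
  obtain s where s: "s \<in> \<rat>" "r' < s" "s < s'" using Rats_dense_in_real[of r' s'] r' by auto
  have "x \<in> low r"
   unfolding low_def
  proof safe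
   fix n :: nat
   have "\<exists>h. h \<noteq> 0 \<and> \<bar>h\<bar> < 1 / Suc n \<and> quot x h < r"
   proof (rule ccontr)
    assume "\<not> ?thesis"
    then have "eventually (%h. ereal r <= ereal (quot x h)) (at 0)"
     unfolding eventually_at by (intro exI[of _ "1 / Suc n"]) (auto simp: not_less)
    then have "ereal r <= l" unfolding l_def by (rule Liminf_bounded)
    then show False using r lu' by auto
   qed
   then obtain h where h: "h \<noteq> 0" "\<bar>h\<bar> < 1 / Suc n" "quot x h < r" by auto
   show "\<exists>h\<in>\<rat>. h \<noteq> 0 \<and> \<bar>h\<bar> < 1 / real (Suc n) \<and> quot x h < r"
    using rat[OF h(1,2) _ h(3), of "quot x h - 1"] by auto
  qed
  moreover have "x \<in> upp s"
   unfolding upp_def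
  proof safe
   fix n :: nat
   have "\<exists>h. h \<noteq> 0 \<and> \<bar>h\<bar> < 1 / Suc n \<and> s < quot x h"
   proof (rule ccontr)
    assume "\<not> ?thesis"
    then have "eventually (%h. ereal (quot x h) <= ereal s) (at 0)"
     unfolding eventually_at by (intro exI[of _ "1 / Suc n"]) (auto simp: not_less)
    then have "u <= ereal s" unfolding u_def by (rule Limsup_bounded)
    then show False using s s' by (metis ereal_less_eq(3) less_ereal.simps(1) not_less order.strict_trans2 order.strict_implies_order)
   qed
   then obtain h where h: "h \<noteq> 0" "\<bar>h\<bar> < 1 / Suc n" "s < quot x h" by auto
   show "\<exists>h\<in>\<rat>. h \<noteq> 0 \<and> \<bar>h\<bar> < 1 / real (Suc n) \<and> s < quot x h"
    using rat[OF h(1,2) h(3), of "quot x h + 1"] by auto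
  qed
  ultimately show "x \<in> (\<Union>p\<in>{p\<in>\<rat>\<times>\<rat>. fst p < snd p}. low (fst p) \<inter> upp (snd p))"
   using r s by (intro UN_I[of "(r, s)"]) auto
 qed
qed

section \<open>Square integrable functions\<close>

lemma integrable_mult_of_squares:
 fixes f g :: "'a => real"
 assumes [measurable]: "f \<in> borel_measurable M" "g \<in> borel_measurable M"
  and f: "integrable M (%x. (f x)^2)" and g: "integrable M (%x. (g x)^2)"
 shows "integrable M (%x. f x * g x)"
proof (rule dominated_integrable)
 show "integrable M (%x. (f x)^2 + (g x)^2)" using f g by simp
 have "\<bar>a * b\<bar> <= a^2 + b^2" for a b :: real
 proof -
  have "2 * (\<bar>a\<bar> * \<bar>b\<bar>) <= a^2 + b^2" using sum_squares_bound[of "\<bar>a\<bar>" "\<bar>b\<bar>"] by simp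
  moreover have "0 <= \<bar>a\<bar> * \<bar>b\<bar>" by simp
  ultimately have "\<bar>a\<bar> * \<bar>b\<bar> <= a^2 + b^2" by linarith
  then show ?thesis by (simp add: abs_mult)
 qed
 then show "AE x in M. norm (f x * g x) <= norm ((f x)^2 + (g x)^2)" by (auto simp: abs_mult)
qed measurable

lemma integral_Cauchy_Schwarz:
 fixes f g :: "'a => real"
 assumes [measurable]: "f \<in> borel_measurable M" "g \<in> borel_measurable M"
  and f: "integrable M (%x. (f x)^2)" and g: "integrable M (%x. (g x)^2)"
 shows "(\<integral>x. f x * g x \<partial>M)^2 <= (\<integral>x. (f x)^2 \<partial>M) * (\<integral>x. (g x)^2 \<partial>M)"
proof -
 define a b c where "a = (\<integral>x. (f x)^2 \<partial>M)" and "b = (\<integral>x. f x * g x \<partial>M)" and "c = (\<integral>x. (g x)^2 \<partial>M)"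
 have fg: "integrable M (%x. f x * g x)" by (rule integrable_mult_of_squares) (use f g in auto)
 have q: "0 <= a - 2 * t * b + t^2 * c" for t
 proof -
  have "0 <= (\<integral>x. (f x - t * g x)^2 \<partial>M)" by simp
  also have "(\<integral>x. (f x - t * g x)^2 \<partial>M) = (\<integral>x. (f x)^2 - (2 * t) * (f x * g x) + t^2 * (g x)^2 \<partial>M)"
   by (rule lint_cong) (auto simp: power2_eq_square algebra_simps)
  also have "... = a - 2 * t * b + t^2 * c" using f g fg by (simp add: a_def b_def c_def)
  finally show ?thesis .
 qed
 have "b^2 <= a * c"
 proof (cases "c = 0")
  case True
  have "b = 0"
  proof (rule ccontr)
   assume "b \<noteq> 0"
   then show False using q[of "(a + 1) / (2 * b)"] True by (simp add: field_simps)
  qed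
  then show ?thesis using True by simp
 next
  case False
  moreover have "0 <= c" by (simp add: c_def)
  ultimately have c: "0 < c" by simp
  have "0 <= c * (a - 2 * (b / c) * b + (b / c)^2 * c)" using q[of "b / c"] c by simp
  also have "... = a * c - b^2" using c by (simp add: field_simps power2_eq_square)
  finally show ?thesis by simp
 qed
 then show ?thesis by (simp add: a_def b_def c_def)
qed

lemma abs_integral_mult_le:
 fixes f g :: "'a => real"
 assumes "f \<in> borel_measurable M" "g \<in> borel_measurable M"
  and "integrable M (%x. (f x)^2)" and "integrable M (%x. (g x)^2)"
 shows "\<bar>\<integral>x. f x * g x \<partial>M\<bar> <= sqrt (\<integral>x. (f x)^2 \<partial>M) * sqrt (\<integral>x. (g x)^2 \<partial>M)"
proof -
 have "sqrt ((\<integral>x. f x * g x \<partial>M)^2) <= sqrt ((\<integral>x. (f x)^2 \<partial>M) * (\<integral>x. (g x)^2 \<partial>M))"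
  using integral_Cauchy_Schwarz[OF assms] by (rule real_sqrt_le_mono)
 then show ?thesis by (simp add: real_sqrt_mult)
qed

section \<open>The antiderivative of the square root of the derivative\<close>

lemma integrable_Icc_const: "integrable lborel (%x. indicat_real {a..b::real} x *\<^sub>R (c::real))"
 using borel_integrable_atLeastAtMost'[of a b "%_. c"] by (simp add: set_integrable_def)

text \<open>The difference quotients are bounded by \<open>L\<close>, so their integrals over an interval converge to the
 integral of the derivative; by monotonicity these integrals are at most an increment of \<open>G\<close>. The Borel function \<open>D\<close> replaces \<^term>\<open>deriv G\<close>, which has
 unspecified values where \<open>G\<close> is not differentiable.\<close>

lemma mono_lipschitz_derivative:
 fixes G :: "real => real"
 assumes mono: "mono G" and lip: "L-lipschitz_on UNIV G"
 obtains D where "D \<in> borel_measurable borel" "!!x. 0 <= D x" "!!x. D x <= L"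
  "AE x in lborel. deriv G x = D x" "!!a b. a <= b ==> (LBINT x:{a..b}. D x) <= G b - G a"
proof -
 have lipd: "\<bar>G x - G y\<bar> <= L * \<bar>x - y\<bar>" for x y
  using lipschitz_onD[OF lip, of x y] by (simp add: dist_real_def)
 have L0: "0 <= L" by (rule lipschitz_on_nonneg[OF lip])
 have cont: "continuous_on UNIV G" using lip lipschitz_on_continuous_on by blast
 have Gm[measurable]: "G \<in> borel_measurable borel" by (rule borel_measurable_continuous_onI[OF cont])
 define h where "h = (%n::nat. 1 / real (Suc n))"
 have h: "0 < h n" for n by (simp add: h_def)
 have h0: "h \<longlonglongrightarrow> 0" unfolding h_def using LIMSEQ_Suc[OF lim_1_over_n] by (simp add: inverse_eq_divide)
 define q where "q = (%n x. (G (x + h n) - G x) / h n)"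
 have qm[measurable]: "q n \<in> borel_measurable borel" for n unfolding q_def by measurable
 have q: "0 <= q n x" "q n x <= L" for n x
  using monoD[OF mono, of x "x + h n"] lipd[of "x + h n" x] h[of n] by (auto simp: q_def field_simps)
 define D where "D = (%x. max 0 (min L (lim (%n. q n x))))"
 have Dm[measurable]: "D \<in> borel_measurable borel" unfolding D_def by measurable
 have lim: "(%n. q n x) \<longlonglongrightarrow> D x" and der: "deriv G x = D x" if "G differentiable (at x)" for x
 proof -
  have "(G has_real_derivative deriv G x) (at x)" using that DERIV_deriv_iff_real_differentiable by blast
  then have "((%t. (G (x + t) - G x) / t) \<longlongrightarrow> deriv G x) (at 0)" by (simp add: DERIV_def)
  moreover have "filterlim h (at 0) sequentially"
   using h0 h by (auto simp: filterlim_at eventually_sequentially intro!: exI[of _ 0] less_imp_neq[THEN not_sym])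
  ultimately have *: "(%n. q n x) \<longlonglongrightarrow> deriv G x"
   unfolding q_def by (rule filterlim_compose[of "%t. (G (x + t) - G x) / t"])
  have "0 <= deriv G x" by (rule LIMSEQ_le_const[OF *]) (use q in auto)
  moreover have "deriv G x <= L" by (rule LIMSEQ_le_const2[OF *]) (use q in auto)
  ultimately show "deriv G x = D x" using limI[OF *] by (simp add: D_def)
  then show "(%n. q n x) \<longlonglongrightarrow> D x" using * by simp
 qed
 have AEd: "AE x in lborel. G differentiable (at x)" by (rule mono_lipschitz_differentiable_AE[OF mono lip])
 have D: "0 <= D x" "D x <= L" for x using L0 by (auto simp: D_def)
 have int: "(LBINT x:{a..b}. D x) <= G b - G a" if ab: "a <= b" for a b
 proof (cases "a = b")
  case True
  have "AE x in lborel. x \<noteq> b" by (rule AE_lborel_singleton)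
  then have "AE x in lborel. indicat_real {b..b} x *\<^sub>R D x = 0"
   by eventually_elim (auto simp: indicator_def)
  then have "(LBINT x:{a..b}. D x) = 0"
   unfolding set_lebesgue_integral_def True by (rule integral_eq_zero_AE)
  then show ?thesis using True by simp
 next
  case False
  then have "a < b" using ab by simp
  have "(%n. LBINT x:{a..b}. q n x) \<longlonglongrightarrow> (LBINT x:{a..b}. D x)"
   unfolding set_lebesgue_integral_def
  proof (rule integral_dominated_convergence)
   show "integrable lborel (%x. indicator {a..b} x *\<^sub>R L)" by (rule integrable_Icc_const)
   show "AE x in lborel. (%n. indicator {a..b} x *\<^sub>R q n x) \<longlonglongrightarrow> indicator {a..b} x *\<^sub>R D x"
    using AEd by eventually_elim (intro tendsto_intros lim)
   show "AE x in lborel. norm (indicator {a..b} x *\<^sub>R q n x) <= indicator {a..b} x *\<^sub>R L" for n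
    using q by (auto simp: indicator_def)
  qed auto
  moreover have "eventually (%n. (LBINT x:{a..b}. q n x) <= G (b + h n) - G a) sequentially"
  proof -
   have "eventually (%n. h n < b - a) sequentially"
    using h0 \<open>a < b\<close> by (intro order_tendstoD) auto
   then show ?thesis
   proof eventually_elim
    case (elim n)
    have Gi: "integrable lborel (%x. indicator {c..d} x *\<^sub>R G x)" for c d
     using borel_integrable_atLeastAtMost'[of c d G] cont continuous_on_subset
     unfolding set_integrable_def by blast
    have shift: "(\<integral>x. indicator {a..b} x *\<^sub>R G (x + h n) \<partial>lborel) = (\<integral>x. indicator {a + h n..b + h n} x *\<^sub>R G x \<partial>lborel)"
     by (subst lborel_integral_real_affine[of 1 _ "h n"])
       (auto intro!: lint_cong simp: indicator_def algebra_simps)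
    have Gis: "integrable lborel (%x. indicator {a..b} x *\<^sub>R G (x + h n))"
    proof -
     have "continuous_on {a..b} (%x. G (x + h n))"
      by (rule continuous_on_compose2[OF cont]) (auto intro!: continuous_intros)
     then show ?thesis
      using borel_integrable_atLeastAtMost'[of a b "%x. G (x + h n)"] by (simp add: set_integrable_def)
    qed
    have "h n * (LBINT x:{a..b}. q n x) = (\<integral>x. indicator {a..b} x *\<^sub>R G (x + h n) - indicator {a..b} x *\<^sub>R G x \<partial>lborel)"
     unfolding set_lebesgue_integral_def integral_mult_right_zero[symmetric]
     using h[of n] by (intro lint_cong) (auto simp: q_def indicator_def)
    also have "... = (\<integral>x. indicator {a + h n..b + h n} x *\<^sub>R G x - indicator {a..b} x *\<^sub>R G x \<partial>lborel)"
     using Gi Gis shift by simp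
    also have "... <= (\<integral>x. G (b + h n) * indicator {b<..b + h n} x - G a * indicator {a..<a + h n} x \<partial>lborel)"
    proof (rule integral_mono)
     show "integrable lborel (%x. G (b + h n) * indicator {b<..b + h n} x - G a * indicator {a..<a + h n} x)"
      using h[of n] by (intro Bochner_Integration.integrable_diff integrable_mult_right) auto
     fix x
     show "indicator {a + h n..b + h n} x *\<^sub>R G x - indicator {a..b} x *\<^sub>R G x
        <= G (b + h n) * indicator {b<..b + h n} x - G a * indicator {a..<a + h n} x"
      using monoD[OF mono, of x "b + h n"] monoD[OF mono, of a x] h[of n] elim
      by (auto simp: indicator_def)
    qed (use Gi in auto)
    also have "... = G (b + h n) * h n - G a * h n"
     using h[of n] by (subst Bochner_Integration.integral_diff) (auto intro!: integrable_mult_right)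
    finally have "h n * (LBINT x:{a..b}. q n x) <= h n * (G (b + h n) - G a)" by (simp add: algebra_simps)
    then show ?case using h[of n] by simp
   qed
  qed
  moreover have "(%n. G (b + h n) - G a) \<longlonglongrightarrow> G (b + 0) - G a"
   using cont by (intro tendsto_intros isCont_tendsto_compose[of _ G] h0) (auto simp: continuous_on_eq_continuous_at)
  ultimately show ?thesis using tendsto_le[OF sequentially_bot] by fastforce
 qed
 show thesis
  by (rule that[OF Dm D]) (use AEd der int in auto)
qed

text \<open>Cauchy-Schwarz for \<open>\<integral> 1 \<cdot> sqrt G'\<close> over the interval between \<open>a\<close> and \<open>b\<close>. This is the only property
 of \<open>g\<close> besides continuity that the limit passage uses.\<close>

lemma gfun_diff_square_le:
 fixes G :: "real => real"
 assumes mono: "mono G" and lip: "L-lipschitz_on UNIV G"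
 shows "(gfun G b - gfun G a)^2 <= (b - a) * (G b - G a)"
proof -
 obtain D where Dm[measurable]: "D \<in> borel_measurable borel" and D: "!!x. 0 <= D x" "!!x. D x <= L"
  and AED: "AE x in lborel. deriv G x = D x" and int: "!!a b. a <= b ==> (LBINT x:{a..b}. D x) <= G b - G a"
  using mono_lipschitz_derivative[OF mono lip] by blast
 have sint: "set_integrable lborel {a..b} (%x. sqrt (D x))" for a b
  unfolding set_integrable_def
 proof (rule dominated_integrable)
  show "integrable lborel (%x. indicat_real {a..b} x *\<^sub>R sqrt L)" by (rule integrable_Icc_const)
  have "sqrt (D x) <= \<bar>sqrt L\<bar>" for x using D(2)[of x] by (metis abs_ge_self order_trans real_sqrt_le_mono)
  then show "AE x in lborel. norm (indicat_real {a..b} x *\<^sub>R sqrt (D x)) <= norm (indicat_real {a..b} x *\<^sub>R sqrt L)"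
   using D(1) by (auto simp: indicator_def)
 qed measurable
 have eq: "(LINT x:A|lebesgue. sqrt (deriv G x)) = (LINT x:A|lborel. sqrt (D x))" if "A \<in> sets borel" for A
 proof -
  have "AE x in lebesgue. deriv G x = D x" using AED by (rule AE_completion)
  then have ae: "AE x in lebesgue. indicator A x *\<^sub>R sqrt (D x) = indicator A x *\<^sub>R sqrt (deriv G x)"
   by eventually_elim simp
  have bm: "(%x. indicator A x *\<^sub>R sqrt (D x)) \<in> borel_measurable lborel" using that by measurable
  have m: "(%x. indicator A x *\<^sub>R sqrt (D x)) \<in> borel_measurable lebesgue"
   by (rule measurable_completion[OF bm])
  have m2: "(%x. indicator A x *\<^sub>R sqrt (deriv G x)) \<in> borel_measurable lebesgue"
   using borel_measurable_AE[OF m ae] .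
  have "(\<integral>x. indicator A x *\<^sub>R sqrt (deriv G x) \<partial>lebesgue) = (\<integral>x. indicator A x *\<^sub>R sqrt (D x) \<partial>lebesgue)"
   by (rule integral_cong_AE[OF m2 m]) (use ae in \<open>auto elim: eventually_mono\<close>)
  also have "... = (\<integral>x. indicator A x *\<^sub>R sqrt (D x) \<partial>lborel)" by (rule integral_completion[OF bm])
  finally show ?thesis by (simp add: set_lebesgue_integral_def)
 qed
 have g: "gfun G u = (LBINT x=0..ereal u. sqrt (D x))" for u
  unfolding gfun_def interval_lebesgue_integral_def using eq by auto
 have main: "(gfun G b - gfun G a)^2 <= (b - a) * (G b - G a)" if ab: "a <= b" for a b
 proof -
  have ii: "interval_lebesgue_integrable lborel (ereal c) (ereal d) (%x. sqrt (D x))" for c d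
   unfolding interval_lebesgue_integrable_def
   by (auto intro: set_integrable_subset[OF sint, of _ c d] set_integrable_subset[OF sint, of _ d c])
  have "(LBINT x=0..ereal a. sqrt (D x)) + (LBINT x=ereal a..ereal b. sqrt (D x)) = (LBINT x=0..ereal b. sqrt (D x))"
   using interval_integral_sum[of "ereal 0" "ereal a" "ereal b" "%x. sqrt (D x)"] ii
   by (simp add: zero_ereal_def min_def max_def)
  then have "gfun G b - gfun G a = (LBINT x=ereal a..ereal b. sqrt (D x))" by (simp add: g)
  also have "... = (LBINT x:{a..b}. sqrt (D x))" using ab by (simp add: interval_integral_Icc)
  also have "... = (\<integral>x. indicator {a..b} x * (indicator {a..b} x * sqrt (D x)) \<partial>lborel)"
   unfolding set_lebesgue_integral_def by (intro lint_cong) (auto simp: indicator_def)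
  finally have "(gfun G b - gfun G a)^2 = (\<integral>x. indicator {a..b} x * (indicator {a..b} x * sqrt (D x)) \<partial>lborel)^2"
   by simp
  also have "... <= (\<integral>x. (indicator {a..b} x)^2 \<partial>lborel) * (\<integral>x. (indicator {a..b} x * sqrt (D x))^2 \<partial>lborel)"
  proof (rule integral_Cauchy_Schwarz)
   have e1: "(%x. (indicator {a..b} x)^2) = (indicator {a..b} :: real => real)" by (auto simp: indicator_def)
   show "integrable lborel (%x. (indicat_real {a..b} x)^2)" unfolding e1 using integrable_Icc_const[of a b 1] by simp
   show "integrable lborel (%x. (indicat_real {a..b} x * sqrt (D x))^2)"
    by (rule dominated_integrable[OF integrable_Icc_const[of a b L]])
      (auto simp: indicator_def D power_mult_distrib order_trans[OF D(2)])
  qed auto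
  also have "(\<integral>x. (indicat_real {a..b} x)^2 \<partial>lborel) = (\<integral>x. indicat_real {a..b} x \<partial>lborel)"
   by (intro lint_cong) (auto simp: indicator_def)
  also have "... = b - a" using ab by simp
  also have "(\<integral>x. (indicator {a..b} x * sqrt (D x))^2 \<partial>lborel) = (LBINT x:{a..b}. D x)"
   unfolding set_lebesgue_integral_def using D by (intro lint_cong) (auto simp: indicator_def)
  also have "(b - a) * (LBINT x:{a..b}. D x) <= (b - a) * (G b - G a)"
   using int[OF ab] ab by (intro mult_left_mono) auto
  finally show ?thesis .
 qed
 show ?thesis
 proof (cases "a <= b")
  case False
  then show ?thesis using main[of b a] by (simp add: power2_commute algebra_simps)
 qed (rule main)
qed

lemma continuous_on_gfun:
 assumes mono: "mono G" and lip: "L-lipschitz_on UNIV G"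
 shows "continuous_on UNIV (gfun G)"
proof -
 have "(sqrt L)-lipschitz_on UNIV (gfun G)"
 proof (rule lipschitz_onI)
  fix x y :: real
  have "(gfun G x - gfun G y)^2 <= \<bar>x - y\<bar> * \<bar>G x - G y\<bar>"
   using gfun_diff_square_le[OF mono lip, of x y] abs_ge_self[of "(x - y) * (G x - G y)"]
   by (simp add: abs_mult)
  also have "... <= \<bar>x - y\<bar> * (L * \<bar>x - y\<bar>)"
   using lipschitz_onD[OF lip, of x y] by (intro mult_left_mono) (auto simp: dist_real_def)
  finally have "(gfun G x - gfun G y)^2 <= L * \<bar>x - y\<bar>^2" by (simp add: power2_eq_square algebra_simps)
  then have "sqrt ((gfun G x - gfun G y)^2) <= sqrt (L * \<bar>x - y\<bar>^2)" by (rule real_sqrt_le_mono)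
  then show "dist (gfun G x) (gfun G y) <= sqrt L * dist x y" by (simp add: dist_real_def real_sqrt_mult)
 qed (use lipschitz_on_nonneg[OF lip] in simp)
 then show ?thesis by (rule lipschitz_on_continuous_on)
qed

section \<open>A weak compactness principle\<close>

text \<open>Finite dyadic convex combinations of a tail of the sequence. Closure under midpoints is all that the
 parallelogram law needs, and it makes convexity arguments inductions with one step.\<close>

inductive midpoint_hull :: "(nat => 'a => 'b::real_vector) => nat => ('a => 'b) => bool"
 for f n where
 base: "n <= m ==> midpoint_hull f n (f m)"
| mid: "midpoint_hull f n g ==> midpoint_hull f n h ==> midpoint_hull f n (%z. (1/2) *\<^sub>R (g z + h z))"

lemma midpoint_hull_mono: "midpoint_hull f n g ==> m <= n ==> midpoint_hull f m g"
 by (induction rule: midpoint_hull.induct) (auto intro: midpoint_hull.intros)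

definition L2 :: "'a measure => ('a => 'b::euclidean_space) => bool" where
 "L2 M f \<longleftrightarrow> f \<in> borel_measurable M \<and> integrable M (%x. (norm (f x))^2)"

abbreviation sqnorm :: "'a measure => ('a => 'b::euclidean_space) => real" where
 "sqnorm M f \<equiv> (\<integral>x. (norm (f x))^2 \<partial>M)"

lemma norm_add_square_le: "(norm (a + b))^2 <= 2 * (norm a)^2 + 2 * (norm (b :: 'b::real_inner))^2"
proof -
 have "0 <= (norm (a - b))^2" by simp
 then show ?thesis by (simp add: power2_norm_eq_inner inner_add inner_diff inner_commute)
qed

lemma L2_add:
 assumes "L2 M f" "L2 M g"
 shows "L2 M (%x. f x + g x)"
 unfolding L2_def
proof
 have [measurable]: "f \<in> borel_measurable M" "g \<in> borel_measurable M"
  using assms by (auto simp: L2_def)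
 show "(%x. f x + g x) \<in> borel_measurable M" by measurable
 show "integrable M (%x. (norm (f x + g x))^2)"
  by (rule dominated_integrable[where f="%x. 2 * (norm (f x))^2 + 2 * (norm (g x))^2"])
    (use assms norm_add_square_le in \<open>auto simp: L2_def\<close>)
qed

lemma L2_scaleR:
 assumes "L2 M f"
 shows "L2 M (%x. c *\<^sub>R f x)"
 using assms by (auto simp: L2_def power_mult_distrib)

lemma L2_diff:
 assumes "L2 M f" "L2 M g"
 shows "L2 M (%x. f x - g x)"
 using L2_add[OF assms(1) L2_scaleR[OF assms(2), of "-1"]] by simp

lemma L2_midpoint_hull:
 assumes "midpoint_hull f n g" and "!!n. L2 M (f n)"
 shows "L2 M g"
 using assms(1)
 by induction (auto intro!: assms(2) L2_scaleR L2_add)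

lemma parallelogram_sqnorm:
 assumes f: "L2 M f" and g: "L2 M g"
 shows "sqnorm M (%x. f x - g x) = 2 * sqnorm M f + 2 * sqnorm M g - 4 * sqnorm M (%x. (1/2) *\<^sub>R (f x + g x))"
proof -
 have i: "integrable M (%x. (norm (f x))^2)" "integrable M (%x. (norm (g x))^2)"
   "integrable M (%x. (norm ((1/2) *\<^sub>R (f x + g x)))^2)"
  using f g L2_scaleR[OF L2_add[OF f g], of "1/2"] by (auto simp: L2_def)
 have p: "(norm (a - b))^2 = 2 * (norm a)^2 + 2 * (norm b)^2 - 4 * (norm ((1/2) *\<^sub>R (a + b)))^2" for a b :: 'b
  by (simp add: power2_norm_eq_inner inner_add inner_diff inner_commute algebra_simps)
 show ?thesis unfolding p using i by simp
qed

text \<open>A rapidly convergent subsequence converges pointwise almost everywhere, and Fatou's lemma bounds the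
 distance to the pointwise limit.\<close>

lemma L2_complete:
 fixes h :: "nat => 'a => 'b::euclidean_space"
 assumes h: "!!n. L2 M (h n)"
  and Cauchy: "!!n m. n <= m ==> sqnorm M (%x. h n x - h m x) <= e n" and e: "e \<longlonglongrightarrow> 0"
 obtains g where "L2 M g" "(%n. sqnorm M (%x. h n x - g x)) \<longlonglongrightarrow> 0"
proof -
 have [measurable]: "h n \<in> borel_measurable M" for n using h by (auto simp: L2_def)
 have "\<exists>n. \<forall>m\<ge>n. e m <= (1/4)^k" for k :: nat
 proof -
  have "eventually (%m. e m < (1/4)^k) sequentially" using e by (intro order_tendstoD) auto
  then show ?thesis by (auto simp: eventually_sequentially intro: less_imp_le)
 qed
 then obtain s where s: "!!k m. s k <= m ==> e m <= (1/4)^k" by metis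
 define r where "r = rec_nat (s 0) (%k v. max (Suc v) (s (Suc k)))"
 have rS: "r (Suc k) = max (Suc (r k)) (s (Suc k))" for k by (simp add: r_def)
 have r: "strict_mono r" by (rule strict_mono_Suc_iff[THEN iffD2]) (simp add: rS less_max_iff_disj)
 have rs: "s k <= r k" for k by (cases k) (auto simp: rS, simp add: r_def)
 have small: "sqnorm M (%x. h (r k) x - h (r (Suc k)) x) <= (1/4)^k" for k
  using Cauchy[of "r k" "r (Suc k)"] s[OF rs, of k] strict_monoD[OF r, of k "Suc k"] by fastforce
 have nn: "(\<integral>\<^sup>+x. ennreal ((norm (h n x - h m x))^2) \<partial>M) = ennreal (sqnorm M (%x. h n x - h m x))" for n m
  using L2_diff[OF h h, of n m] by (intro nn_integral_eq_integral) (auto simp: L2_def)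
 have "(\<integral>\<^sup>+x. (\<Sum>k. ennreal (2^k * (norm (h (r k) x - h (r (Suc k)) x))^2)) \<partial>M)
   = (\<Sum>k. (\<integral>\<^sup>+x. ennreal (2^k * (norm (h (r k) x - h (r (Suc k)) x))^2) \<partial>M))"
  by (rule nn_integral_suminf) measurable
 also have "... = (\<Sum>k. ennreal (2^k * sqnorm M (%x. h (r k) x - h (r (Suc k)) x)))"
 proof (rule suminf_cong)
  fix k
  show "(\<integral>\<^sup>+x. ennreal (2^k * (norm (h (r k) x - h (r (Suc k)) x))^2) \<partial>M) = ennreal (2^k * sqnorm M (%x. h (r k) x - h (r (Suc k)) x))"
   by (simp add: ennreal_mult nn_integral_cmult nn)
 qed
 also have "... <= (\<Sum>k. ennreal ((1/2)^k))"
 proof (rule suminf_le)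
  fix k
  have "2^k * sqnorm M (%x. h (r k) x - h (r (Suc k)) x) <= 2^k * (1/4)^k"
   using small[of k] by (intro mult_left_mono) auto
  also have "... = (1/2 :: real)^k" by (simp flip: power_mult_distrib)
  finally show "ennreal (2^k * sqnorm M (%x. h (r k) x - h (r (Suc k)) x)) <= ennreal ((1/2)^k)" by (rule ennreal_leI)
 qed auto
 also have "... = ennreal (\<Sum>k. (1/2)^k)" by (rule suminf_ennreal2) (auto intro: summable_geometric)
 also have "... < \<infinity>" by simp
 finally have "AE x in M. (\<Sum>k. ennreal (2^k * (norm (h (r k) x - h (r (Suc k)) x))^2)) \<noteq> \<infinity>"
  by (intro nn_integral_PInf_AE) auto
 then have conv: "AE x in M. convergent (%k. h (r k) x)"
 proof eventually_elim
  case (elim x)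
  define a where "a = (%k. norm (h (r k) x - h (r (Suc k)) x))"
  have a0: "0 <= a k" for k by (simp add: a_def)
  define S where "S = enn2real (\<Sum>k. ennreal (2^k * (a k)^2))"
  have "(\<Sum>k. ennreal (2^k * (a k)^2)) \<noteq> \<infinity>" unfolding a_def by (rule elim)
  then have "(\<Sum>k. ennreal (2^k * (a k)^2)) < top" unfolding less_top infinity_ennreal_def by assumption
  then have S1: "(\<Sum>k. ennreal (2^k * (a k)^2)) = ennreal S"
   unfolding S_def by (rule ennreal_enn2real[symmetric])
  have S2: "0 <= S" unfolding S_def by (rule enn2real_nonneg)
  note S = S1 S2
  have "a k <= sqrt S * (1 / sqrt 2)^k" for k
  proof -
   define F where "F = (%k. ennreal (2^k * (a k)^2))"
   have "sum F {k} <= suminf F" by (rule sum_le_suminf) auto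
   moreover have "suminf F = ennreal S" unfolding F_def by (rule S1)
   ultimately have "ennreal (2^k * (a k)^2) <= ennreal S" by (simp add: F_def)
   then have "2^k * (a k)^2 <= S" using S2 by (simp add: ennreal_le_iff)
   then have "sqrt (2^k * (a k)^2) <= sqrt S" by (rule real_sqrt_le_mono)
   then have "sqrt 2 ^ k * a k <= sqrt S" using a0 by (simp add: real_sqrt_mult real_sqrt_power)
   then show ?thesis by (simp add: power_divide field_simps)
  qed
  moreover have "summable (%k. sqrt S * (1 / sqrt 2)^k)" by (intro summable_mult summable_geometric) simp
  ultimately have sm: "summable a" using a0 by - (rule summable_comparison_test'[of "%k. sqrt S * (1 / sqrt 2)^k" 0], auto)
  have "summable (%k. h (r (Suc k)) x - h (r k) x)"
   by (rule summable_norm_cancel) (use sm in \<open>simp add: a_def norm_minus_commute\<close>)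
  then have "convergent (%n. \<Sum>k<n. h (r (Suc k)) x - h (r k) x)" by (simp add: summable_iff_convergent)
  then have "convergent (%n. h (r n) x - h (r 0) x)" by (simp only: sum_lessThan_telescope[of "%k. h (r k) x"])
  then have "convergent (%n. (h (r n) x - h (r 0) x) + h (r 0) x)" by (intro convergent_add convergent_const)
  then show ?case by simp
 qed
 define g where "g = (%x. lim (%k. h (r k) x))"
 have gm[measurable]: "g \<in> borel_measurable M" unfolding g_def by (rule borel_measurable_lim_metric) measurable
 have gl: "AE x in M. (%k. h (r k) x) \<longlonglongrightarrow> g x" using conv unfolding g_def
  by eventually_elim (simp add: convergent_LIMSEQ_iff)
 have fat: "(\<integral>\<^sup>+x. ennreal ((norm (h n x - g x))^2) \<partial>M) <= ennreal (e n)" for n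
 proof -
  have "(\<integral>\<^sup>+x. ennreal ((norm (h n x - g x))^2) \<partial>M) = (\<integral>\<^sup>+x. liminf (%k. ennreal ((norm (h n x - h (r k) x))^2)) \<partial>M)"
  proof (rule nn_integral_cong_AE)
   show "AE x in M. ennreal ((norm (h n x - g x))^2) = liminf (%k. ennreal ((norm (h n x - h (r k) x))^2))"
    using gl
   proof eventually_elim
    case (elim x)
    have "(%k. ennreal ((norm (h n x - h (r k) x))^2)) \<longlonglongrightarrow> ennreal ((norm (h n x - g x))^2)"
     by (intro tendsto_intros tendsto_ennrealI elim)
    then show ?case using lim_imp_Liminf[OF sequentially_bot] by fastforce
   qed
  qed
  also have "... <= liminf (%k. (\<integral>\<^sup>+x. ennreal ((norm (h n x - h (r k) x))^2) \<partial>M))"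
   by (rule nn_integral_liminf) measurable
  also have "... <= ennreal (e n)"
  proof (rule Liminf_le)
   have "eventually (%k. n <= r k) sequentially"
    using seq_suble[OF r] by (intro eventually_sequentiallyI[of n]) (meson order_trans)
   then show "eventually (%k. (\<integral>\<^sup>+x. ennreal ((norm (h n x - h (r k) x))^2) \<partial>M) <= ennreal (e n)) sequentially"
    by eventually_elim (simp add: nn Cauchy ennreal_leI)
  qed simp
  finally show ?thesis .
 qed
 have hg: "L2 M (%x. h n x - g x)" for n
  unfolding L2_def
 proof
  show "integrable M (%x. (norm (h n x - g x))^2)"
   by (rule integrableI_nonneg) (use fat[of n] in \<open>auto simp: le_less_trans\<close>)
 qed measurable
 have g: "L2 M g"
  using L2_diff[OF h[of 0] hg[of 0]] by simp
 have le: "sqnorm M (%x. h n x - g x) <= e n" for n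
 proof -
  have "0 <= e n" using Cauchy[of n n] by simp
  moreover have "ennreal (sqnorm M (%x. h n x - g x)) <= ennreal (e n)"
   using fat[of n] hg[of n] by (subst nn_integral_eq_integral[symmetric]) (auto simp: L2_def)
  ultimately show ?thesis by simp
 qed
 have "(%n. sqnorm M (%x. h n x - g x)) \<longlonglongrightarrow> 0"
  by (rule tendsto_sandwich[OF _ _ tendsto_const e]) (auto simp: le)
 then show thesis using g that by blast
qed

text \<open>Choose in the hull of the \<open>n\<close>-th tail an element of almost minimal norm. The minimal norms increase to
 a finite limit, so the parallelogram law makes the choices a Cauchy sequence. An
 inequality that is convex in \<open>f n\<close> and holds for large \<open>n\<close> passes to these combinations.\<close>

lemma Mazur_strong_limit:
 fixes f :: "nat => 'a => 'b::euclidean_space"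
 assumes f: "!!n. L2 M (f n)" and C: "!!n. sqnorm M (f n) <= C"
 obtains h g where "!!n. midpoint_hull f n (h n)" "L2 M g"
   "(%n. sqnorm M (%x. h n x - g x)) \<longlonglongrightarrow> 0"
proof -
 define D where "D = (%n. {sqnorm M h |h. midpoint_hull f n h})"
 define d where "d = (%n. Inf (D n))"
 have bdd: "bdd_below (D n)" for n by (rule bdd_belowI[of _ 0]) (auto simp: D_def)
 have ne: "sqnorm M (f n) \<in> D n" for n by (auto simp: D_def intro: midpoint_hull.base)
 have dle: "d n <= sqnorm M h" if "midpoint_hull f n h" for n h
  unfolding d_def by (rule cInf_lower[OF _ bdd]) (use that in \<open>auto simp: D_def\<close>)
 have dC: "d n <= C" for n using dle[OF midpoint_hull.base[OF order_refl]] C order_trans by blast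
 have dmono: "incseq d"
 proof (rule incseq_SucI)
  fix n show "d n <= d (Suc n)"
   unfolding d_def
  proof (rule cInf_superset_mono)
   show "D (Suc n) \<noteq> {}" using ne by blast
   show "D (Suc n) \<subseteq> D n" unfolding D_def using midpoint_hull_mono[of f "Suc n" _ n] by auto
  qed (rule bdd)
 qed
 obtain d' where d': "d \<longlonglongrightarrow> d'" "!!n. d n <= d'" using incseq_convergent[OF dmono, of C] dC by blast
 have "\<exists>h. midpoint_hull f n h \<and> sqnorm M h < d n + 1 / real (Suc n)" for n
 proof -
  have "\<exists>y\<in>D n. y < d n + 1 / real (Suc n)"
   using cInf_less_iff[OF _ bdd, of n "d n + 1 / real (Suc n)"] ne[of n] unfolding d_def by auto
  then show ?thesis by (auto simp: D_def)
 qed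
 then obtain h where h: "!!n. midpoint_hull f n (h n)" "!!n. sqnorm M (h n) < d n + 1 / real (Suc n)" by metis
 have hs: "L2 M (h n)" for n using L2_midpoint_hull[OF h(1) f] .
 define e where "e = (%n. 2 * (d' - d n) + 4 * (1 / real (Suc n)))"
 have Cau: "sqnorm M (%x. h n x - h m x) <= e n" if "n <= m" for n m
 proof -
  have "midpoint_hull f n (%x. (1/2) *\<^sub>R (h n x + h m x))"
   by (intro midpoint_hull.mid h(1) midpoint_hull_mono[OF h(1) that])
  then have "d n <= sqnorm M (%x. (1/2) *\<^sub>R (h n x + h m x))" by (rule dle)
  moreover have "1 / real (Suc m) <= 1 / real (Suc n)" using that by (simp add: frac_le)
  moreover define i j X Y Z where "i = 1 / real (Suc n)" and "j = 1 / real (Suc m)"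
   and "X = sqnorm M (h n)" and "Y = sqnorm M (h m)" and "Z = sqnorm M (%x. (1/2) *\<^sub>R (h n x + h m x))"
  ultimately have "d n <= Z" "j <= i" "X < d n + i" "Y < d m + j" "d m <= d'"
   using h(2)[of n] h(2)[of m] d'(2)[of m] by simp_all
  then have "2 * X <= 2 * d n + 2 * i" "2 * Y <= 2 * d' + 2 * i" "4 * d n <= 4 * Z" by auto
  then have "2 * X + 2 * Y - 4 * Z <= 2 * (d' - d n) + 4 * i" by (simp add: algebra_simps)
  then show ?thesis
   unfolding parallelogram_sqnorm[OF hs hs, of n m] e_def i_def X_def Y_def Z_def .
 qed
 have "e \<longlonglongrightarrow> 2 * (d' - d') + 4 * 0"
  unfolding e_def using LIMSEQ_Suc[OF lim_1_over_n] by (intro tendsto_intros d') (simp add: inverse_eq_divide)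
 then have e0: "e \<longlonglongrightarrow> 0" by simp
 obtain g where "L2 M g" "(%n. sqnorm M (%x. h n x - g x)) \<longlonglongrightarrow> 0"
  by (rule L2_complete[OF hs Cau e0])
 then show thesis by (rule that[OF h(1)])
qed

lemma L2_real:
 "L2 M (f :: 'a => real) \<longleftrightarrow> f \<in> borel_measurable M \<and> integrable M (%x. (f x)^2)"
 by (simp add: L2_def)

lemma tendsto_integral_mult:
 fixes h :: "nat => 'a => real"
 assumes h: "!!n. L2 M (h n)" and g: "L2 M g" and \<psi>: "L2 M \<psi>"
  and lim: "(%n. \<integral>x. (h n x - g x)^2 \<partial>M) \<longlonglongrightarrow> 0"
 shows "(%n. \<integral>x. \<psi> x * h n x \<partial>M) \<longlonglongrightarrow> (\<integral>x. \<psi> x * g x \<partial>M)"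
proof -
 have d: "L2 M (%x. h n x - g x)" for n by (rule L2_diff[OF h g])
 have "(%n. sqrt (\<integral>x. (\<psi> x)^2 \<partial>M) * sqrt (\<integral>x. (h n x - g x)^2 \<partial>M)) \<longlonglongrightarrow> sqrt (\<integral>x. (\<psi> x)^2 \<partial>M) * sqrt 0"
  by (intro tendsto_intros lim)
 then have z: "(%n. sqrt (\<integral>x. (\<psi> x)^2 \<partial>M) * sqrt (\<integral>x. (h n x - g x)^2 \<partial>M)) \<longlonglongrightarrow> 0" by simp
 have le: "norm ((\<integral>x. \<psi> x * h n x \<partial>M) - (\<integral>x. \<psi> x * g x \<partial>M)) <= sqrt (\<integral>x. (\<psi> x)^2 \<partial>M) * sqrt (\<integral>x. (h n x - g x)^2 \<partial>M)" for n
 proof -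
  have i: "integrable M (%x. \<psi> x * h n x)" "integrable M (%x. \<psi> x * g x)"
   using h[of n] g \<psi> by (auto intro!: integrable_mult_of_squares simp: L2_real)
  have "(\<integral>x. \<psi> x * h n x \<partial>M) - (\<integral>x. \<psi> x * g x \<partial>M) = (\<integral>x. \<psi> x * (h n x - g x) \<partial>M)"
   using i by (simp add: algebra_simps)
  then show ?thesis
   using abs_integral_mult_le[of \<psi> M "%x. h n x - g x"] d[of n] \<psi> by (simp add: L2_real)
 qed
 show ?thesis
  by (rule LIM_zero_cancel, rule Lim_null_comparison[OF _ z]) (use le in auto)
qed

text \<open>The limit passage needed below: linear terms with strongly convergent coefficients plus a quadratic term
 with bounded, pointwise convergent weights \<open>wn \<ge> 0\<close>. The pair \<open>(q, p)\<close> is treated as one vector valued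
 sequence so that both limits come from the same convex combinations. The weights vary with \<open>n\<close>, which would
 destroy convexity; on the set \<open>E K\<close> where \<open>w <= wn m + \<epsilon>\<close> for all \<open>m \<ge> K\<close> the weight \<open>w\<close> can be used for
 all large indices at once, and these sets exhaust the space up to a null set.\<close>

lemma weak_limit_exists:
 fixes q p :: "nat => 'a => real"
 assumes q: "!!n. L2 M (q n)" and p: "!!n. L2 M (p n)"
  and qC: "!!n. (\<integral>x. (q n x)^2 \<partial>M) <= C" and pC: "!!n. (\<integral>x. (p n x)^2 \<partial>M) <= C"
 obtains q' p' where "L2 M q'" "L2 M p'"
  "!!\<psi>n \<psi> \<theta>n \<theta> wn w W an a.
   \<lbrakk>!!n. L2 M (\<psi>n n); L2 M \<psi>; (%n. \<integral>x. (\<psi>n n x - \<psi> x)^2 \<partial>M) \<longlonglongrightarrow> 0;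
   !!n. L2 M (\<theta>n n); L2 M \<theta>; (%n. \<integral>x. (\<theta>n n x - \<theta> x)^2 \<partial>M) \<longlonglongrightarrow> 0;
   !!n. wn n \<in> borel_measurable M; w \<in> borel_measurable M; !!n x. 0 <= wn n x; !!n x. wn n x <= W;
   !!x. 0 <= w x; !!x. w x <= W; AE x in M. (%n. wn n x) \<longlonglongrightarrow> w x; an \<longlonglongrightarrow> a;
   eventually (%n. (\<integral>x. wn n x * (p n x)^2 \<partial>M) + (\<integral>x. \<psi>n n x * q n x \<partial>M) + (\<integral>x. \<theta>n n x * p n x \<partial>M) <= an n) sequentially\<rbrakk>
   \<Longrightarrow> (\<integral>x. w x * (p' x)^2 \<partial>M) + (\<integral>x. \<psi> x * q' x \<partial>M) + (\<integral>x. \<theta> x * p' x \<partial>M) <= a"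
proof -
 define f where "f = (%n x. (q n x, p n x))"
 have np: "(norm (a, b))^2 = a^2 + b^2" for a b :: real by (simp add: norm_Pair)
 have f: "L2 M (f n)" for n
  using q[of n] p[of n] by (auto simp: L2_def f_def norm_Pair)
 have fC: "sqnorm M (f n) <= 2 * C" for n
  using qC[of n] pC[of n] q[of n] p[of n] by (simp add: f_def np L2_real)
 obtain h g where hull: "!!n. midpoint_hull f n (h n)" and g: "L2 M g"
  and lim: "(%n. sqnorm M (%x. h n x - g x)) \<longlonglongrightarrow> 0"
  by (rule Mazur_strong_limit[where f=f, OF f fC]) (rule that)
 have h: "L2 M (h n)" for n using L2_midpoint_hull[OF hull f] .
 have fs: "L2 M (%x. fst (k x))" "L2 M (%x. snd (k x))"
   "(\<integral>x. (fst (k x))^2 \<partial>M) <= sqnorm M k" "(\<integral>x. (snd (k x))^2 \<partial>M) <= sqnorm M k"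
  if k: "L2 M k" for k :: "'a => real \<times> real"
 proof -
  have [measurable]: "k \<in> borel_measurable M" using k by (simp add: L2_def)
  have k2: "integrable M (%x. (norm (k x))^2)" using k by (simp add: L2_def)
  have n: "(norm (k x))^2 = (fst (k x))^2 + (snd (k x))^2" for x
   by (metis np prod.collapse)
  have m: "(%x. fst (k x)) \<in> borel_measurable M" "(%x. snd (k x)) \<in> borel_measurable M"
   by (auto intro!: borel_measurable_continuous_on[of fst] borel_measurable_continuous_on[of snd] continuous_intros)
  have i1: "integrable M (%x. (fst (k x))^2)" and i2: "integrable M (%x. (snd (k x))^2)"
   by (rule dominated_integrable[OF k2]; use m n in auto)+
  show "L2 M (%x. fst (k x))" "L2 M (%x. snd (k x))"
   using m i1 i2 by (auto simp: L2_real)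
  show "(\<integral>x. (fst (k x))^2 \<partial>M) <= sqnorm M k" "(\<integral>x. (snd (k x))^2 \<partial>M) <= sqnorm M k"
   by (rule integral_mono; use i1 i2 k2 n in auto)+
 qed
 define q' where "q' = (%x. fst (g x))"
 define p' where "p' = (%x. snd (g x))"
 have q': "L2 M q'" and p': "L2 M p'" using fs[OF g] by (auto simp: q'_def p'_def)
 define hq where "hq = (%n x. fst (h n x))"
 define hp where "hp = (%n x. snd (h n x))"
 have hq: "L2 M (hq n)" and hp: "L2 M (hp n)" for n
  using fs[OF h] by (auto simp: hq_def hp_def)
 have limq: "(%n. \<integral>x. (hq n x - q' x)^2 \<partial>M) \<longlonglongrightarrow> 0"
  by (rule tendsto_sandwich[OF _ _ tendsto_const lim])
    (use fs(3)[OF L2_diff[OF h g]] in \<open>auto simp: hq_def q'_def\<close>)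
 have limp: "(%n. \<integral>x. (hp n x - p' x)^2 \<partial>M) \<longlonglongrightarrow> 0"
  by (rule tendsto_sandwich[OF _ _ tendsto_const lim])
    (use fs(4)[OF L2_diff[OF h g]] in \<open>auto simp: hp_def p'_def\<close>)
 have C0: "0 <= C" using qC[of 0] by (smt (verit) integral_nonneg_AE AE_I2 zero_le_power2)
 show thesis
 proof (rule that[OF q' p'])
  fix \<psi>n \<psi> \<theta>n \<theta> wn w W an a
  assume \<psi>n: "!!n. L2 M (\<psi>n n)" and \<psi>: "L2 M \<psi>"
   and \<psi>lim: "(%n. \<integral>x. (\<psi>n n x - \<psi> x)^2 \<partial>M) \<longlonglongrightarrow> 0"
   and \<theta>n: "!!n. L2 M (\<theta>n n)" and \<theta>: "L2 M \<theta>"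
   and \<theta>lim: "(%n. \<integral>x. (\<theta>n n x - \<theta> x)^2 \<partial>M) \<longlonglongrightarrow> 0"
   and wn[measurable]: "!!n. wn n \<in> borel_measurable M" and w[measurable]: "w \<in> borel_measurable M"
   and wn0: "!!n x. 0 <= wn n x" and wnW: "!!n x. wn n x <= W" and w0: "!!x. 0 <= w x" and wW: "!!x. w x <= W"
   and wlim: "AE x in M. (%n. wn n x) \<longlonglongrightarrow> w x" and alim: "an \<longlonglongrightarrow> a"
   and ineq: "eventually (%n. (\<integral>x. wn n x * (p n x)^2 \<partial>M) + (\<integral>x. \<psi>n n x * q n x \<partial>M) + (\<integral>x. \<theta>n n x * p n x \<partial>M) <= an n) sequentially"
  have im: "integrable M (%x. f x * g x)" if "L2 M f" "L2 M g" for f g :: "'a => real"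
   using that by (auto intro!: integrable_mult_of_squares simp: L2_real)
  have isq: "integrable M (%x. b x * (f x)^2)"
   if [measurable]: "b \<in> borel_measurable M" and b: "!!x. 0 <= b x" "!!x. b x <= K" and f: "L2 M f" for b f :: "'a => real" and K
  proof (rule dominated_integrable[where f="%x. K * (f x)^2"])
   have [measurable]: "f \<in> borel_measurable M" using f by (simp add: L2_real)
   show "integrable M (%x. K * (f x)^2)" using f by (simp add: L2_real)
   show "(%x. b x * (f x)^2) \<in> borel_measurable M" by measurable
   have "\<bar>b x\<bar> <= \<bar>K\<bar>" for x using b[of x] by linarith
   then show "AE x in M. norm (b x * (f x)^2) <= norm (K * (f x)^2)"
    by (auto simp: abs_mult intro!: mult_right_mono)
  qed
  define T where "T = (\<integral>x. w x * (p' x)^2 \<partial>M) + (\<integral>x. \<psi> x * q' x \<partial>M) + (\<integral>x. \<theta> x * p' x \<partial>M)"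
  define \<delta> where "\<delta> = (%n. sqrt C * sqrt (\<integral>x. (\<psi>n n x - \<psi> x)^2 \<partial>M) + sqrt C * sqrt (\<integral>x. (\<theta>n n x - \<theta> x)^2 \<partial>M))"
  have "\<delta> \<longlonglongrightarrow> sqrt C * sqrt 0 + sqrt C * sqrt 0" unfolding \<delta>_def by (intro tendsto_intros \<psi>lim \<theta>lim)
  then have al: "(%n. an n + \<delta> n) \<longlonglongrightarrow> a" using tendsto_add[OF alim] by fastforce
  have lin: "(\<integral>x. \<psi> x * q n x \<partial>M) + (\<integral>x. \<theta> x * p n x \<partial>M)
    <= (\<integral>x. \<psi>n n x * q n x \<partial>M) + (\<integral>x. \<theta>n n x * p n x \<partial>M) + \<delta> n" for n
  proof -
   have one: "(\<integral>x. u x * f x \<partial>M) - (\<integral>x. v x * f x \<partial>M) <= sqrt C * sqrt (\<integral>x. (v x - u x)^2 \<partial>M)"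
    if u: "L2 M u" and v: "L2 M v" and f: "L2 M f" and fC: "(\<integral>x. (f x)^2 \<partial>M) <= C" for u v f :: "'a => real"
   proof -
    have "(\<integral>x. u x * f x \<partial>M) - (\<integral>x. v x * f x \<partial>M) = - (\<integral>x. f x * (v x - u x) \<partial>M)"
     using im[OF u f] im[OF v f] by (simp add: algebra_simps)
    also have "... <= \<bar>\<integral>x. f x * (v x - u x) \<partial>M\<bar>" by simp
    also have "... <= sqrt (\<integral>x. (f x)^2 \<partial>M) * sqrt (\<integral>x. (v x - u x)^2 \<partial>M)"
     using f L2_diff[OF v u] by (intro abs_integral_mult_le) (auto simp: L2_real)
    also have "... <= sqrt C * sqrt (\<integral>x. (v x - u x)^2 \<partial>M)" using fC by (intro mult_right_mono real_sqrt_le_mono) auto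
    finally show ?thesis .
   qed
   show ?thesis
    using one[OF \<psi> \<psi>n[of n] q[of n] qC[of n]] one[OF \<theta> \<theta>n[of n] p[of n] pC[of n]] unfolding \<delta>_def by linarith
  qed
  have key: "T <= a + \<epsilon> * (1 + C)" if e: "0 < \<epsilon>" for \<epsilon>
  proof -
   define E where "E = (%K. {x\<in>space M. \<forall>m\<ge>K. w x <= wn m x + \<epsilon>})"
   have Em[measurable]: "E K \<in> sets M" for K unfolding E_def by measurable
   have step: "(\<integral>x. (indicator (E K) x * w x) * (p' x)^2 \<partial>M) + (\<integral>x. \<psi> x * q' x \<partial>M) + (\<integral>x. \<theta> x * p' x \<partial>M) <= a + \<epsilon> * (1 + C)" for K
   proof -
    define b where "b = (%x. indicator (E K) x * w x)"
    have bm[measurable]: "b \<in> borel_measurable M" unfolding b_def by measurable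
    have b: "0 <= b x" "b x <= W" for x using w0[of x] wW[of x] by (auto simp: b_def indicator_def)
    define \<Phi> where "\<Phi> = (%k::'a => real \<times> real. (\<integral>x. b x * (snd (k x))^2 \<partial>M) + (\<integral>x. \<psi> x * fst (k x) \<partial>M) + (\<integral>x. \<theta> x * snd (k x) \<partial>M))"
    have "eventually (%n. an n + \<delta> n < a + \<epsilon>) sequentially" using al e by (intro order_tendstoD) auto
    with ineq have "eventually (%n. an n + \<delta> n < a + \<epsilon> \<and>
      (\<integral>x. wn n x * (p n x)^2 \<partial>M) + (\<integral>x. \<psi>n n x * q n x \<partial>M) + (\<integral>x. \<theta>n n x * p n x \<partial>M) <= an n) sequentially"
     by eventually_elim simp
    then obtain n1 where n1: "!!n. n1 <= n ==> an n + \<delta> n < a + \<epsilon> \<and>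
      (\<integral>x. wn n x * (p n x)^2 \<partial>M) + (\<integral>x. \<psi>n n x * q n x \<partial>M) + (\<integral>x. \<theta>n n x * p n x \<partial>M) <= an n"
     by (auto simp: eventually_sequentially)
    have base: "\<Phi> (f m) <= a + \<epsilon> * (1 + C)" if m: "max K n1 <= m" for m
    proof -
     have "(\<integral>x. b x * (p m x)^2 \<partial>M) <= (\<integral>x. wn m x * (p m x)^2 + \<epsilon> * (p m x)^2 \<partial>M)"
     proof (rule integral_mono)
      show "integrable M (%x. b x * (p m x)^2)" by (rule isq[OF bm b p])
      show "integrable M (%x. wn m x * (p m x)^2 + \<epsilon> * (p m x)^2)"
       using isq[OF wn wn0 wnW p, of m m] p[of m] by (simp add: L2_real)
      fix x
      have "b x <= wn m x + \<epsilon>"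
       using m wn0[of m x] e by (auto simp: b_def E_def indicator_def)
      then have "b x * (p m x)^2 <= (wn m x + \<epsilon>) * (p m x)^2" by (intro mult_right_mono) auto
      then show "b x * (p m x)^2 <= wn m x * (p m x)^2 + \<epsilon> * (p m x)^2" by (simp add: algebra_simps)
     qed
     also have "... = (\<integral>x. wn m x * (p m x)^2 \<partial>M) + \<epsilon> * (\<integral>x. (p m x)^2 \<partial>M)"
      using isq[OF wn wn0 wnW p, of m m] p[of m] by (simp add: L2_real)
     also have "... <= (\<integral>x. wn m x * (p m x)^2 \<partial>M) + \<epsilon> * C"
      using pC[of m] e by (intro add_left_mono mult_left_mono) auto
     finally show ?thesis using lin[of m] n1[of m] m by (simp add: \<Phi>_def f_def algebra_simps)
    qed
    have hullb: "\<Phi> k <= a + \<epsilon> * (1 + C)" if "midpoint_hull f (max K n1) k" for k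
     using that
    proof induction
     case (base m) then show ?case using \<open>!!m. max K n1 <= m ==> \<Phi> (f m) <= a + \<epsilon> * (1 + C)\<close> by simp
    next
     case (mid k l)
     have k: "L2 M k" and l: "L2 M l"
      using mid.hyps L2_midpoint_hull[OF _ f] by auto
     note kk = fs(1,2)[OF k] and ll = fs(1,2)[OF l]
     have sq: "((1/2) * (a + b))^2 <= (1/2) * a^2 + (1/2) * b^2" for a b :: real
      using zero_le_power2[of "a - b"] by (simp add: power2_eq_square algebra_simps)
     have sc: "L2 M (%x. (1/2) * (snd (k x) + snd (l x)))"
      using L2_scaleR[OF L2_add[OF kk(2) ll(2)], of "1/2"] by simp
     have "(\<integral>x. b x * ((1/2) * (snd (k x) + snd (l x)))^2 \<partial>M) <= (\<integral>x. (1/2) * (b x * (snd (k x))^2) + (1/2) * (b x * (snd (l x))^2) \<partial>M)"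
     proof (rule integral_mono)
      fix x
      show "b x * ((1/2) * (snd (k x) + snd (l x)))^2 <= (1/2) * (b x * (snd (k x))^2) + (1/2) * (b x * (snd (l x))^2)"
       using mult_left_mono[OF sq[of "snd (k x)" "snd (l x)"] b(1)[of x]] by (simp add: algebra_simps)
     qed (use isq[OF bm b kk(2)] isq[OF bm b ll(2)] isq[OF bm b sc] in auto)
     also have "... = (1/2) * (\<integral>x. b x * (snd (k x))^2 \<partial>M) + (1/2) * (\<integral>x. b x * (snd (l x))^2 \<partial>M)"
      using isq[OF bm b kk(2)] isq[OF bm b ll(2)] by simp
     finally have 1: "(\<integral>x. b x * ((1/2) * (snd (k x) + snd (l x)))^2 \<partial>M) <= (1/2) * (\<integral>x. b x * (snd (k x))^2 \<partial>M) + (1/2) * (\<integral>x. b x * (snd (l x))^2 \<partial>M)" .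
     have li: "(\<integral>x. \<xi> x * ((1/2) * (u x + v x)) \<partial>M) = (1/2) * (\<integral>x. \<xi> x * u x \<partial>M) + (1/2) * (\<integral>x. \<xi> x * v x \<partial>M)"
      if "L2 M \<xi>" "L2 M u" "L2 M v" for \<xi> u v :: "'a => real"
     proof -
      have "(\<integral>x. \<xi> x * ((1/2) * (u x + v x)) \<partial>M) = (\<integral>x. (1/2) * (\<xi> x * u x) + (1/2) * (\<xi> x * v x) \<partial>M)"
       by (rule lint_cong) (auto simp: algebra_simps)
      then show ?thesis using im[OF that(1,2)] im[OF that(1,3)] by simp
     qed
     have "\<Phi> (%z. (1/2) *\<^sub>R (k z + l z)) <= (1/2) * \<Phi> k + (1/2) * \<Phi> l"
      unfolding \<Phi>_def fst_scaleR snd_scaleR fst_add snd_add real_scaleR_def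
      using 1 li[OF \<psi> kk(1) ll(1)] li[OF \<theta> kk(2) ll(2)] by argo
     then show ?case using mid.IH by argo
    qed
    have hb: "eventually (%n. \<Phi> (h n) <= a + \<epsilon> * (1 + C)) sequentially"
     by (rule eventually_sequentiallyI[of "max K n1"]) (use hullb midpoint_hull_mono[OF hull] in blast)
    have bp: "L2 M (%x. b x * p' x)"
     unfolding L2_real
    proof
     have [measurable]: "p' \<in> borel_measurable M" using p' by (simp add: L2_real)
     show "(%x. b x * p' x) \<in> borel_measurable M" by measurable
     have "integrable M (%x. (b x)^2 * (p' x)^2)"
      by (rule isq[OF _ _ _ p', of _ "W^2"]) (use b in \<open>auto intro: power_mono\<close>)
     then show "integrable M (%x. (b x * p' x)^2)" by (simp add: power_mult_distrib)
    qed
    \<comment> \<open>linearization at \<open>p'\<close> from below\<close>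
    have low: "(\<integral>x. b x * (p' x)^2 \<partial>M) + 2 * ((\<integral>x. (b x * p' x) * hp n x \<partial>M) - (\<integral>x. (b x * p' x) * p' x \<partial>M)) <= (\<integral>x. b x * (hp n x)^2 \<partial>M)" for n
    proof -
     have "(\<integral>x. b x * (p' x)^2 \<partial>M) + 2 * ((\<integral>x. (b x * p' x) * hp n x \<partial>M) - (\<integral>x. (b x * p' x) * p' x \<partial>M))
       = (\<integral>x. b x * (p' x)^2 + 2 * ((b x * p' x) * hp n x - (b x * p' x) * p' x) \<partial>M)"
      using isq[OF bm b p'] im[OF bp hp] im[OF bp p'] by simp
     also have "... <= (\<integral>x. b x * (hp n x)^2 \<partial>M)"
     proof (rule integral_mono)
      show "integrable M (%x. b x * (p' x)^2 + 2 * ((b x * p' x) * hp n x - (b x * p' x) * p' x))"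
       using isq[OF bm b p'] im[OF bp hp] im[OF bp p'] by simp
      show "integrable M (%x. b x * (hp n x)^2)" by (rule isq[OF bm b hp])
      fix x
      have "0 <= b x * (hp n x - p' x)^2" using b by simp
      then show "b x * (p' x)^2 + 2 * ((b x * p' x) * hp n x - (b x * p' x) * p' x) <= b x * (hp n x)^2"
       by (simp add: power2_eq_square algebra_simps)
     qed
     finally show ?thesis .
    qed
    define Z where "Z = (%n. (\<integral>x. b x * (p' x)^2 \<partial>M) + 2 * ((\<integral>x. (b x * p' x) * hp n x \<partial>M) - (\<integral>x. (b x * p' x) * p' x \<partial>M))
       + (\<integral>x. \<psi> x * hq n x \<partial>M) + (\<integral>x. \<theta> x * hp n x \<partial>M))"
    have "Z \<longlonglongrightarrow> (\<integral>x. b x * (p' x)^2 \<partial>M) + 2 * ((\<integral>x. (b x * p' x) * p' x \<partial>M) - (\<integral>x. (b x * p' x) * p' x \<partial>M))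
       + (\<integral>x. \<psi> x * q' x \<partial>M) + (\<integral>x. \<theta> x * p' x \<partial>M)"
     unfolding Z_def
     by (intro tendsto_intros tendsto_integral_mult hq hp q' p' \<psi> \<theta> bp limq limp)
    moreover have "eventually (%n. Z n <= a + \<epsilon> * (1 + C)) sequentially"
     using hb
    proof eventually_elim
     case (elim n)
     then show ?case using low[of n] by (simp add: Z_def \<Phi>_def hq_def hp_def)
    qed
    ultimately have "(\<integral>x. b x * (p' x)^2 \<partial>M) + (\<integral>x. \<psi> x * q' x \<partial>M) + (\<integral>x. \<theta> x * p' x \<partial>M) <= a + \<epsilon> * (1 + C)"
     using tendsto_upperbound[OF _ _ sequentially_bot] by fastforce
    then show ?thesis by (simp add: b_def)
   qed
   have [measurable]: "p' \<in> borel_measurable M" using p' by (simp add: L2_real)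
   have "(%K. \<integral>x. (indicator (E K) x * w x) * (p' x)^2 \<partial>M) \<longlonglongrightarrow> (\<integral>x. w x * (p' x)^2 \<partial>M)"
   proof (rule integral_dominated_convergence)
    show "integrable M (%x. w x * (p' x)^2)" by (rule isq[OF w w0 wW p'])
    show "AE x in M. (%K. (indicator (E K) x * w x) * (p' x)^2) \<longlonglongrightarrow> w x * (p' x)^2"
     using wlim AE_space
    proof eventually_elim
     case (elim x)
     have "eventually (%n. w x - \<epsilon> < wn n x) sequentially" using elim e by (intro order_tendstoD) auto
     then obtain K0 where K0: "!!n. K0 <= n ==> w x - \<epsilon> < wn n x" by (auto simp: eventually_sequentially)
     have "eventually (%K. (indicator (E K) x * w x) * (p' x)^2 = w x * (p' x)^2) sequentially"
     proof (rule eventually_sequentiallyI[of K0])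
      fix K assume "K0 <= K"
      then have "x \<in> E K" using K0 elim(2) unfolding E_def by (auto, smt (verit) le_trans)
      then show "(indicator (E K) x * w x) * (p' x)^2 = w x * (p' x)^2" by simp
     qed
     then show ?case by (rule tendsto_eventually)
    qed
    show "AE x in M. norm ((indicator (E K) x * w x) * (p' x)^2) <= w x * (p' x)^2" for K
     using w0 by (auto simp: indicator_def)
   qed measurable
   then have "(%K. (\<integral>x. (indicator (E K) x * w x) * (p' x)^2 \<partial>M) + (\<integral>x. \<psi> x * q' x \<partial>M) + (\<integral>x. \<theta> x * p' x \<partial>M)) \<longlonglongrightarrow> T"
    unfolding T_def by (intro tendsto_intros)
   then show ?thesis by (rule LIMSEQ_le_const2) (use step in auto)
  qed
  \<comment> \<open>the \<open>\<epsilon>\<close> above is arbitrary\<close>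
  have "T <= a"
  proof (rule field_le_epsilon)
   fix e :: real assume "0 < e"
   then have "T <= a + (e / (1 + C)) * (1 + C)" using C0 by (intro key) simp
   then show "T <= a + e" using C0 by simp
  qed
  then show "(\<integral>x. w x * (p' x)^2 \<partial>M) + (\<integral>x. \<psi> x * q' x \<partial>M) + (\<integral>x. \<theta> x * p' x \<partial>M) <= a" by (simp add: T_def)
 qed
qed

section \<open>One implicit step\<close>

text \<open>The flux \<open>\<kappa> \<Delta>G(v)\<close> through the left edge of cell \<open>i\<close>. The boundary condition sets it to zero
 at both ends, so the ghost cells of the scheme disappear.\<close>

definition nflux :: "(real => real) => (nat => real) => nat => (nat => real) => nat => real" where
 "nflux G \<kappa> N v i = (if i = 0 \<or> N < i then 0 else \<kappa> i * (G (v i) - G (v (i - 1))))"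

definition nat_step :: "(real => real) => (nat => real) => nat => real => (nat => real) => (nat => real) => bool" where
 "nat_step G \<kappa> N \<mu> w v \<longleftrightarrow> (\<forall>i\<le>N. v i - w i = \<mu> * (nflux G \<kappa> N v (Suc i) - nflux G \<kappa> N v i))"

lemma nflux_0 [simp]: "nflux G \<kappa> N v 0 = 0"
 and nflux_Suc_N [simp]: "nflux G \<kappa> N v (Suc N) = 0"
 and nflux_Suc: "i < N ==> nflux G \<kappa> N v (Suc i) = \<kappa> (Suc i) * (G (v (Suc i)) - G (v i))"
 by (auto simp: nflux_def)

lemma summation_by_parts_aux:
 fixes f r :: "nat => real"
 shows "f 0 = 0 ==> (\<Sum>i\<le>N. (f (Suc i) - f i) * r i) = f (Suc N) * r N - (\<Sum>i<N. f (Suc i) * (r (Suc i) - r i))"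
 by (induction N) (auto simp: algebra_simps)

lemma nat_step_sum:
 assumes "nat_step G \<kappa> N \<mu> w v"
 shows "(\<Sum>i\<le>N. (v i - w i) * r i) = - \<mu> * (\<Sum>i<N. nflux G \<kappa> N v (Suc i) * (r (Suc i) - r i))"
proof -
 have "(\<Sum>i\<le>N. (v i - w i) * r i) = (\<Sum>i\<le>N. \<mu> * ((nflux G \<kappa> N v (Suc i) - nflux G \<kappa> N v i) * r i))"
  using assms by (intro sum.cong) (auto simp: nat_step_def)
 also have "... = \<mu> * (\<Sum>i\<le>N. (nflux G \<kappa> N v (Suc i) - nflux G \<kappa> N v i) * r i)" by (simp add: sum_distrib_left)
 finally show ?thesis by (simp add: summation_by_parts_aux)
qed

text \<open>Testing the difference of two solutions with \<open>G v - G v'\<close> gives two nonnegative terms with sum zero.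
 Since \<open>G\<close> may be constant on intervals, this only shows that the fluxes agree; the step then determines \<open>v\<close>.\<close>

lemma nat_step_unique:
 assumes v: "nat_step G \<kappa> N \<mu> w v" and v': "nat_step G \<kappa> N \<mu> w v'" and mono: "mono G"
  and \<mu>: "0 < \<mu>" and \<kappa>: "!!i. 1 <= i ==> i <= N ==> 0 < \<kappa> i" and i: "i <= N"
 shows "v i = v' i"
proof -
 define r where "r = (%i. G (v i) - G (v' i))"
 have "(\<Sum>i\<le>N. (v i - w i) * r i) - (\<Sum>i\<le>N. (v' i - w i) * r i)
   = - \<mu> * ((\<Sum>i<N. nflux G \<kappa> N v (Suc i) * (r (Suc i) - r i)) - (\<Sum>i<N. nflux G \<kappa> N v' (Suc i) * (r (Suc i) - r i)))"
  unfolding nat_step_sum[OF v] nat_step_sum[OF v'] by (simp add: algebra_simps)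
 then have eq: "(\<Sum>i\<le>N. (v i - v' i) * r i) = - \<mu> * (\<Sum>i<N. \<kappa> (Suc i) * (r (Suc i) - r i)^2)"
 proof -
  have "(\<Sum>i\<le>N. (v i - w i) * r i) - (\<Sum>i\<le>N. (v' i - w i) * r i) = (\<Sum>i\<le>N. (v i - v' i) * r i)"
   by (simp add: algebra_simps flip: sum_subtractf)
  moreover have "(\<Sum>i<N. nflux G \<kappa> N v (Suc i) * (r (Suc i) - r i)) - (\<Sum>i<N. nflux G \<kappa> N v' (Suc i) * (r (Suc i) - r i))
    = (\<Sum>i<N. \<kappa> (Suc i) * (r (Suc i) - r i)^2)"
   unfolding sum_subtractf[symmetric]
   by (rule sum.cong) (auto simp: nflux_Suc r_def power2_eq_square algebra_simps)
  ultimately show ?thesis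
   using \<open>(\<Sum>i\<le>N. (v i - w i) * r i) - (\<Sum>i\<le>N. (v' i - w i) * r i)
   = - \<mu> * ((\<Sum>i<N. nflux G \<kappa> N v (Suc i) * (r (Suc i) - r i)) - (\<Sum>i<N. nflux G \<kappa> N v' (Suc i) * (r (Suc i) - r i)))\<close> by simp
 qed
 have "0 <= (v i - v' i) * r i" for i
 proof (cases "v' i <= v i")
  case True then show ?thesis using monoD[OF mono, of "v' i" "v i"] by (simp add: r_def)
 next
  case False then show ?thesis using monoD[OF mono, of "v i" "v' i"] by (simp add: r_def mult_nonpos_nonpos)
 qed
 then have "0 <= (\<Sum>i\<le>N. (v i - v' i) * r i)" by (intro sum_nonneg) auto
 moreover have nn: "0 <= \<kappa> (Suc i) * (r (Suc i) - r i)^2" if "i < N" for i using \<kappa>[of "Suc i"] that by simp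
 then have "0 <= (\<Sum>i<N. \<kappa> (Suc i) * (r (Suc i) - r i)^2)" by (intro sum_nonneg) auto
 moreover from calculation(1) have "\<mu> * (\<Sum>i<N. \<kappa> (Suc i) * (r (Suc i) - r i)^2) <= 0" using eq by simp
 ultimately have "(\<Sum>i<N. \<kappa> (Suc i) * (r (Suc i) - r i)^2) = 0" using \<mu> by (simp add: mult_le_0_iff)
 then have "\<forall>i\<in>{..<N}. \<kappa> (Suc i) * (r (Suc i) - r i)^2 = 0"
  using nn by (subst (asm) sum_nonneg_eq_0_iff) auto
 then have z: "\<kappa> (Suc i) * (r (Suc i) - r i)^2 = 0" if "i < N" for i using that by blast
 have rr: "r (Suc i) = r i" if "i < N" for i using z[OF that] \<kappa>[of "Suc i"] that by simp
 have "nflux G \<kappa> N v (Suc i) = nflux G \<kappa> N v' (Suc i)" if "i < N" for i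
  using rr[OF that] that by (simp add: nflux_Suc r_def)
 then have "nflux G \<kappa> N v j = nflux G \<kappa> N v' j" if "j <= Suc N" for j
  using that by (cases j; cases "j = Suc N") (auto simp: less_Suc_eq_le le_less)
 then show ?thesis using v v' i unfolding nat_step_def by (smt (verit) Suc_le_mono le_SucI)
qed

text \<open>At a maximum of \<open>v\<close> the flux through the right edge is nonpositive and the one through the left edge
 nonnegative, so \<open>v <= w\<close> there; likewise at a minimum.\<close>

lemma nat_step_bounds:
 assumes v: "nat_step G \<kappa> N \<mu> w v" and mono: "mono G"
  and \<mu>: "0 <= \<mu>" and \<kappa>: "!!i. 1 <= i ==> i <= N ==> 0 < \<kappa> i" and w: "!!i. i <= N ==> \<bar>w i\<bar> <= M" and i: "i <= N"
 shows "\<bar>v i\<bar> <= M"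
proof -
 define S where "S = v ` {..N}"
 have S: "finite S" "S \<noteq> {}" by (auto simp: S_def)
 have "Max S \<in> v ` {..N}" "Min S \<in> v ` {..N}" using Max_in[OF S] Min_in[OF S] by (simp_all only: S_def)
 then obtain j l where j: "j <= N" "v j = Max S" and l: "l <= N" "v l = Min S" by (metis atMost_iff imageE)
 have mx: "v i <= v j" "v l <= v i" if "i <= N" for i using that S j(2) l(2) by (auto simp: S_def)
 have pos: "0 <= \<kappa> i" if "1 <= i" "i <= N" for i using \<kappa>[OF that] by simp
 have "nflux G \<kappa> N v (Suc j) <= 0"
  using j mx(1)[of "Suc j"] monoD[OF mono, of "v (Suc j)" "v j"] pos[of "Suc j"]
  by (auto simp: nflux_def mult_nonneg_nonpos)
 moreover have "0 <= nflux G \<kappa> N v j"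
  using j mx(1)[of "j - 1"] monoD[OF mono, of "v (j - 1)" "v j"] pos[of j]
  by (auto simp: nflux_def)
 moreover have "v j - w j = \<mu> * (nflux G \<kappa> N v (Suc j) - nflux G \<kappa> N v j)"
  using v j(1) unfolding nat_step_def by blast
 ultimately have "v j - w j <= 0"
  using mult_nonneg_nonpos[OF \<mu>, of "nflux G \<kappa> N v (Suc j) - nflux G \<kappa> N v j"] by simp
 then have 1: "v j <= M" using w[OF j(1)] by auto
 have "0 <= nflux G \<kappa> N v (Suc l)"
  using l mx(2)[of "Suc l"] monoD[OF mono, of "v l" "v (Suc l)"] pos[of "Suc l"]
  by (auto simp: nflux_def)
 moreover have "nflux G \<kappa> N v l <= 0"
  using l mx(2)[of "l - 1"] monoD[OF mono, of "v l" "v (l - 1)"] pos[of l]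
  by (auto simp: nflux_def mult_nonneg_nonpos)
 moreover have "v l - w l = \<mu> * (nflux G \<kappa> N v (Suc l) - nflux G \<kappa> N v l)"
  using v l(1) unfolding nat_step_def by blast
 ultimately have "0 <= v l - w l"
  using mult_nonneg_nonneg[OF \<mu>, of "nflux G \<kappa> N v (Suc l) - nflux G \<kappa> N v l"] by simp
 then have "- M <= v l" using w[OF l(1)] by auto
 then show ?thesis using 1 mx[OF i] by auto
qed

text \<open>The jump of \<open>v\<close> and the flux through the same edge have equal sign, so the edge keeps its full
 jump plus twice the modulus of its flux; the neighbouring fluxes are subtracted and the differences telescope.\<close>

lemma nat_step_total_variation:
 assumes v: "nat_step G \<kappa> N \<mu> w v" and mono: "mono G"
  and \<mu>: "0 <= \<mu>" and \<kappa>: "!!i. 1 <= i ==> i <= N ==> 0 < \<kappa> i"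
 shows "(\<Sum>i<N. \<bar>v (Suc i) - v i\<bar>) <= (\<Sum>i<N. \<bar>w (Suc i) - w i\<bar>)"
proof -
 define A where "A = (%i. \<bar>nflux G \<kappa> N v i\<bar>)"
 define D where "D = (%i. A (Suc i) - A i)"
 have le: "\<bar>v (Suc i) - v i\<bar> + \<mu> * (D i - D (Suc i)) <= \<bar>w (Suc i) - w i\<bar>" if "i < N" for i
 proof -
  let ?F = "nflux G \<kappa> N v"
  define d where "d = v (Suc i) - v i"
  have e: "w (Suc i) - w i = d + 2 * (\<mu> * ?F (Suc i)) - \<mu> * ?F (Suc (Suc i)) - \<mu> * ?F i"
   using v that unfolding nat_step_def d_def by (smt (verit) Suc_leI le_SucI less_imp_le_nat right_diff_distrib)
  have same: "\<bar>d + 2 * (\<mu> * ?F (Suc i))\<bar> = \<bar>d\<bar> + 2 * (\<mu> * A (Suc i))"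
  proof (cases "0 <= d")
   case True
   then have "0 <= ?F (Suc i)"
    using that \<kappa>[of "Suc i"] monoD[OF mono, of "v i" "v (Suc i)"] by (simp add: nflux_Suc d_def)
   then show ?thesis using True \<mu> by (simp add: A_def)
  next
   case False
   then have F: "?F (Suc i) <= 0"
    using that \<kappa>[of "Suc i"] monoD[OF mono, of "v (Suc i)" "v i"] by (simp add: nflux_Suc d_def mult_nonneg_nonpos)
   then have "\<mu> * ?F (Suc i) <= 0" using \<mu> by (simp add: mult_nonneg_nonpos)
   then show ?thesis using False F by (simp add: A_def)
  qed
  define a b c where "a = \<mu> * ?F (Suc i)" and "b = \<mu> * ?F (Suc (Suc i))" and "c = \<mu> * ?F i"
  have A: "\<mu> * A j = \<bar>\<mu> * ?F j\<bar>" for j using \<mu> by (simp add: A_def abs_mult)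
  have "\<mu> * (D i - D (Suc i)) = 2 * \<bar>a\<bar> - \<bar>c\<bar> - \<bar>b\<bar>"
   unfolding D_def right_diff_distrib A a_def b_def c_def by simp
  moreover have "\<bar>d + 2 * a\<bar> = \<bar>d\<bar> + 2 * \<bar>a\<bar>" using same unfolding A a_def by simp
  moreover have "w (Suc i) - w i = d + 2 * a - b - c" using e by (simp add: a_def b_def c_def)
  ultimately show ?thesis unfolding d_def[symmetric] by linarith
 qed
 have "(\<Sum>i<N. \<bar>v (Suc i) - v i\<bar>) + \<mu> * (\<Sum>i<N. D i - D (Suc i)) = (\<Sum>i<N. \<bar>v (Suc i) - v i\<bar> + \<mu> * (D i - D (Suc i)))"
  by (simp add: sum.distrib sum_distrib_left)
 also have "... <= (\<Sum>i<N. \<bar>w (Suc i) - w i\<bar>)" using le by (intro sum_mono) auto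
 also have "(\<Sum>i<N. D i - D (Suc i)) = D 0 - D N" by (rule sum_lessThan_telescope')
 finally have "(\<Sum>i<N. \<bar>v (Suc i) - v i\<bar>) + \<mu> * (D 0 - D N) <= (\<Sum>i<N. \<bar>w (Suc i) - w i\<bar>)" .
 moreover have "0 <= D 0 - D N" by (simp add: D_def A_def)
 then have "0 <= \<mu> * (D 0 - D N)" using \<mu> by simp
 ultimately show ?thesis by linarith
qed

text \<open>Existence by shooting: prescribe the flux \<open>F\<close> that leaves cell \<open>n\<close> and solve the cells to the left of
 it. The value \<open>R F\<close> in cell \<open>n\<close> is increasing and nonexpansive in \<open>F\<close>; this monotonicity is what lets the
 intermediate value theorem add one more cell. A solution of the step is the case \<open>F = 0\<close>.\<close>

lemma nat_step_shooting:
 fixes c w :: "nat => real"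
 assumes mono: "mono G" and cont: "continuous_on UNIV G" and c: "!!i. 1 <= i ==> i <= n ==> 0 <= c i"
 shows "\<exists>R. (\<forall>x y. x <= y --> R x <= R y \<and> R y - R x <= y - x) \<and>
   (\<forall>F. \<exists>v f. f 0 = 0 \<and> f (Suc n) = F \<and> (\<forall>i. 1 <= i \<and> i <= n --> f i = c i * (G (v i) - G (v (i - 1)))) \<and>
      (\<forall>i\<le>n. v i = w i + f (Suc i) - f i) \<and> v n = R F)"
 using c
proof (induction n)
 case 0
 show ?case
 proof (intro exI[of _ "%F. w 0 + F"] conjI allI impI)
  fix F
  show "\<exists>v f. f 0 = 0 \<and> f (Suc 0) = F \<and> (\<forall>i. 1 <= i \<and> i <= 0 --> f i = c i * (G (v i) - G (v (i - 1)))) \<and>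
      (\<forall>i\<le>0. v i = w i + f (Suc i) - f i) \<and> v 0 = w 0 + F"
   by (rule exI[of _ "%_. w 0 + F"], rule exI[of _ "%i. if i = 0 then 0 else F"]) auto
 qed auto
next
 case (Suc n)
 then obtain R where R: "!!x y. x <= y ==> R x <= R y \<and> R y - R x <= y - x"
  and sol: "!!F. \<exists>v f. f 0 = 0 \<and> f (Suc n) = F \<and> (\<forall>i. 1 <= i \<and> i <= n --> f i = c i * (G (v i) - G (v (i - 1)))) \<and>
      (\<forall>i\<le>n. v i = w i + f (Suc i) - f i) \<and> v n = R F" by (auto simp: le_Suc_eq)
 define b where "b = c (Suc n)"
 have b: "0 <= b" using Suc.prems by (simp add: b_def)
 \<comment> \<open>the flux \<open>f\<close> through the new edge is the zero of \<open>H F\<close>, where cell \<open>Suc n\<close> has the value \<open>w (Suc n) + F - f\<close>\<close>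
 define H where "H = (%F f. f + b * (G (R f) - G (w (Suc n) + F - f)))"
 have Rlip: "1-lipschitz_on UNIV R"
 proof (rule lipschitz_onI)
  fix x y :: real show "dist (R x) (R y) <= 1 * dist x y"
   using R[of x y] R[of y x] by (cases "x <= y") (auto simp: dist_real_def)
 qed simp
 have Rc: "continuous_on UNIV R" by (rule lipschitz_on_continuous_on[OF Rlip])
 have Hc: "continuous_on UNIV (H F)" for F
  unfolding H_def by (intro continuous_intros continuous_on_compose2[OF cont] Rc) auto
 have Hinc: "y - x <= H F y - H F x" if "x <= y" for F x y
 proof -
  have "G (R x) <= G (R y)" using R[OF that] monoD[OF mono] by blast
  moreover have "G (w (Suc n) + F - y) <= G (w (Suc n) + F - x)" using that by (intro monoD[OF mono]) simp
  ultimately have "b * (G (R x) - G (w (Suc n) + F - x)) <= b * (G (R y) - G (w (Suc n) + F - y))"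
   using b by (intro mult_left_mono) auto
  then show ?thesis by (simp add: H_def)
 qed
 have "\<exists>f. H F f = 0" for F
 proof -
  define f0 where "f0 = \<bar>H F 0\<bar>"
  have "H F (- f0) <= 0" using Hinc[of "- f0" 0 F] by (auto simp: f0_def)
  moreover have "0 <= H F f0" using Hinc[of 0 f0 F] by (auto simp: f0_def)
  moreover have "- f0 <= f0" by (simp add: f0_def)
  ultimately show ?thesis
   using IVT'[of "H F" "- f0" 0 f0] continuous_on_subset[OF Hc] by blast
 qed
 then obtain \<phi> where \<phi>: "!!F. H F (\<phi> F) = 0" by metis
 have H2: "H F' f <= H F f" if "F <= F'" for F F' f
  using monoD[OF mono, of "w (Suc n) + F - f" "w (Suc n) + F' - f"] that b by (simp add: H_def mult_left_mono)
 have \<phi>1: "\<phi> F <= \<phi> F'" if "F <= F'" for F F'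
 proof (rule ccontr)
  assume "\<not> \<phi> F <= \<phi> F'"
  then have "0 < H F' (\<phi> F) - H F' (\<phi> F')" using Hinc[of "\<phi> F'" "\<phi> F" F'] by auto
  then show False using H2[OF that, of "\<phi> F"] \<phi>[of F] \<phi>[of F'] by linarith
 qed
 have \<phi>2: "\<phi> F' <= \<phi> F + (F' - F)" if "F <= F'" for F F'
 proof (rule ccontr)
  assume "\<not> \<phi> F' <= \<phi> F + (F' - F)"
  then have *: "0 < H F' (\<phi> F') - H F' (\<phi> F + (F' - F))" using Hinc[of "\<phi> F + (F' - F)" "\<phi> F'" F'] by auto
  have "G (R (\<phi> F)) <= G (R (\<phi> F + (F' - F)))" using R[of "\<phi> F" "\<phi> F + (F' - F)"] that monoD[OF mono] by auto
  then have "b * (G (R (\<phi> F)) - G (w (Suc n) + F - \<phi> F)) <= b * (G (R (\<phi> F + (F' - F))) - G (w (Suc n) + F' - (\<phi> F + (F' - F))))"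
   using b by (intro mult_left_mono) (auto simp: algebra_simps)
  then have "H F (\<phi> F) <= H F' (\<phi> F + (F' - F))" using that by (simp add: H_def)
  then show False using * \<phi>[of F] \<phi>[of F'] by linarith
 qed
 show ?case
 proof (intro exI[of _ "%F. w (Suc n) + F - \<phi> F"] conjI allI impI)
  fix x y :: real assume "x <= y"
  then show "w (Suc n) + x - \<phi> x <= w (Suc n) + y - \<phi> y" "w (Suc n) + y - \<phi> y - (w (Suc n) + x - \<phi> x) <= y - x"
   using \<phi>1[of x y] \<phi>2[of x y] by auto
 next
  fix F
  obtain v f where vf: "f 0 = 0" "f (Suc n) = \<phi> F" "!!i. 1 <= i ==> i <= n ==> f i = c i * (G (v i) - G (v (i - 1)))"
   "!!i. i <= n ==> v i = w i + f (Suc i) - f i" "v n = R (\<phi> F)" using sol[of "\<phi> F"] by blast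
  define v' where "v' = v(Suc n := w (Suc n) + F - \<phi> F)"
  define f' where "f' = f(Suc (Suc n) := F)"
  have "f' 0 = 0 \<and> f' (Suc (Suc n)) = F \<and> (\<forall>i. 1 <= i \<and> i <= Suc n --> f' i = c i * (G (v' i) - G (v' (i - 1)))) \<and>
    (\<forall>i\<le>Suc n. v' i = w i + f' (Suc i) - f' i) \<and> v' (Suc n) = w (Suc n) + F - \<phi> F"
  proof (intro conjI allI impI)
   fix i assume i: "1 <= i \<and> i <= Suc n"
   show "f' i = c i * (G (v' i) - G (v' (i - 1)))"
   proof (cases "i = Suc n")
    case True
    have "\<phi> F + b * (G (R (\<phi> F)) - G (w (Suc n) + F - \<phi> F)) = 0" using \<phi>[of F] by (simp add: H_def)
    then show ?thesis using True vf by (simp add: f'_def v'_def b_def algebra_simps)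
   next
    case False
    then have "i <= n" "i \<noteq> Suc (Suc n)" "i - 1 \<noteq> Suc n" using i by auto
    then show ?thesis using i False vf(3)[of i] by (simp add: f'_def v'_def)
   qed
  next
   fix i assume i: "i <= Suc n"
   show "v' i = w i + f' (Suc i) - f' i"
    using i vf(2,4) by (cases "i = Suc n") (auto simp: f'_def v'_def)
  qed (use vf in \<open>auto simp: f'_def v'_def\<close>)
  then show "\<exists>v f. f 0 = 0 \<and> f (Suc (Suc n)) = F \<and> (\<forall>i. 1 <= i \<and> i <= Suc n --> f i = c i * (G (v i) - G (v (i - 1)))) \<and>
    (\<forall>i\<le>Suc n. v i = w i + f (Suc i) - f i) \<and> v (Suc n) = w (Suc n) + F - \<phi> F" by blast
 qed
qed

lemma nat_step_exists:
 assumes mono: "mono G" and cont: "continuous_on UNIV G" and \<mu>: "0 <= \<mu>"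
  and \<kappa>: "!!i. 1 <= i ==> i <= N ==> 0 < \<kappa> i"
 shows "\<exists>v. nat_step G \<kappa> N \<mu> w v"
proof -
 have "0 <= \<mu> * \<kappa> i" if "1 <= i" "i <= N" for i using \<kappa>[OF that] \<mu> by simp
 then have "\<exists>R. (\<forall>x y. x <= y --> R x <= R y \<and> R y - R x <= y - x) \<and>
   (\<forall>F. \<exists>v f. f 0 = 0 \<and> f (Suc N) = F \<and> (\<forall>i. 1 <= i \<and> i <= N --> f i = \<mu> * \<kappa> i * (G (v i) - G (v (i - 1)))) \<and>
      (\<forall>i\<le>N. v i = w i + f (Suc i) - f i) \<and> v N = R F)"
  using nat_step_shooting[OF mono cont, where c="%i. \<mu> * \<kappa> i" and n=N and w=w] by simp
 then obtain v f where vf: "f 0 = 0" "f (Suc N) = 0"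
   "\<forall>i. 1 <= i \<and> i <= N --> f i = \<mu> * \<kappa> i * (G (v i) - G (v (i - 1)))"
   "\<forall>i\<le>N. v i = w i + f (Suc i) - f i"
  by (elim exE conjE, drule_tac x=0 in spec) (elim exE conjE, rule that)
 have f: "f i = \<mu> * nflux G \<kappa> N v i" if "i <= Suc N" for i
  using vf(1-3) that by (cases "i = 0 \<or> i = Suc N") (auto simp: nflux_def mult.assoc)
 show ?thesis
  by (rule exI[of _ v]) (use vf(4) f in \<open>auto simp: nat_step_def algebra_simps\<close>)
qed

lemma implicit_step_nat_step:
 assumes "implicit_step G k N dt w v"
 shows "nat_step G (%i. k (real i * dx N)) N (dt / (dx N)^2) (%i. w (int i)) (%i. v (int i))"
 unfolding nat_step_def
proof (intro allI impI)
 fix i assume i: "i <= N"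
 let ?F = "%j::int. k (of_int j * dx N) * (G (v j) - G (v (j - 1)))"
 have *: "v (int i) - dt / (dx N)^2 * (?F (int i + 1) - ?F (int i)) = w (int i)"
  using assms i unfolding implicit_step_def by (auto dest!: bspec[of _ _ "int i"])
 have b: "v (-1) = v 0" "v (int N + 1) = v (int N)" using assms by (auto simp: implicit_step_def)
 have F: "?F (int l) = nflux G (%i. k (real i * dx N)) N (%i. v (int i)) l" if "l <= Suc N" for l
 proof -
  consider "l = 0" | "l = Suc N" | "1 <= l" "l <= N" using \<open>l <= Suc N\<close> by linarith
  then show ?thesis
  proof cases
   case 2 then show ?thesis using b(2) by (simp add: nflux_def add.commute)
  next
   case 3 then show ?thesis by (simp add: nflux_def of_nat_diff)
  qed (use b(1) in \<open>simp add: nflux_def\<close>)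
 qed
 have "int i + 1 = int (Suc i)" by simp
 then have c: "?F (int i + 1) = nflux G (%i. k (real i * dx N)) N (%i. v (int i)) (Suc i)"
  using F[of "Suc i"] i by (simp only: Suc_le_mono)
 have d: "?F (int i) = nflux G (%i. k (real i * dx N)) N (%i. v (int i)) i"
  by (rule F) (use i in simp)
 show "v (int i) - w (int i) = dt / (dx N)^2 * (nflux G (%i. k (real i * dx N)) N (%i. v (int i)) (Suc i)
    - nflux G (%i. k (real i * dx N)) N (%i. v (int i)) i)"
  using *[unfolded c d] by simp
qed

lemma nat_step_implicit_step:
 assumes s: "nat_step G (%i. k (real i * dx N)) N (dt / (dx N)^2) (%i. w (int i)) v"
 shows "implicit_step G k N dt w (%j. if j = -1 then v 0 else if j = int N + 1 then v N else
   if j < -1 \<or> int N + 1 < j then 0 else v (nat j))" (is "implicit_step G k N dt w ?v")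
 unfolding implicit_step_def
proof (intro conjI ballI allI impI)
 fix j assume "j \<in> {0..int N}"
 then obtain i where i: "j = int i" "i <= N" by (metis atLeastAtMost_iff nonneg_int_cases of_nat_le_iff)
 have F: "k (of_int l * dx N) * (G (?v l) - G (?v (l - 1))) = nflux G (%i. k (real i * dx N)) N v (nat l)"
  if "0 <= l" "l <= int N + 1" for l
 proof -
  consider "l = 0" | "l = int N + 1" | "1 <= l" "l <= int N" using \<open>0 <= l\<close> \<open>l <= int N + 1\<close> by linarith
  then show ?thesis
  proof cases
   case 3
   then have "real_of_int l = real (nat l)" "nat (l - 1) = nat l - 1" by auto
   then show ?thesis using 3 by (auto simp: nflux_def)
  qed (auto simp: nflux_def nat_add_distrib)
 qed
 have n: "nat (j + 1) = Suc i" "nat j = i" using i by auto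
 have e: "v i - w (int i) = dt / (dx N)^2 * (nflux G (%i. k (real i * dx N)) N v (Suc i)
    - nflux G (%i. k (real i * dx N)) N v i)"
  using s i(2) unfolding nat_step_def by blast
 have vj: "?v j = v i" using i by auto
 have c: "k (of_int (j + 1) * dx N) * (G (?v (j + 1)) - G (?v j)) = nflux G (%i. k (real i * dx N)) N v (Suc i)"
  using F[of "j + 1"] i n by simp
 have d: "k (of_int j * dx N) * (G (?v j) - G (?v (j - 1))) = nflux G (%i. k (real i * dx N)) N v i"
  using F[of j] i n by simp
 show "?v j - dt / (dx N)^2 * (k (of_int (j + 1) * dx N) * (G (?v (j + 1)) - G (?v j))
      - k (of_int j * dx N) * (G (?v j) - G (?v (j - 1)))) = w j"
  unfolding c d using e vj i by simp
qed auto

lemma scheme_nat_step: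
 assumes mono: "mono G" and cont: "continuous_on UNIV G" and dt: "0 < dt"
  and k: "!!x. x \<in> {0..1} ==> 0 < k x"
 shows "nat_step G (%i. k (real i * dx N)) N (dt / (dx N)^2)
   (%i. scheme G k u0 N dt n (int i)) (%i. scheme G k u0 N dt (Suc n) (int i))"
proof -
 let ?\<kappa> = "%i. k (real i * dx N)" and ?\<mu> = "dt / (dx N)^2" and ?w = "scheme G k u0 N dt n"
 have dx: "0 < dx N" by (simp add: dx_def)
 have \<mu>: "0 < ?\<mu>" using dt dx by simp
 have \<kappa>: "0 < ?\<kappa> i" if "1 <= i" "i <= N" for i
  using that by (intro k) (auto simp: dx_def field_simps)
 obtain v where v: "nat_step G ?\<kappa> N ?\<mu> (%i. ?w (int i)) v"
  using nat_step_exists[OF mono cont, of ?\<mu> N ?\<kappa>] \<mu> \<kappa> by (metis less_imp_le)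
 have ex: "\<exists>v. implicit_step G k N dt ?w v" using nat_step_implicit_step[OF v] by blast
 have uniq: "v1 = v2" if v1: "implicit_step G k N dt ?w v1" and v2: "implicit_step G k N dt ?w v2" for v1 v2
 proof
  fix j :: int
  have eq: "v1 (int i) = v2 (int i)" if "i <= N" for i
   by (rule nat_step_unique[OF implicit_step_nat_step[OF v1] implicit_step_nat_step[OF v2] mono \<mu> \<kappa> that])
  consider "j = -1" | "j = int N + 1" | "j < -1 \<or> int N + 1 < j" | "0 <= j" "j <= int N" by linarith
  then show "v1 j = v2 j"
  proof cases
   case 1 then show ?thesis using eq[of 0] v1 v2 unfolding implicit_step_def by auto
  next
   case 2 then show ?thesis using eq[of N] v1 v2 unfolding implicit_step_def by auto
  next
   case 3 then show ?thesis using v1 v2 unfolding implicit_step_def by auto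
  next
   case 4 then show ?thesis using eq[of "nat j"] by auto
  qed
 qed
 have "implicit_step G k N dt ?w (THE v. implicit_step G k N dt ?w v)"
  using ex uniq by (metis theI')
 then show ?thesis using implicit_step_nat_step[of G k N dt ?w "scheme G k u0 N dt (Suc n)"] by simp
qed

section \<open>Functions on the unit interval\<close>

abbreviation m01 :: "real measure" where "m01 \<equiv> restrict_space lborel B"

lemma space_m01 [simp]: "space m01 = B" by (simp add: space_restrict_space)

lemma finite_measure_m01: "finite_measure m01"
 by (rule finite_measureI) (simp add: emeasure_restrict_space)

interpretation m01: finite_measure m01 by (rule finite_measure_m01)

lemma measure_m01: "A \<in> sets borel ==> A \<subseteq> B ==> measure m01 A = measure lborel A"
 by (simp add: measure_restrict_space)

lemma measurable_m01 [measurable (raw)]: "f \<in> borel_measurable borel ==> f \<in> borel_measurable m01"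
 by (rule measurable_restrict_space1) simp

lemma integrable_m01_bounded:
 fixes f :: "real => real"
 assumes "f \<in> borel_measurable m01" "!!x. x \<in> B ==> \<bar>f x\<bar> <= C"
 shows "integrable m01 f"
 by (rule m01.integrable_const_bound[of _ C]) (use assms in \<open>auto intro!: AE_I2\<close>)

lemma measure_m01_B [simp]: "measure m01 B = 1"
 by (simp add: measure_restrict_space)

lemma integral_m01_const [simp]: "(\<integral>x. c \<partial>m01) = (c::real)"
 by (simp add: measure_restrict_space)

lemma integral_m01_eq_lebesgue:
 fixes f :: "real => real"
 assumes "f \<in> borel_measurable m01"
 shows "(LINT x:B|lebesgue. f x) = (\<integral>x. f x \<partial>m01)"
proof -
 have *: "(%x. indicator B x *\<^sub>R f x) \<in> borel_measurable lborel"
  using assms by (subst (asm) borel_measurable_restrict_space_iff) auto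
 have "(\<integral>x. f x \<partial>m01) = (LINT x:B|lborel. f x)"
  by (subst integral_restrict_space) (auto simp: set_lebesgue_integral_def)
 also have "... = (LINT x:B|lebesgue. f x)"
  unfolding set_lebesgue_integral_def by (rule integral_completion[symmetric, OF *])
 finally show ?thesis by simp
qed

text \<open>The primitive of \<open>w\<close> from the left end, whose size is a negative norm of \<open>w\<close>.\<close>

definition prim :: "(real => real) => real => real" where
 "prim w x = (\<integral>y. indicator {..<x} y * w y \<partial>m01)"

lemma prim_diff:
 assumes w: "w \<in> borel_measurable m01" "!!x. x \<in> B ==> \<bar>w x\<bar> <= M" and xy: "x <= y"
 shows "prim w y - prim w x = (\<integral>z. indicator {x..<y} z * w z \<partial>m01)"
proof -
 have i: "integrable m01 (%z. indicator A z * w z)" if "A \<in> sets borel" for A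
 proof (rule integrable_m01_bounded[of _ M])
  have [measurable]: "indicat_real A \<in> borel_measurable m01" using that by (intro measurable_m01 borel_measurable_indicator) auto
  show "(%z. indicat_real A z * w z) \<in> borel_measurable m01" using w(1) by measurable
  show "\<bar>indicat_real A z * w z\<bar> <= M" if "z \<in> B" for z using w(2)[OF that] by (auto simp: indicator_def)
 qed
 have "prim w y - prim w x = (\<integral>z. indicator {..<y} z * w z - indicator {..<x} z * w z \<partial>m01)"
  unfolding prim_def by (rule Bochner_Integration.integral_diff[symmetric]) (auto intro: i)
 also have "... = (\<integral>z. indicator {x..<y} z * w z \<partial>m01)"
  using xy by (intro lint_cong) (auto simp: indicator_def)
 finally show ?thesis .
qed

lemma prim_0 [simp]: "prim w 0 = 0"
proof -
 have "prim w 0 = (\<integral>y. 0 \<partial>m01)" unfolding prim_def by (rule lint_cong) (auto simp: indicator_def)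
 then show ?thesis by simp
qed

lemma prim_1: "prim w 1 = (\<integral>y. w y \<partial>m01)"
 unfolding prim_def by (rule lint_cong) (auto simp: indicator_def)

lemma prim_lipschitz:
 assumes w: "w \<in> borel_measurable m01" "!!x. x \<in> B ==> \<bar>w x\<bar> <= M"
 shows "\<bar>prim w y - prim w x\<bar> <= M * \<bar>y - x\<bar>"
proof -
 have M: "0 <= M" using w(2)[of "1/2"] by auto
 have main: "\<bar>prim w y - prim w x\<bar> <= M * (y - x)" if xy: "x <= y" for x y
 proof -
  have [measurable]: "indicat_real {x..<y} \<in> borel_measurable m01" by (intro measurable_m01) measurable
  have "\<bar>prim w y - prim w x\<bar> = \<bar>\<integral>z. indicator {x..<y} z * w z \<partial>m01\<bar>"
   unfolding prim_diff[OF w(1) w(2) xy, simplified] by (rule refl)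
  also have "... <= (\<integral>z. \<bar>indicator {x..<y} z * w z\<bar> \<partial>m01)" by (rule integral_abs_bound)
  also have "... <= (\<integral>z. M * indicator {x..<y} z \<partial>m01)"
  proof (rule integral_mono)
   show "integrable m01 (%z. \<bar>indicator {x..<y} z * w z\<bar>)"
    using w by (intro integrable_m01_bounded[of _ M]) (auto simp: indicator_def M)
   show "integrable m01 (%z. M * indicator {x..<y} z)"
    by (intro integrable_m01_bounded[of _ M]) (auto simp: indicator_def M)
   show "\<bar>indicator {x..<y} z * w z\<bar> <= M * indicator {x..<y} z" if "z \<in> space m01" for z
    using w(2)[of z] that by (auto simp: indicator_def)
  qed
  also have "... = M * measure m01 ({x..<y} \<inter> B)"
   by (simp add: measure_restrict_space flip: integral_indicator) 
  also have "... <= M * (y - x)"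
  proof (rule mult_left_mono[OF _ M])
   have "measure m01 ({x..<y} \<inter> B) = measure lborel ({x..<y} \<inter> B)" by (rule measure_m01) auto
   also have "... <= measure lborel {x..<y}"
    by (rule measure_mono_fmeasurable) (use xy in \<open>auto simp: fmeasurable_def\<close>)
   also have "... = y - x" using xy by simp
   finally show "measure m01 ({x..<y} \<inter> B) <= y - x" .
  qed
  finally show ?thesis .
 qed
 show ?thesis using main[of x y] main[of y x] by (cases "x <= y") auto
qed

lemma prim_bound:
 assumes w: "w \<in> borel_measurable m01" "!!x. x \<in> B ==> \<bar>w x\<bar> <= M" and "x \<in> {0..1}"
 shows "\<bar>prim w x\<bar> <= M"
proof -
 have "0 <= M" using w(2)[of "1/2"] by auto
 then have "M * \<bar>x\<bar> <= M * 1" using assms(3) by (intro mult_left_mono) auto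
 then show ?thesis using prim_lipschitz[OF w, of x 0] by simp
qed

lemma prim_measurable [measurable]:
 assumes w: "w \<in> borel_measurable m01" "!!x. x \<in> B ==> \<bar>w x\<bar> <= M"
 shows "prim w \<in> borel_measurable borel"
proof -
 have "M-lipschitz_on UNIV (prim w)"
  by (rule lipschitz_onI) (use prim_lipschitz[OF w] w(2)[of "1/2"] in \<open>auto simp: dist_real_def\<close>)
 then show ?thesis using lipschitz_on_continuous_on borel_measurable_continuous_onI by blast
qed

subsection \<open>Interpolation\<close>

text \<open>An integrable form of total variation at most \<open>V\<close>: the oscillation of \<open>w\<close> over windows of length
 \<open>\<delta>\<close> has integral at most \<open>V \<delta>\<close>. It is stable under sums and holds for step functions, also for the difference
 of step functions on different grids.\<close>

definition osc_bound :: "(real => real) => real => bool" where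
 "osc_bound w V \<longleftrightarrow> (\<forall>\<delta>. 0 < \<delta> \<and> \<delta> < 1 --> (\<exists>S. integrable lborel S \<and> (\<forall>x. 0 <= S x) \<and> (\<integral>x. S x \<partial>lborel) <= V * \<delta> \<and>
   (\<forall>x y. 0 < x \<and> x <= y \<and> y <= x + \<delta> \<and> y < 1 --> \<bar>w y - w x\<bar> <= S x)))"

lemma osc_bound_add:
 assumes "osc_bound w V" "osc_bound w' V'"
 shows "osc_bound (%x. w x + w' x) (V + V')"
 unfolding osc_bound_def
proof (intro allI impI)
 fix \<delta> :: real assume \<delta>: "0 < \<delta> \<and> \<delta> < 1"
 obtain S where S: "integrable lborel S" "!!x. 0 <= S x" "(\<integral>x. S x \<partial>lborel) <= V * \<delta>"
   "!!x y. 0 < x ==> x <= y ==> y <= x + \<delta> ==> y < 1 ==> \<bar>w y - w x\<bar> <= S x"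
  using assms(1) \<delta> unfolding osc_bound_def by meson
 obtain S' where S': "integrable lborel S'" "!!x. 0 <= S' x" "(\<integral>x. S' x \<partial>lborel) <= V' * \<delta>"
   "!!x y. 0 < x ==> x <= y ==> y <= x + \<delta> ==> y < 1 ==> \<bar>w' y - w' x\<bar> <= S' x"
  using assms(2) \<delta> unfolding osc_bound_def by meson
 show "\<exists>S. integrable lborel S \<and> (\<forall>x. 0 <= S x) \<and> (\<integral>x. S x \<partial>lborel) <= (V + V') * \<delta> \<and>
   (\<forall>x y. 0 < x \<and> x <= y \<and> y <= x + \<delta> \<and> y < 1 --> \<bar>w y + w' y - (w x + w' x)\<bar> <= S x)"
 proof (rule exI[of _ "%x. S x + S' x"], intro conjI allI impI)
  fix x y assume "0 < x \<and> x <= y \<and> y <= x + \<delta> \<and> y < 1"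
  then show "\<bar>w y + w' y - (w x + w' x)\<bar> <= S x + S' x" using S(4)[of x y] S'(4)[of x y] by auto
 qed (use S S' in \<open>auto simp: distrib_right\<close>)
qed

lemma osc_bound_scale:
 assumes "osc_bound w V"
 shows "osc_bound (%x. c * w x) (\<bar>c\<bar> * V)"
 unfolding osc_bound_def
proof (intro allI impI)
 fix \<delta> :: real assume \<delta>: "0 < \<delta> \<and> \<delta> < 1"
 obtain S where S: "integrable lborel S" "!!x. 0 <= S x" "(\<integral>x. S x \<partial>lborel) <= V * \<delta>"
   "!!x y. 0 < x ==> x <= y ==> y <= x + \<delta> ==> y < 1 ==> \<bar>w y - w x\<bar> <= S x"
  using assms(1) \<delta> unfolding osc_bound_def by meson
 show "\<exists>S. integrable lborel S \<and> (\<forall>x. 0 <= S x) \<and> (\<integral>x. S x \<partial>lborel) <= \<bar>c\<bar> * V * \<delta> \<and>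
   (\<forall>x y. 0 < x \<and> x <= y \<and> y <= x + \<delta> \<and> y < 1 --> \<bar>c * w y - c * w x\<bar> <= S x)"
 proof (rule exI[of _ "%x. \<bar>c\<bar> * S x"], intro conjI allI impI)
  fix x y assume "0 < x \<and> x <= y \<and> y <= x + \<delta> \<and> y < 1"
  then have "\<bar>c\<bar> * \<bar>w y - w x\<bar> <= \<bar>c\<bar> * S x" using S(4)[of x y] by (intro mult_left_mono) auto
  then show "\<bar>c * w y - c * w x\<bar> <= \<bar>c\<bar> * S x" by (simp add: right_diff_distrib flip: abs_mult)
 next
  show "(\<integral>x. \<bar>c\<bar> * S x \<partial>lborel) <= \<bar>c\<bar> * V * \<delta>"
   using mult_left_mono[OF S(3), of "\<bar>c\<bar>"] by (simp add: mult.assoc)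
 qed (use S in auto)
qed

text \<open>Up to the oscillation of \<open>w\<close>, \<open>\<delta> w x\<close> is the increment of the primitive over a window of length \<open>\<delta>\<close>;
 within \<open>\<delta>\<close> of the right end the bound \<open>M\<close> is used instead.\<close>

lemma L1_interpolation_step:
 assumes w: "w \<in> borel_measurable m01" "!!x. x \<in> B ==> \<bar>w x\<bar> <= M" and osc: "osc_bound w V"
  and \<delta>: "0 < \<delta>" "\<delta> < 1"
 shows "(\<integral>x. \<bar>w x\<bar> \<partial>m01) <= (V + M) * \<delta> + 2 * (\<integral>x. \<bar>prim w x\<bar> \<partial>m01) / \<delta>"
proof -
 have M: "0 <= M" using w(2)[of "1/2"] by auto
 obtain S where S: "integrable lborel S" "!!x. 0 <= S x" "(\<integral>x. S x \<partial>lborel) <= V * \<delta>"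
   "!!x y. 0 < x ==> x <= y ==> y <= x + \<delta> ==> y < 1 ==> \<bar>w y - w x\<bar> <= S x"
  using osc \<delta> unfolding osc_bound_def by meson
 have Sm: "integrable m01 S"
  using integrable_mult_indicator[of B lborel S] S(1) by (simp add: integrable_restrict_space)
 have pm[measurable]: "prim w \<in> borel_measurable borel" by (rule prim_measurable[OF w])
 define W where "W = (%x. \<bar>prim w x\<bar>)"
 have W[measurable]: "W \<in> borel_measurable borel" unfolding W_def by measurable
 have Wb: "0 <= W x" "x \<in> {0..1} ==> W x <= M" for x using prim_bound[OF w] by (auto simp: W_def)
 define J where "J = (%x. indicat_real {..<1-\<delta>} x)"
 have J[measurable]: "J \<in> borel_measurable borel" unfolding J_def by measurable
 have pt: "\<bar>w x\<bar> <= J x * S x + (1/\<delta>) * (J x * W (x + \<delta>) + W x) + M * (1 - J x)" if x: "x \<in> B" for x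
 proof (cases "x < 1 - \<delta>")
  case False
  then show ?thesis using w(2)[OF x] Wb(1)[of x] \<delta> by (simp add: J_def) (smt (verit) divide_nonneg_pos)
 next
  case True
  have im: "integrable m01 (%z. indicator {x..<x+\<delta>} z * w z)"
  proof (rule integrable_m01_bounded[of _ M])
   have [measurable]: "indicat_real {x..<x+\<delta>} \<in> borel_measurable m01" by (intro measurable_m01) measurable
   show "(%z. indicat_real {x..<x+\<delta>} z * w z) \<in> borel_measurable m01" using w(1) by measurable
   show "\<bar>indicat_real {x..<x+\<delta>} z * w z\<bar> <= M" if "z \<in> B" for z using w(2)[OF that] M by (auto simp: indicator_def)
  qed
  have ii: "integrable m01 (%z. indicat_real {x..<x+\<delta>} z)"
   by (rule integrable_m01_bounded[of _ 1]) auto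
  have meas: "(\<integral>z. indicat_real {x..<x+\<delta>} z \<partial>m01) = \<delta>"
  proof -
   have "(\<integral>z. indicat_real {x..<x+\<delta>} z \<partial>m01) = measure m01 ({x..<x+\<delta>} \<inter> B)" by simp
   also have "{x..<x+\<delta>} \<inter> B = {x..<x+\<delta>}" using x True by auto
   also have "measure m01 {x..<x+\<delta>} = measure lborel {x..<x+\<delta>}" using x True by (intro measure_m01) auto
   finally show ?thesis using \<delta> by simp
  qed
  have "\<bar>\<delta> * w x - (prim w (x+\<delta>) - prim w x)\<bar> = \<bar>\<integral>z. indicat_real {x..<x+\<delta>} z * w x - indicator {x..<x+\<delta>} z * w z \<partial>m01\<bar>"
  proof -
   have "prim w (x+\<delta>) - prim w x = (\<integral>z. indicator {x..<x+\<delta>} z * w z \<partial>m01)"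
    by (rule prim_diff[OF w(1) w(2)]) (use \<delta> in auto)
   moreover have "(\<integral>z. indicat_real {x..<x+\<delta>} z * w x - indicator {x..<x+\<delta>} z * w z \<partial>m01)
     = (\<integral>z. indicat_real {x..<x+\<delta>} z * w x \<partial>m01) - (\<integral>z. indicator {x..<x+\<delta>} z * w z \<partial>m01)"
    using ii im by (intro Bochner_Integration.integral_diff integrable_mult_left) auto
   moreover have "(\<integral>z. indicat_real {x..<x+\<delta>} z * w x \<partial>m01) = \<delta> * w x"
    by (simp only: integral_mult_left_zero meas)
   ultimately show ?thesis by (simp only:)
  qed
  also have "... <= (\<integral>z. \<bar>indicat_real {x..<x+\<delta>} z * w x - indicator {x..<x+\<delta>} z * w z\<bar> \<partial>m01)" by (rule integral_abs_bound)
  also have "... <= (\<integral>z. S x * indicat_real {x..<x+\<delta>} z \<partial>m01)"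
  proof (rule integral_mono)
   show "integrable m01 (%z. \<bar>indicat_real {x..<x+\<delta>} z * w x - indicator {x..<x+\<delta>} z * w z\<bar>)" using ii im by auto
   show "integrable m01 (%z. S x * indicat_real {x..<x+\<delta>} z)" using ii by auto
   fix z assume "z \<in> space m01"
   then show "\<bar>indicat_real {x..<x+\<delta>} z * w x - indicator {x..<x+\<delta>} z * w z\<bar> <= S x * indicat_real {x..<x+\<delta>} z"
    using S(4)[of x z] x by (auto simp: indicator_def abs_minus_commute)
  qed
  also have "... = S x * \<delta>" using meas by simp
  finally have "\<bar>\<delta> * w x\<bar> <= S x * \<delta> + (W (x+\<delta>) + W x)" by (simp add: W_def)
  then have "\<delta> * \<bar>w x\<bar> <= S x * \<delta> + (W (x+\<delta>) + W x)" using \<delta> by (simp add: abs_mult)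
  then have "\<bar>w x\<bar> <= S x + (1/\<delta>) * (W (x+\<delta>) + W x)" using \<delta> by (simp add: field_simps)
  then show ?thesis using True by (simp add: J_def)
 qed
 have iW: "integrable m01 W" by (rule integrable_m01_bounded[of _ M]) (use Wb in auto)
 have iJW: "integrable m01 (%x. J x * W (x + \<delta>))"
 proof (rule integrable_m01_bounded[of _ M])
  show "\<bar>J x * W (x + \<delta>)\<bar> <= M" if "x \<in> B" for x
   using Wb(1)[of "x+\<delta>"] Wb(2)[of "x+\<delta>"] that \<delta> M by (auto simp: J_def indicator_def)
 qed measurable
 have JW: "(\<integral>x. J x * W (x + \<delta>) \<partial>m01) <= (\<integral>x. W x \<partial>m01)"
 proof -
  have "(\<integral>x. J x * W (x + \<delta>) \<partial>m01) = (\<integral>x. indicator B x * (J x * W (x + \<delta>)) \<partial>lborel)"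
   by (subst integral_restrict_space) auto
  also have "... = (\<integral>x. indicator {\<delta><..<1} (\<delta> + 1 * x) * W (\<delta> + 1 * x) \<partial>lborel)"
   using \<delta> by (intro lint_cong) (auto simp: J_def indicator_def add.commute)
  also have "... = (\<integral>x. indicator {\<delta><..<1} x * W x \<partial>lborel)"
   by (subst lborel_integral_real_affine[of 1 "%x. indicator {\<delta><..<1} x * W x" \<delta>]) simp_all
  also have "... <= (\<integral>x. indicator B x * W x \<partial>lborel)"
  proof (rule integral_mono')
   show "integrable lborel (%x. indicator B x * W x)" using iW by (simp add: integrable_restrict_space)
  qed (use Wb \<delta> in \<open>auto simp: indicator_def\<close>)
  also have "... = (\<integral>x. W x \<partial>m01)" by (subst integral_restrict_space) auto
  finally show ?thesis .
 qed
 have iJS: "integrable m01 (%x. J x * S x)"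
  by (rule dominated_integrable[OF Sm]) (use Sm in \<open>auto simp: J_def indicator_def S(2)\<close>)
 have JS: "(\<integral>x. J x * S x \<partial>m01) <= V * \<delta>"
 proof -
  have "(\<integral>x. J x * S x \<partial>m01) = (\<integral>x. indicator B x * (J x * S x) \<partial>lborel)" by (subst integral_restrict_space) auto
  also have "... <= (\<integral>x. S x \<partial>lborel)" by (rule integral_mono'[OF S(1)]) (use S(2) in \<open>auto simp: J_def indicator_def\<close>)
  finally show ?thesis using S(3) by simp
 qed
 have iJ: "integrable m01 J" by (rule integrable_m01_bounded[of _ 1]) (auto simp: J_def)
 have J1: "(\<integral>x. 1 - J x \<partial>m01) = \<delta>"
 proof -
  have "(\<integral>x. J x \<partial>m01) = measure m01 ({..<1-\<delta>} \<inter> B)" by (simp add: J_def)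
  also have "... = measure lborel ({..<1-\<delta>} \<inter> B)" by (rule measure_m01) auto
  also have "{..<1-\<delta>} \<inter> B = {0<..<1-\<delta>}" using \<delta> by auto
  finally have "(\<integral>x. J x \<partial>m01) = 1 - \<delta>" using \<delta> by simp
  then show ?thesis using iJ by simp
 qed
 have "(\<integral>x. \<bar>w x\<bar> \<partial>m01) <= (\<integral>x. J x * S x + (1/\<delta>) * (J x * W (x + \<delta>) + W x) + M * (1 - J x) \<partial>m01)"
 proof (rule integral_mono)
  show "integrable m01 (%x. \<bar>w x\<bar>)" by (rule integrable_m01_bounded[of _ M]) (use w in auto)
 qed (use pt iJS iJW iW iJ in auto)
 also have "... = (\<integral>x. J x * S x \<partial>m01) + (1/\<delta>) * ((\<integral>x. J x * W (x + \<delta>) \<partial>m01) + (\<integral>x. W x \<partial>m01)) + M * (\<integral>x. 1 - J x \<partial>m01)"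
  using iJS iJW iW iJ by simp
 also have "... <= V * \<delta> + (1/\<delta>) * ((\<integral>x. W x \<partial>m01) + (\<integral>x. W x \<partial>m01)) + M * \<delta>"
 proof -
  have "(1/\<delta>) * ((\<integral>x. J x * W (x + \<delta>) \<partial>m01) + (\<integral>x. W x \<partial>m01)) <= (1/\<delta>) * ((\<integral>x. W x \<partial>m01) + (\<integral>x. W x \<partial>m01))"
   using JW \<delta> by (intro mult_left_mono) auto
  then show ?thesis unfolding J1 using JS by linarith
 qed
 finally show ?thesis using \<delta> by (simp add: W_def field_simps)
qed

text \<open>The window \<open>\<delta> = sqrt e\<close> balances the two terms.\<close>

lemma L1_interpolation:
 assumes w: "w \<in> borel_measurable m01" "!!x. x \<in> B ==> \<bar>w x\<bar> <= M" and osc: "osc_bound w V"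
  and V: "0 <= V" and e: "(\<integral>x. \<bar>prim w x\<bar> \<partial>m01) <= e"
 shows "(\<integral>x. \<bar>w x\<bar> \<partial>m01) <= (V + M + 2) * sqrt e"
proof -
 have M: "0 <= M" using w(2)[of "1/2"] by auto
 have e0: "0 <= e" using e by (smt (verit) integral_nonneg_AE AE_I2 abs_ge_zero)
 have iw: "integrable m01 (%x. \<bar>w x\<bar>)" by (rule integrable_m01_bounded[of _ M]) (use w in auto)
 have step: "(\<integral>x. \<bar>w x\<bar> \<partial>m01) <= (V + M) * \<delta> + 2 * e / \<delta>" if "0 < \<delta>" "\<delta> < 1" for \<delta>
 proof -
  have "2 * (\<integral>x. \<bar>prim w x\<bar> \<partial>m01) / \<delta> <= 2 * e / \<delta>" using e that by (intro divide_right_mono) auto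
  then show ?thesis using L1_interpolation_step[OF w osc that] by linarith
 qed
 consider "e = 0" | "0 < e" "e < 1" | "1 <= e" using e0 by linarith
 then show ?thesis
 proof cases
  case 1
  have "(\<integral>x. \<bar>w x\<bar> \<partial>m01) <= 0"
  proof (rule field_le_epsilon)
   fix r :: real assume r: "0 < r"
   define \<delta> where "\<delta> = min (1/2) (r / (V + M + 1))"
   have \<delta>: "0 < \<delta>" "\<delta> < 1" "\<delta> <= r / (V + M + 1)" using r V M by (auto simp: \<delta>_def)
   have "(V + M) * \<delta> <= (V + M + 1) * (r / (V + M + 1))" using \<delta> V M by (intro mult_mono) auto
   also have "... = r" using V M by simp
   finally show "(\<integral>x. \<bar>w x\<bar> \<partial>m01) <= 0 + r" using step[OF \<delta>(1,2)] 1 by simp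
  qed
  then show ?thesis using 1 by simp
 next
  case 2
  then have s: "0 < sqrt e" "sqrt e < 1" by auto
  have "e / sqrt e = sqrt e" using 2 by (simp add: real_div_sqrt)
  then have "2 * e / sqrt e = 2 * sqrt e" by (metis times_divide_eq_right)
  then show ?thesis using step[OF s] by (simp add: algebra_simps)
 next
  case 3
  have "(\<integral>x. \<bar>w x\<bar> \<partial>m01) <= (\<integral>x. M \<partial>m01)" by (rule integral_mono[OF iw]) (use w in auto)
  then have "(\<integral>x. \<bar>w x\<bar> \<partial>m01) <= M" by simp
  also have "M <= (V + M + 2) * 1" using V by simp
  also have "... <= (V + M + 2) * sqrt e" using 3 V M by (intro mult_left_mono) auto
  finally show ?thesis .
 qed
qed

subsection \<open>Step functions\<close>

definition idx :: "real => real => nat" where "idx h x = nat \<lfloor>x / h\<rfloor>"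

lemma idx_measurable [measurable]: "idx h \<in> measurable borel (count_space UNIV)"
 unfolding idx_def by measurable

lemma idx_eq_iff: "0 < h ==> 0 <= x ==> idx h x = i \<longleftrightarrow> real i * h <= x \<and> x < (real i + 1) * h"
proof -
 assume h: "0 < h" "0 <= x"
 then have "0 <= \<lfloor>x / h\<rfloor>" by simp
 then have "idx h x = i \<longleftrightarrow> \<lfloor>x / h\<rfloor> = int i" by (auto simp: idx_def)
 also have "... \<longleftrightarrow> real i <= x / h \<and> x / h < real i + 1" by (simp add: floor_eq_iff)
 finally show ?thesis using h by (simp add: field_simps)
qed

lemma idx_bounds:
 assumes "0 < h" "0 <= x" shows "real (idx h x) * h <= x" "x < (real (idx h x) + 1) * h"
 using idx_eq_iff[OF assms, of "idx h x"] by auto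

lemma dx_pos [simp]: "0 < dx N" and dx_mult: "(real N + 1) * dx N = 1" and dx_le_1: "dx N <= 1"
 by (auto simp: dx_def)

lemma idx_le_N: assumes "x \<in> B" shows "idx (dx N) x <= N"
proof (rule ccontr)
 assume "\<not> idx (dx N) x <= N"
 then have "real N + 1 <= real (idx (dx N) x)" by linarith
 then have "(real N + 1) * dx N <= real (idx (dx N) x) * dx N" by (intro mult_right_mono) (auto intro: less_imp_le)
 then show False using idx_bounds(1)[OF dx_pos, of x N] assms by (simp add: dx_mult)
qed

lemma idx_mono: "0 < h ==> x <= y ==> idx h x <= idx h y"
 unfolding idx_def by (intro nat_mono floor_mono divide_right_mono) auto

definition cell :: "nat => nat => real set" where
 "cell N i = {x \<in> B. idx (dx N) x = i}"

lemma cell_eq: assumes "i <= N" shows "cell N i = {real i * dx N..<(real i + 1) * dx N} - {0}"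
proof -
 have "(real i + 1) * dx N <= (real N + 1) * dx N" using assms by (intro mult_right_mono) (auto intro: less_imp_le)
 then have *: "(real i + 1) * dx N <= 1" by (simp add: dx_mult)
 have "0 <= real i * dx N" by (simp add: less_imp_le)
 show ?thesis
 proof (rule set_eqI)
  fix x
  show "x \<in> cell N i \<longleftrightarrow> x \<in> {real i * dx N..<(real i + 1) * dx N} - {0}"
   using * \<open>0 <= real i * dx N\<close> idx_eq_iff[OF dx_pos[of N], of x i] by (cases "0 < x") (auto simp: cell_def)
 qed
qed

lemma sets_cell [measurable]: "cell N i \<in> sets borel"
proof -
 have "cell N i = (idx (dx N) -` {i} \<inter> space borel) \<inter> B" by (auto simp: cell_def)
 also have "... \<in> sets borel" by (intro sets.Int measurable_sets[OF idx_measurable]) auto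
 finally show ?thesis .
qed

lemma measure_cell: assumes "i <= N" shows "measure lborel (cell N i) = dx N"
proof -
 have "measure lborel (cell N i) = measure lborel {real i * dx N..<(real i + 1) * dx N}"
 proof -
  have "{0::real} \<in> null_sets lborel" by (simp add: null_sets_def)
  then show ?thesis unfolding cell_eq[OF assms] by (intro measure_Diff_null_set) auto
 qed
 also have "... = dx N" by (simp add: algebra_simps less_imp_le)
 finally show ?thesis .
qed

lemma step_measurable [measurable]: "(%x. v (idx h x)) \<in> borel_measurable borel" for v :: "nat => real"
 by measurable

lemma integral_m01_cells:
 fixes g :: "real => real"
 assumes g: "integrable m01 g"
 shows "(\<integral>x. v (idx (dx N) x) * g x \<partial>m01) = (\<Sum>i\<le>N. v i * (\<integral>x. indicator (cell N i) x * g x \<partial>m01))"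
proof -
 have i: "integrable m01 (%x. indicator (cell N i) x * g x)" for i
 proof -
  have "cell N i \<subseteq> B" by (auto simp: cell_def)
  then have "cell N i \<in> sets m01" using sets_cell[of N i] by (subst sets_restrict_space_iff) auto
  from integrable_mult_indicator[OF this g] show ?thesis by simp
 qed
 have "(\<integral>x. v (idx (dx N) x) * g x \<partial>m01) = (\<integral>x. (\<Sum>i\<le>N. v i * (indicator (cell N i) x * g x)) \<partial>m01)"
 proof (rule lint_cong[OF refl])
  fix x assume "x \<in> space m01"
  then have x: "x \<in> B" by simp
  have "(\<Sum>i\<le>N. v i * (indicator (cell N i) x * g x)) = (\<Sum>i\<le>N. if i = idx (dx N) x then v i * g x else 0)"
   using x by (intro sum.cong) (auto simp: cell_def indicator_def)
  also have "... = v (idx (dx N) x) * g x" using idx_le_N[OF x, of N] by simp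
  finally show "v (idx (dx N) x) * g x = (\<Sum>i\<le>N. v i * (indicator (cell N i) x * g x))" by simp
 qed
 also have "... = (\<Sum>i\<le>N. v i * (\<integral>x. indicator (cell N i) x * g x \<partial>m01))"
  using i by simp
 finally show ?thesis .
qed

lemma integral_cell: assumes "i <= N" shows "(\<integral>x. indicator (cell N i) x \<partial>m01) = dx N"
proof -
 have "cell N i \<inter> B = cell N i" by (auto simp: cell_def)
 then have "(\<integral>x. indicat_real (cell N i) x \<partial>m01) = measure m01 (cell N i)" by simp
 also have "... = measure lborel (cell N i)" by (rule measure_m01) (auto simp: cell_def sets_cell[unfolded cell_def])
 finally show ?thesis using measure_cell[OF assms] by simp
qed

lemma integral_step: "(\<integral>x. v (idx (dx N) x) \<partial>m01) = dx N * (\<Sum>i\<le>N. v i)"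
proof -
 have "(\<integral>x. v (idx (dx N) x) * 1 \<partial>m01) = (\<Sum>i\<le>N. v i * (\<integral>x. indicator (cell N i) x * 1 \<partial>m01))"
  by (rule integral_m01_cells) simp
 also have "... = (\<Sum>i\<le>N. v i * dx N)"
  by (intro sum.cong refl, simp only: mult_1_right, subst integral_cell) auto
 finally show ?thesis by (simp add: sum_distrib_left mult.commute)
qed

lemma step_abs_le:
 assumes "!!i. i <= N ==> \<bar>v i\<bar> <= M" "x \<in> B" shows "\<bar>v (idx (dx N) x)\<bar> <= M"
 using assms(1)[OF idx_le_N[OF assms(2)]] .

lemma osc_bound_step:
 fixes v :: "nat => real"
 assumes V: "(\<Sum>i<N. \<bar>v (Suc i) - v i\<bar>) <= V"
 shows "osc_bound (%x. v (idx (dx N) x)) V"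
 unfolding osc_bound_def
proof (intro allI impI)
 fix \<delta> :: real assume \<delta>: "0 < \<delta> \<and> \<delta> < 1"
 define I where "I = (%i. {(real i + 1) * dx N - \<delta>..<(real i + 1) * dx N})"
 define S where "S = (%x. \<Sum>i<N. \<bar>v (Suc i) - v i\<bar> * indicat_real (I i) x)"
 have ii: "integrable lborel (indicat_real (I i))" for i unfolding I_def using \<delta> by (simp add: integrable_real_indicator)
 have int: "(\<integral>x. S x \<partial>lborel) = (\<Sum>i<N. \<bar>v (Suc i) - v i\<bar>) * \<delta>"
 proof -
  have "(\<integral>x. S x \<partial>lborel) = (\<Sum>i<N. \<bar>v (Suc i) - v i\<bar> * (\<integral>x. indicat_real (I i) x \<partial>lborel))"
   unfolding S_def by (subst Bochner_Integration.integral_sum, rule integrable_mult_right, rule ii) (simp only: integral_mult_right_zero)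
  also have "... = (\<Sum>i<N. \<bar>v (Suc i) - v i\<bar> * \<delta>)" using \<delta> by (intro sum.cong) (auto simp: I_def)
  finally show ?thesis by (simp add: sum_distrib_right)
 qed
 show "\<exists>S. integrable lborel S \<and> (\<forall>x. 0 <= S x) \<and> (\<integral>x. S x \<partial>lborel) <= V * \<delta> \<and>
   (\<forall>x y. 0 < x \<and> x <= y \<and> y <= x + \<delta> \<and> y < 1 --> \<bar>v (idx (dx N) y) - v (idx (dx N) x)\<bar> <= S x)"
 proof (rule exI[of _ S], intro conjI allI impI)
  show "integrable lborel S" unfolding S_def by (intro Bochner_Integration.integrable_sum integrable_mult_right ii)
  show "(\<integral>x. S x \<partial>lborel) <= V * \<delta>" unfolding int using V \<delta> by (intro mult_right_mono) auto
  show "0 <= S x" for x unfolding S_def by (intro sum_nonneg) auto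
  fix x y assume xy: "0 < x \<and> x <= y \<and> y <= x + \<delta> \<and> y < 1"
  let ?a = "idx (dx N) x" and ?b = "idx (dx N) y"
  have ab: "?a <= ?b" "?b <= N" using idx_mono[OF dx_pos] idx_le_N[of y N] xy by auto
  have "v ?b - v ?a = (\<Sum>i=?a..<?b. v (Suc i) - v i)" using ab by (simp add: sum_Suc_diff')
  then have "\<bar>v ?b - v ?a\<bar> <= (\<Sum>i=?a..<?b. \<bar>v (Suc i) - v i\<bar>)" by simp
  also have "... = (\<Sum>i=?a..<?b. \<bar>v (Suc i) - v i\<bar> * indicat_real (I i) x)"
  proof (rule sum.cong[OF refl])
   fix i assume i: "i \<in> {?a..<?b}"
   have "(real ?a + 1) * dx N <= (real i + 1) * dx N" using i by (intro mult_right_mono) (auto intro: less_imp_le)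
   moreover have "(real i + 1) * dx N <= real ?b * dx N" using i by (intro mult_right_mono) (auto intro: less_imp_le)
   moreover have "x < (real ?a + 1) * dx N" "real ?b * dx N <= y" using idx_bounds[OF dx_pos, of _ N] xy by auto
   moreover have "x <= y" "y <= x + \<delta>" using xy by auto
   ultimately have "(real i + 1) * dx N - \<delta> <= x" "x < (real i + 1) * dx N" by linarith+
   then have "x \<in> I i" unfolding I_def atLeastLessThan_iff by blast
   then show "\<bar>v (Suc i) - v i\<bar> = \<bar>v (Suc i) - v i\<bar> * indicat_real (I i) x" by simp
  qed
  also have "... <= S x" unfolding S_def using ab by (intro sum_mono2) auto
  finally show "\<bar>v ?b - v ?a\<bar> <= S x" .
 qed
qed

lemma prim_node:
 fixes v :: "nat => real"
 assumes "i <= Suc N"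
 shows "prim (%x. v (idx (dx N) x)) (real i * dx N) = dx N * (\<Sum>l<i. v l)"
proof -
 have "prim (%x. v (idx (dx N) x)) (real i * dx N) = (\<integral>x. (%l. if l < i then v l else 0) (idx (dx N) x) \<partial>m01)"
  unfolding prim_def
 proof (rule lint_cong[OF refl])
  fix x assume "x \<in> space m01"
  then have x: "0 <= x" by simp
  have "x < real i * dx N \<longleftrightarrow> idx (dx N) x < i"
  proof
   assume "x < real i * dx N"
   then have "real (idx (dx N) x) * dx N < real i * dx N" by (rule le_less_trans[OF idx_bounds(1)[OF dx_pos x]])
   then show "idx (dx N) x < i" using mult_less_cancel_right_pos[OF dx_pos, of "real (idx (dx N) x)" N "real i"] by simp
  next
   assume "idx (dx N) x < i"
   then have "(real (idx (dx N) x) + 1) * dx N <= real i * dx N" by (intro mult_right_mono) (auto intro: less_imp_le)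
   then show "x < real i * dx N" by (rule less_le_trans[OF idx_bounds(2)[OF dx_pos x]])
  qed
  then show "indicator {..<real i * dx N} x * v (idx (dx N) x) = (if idx (dx N) x < i then v (idx (dx N) x) else 0)"
   by (simp add: indicator_def)
 qed
 also have "... = dx N * (\<Sum>l\<le>N. if l < i then v l else 0)" by (rule integral_step)
 also have "(\<Sum>l\<le>N. if l < i then v l else 0) = (\<Sum>l<i. v l)"
  using assms by (intro sum.mono_neutral_cong_right) auto
 finally show ?thesis .
qed

section \<open>A priori estimates\<close>

lemma dx_simps [simp]: "dx N \<noteq> 0" "0 <= dx N" "\<bar>dx N\<bar> = dx N"
 by (simp_all add: less_imp_le less_imp_neq[THEN not_sym])

text \<open>A discrete solution with the data on which all constants depend. Two discretizations of the same problem
 share every parameter except \<open>dt\<close>, \<open>N\<close> and \<open>a\<close>; in particular both have initial values that are cell averages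
 of one function, expressed by its primitive \<open>I\<close>.\<close>

locale fd =
 fixes G k :: "real => real" and L k0 k1 K M V :: real and I :: "real => real"
  and dt :: real and N :: nat and a :: "nat => nat => real"
 assumes mono: "mono G" and lip: "L-lipschitz_on UNIV G"
  and k0: "0 < k0" and k_bounds: "!!x. x \<in> {0..1} ==> k0 <= k x \<and> k x <= k1"
  and k_lip: "!!x y. x \<in> {0..1} ==> y \<in> {0..1} ==> \<bar>k x - k y\<bar> <= K * \<bar>x - y\<bar>"
  and dt: "0 < dt"
  and step: "!!n. nat_step G (%i. k (real i * dx N)) N (dt / (dx N)^2) (a n) (a (Suc n))"
  and init_bound: "!!i. i <= N ==> \<bar>a 0 i\<bar> <= M"
  and init_tv: "(\<Sum>i<N. \<bar>a 0 (Suc i) - a 0 i\<bar>) <= V"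
  and I_lip: "!!x y. \<bar>I x - I y\<bar> <= M * \<bar>x - y\<bar>"
  and init_I: "!!i. i <= Suc N ==> dx N * (\<Sum>l<i. a 0 l) = I (real i * dx N)"
begin

abbreviation "h \<equiv> dx N"
definition s :: "nat => real => real" where "s n x = a n (idx h x)"
definition fl :: "nat => nat => real" where "fl n i = nflux G (%i. k (real i * h)) N (a n) i"
definition U :: "nat => nat => real" where "U n i = h * (\<Sum>l<i. a n l)"
definition C1 :: real where "C1 = k1 * L * V"

lemma L0: "0 <= L" by (rule lipschitz_on_nonneg[OF lip])
lemma M0: "0 <= M" using init_bound[of 0] by auto
lemma V0: "0 <= V" using order_trans[OF sum_nonneg init_tv] by auto
lemma k01: "k0 <= k1" and k1: "0 < k1" using k_bounds[of 0] k0 by auto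
lemma K0: "0 <= K" using order_trans[OF abs_ge_zero k_lip[of 1 0]] by auto
lemma C10: "0 <= C1" using L0 V0 k1 by (simp add: C1_def)

lemma node_in: "i <= Suc N ==> real i * h \<in> {0..1}"
proof -
 assume "i <= Suc N"
 then have "real i * h <= (real N + 1) * h" by (intro mult_right_mono) (auto intro: less_imp_le)
 then show ?thesis by (simp add: dx_mult less_imp_le)
qed

lemma \<kappa>_pos: "i <= Suc N ==> 0 < k (real i * h)"
 using k_bounds[OF node_in] k0 by fastforce

lemma G_lip: "\<bar>G x - G y\<bar> <= L * \<bar>x - y\<bar>"
 using lipschitz_onD[OF lip, of x y] by (simp add: dist_real_def)

lemma \<mu>0: "0 <= dt / h^2" using dt by simp

lemma a_bound: "i <= N ==> \<bar>a n i\<bar> <= M"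
proof (induction n arbitrary: i)
 case 0 then show ?case by (rule init_bound)
next
 case (Suc n)
 show ?case by (rule nat_step_bounds[OF step mono \<mu>0 _ Suc.IH Suc.prems]) (use \<kappa>_pos in auto)
qed

lemma a_tv: "(\<Sum>i<N. \<bar>a n (Suc i) - a n i\<bar>) <= V"
proof (induction n)
 case 0 show ?case by (rule init_tv)
next
 case (Suc n)
 have "(\<Sum>i<N. \<bar>a (Suc n) (Suc i) - a (Suc n) i\<bar>) <= (\<Sum>i<N. \<bar>a n (Suc i) - a n i\<bar>)"
  by (rule nat_step_total_variation[OF step mono \<mu>0]) (use \<kappa>_pos in auto)
 then show ?case using Suc by simp
qed

lemma fl_0 [simp]: "fl n 0 = 0" and fl_end [simp]: "fl n (Suc N) = 0" by (simp_all add: fl_def)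

lemma fl_Suc: "i < N ==> fl n (Suc i) = k (real (Suc i) * h) * (G (a n (Suc i)) - G (a n i))"
 unfolding fl_def by (rule nflux_Suc)

lemma step_fl: "i <= N ==> a (Suc n) i - a n i = dt / h^2 * (fl (Suc n) (Suc i) - fl (Suc n) i)"
 using step[of n] unfolding nat_step_def fl_def by blast

lemma sum_fl_shift: "(\<Sum>i\<le>N. f i * \<bar>fl n i\<bar>) = (\<Sum>i<N. f (Suc i) * \<bar>fl n (Suc i)\<bar>)"
 by (subst lessThan_Suc_atMost[symmetric], subst sum.lessThan_Suc_shift) simp

text \<open>The flux is at most \<open>k1 L\<close> times the jump of \<open>a\<close>, so the total variation bounds it.\<close>

lemma sum_fl: "(\<Sum>i\<le>N. \<bar>fl n i\<bar>) <= C1"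
proof -
 have "(\<Sum>i\<le>N. \<bar>fl n i\<bar>) = (\<Sum>i<N. \<bar>fl n (Suc i)\<bar>)" using sum_fl_shift[of "%_. 1" n] by simp
 also have "... <= (\<Sum>i<N. k1 * (L * \<bar>a n (Suc i) - a n i\<bar>))"
 proof (rule sum_mono)
  fix i assume "i \<in> {..<N}"
  then have i: "i < N" by simp
  have "\<bar>fl n (Suc i)\<bar> = k (real (Suc i) * h) * \<bar>G (a n (Suc i)) - G (a n i)\<bar>"
   using fl_Suc[OF i] \<kappa>_pos[of "Suc i"] i by (simp add: abs_mult)
  also have "... <= k1 * (L * \<bar>a n (Suc i) - a n i\<bar>)"
   using k_bounds[OF node_in, of "Suc i"] i G_lip k1 by (intro mult_mono) auto
  finally show "\<bar>fl n (Suc i)\<bar> <= k1 * (L * \<bar>a n (Suc i) - a n i\<bar>)" .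
 qed
 also have "... = k1 * L * (\<Sum>i<N. \<bar>a n (Suc i) - a n i\<bar>)" by (simp add: sum_distrib_left mult.assoc)
 also have "... <= k1 * L * V" using a_tv[of n] k1 L0 by (intro mult_left_mono) auto
 finally show ?thesis by (simp add: C1_def)
qed

lemma U_step: "i <= Suc N ==> U (Suc n) i - U n i = dt / h * fl (Suc n) i"
proof -
 assume i: "i <= Suc N"
 have "U (Suc n) i - U n i = h * (\<Sum>l<i. a (Suc n) l - a n l)"
  by (simp add: U_def right_diff_distrib sum_subtractf)
 also have "(\<Sum>l<i. a (Suc n) l - a n l) = (\<Sum>l<i. dt / h^2 * (fl (Suc n) (Suc l) - fl (Suc n) l))"
  using i by (intro sum.cong refl step_fl) auto
 also have "... = dt / h^2 * fl (Suc n) i"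
  by (simp only: sum_distrib_left[symmetric] sum_lessThan_telescope[of "fl (Suc n)"] fl_0 diff_0_right)
 finally show ?thesis by (simp add: power2_eq_square)
qed

lemma U_prim: "i <= Suc N ==> prim (s n) (real i * h) = U n i"
 unfolding s_def U_def by (rule prim_node)

lemma U_0: "i <= Suc N ==> U 0 i = I (real i * h)"
 unfolding U_def by (rule init_I)

lemma U_end: "U n (Suc N) = I 1"
proof (induction n)
 case 0
 have "real (Suc N) * h = 1" using dx_mult[of N] by (simp add: add.commute)
 then show ?case using U_0[of "Suc N"] by simp
next
 case (Suc n) then show ?case using U_step[of "Suc N" n] by simp
qed

lemma s_measurable [measurable]: "s n \<in> borel_measurable borel" unfolding s_def by measurable

lemma s_measurable' [measurable]: "s n \<in> borel_measurable m01" by (rule measurable_m01) measurable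

lemma s_bound: "x \<in> B ==> \<bar>s n x\<bar> <= M"
 unfolding s_def by (rule step_abs_le[OF a_bound])

lemma s_osc: "osc_bound (s n) V"
 unfolding s_def by (rule osc_bound_step[OF a_tv])

lemma s_integral: "(\<integral>x. s n x \<partial>m01) = I 1"
proof -
 have "real (Suc N) * h = 1" using dx_mult[of N] by (simp add: add.commute)
 then have "prim (s n) 1 = U n (Suc N)" using U_prim[of "Suc N" n] by simp
 then show ?thesis by (simp add: prim_1 U_end)
qed

lemma U_bound: "i <= Suc N ==> \<bar>U n i\<bar> <= M"
 using U_prim[of i n] prim_bound[OF s_measurable' s_bound node_in, of i n] by simp

lemma k_measurable [measurable]: "k \<in> borel_measurable m01"
proof -
 have "continuous_on B k"
  by (rule lipschitz_on_continuous_on[of K], rule lipschitz_onI)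
    (use k_lip K0 in \<open>auto simp: dist_real_def\<close>)
 then have "k \<in> borel_measurable (restrict_space borel B)" by (rule borel_measurable_continuous_on_restrict)
 then show ?thesis by (simp cong: measurable_cong_sets sets_restrict_space_cong)
qed

text \<open>The primitive moves with the flux, hence at speed \<open>O(1)\<close> in \<open>L\<^sup>1\<close>; interpolation costs a square root.\<close>

lemma L1_time:
 assumes "n <= m"
 shows "(\<integral>x. \<bar>s m x - s n x\<bar> \<partial>m01) <= (2 * V + 2 * M + 2) * sqrt (3 * C1 * (real (m - n) * dt))"
proof -
 define w where "w = (%x. s m x - s n x)"
 have wm: "w \<in> borel_measurable m01" unfolding w_def by measurable
 have wb: "\<bar>w x\<bar> <= 2 * M" if "x \<in> B" for x using s_bound[OF that, of m] s_bound[OF that, of n] by (auto simp: w_def)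
 have osc: "osc_bound w (2 * V)"
  using osc_bound_add[OF s_osc[of m] osc_bound_scale[OF s_osc[of n], of "-1"]] by (simp add: w_def)
 define D where "D = (%i. prim w (real i * h))"
 have D: "D i = U m i - U n i" if "i <= Suc N" for i
 proof -
  have "w = (%x. (%l. a m l - a n l) (idx h x))" by (auto simp: w_def s_def)
  then have "D i = h * (\<Sum>l<i. a m l - a n l)" unfolding D_def using prim_node[OF that, of "%l. a m l - a n l"] by simp
  then show ?thesis by (simp add: U_def right_diff_distrib sum_subtractf)
 qed
 have Dsum: "D i = (\<Sum>l=n..<m. dt / h * fl (Suc l) i)" if "i <= Suc N" for i
  unfolding D[OF that] using assms U_step[OF that] by (simp add: sum_Suc_diff'[of n m "%l. U l i", symmetric])
 have hD: "h * (\<Sum>i\<le>N. \<bar>D i\<bar>) <= C1 * (real (m - n) * dt)"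
 proof -
  have "(\<Sum>i\<le>N. \<bar>D i\<bar>) <= (\<Sum>i\<le>N. \<Sum>l=n..<m. dt / h * \<bar>fl (Suc l) i\<bar>)"
  proof (rule sum_mono)
   fix i assume "i \<in> {..N}"
   then have "\<bar>D i\<bar> <= (\<Sum>l=n..<m. \<bar>dt / h * fl (Suc l) i\<bar>)" using Dsum[of i] by (simp only: atMost_iff le_SucI sum_abs)
   then show "\<bar>D i\<bar> <= (\<Sum>l=n..<m. dt / h * \<bar>fl (Suc l) i\<bar>)" using dt by (simp add: abs_mult abs_of_pos[OF dx_pos])
  qed
  also have "... = (\<Sum>l=n..<m. dt / h * (\<Sum>i\<le>N. \<bar>fl (Suc l) i\<bar>))"
   by (subst sum.swap) (simp add: sum_distrib_left)
  also have "... <= (\<Sum>l=n..<m. dt / h * C1)"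
   using dt by (intro sum_mono mult_left_mono sum_fl) (auto intro!: divide_nonneg_nonneg less_imp_le)
  also have "... = real (m - n) * (dt / h * C1)" by simp
  finally have "h * (\<Sum>i\<le>N. \<bar>D i\<bar>) <= h * (real (m - n) * (dt / h * C1))" by (intro mult_left_mono) (auto intro: less_imp_le)
  then show ?thesis by (simp add: field_simps)
 qed
 have pt: "\<bar>prim w x\<bar> <= (%i. 2 * \<bar>D i\<bar> + \<bar>D (Suc i)\<bar>) (idx h x)" if x: "x \<in> B" for x
 proof -
  define i where "i = idx h x"
  have i: "i <= N" unfolding i_def by (rule idx_le_N[OF x])
  have xi: "real i * h <= x" "x < (real i + 1) * h" using idx_bounds[OF dx_pos, of x N] x by (auto simp: i_def)
  define c where "c = a m i - a n i"
  have on_cell: "prim w y - prim w (real i * h) = c * (\<integral>z. indicator {real i * h..<y} z \<partial>m01)" if y: "real i * h <= y" "y <= (real i + 1) * h" for y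
  proof -
   have "prim w y - prim w (real i * h) = (\<integral>z. indicator {real i * h..<y} z * w z \<partial>m01)"
    by (rule prim_diff[OF wm wb y(1)])
   also have "... = (\<integral>z. c * indicator {real i * h..<y} z \<partial>m01)"
   proof (rule lint_cong[OF refl])
    fix z assume z: "z \<in> space m01"
    show "indicator {real i * h..<y} z * w z = c * indicator {real i * h..<y} z"
    proof (cases "z \<in> {real i * h..<y}")
     case True
     then have "idx h z = i" using z y by (subst idx_eq_iff) auto
     then show ?thesis using True by (simp add: w_def s_def c_def)
    qed simp
   qed
   also have "... = c * (\<integral>z. indicator {real i * h..<y} z \<partial>m01)" by (rule integral_mult_right_zero)
   finally show ?thesis .
  qed
  have mono: "(\<integral>z. indicat_real {real i * h..<x} z \<partial>m01) <= (\<integral>z. indicat_real {real i * h..<(real i + 1) * h} z \<partial>m01)"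
   using xi by (intro integral_mono integrable_m01_bounded[of _ 1]) (auto simp: indicator_def)
  have "\<bar>prim w x - D i\<bar> = \<bar>c\<bar> * (\<integral>z. indicat_real {real i * h..<x} z \<partial>m01)"
   using on_cell[of x] xi by (simp add: D_def abs_mult)
  also have "... <= \<bar>c\<bar> * (\<integral>z. indicat_real {real i * h..<(real i + 1) * h} z \<partial>m01)"
   using mono by (intro mult_left_mono) auto
  also have "... = \<bar>D (Suc i) - D i\<bar>"
   using on_cell[of "(real i + 1) * h"] by (simp add: D_def abs_mult add.commute mult_right_mono less_imp_le)
  finally show ?thesis unfolding i_def[symmetric] by linarith
 qed
 have DN: "D (Suc N) = 0" using D[of "Suc N"] by (simp add: U_end)
 have "(\<integral>x. \<bar>prim w x\<bar> \<partial>m01) <= (\<integral>x. (%i. 2 * \<bar>D i\<bar> + \<bar>D (Suc i)\<bar>) (idx h x) \<partial>m01)"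
 proof (rule integral_mono)
  have [measurable]: "prim w \<in> borel_measurable borel" by (rule prim_measurable[OF wm wb])
  show "integrable m01 (%x. \<bar>prim w x\<bar>)"
   by (rule integrable_m01_bounded[of _ "2 * M"]) (use prim_bound[OF wm wb] in auto)
  show "integrable m01 (%x. (%i. 2 * \<bar>D i\<bar> + \<bar>D (Suc i)\<bar>) (idx h x))"
  proof (rule integrable_m01_bounded)
   show "\<bar>(%i. 2 * \<bar>D i\<bar> + \<bar>D (Suc i)\<bar>) (idx h x)\<bar> <= (\<Sum>i\<le>N. 2 * \<bar>D i\<bar> + \<bar>D (Suc i)\<bar>)" if "x \<in> B" for x
    using member_le_sum[of "idx h x" "{..N}" "%i. 2 * \<bar>D i\<bar> + \<bar>D (Suc i)\<bar>"] idx_le_N[OF that] by auto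
  qed measurable
 qed (use pt in auto)
 also have "... = h * (\<Sum>i\<le>N. 2 * \<bar>D i\<bar> + \<bar>D (Suc i)\<bar>)" by (rule integral_step)
 also have "(\<Sum>i\<le>N. 2 * \<bar>D i\<bar> + \<bar>D (Suc i)\<bar>) <= 3 * (\<Sum>i\<le>N. \<bar>D i\<bar>)"
 proof -
  have "(\<Sum>i\<le>N. \<bar>D (Suc i)\<bar>) + \<bar>D 0\<bar> = (\<Sum>i\<le>N. \<bar>D i\<bar>) + \<bar>D (Suc N)\<bar>"
   using sum.atMost_Suc_shift[of "%i. \<bar>D i\<bar>" N] by (simp add: add.commute)
  then have "(\<Sum>i\<le>N. \<bar>D (Suc i)\<bar>) <= (\<Sum>i\<le>N. \<bar>D i\<bar>)" using DN by simp
  then show ?thesis by (simp add: sum.distrib flip: sum_distrib_left)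
 qed
 then have "h * (\<Sum>i\<le>N. 2 * \<bar>D i\<bar> + \<bar>D (Suc i)\<bar>) <= 3 * (h * (\<Sum>i\<le>N. \<bar>D i\<bar>))"
  using mult_left_mono[OF _ less_imp_le[OF dx_pos]] by fastforce
 also have "... <= 3 * C1 * (real (m - n) * dt)" using hD by simp
 finally have "(\<integral>x. \<bar>prim w x\<bar> \<partial>m01) <= 3 * C1 * (real (m - n) * dt)" .
 from L1_interpolation[OF wm wb osc _ this] V0 show ?thesis by (simp add: w_def)
qed

lemma cell_integral_prim:
 assumes "i <= N" "w \<in> borel_measurable m01" "!!x. x \<in> B ==> \<bar>w x\<bar> <= Mw"
 shows "(\<integral>x. indicator (cell N i) x * w x \<partial>m01) = prim w (real (Suc i) * h) - prim w (real i * h)"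
proof -
 have "prim w (real (Suc i) * h) - prim w (real i * h) = (\<integral>x. indicator {real i * h..<real (Suc i) * h} x * w x \<partial>m01)"
  by (rule prim_diff[OF assms(2,3)]) (auto intro!: mult_right_mono less_imp_le)
 also have "... = (\<integral>x. indicator (cell N i) x * w x \<partial>m01)"
  by (rule lint_cong) (use cell_eq[OF assms(1)] in \<open>auto simp: indicator_def add.commute\<close>)
 finally show ?thesis by simp
qed

text \<open>The discrete form of \<open>\<integral> \<partial>\<^sub>t U W / k = \<integral> \<partial>\<^sub>x G(u) W = - \<integral> G(u) w\<close> for \<open>w = W'\<close>. Here \<open>W\<close> need not
 live on the grid, since it will involve a second discretization. The errors come from replacing \<open>W / k\<close> by its
 value at the edge of the cell, and are multiplied by the \<open>L\<^sup>1\<close> norm of the flux.\<close>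

lemma weak_flux_identity:
 assumes w: "w \<in> borel_measurable m01" "!!x. x \<in> B ==> \<bar>w x\<bar> <= Mw" and w1: "prim w 1 = 0"
  and Wh: "Wh \<in> borel_measurable m01" "!!x. x \<in> B ==> \<bar>Wh x - prim w x\<bar> <= r"
 shows "\<bar>(\<integral>x. (U (Suc n) (idx h x) - U n (idx h x)) / dt * (Wh x / k x) \<partial>m01) + (\<integral>x. G (s (Suc n) x) * w x \<partial>m01)\<bar>
   <= C1 * ((r + Mw * h) / k0 + Mw * K * h / k0^2)"
proof -
 have Mw: "0 <= Mw" using order_trans[OF abs_ge_zero w(2)[of "1/2"]] by auto
 define f where "f = fl (Suc n)"
 define W where "W = (%i. prim w (real i * h))"
 define g where "g = (%x. Wh x / k x)"
 have gm[measurable]: "g \<in> borel_measurable m01" unfolding g_def using Wh(1) by measurable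
 have prb: "\<bar>prim w x\<bar> <= Mw" if "x \<in> {0..1}" for x by (rule prim_bound[OF w that])
 have Whb: "\<bar>Wh x\<bar> <= Mw + r" if "x \<in> B" for x using Wh(2)[OF that] prb[of x] that by auto
 have gb: "\<bar>g x\<bar> <= (Mw + r) / k0" if "x \<in> B" for x
 proof -
  have "k0 <= k x" using k_bounds[of x] that by auto
  then show ?thesis using Whb[OF that] k0 Mw by (simp add: g_def abs_divide frac_le)
 qed
 have gi: "integrable m01 g" by (rule integrable_m01_bounded[OF gm gb])
 have wi: "integrable m01 w" by (rule integrable_m01_bounded[OF w])
 define e where "e = (r + Mw * h) / k0 + Mw * K * h / k0^2"
 have "real (Suc N) * h = 1" using dx_mult[of N] by (simp add: add.commute)
 then have W0: "W 0 = 0" "W (Suc N) = 0" using w1 by (simp_all add: W_def)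
 have first: "(\<integral>x. (U (Suc n) (idx h x) - U n (idx h x)) / dt * g x \<partial>m01) = (\<Sum>i\<le>N. f i * ((1/h) * (\<integral>x. indicator (cell N i) x * g x \<partial>m01)))"
 proof -
  have "(\<integral>x. (U (Suc n) (idx h x) - U n (idx h x)) / dt * g x \<partial>m01) = (\<Sum>i\<le>N. (U (Suc n) i - U n i) / dt * (\<integral>x. indicator (cell N i) x * g x \<partial>m01))"
   by (rule integral_m01_cells[OF gi, of "%i. (U (Suc n) i - U n i) / dt"])
  also have "... = (\<Sum>i\<le>N. f i * ((1/h) * (\<integral>x. indicator (cell N i) x * g x \<partial>m01)))"
   by (rule sum.cong[OF refl], subst U_step) (use dt in \<open>auto simp: f_def\<close>)
  finally show ?thesis .
 qed
 have second: "(\<integral>x. G (s (Suc n) x) * w x \<partial>m01) = - (\<Sum>i\<le>N. f i * (W i / k (real i * h)))"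
 proof -
  have "(\<integral>x. G (s (Suc n) x) * w x \<partial>m01) = (\<Sum>i\<le>N. G (a (Suc n) i) * (\<integral>x. indicator (cell N i) x * w x \<partial>m01))"
   unfolding s_def by (rule integral_m01_cells[OF wi, of "%i. G (a (Suc n) i)"])
  also have "... = (\<Sum>i\<le>N. (W (Suc i) - W i) * G (a (Suc n) i))"
   by (rule sum.cong[OF refl], subst cell_integral_prim[OF _ w]) (auto simp: W_def)
  also have "... = - (\<Sum>i<N. W (Suc i) * (G (a (Suc n) (Suc i)) - G (a (Suc n) i)))"
   using summation_by_parts_aux[of W "%i. G (a (Suc n) i)" N, OF W0(1)] W0(2) by simp
  also have "... = - (\<Sum>i<N. f (Suc i) * (W (Suc i) / k (real (Suc i) * h)))"
  proof -
   have "W (Suc i) * (G (a (Suc n) (Suc i)) - G (a (Suc n) i)) = f (Suc i) * (W (Suc i) / k (real (Suc i) * h))" if "i < N" for i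
    using fl_Suc[OF that, of "Suc n"] \<kappa>_pos[of "Suc i"] that unfolding f_def by (simp del: of_nat_Suc)
   then show ?thesis by simp
  qed
  also have "(\<Sum>i<N. f (Suc i) * (W (Suc i) / k (real (Suc i) * h))) = (\<Sum>i\<le>N. f i * (W i / k (real i * h)))"
   unfolding lessThan_Suc_atMost[symmetric] sum.lessThan_Suc_shift by (simp add: f_def)
  finally show ?thesis .
 qed
 have br: "\<bar>(1/h) * (\<integral>x. indicator (cell N i) x * g x \<partial>m01) - W i / k (real i * h)\<bar> <= e" if i: "i <= N" for i
 proof -
  define c where "c = W i / k (real i * h)"
  have kn: "real i * h \<in> {0..1}" using node_in i by simp
  have diff: "\<bar>g x - c\<bar> <= e" if x: "x \<in> cell N i" for x
  proof -
   have xB: "x \<in> B" and xi: "real i * h <= x" "x < (real i + 1) * h"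
    using x idx_bounds[OF dx_pos, of x N] by (auto simp: cell_def)
   have kx: "k0 <= k x" using k_bounds[of x] xB by auto
   have ki: "k0 <= k (real i * h)" using k_bounds[OF kn] by auto
   have d: "\<bar>x - real i * h\<bar> <= h" using xi by (simp add: algebra_simps)
   have "\<bar>prim w x - W i\<bar> <= Mw * \<bar>x - real i * h\<bar>" unfolding W_def by (rule prim_lipschitz[OF w])
   also have "... <= Mw * h" using d Mw by (rule mult_left_mono)
   finally have 1: "\<bar>Wh x - W i\<bar> <= r + Mw * h" using Wh(2)[OF xB] by linarith
   have 2: "\<bar>k (real i * h) - k x\<bar> <= K * h"
   proof -
    have "\<bar>k x - k (real i * h)\<bar> <= K * \<bar>x - real i * h\<bar>" using k_lip[of x "real i * h"] kn xB by auto
    also have "... <= K * h" using d K0 by (rule mult_left_mono)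
    finally show ?thesis by (simp add: abs_minus_commute)
   qed
   have "g x - c = (Wh x - W i) / k x + W i * (k (real i * h) - k x) / (k x * k (real i * h))"
    using kx ki k0 by (simp add: g_def c_def field_simps)
   then have "\<bar>g x - c\<bar> <= \<bar>Wh x - W i\<bar> / k x + \<bar>W i\<bar> * \<bar>k (real i * h) - k x\<bar> / (k x * k (real i * h))"
    using kx ki k0 abs_triangle_ineq[of "(Wh x - W i) / k x" "W i * (k (real i * h) - k x) / (k x * k (real i * h))"]
    by (simp add: abs_divide abs_mult)
   also have "... <= (r + Mw * h) / k0 + (Mw * (K * h)) / (k0 * k0)"
   proof (intro add_mono frac_le mult_mono)
    show "\<bar>W i\<bar> <= Mw" unfolding W_def by (rule prb[OF kn])
   qed (use 1 2 kx ki k0 Mw in auto)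
   also have "... = e" by (simp add: e_def power2_eq_square mult.assoc)
   finally show ?thesis .
  qed
  have ic: "integrable m01 (indicat_real (cell N i))" by (rule integrable_m01_bounded[of _ 1]) auto
  have icg: "integrable m01 (%x. indicator (cell N i) x * g x)"
   by (rule dominated_integrable[OF gi]) (auto simp: indicator_def)
  have "(1/h) * (\<integral>x. indicator (cell N i) x * g x \<partial>m01) - c = (1/h) * (\<integral>x. indicator (cell N i) x * g x - c * indicator (cell N i) x \<partial>m01)"
  proof -
   have "(\<integral>x. indicator (cell N i) x * g x - c * indicator (cell N i) x \<partial>m01) = (\<integral>x. indicator (cell N i) x * g x \<partial>m01) - c * (\<integral>x. indicator (cell N i) x \<partial>m01)"
    by (subst Bochner_Integration.integral_diff) (use ic icg in \<open>auto intro: integrable_mult_right\<close>)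
   then have e: "(\<integral>x. indicator (cell N i) x * g x - c * indicator (cell N i) x \<partial>m01) = (\<integral>x. indicator (cell N i) x * g x \<partial>m01) - c * h"
    unfolding integral_cell[OF i] .
   show ?thesis unfolding e using dx_pos[of N] by (simp add: right_diff_distrib)
  qed
  also have "\<bar>...\<bar> = (1/h) * \<bar>\<integral>x. indicator (cell N i) x * g x - c * indicator (cell N i) x \<partial>m01\<bar>"
   by (simp add: abs_mult)
  also have "... <= (1/h) * (\<integral>x. e * indicator (cell N i) x \<partial>m01)"
  proof (rule mult_left_mono)
   have "\<bar>\<integral>x. indicator (cell N i) x * g x - c * indicator (cell N i) x \<partial>m01\<bar> <= (\<integral>x. \<bar>indicator (cell N i) x * g x - c * indicator (cell N i) x\<bar> \<partial>m01)"
    by (rule integral_abs_bound)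
   also have "... <= (\<integral>x. e * indicator (cell N i) x \<partial>m01)"
   proof (rule integral_mono)
    show "integrable m01 (%x. \<bar>indicator (cell N i) x * g x - c * indicator (cell N i) x\<bar>)"
     by (intro integrable_abs Bochner_Integration.integrable_diff icg integrable_mult_right ic)
    show "integrable m01 (%x. e * indicat_real (cell N i) x)" by (intro integrable_mult_right ic)
    show "\<bar>indicator (cell N i) x * g x - c * indicator (cell N i) x\<bar> <= e * indicator (cell N i) x" for x
     using diff[of x] by (auto simp: indicator_def)
   qed
   finally show "\<bar>\<integral>x. indicator (cell N i) x * g x - c * indicator (cell N i) x \<partial>m01\<bar> <= (\<integral>x. e * indicator (cell N i) x \<partial>m01)" .
  qed simp
  also have "(\<integral>x. e * indicator (cell N i) x \<partial>m01) = e * h"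
   unfolding integral_mult_right_zero integral_cell[OF i] by (rule refl)
  finally show ?thesis unfolding c_def by simp
 qed
 have e0: "0 <= e" using order_trans[OF abs_ge_zero br[of 0]] by simp
 have "(\<integral>x. (U (Suc n) (idx h x) - U n (idx h x)) / dt * g x \<partial>m01) + (\<integral>x. G (s (Suc n) x) * w x \<partial>m01)
   = (\<Sum>i\<le>N. f i * ((1/h) * (\<integral>x. indicator (cell N i) x * g x \<partial>m01) - W i / k (real i * h)))"
  unfolding first second by (simp add: right_diff_distrib sum_subtractf)
 then have "\<bar>(\<integral>x. (U (Suc n) (idx h x) - U n (idx h x)) / dt * g x \<partial>m01) + (\<integral>x. G (s (Suc n) x) * w x \<partial>m01)\<bar>
   <= (\<Sum>i\<le>N. \<bar>f i * ((1/h) * (\<integral>x. indicator (cell N i) x * g x \<partial>m01) - W i / k (real i * h))\<bar>)" by simp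
 also have "... <= (\<Sum>i\<le>N. \<bar>f i\<bar> * e)"
  by (rule sum_mono, unfold abs_mult, rule mult_left_mono) (use br in auto)
 also have "... = (\<Sum>i\<le>N. \<bar>f i\<bar>) * e" by (simp add: sum_distrib_right)
 also have "... <= C1 * e" using sum_fl[of "Suc n"] e0 unfolding f_def by (rule mult_right_mono)
 finally show ?thesis by (simp add: e_def g_def)
qed

end

section \<open>Comparison of two discretizations\<close>

context fd
begin

text \<open>Position of \<open>t\<close> within its time step. The interpolants below are affine in time on each step, which makes
 them differentiable in time between the nodes of both grids.\<close>

definition th :: "real => real" where "th t = t / dt - real (idx dt t)"
definition Ut :: "real => real => real" where
 "Ut t x = U (idx dt t) (idx h x) + th t * (U (Suc (idx dt t)) (idx h x) - U (idx dt t) (idx h x))"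
definition st :: "real => real => real" where
 "st t x = s (idx dt t) x + th t * (s (Suc (idx dt t)) x - s (idx dt t) x)"
definition Ctau :: real where "Ctau = (2 * V + 2 * M + 2) * sqrt (3 * C1)"

lemma Ctau0: "0 <= Ctau" using V0 M0 C10 by (simp add: Ctau_def)

lemma th_bounds: "0 <= t ==> 0 <= th t \<and> th t <= 1"
 using idx_bounds[OF dt, of t] dt by (simp add: th_def field_simps)

lemma idx_time_cell:
 assumes "real n * dt <= t" "t <= (real n + 1) * dt"
 shows "(idx dt t = n \<and> th t = t / dt - real n) \<or> (idx dt t = Suc n \<and> th t = 0 \<and> t / dt - real n = 1)"
proof -
 have t0: "0 <= t" by (rule order_trans[OF _ assms(1)]) (use dt in simp)
 show ?thesis
 proof (cases "t < (real n + 1) * dt")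
  case True
  then have "idx dt t = n" using assms idx_eq_iff[OF dt t0] by blast
  then show ?thesis by (simp add: th_def)
 next
  case False
  then have t: "t = (real n + 1) * dt" using assms by simp
  then have "idx dt t = Suc n" using dt by (subst idx_eq_iff[OF dt t0]) (simp add: algebra_simps)
  then show ?thesis using t dt by (simp add: th_def)
 qed
qed

lemma Ut_cell:
 assumes "real n * dt <= t" "t <= (real n + 1) * dt"
 shows "Ut t x = U n (idx h x) + (t / dt - real n) * (U (Suc n) (idx h x) - U n (idx h x))"
 using idx_time_cell[OF assms] unfolding Ut_def by auto

lemma st_cell:
 assumes "real n * dt <= t" "t <= (real n + 1) * dt"
 shows "st t x = s n x + (t / dt - real n) * (s (Suc n) x - s n x)"
 using idx_time_cell[OF assms] unfolding st_def by auto

lemma st_convex: "st t x = (1 - th t) * s (idx dt t) x + th t * s (Suc (idx dt t)) x"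
 by (simp add: st_def algebra_simps)

lemma st_measurable [measurable]: "st t \<in> borel_measurable m01"
 unfolding st_def by measurable

lemma convex_abs_le: "0 <= \<theta> ==> \<theta> <= 1 ==> \<bar>p\<bar> <= C ==> \<bar>q\<bar> <= C ==> \<bar>(1 - \<theta>) * p + \<theta> * q\<bar> <= (C::real)"
proof -
 assume a: "0 <= \<theta>" "\<theta> <= 1" "\<bar>p\<bar> <= C" "\<bar>q\<bar> <= C"
 have "\<bar>(1 - \<theta>) * p + \<theta> * q\<bar> <= \<bar>(1 - \<theta>) * p\<bar> + \<bar>\<theta> * q\<bar>" by (rule abs_triangle_ineq)
 also have "... = (1 - \<theta>) * \<bar>p\<bar> + \<theta> * \<bar>q\<bar>" using a by (simp add: abs_mult)
 also have "... <= (1 - \<theta>) * C + \<theta> * C" using a by (intro add_mono mult_left_mono) auto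
 finally show ?thesis by (simp add: algebra_simps)
qed

lemma st_bound: "0 <= t ==> x \<in> B ==> \<bar>st t x\<bar> <= M"
 unfolding st_convex using th_bounds[of t] s_bound[of x] by (intro convex_abs_le) auto

lemma st_osc: "0 <= t ==> osc_bound (st t) V"
proof -
 assume t: "0 <= t"
 have "osc_bound (%x. (1 - th t) * s (idx dt t) x + th t * s (Suc (idx dt t)) x) (\<bar>1 - th t\<bar> * V + \<bar>th t\<bar> * V)"
  by (intro osc_bound_add osc_bound_scale s_osc)
 moreover have "\<bar>1 - th t\<bar> * V + \<bar>th t\<bar> * V = V" using th_bounds[OF t] by (simp add: algebra_simps)
 moreover have "st t = (%x. (1 - th t) * s (idx dt t) x + th t * s (Suc (idx dt t)) x)" by (auto simp: st_convex)
 ultimately show ?thesis by simp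
qed

lemma s_integrable [simp]: "integrable m01 (s n)"
 by (rule integrable_m01_bounded[OF s_measurable' s_bound])

lemma st_integral: "(\<integral>x. st t x \<partial>m01) = I 1"
 unfolding st_def by (simp add: s_integral)

lemma Ut_measurable [measurable]: "Ut t \<in> borel_measurable m01"
proof -
 have "Ut t = (%x. (%i. U (idx dt t) i + th t * (U (Suc (idx dt t)) i - U (idx dt t) i)) (idx h x))" by (auto simp: Ut_def)
 also have "... \<in> borel_measurable m01" by (rule measurable_m01) measurable
 finally show ?thesis .
qed

lemma Ut_prim:
 assumes t: "0 <= t" and x: "x \<in> B"
 shows "\<bar>Ut t x - prim (st t) x\<bar> <= M * h"
proof -
 define i where "i = idx h x"
 have i: "i <= Suc N" using idx_le_N[OF x, of N] by (simp add: i_def)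
 have xi: "real i * h <= x" "x < (real i + 1) * h" using idx_bounds[OF dx_pos, of x N] x by (auto simp: i_def)
 have "st t = (%x. (%l. a (idx dt t) l + th t * (a (Suc (idx dt t)) l - a (idx dt t) l)) (idx h x))"
  by (auto simp: st_def s_def)
 then have "prim (st t) (real i * h) = h * (\<Sum>l<i. a (idx dt t) l + th t * (a (Suc (idx dt t)) l - a (idx dt t) l))"
  using prim_node[OF i, of "%l. a (idx dt t) l + th t * (a (Suc (idx dt t)) l - a (idx dt t) l)"] by simp
 also have "... = Ut t x"
  by (simp add: Ut_def U_def i_def[symmetric] sum.distrib sum_subtractf algebra_simps flip: sum_distrib_left)
 finally have "\<bar>Ut t x - prim (st t) x\<bar> = \<bar>prim (st t) (real i * h) - prim (st t) x\<bar>" by simp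
 also have "... <= M * \<bar>real i * h - x\<bar>" by (rule prim_lipschitz[OF st_measurable st_bound[OF t]])
 also have "... <= M * h" using xi M0 by (intro mult_left_mono) (auto simp: algebra_simps)
 finally show ?thesis .
qed

lemma Ut_bound: assumes t: "0 <= t" and x: "x \<in> B" shows "\<bar>Ut t x\<bar> <= M"
proof -
 have i: "idx h x <= Suc N" using idx_le_N[OF x, of N] by simp
 have "Ut t x = (1 - th t) * U (idx dt t) (idx h x) + th t * U (Suc (idx dt t)) (idx h x)"
  by (simp add: Ut_def algebra_simps)
 then show ?thesis using th_bounds[OF t] U_bound[OF i] convex_abs_le by simp
qed

lemma L1_step: "(\<integral>x. \<bar>s (Suc n) x - s n x\<bar> \<partial>m01) <= Ctau * sqrt dt"
 using L1_time[of n "Suc n"] by (simp add: Ctau_def real_sqrt_mult mult.assoc)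

lemma L1_st:
 assumes "real n * dt <= t" "t <= (real n + 1) * dt"
 shows "(\<integral>x. \<bar>s n x - st t x\<bar> \<partial>m01) <= Ctau * sqrt dt" "(\<integral>x. \<bar>s (Suc n) x - st t x\<bar> \<partial>m01) <= Ctau * sqrt dt"
proof -
 define \<theta> where "\<theta> = t / dt - real n"
 have \<theta>: "0 <= \<theta>" "\<theta> <= 1" using assms dt by (auto simp: \<theta>_def field_simps)
 have 1: "\<bar>s n x - st t x\<bar> = \<theta> * \<bar>s (Suc n) x - s n x\<bar>" and 2: "\<bar>s (Suc n) x - st t x\<bar> = (1 - \<theta>) * \<bar>s (Suc n) x - s n x\<bar>" for x
 proof -
  have "s n x - st t x = - (\<theta> * (s (Suc n) x - s n x))" "s (Suc n) x - st t x = (1 - \<theta>) * (s (Suc n) x - s n x)"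
   unfolding st_cell[OF assms] \<theta>_def[symmetric] by (auto simp: algebra_simps)
  then show "\<bar>s n x - st t x\<bar> = \<theta> * \<bar>s (Suc n) x - s n x\<bar>" "\<bar>s (Suc n) x - st t x\<bar> = (1 - \<theta>) * \<bar>s (Suc n) x - s n x\<bar>"
   using \<theta> by (simp_all add: abs_mult)
 qed
 have nn: "0 <= (\<integral>x. \<bar>s (Suc n) x - s n x\<bar> \<partial>m01)" by simp
 show "(\<integral>x. \<bar>s n x - st t x\<bar> \<partial>m01) <= Ctau * sqrt dt"
  unfolding 1 integral_mult_right_zero using L1_step[of n] mult_right_mono[OF \<theta>(2) nn] by simp
 show "(\<integral>x. \<bar>s (Suc n) x - st t x\<bar> \<partial>m01) <= Ctau * sqrt dt"
  unfolding 2 integral_mult_right_zero using L1_step[of n] mult_right_mono[of "1 - \<theta>" 1, OF _ nn] \<theta> by simp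
qed

end

text \<open>Transfers a transitive relation from the cells of a time grid to arbitrary intervals. It is applied
 to two time grids in turn; on the inner grid \<open>Q\<close> keeps all times in one cell of the outer grid.\<close>

lemma interval_chain:
 fixes P :: "real => real => bool"
 assumes d: "0 < (d::real)" and P: "!!n r t. real n * d <= r ==> r <= t ==> t <= (real n + 1) * d ==> Q r ==> Q t ==> P r t"
  and tr: "!!r t v. P r t ==> P t v ==> P r v"
  and Q: "!!r t v. Q r ==> Q v ==> r <= t ==> t <= v ==> Q t"
  and r: "0 <= r" "r <= t" "Q r" "Q t"
 shows "P r t"
proof -
 have "P r t" if "t <= (real n + 1) * d" "r <= t" "Q t" for n t
  using that
 proof (induction n arbitrary: t)
  case 0 then show ?case using P[of 0 r t] r by simp
 next
  case (Suc n)
  show ?case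
  proof (cases "t <= (real n + 1) * d")
   case True then show ?thesis using Suc by blast
  next
   case False
   show ?thesis
   proof (cases "r <= (real n + 1) * d")
    case True
    have Qn: "Q ((real n + 1) * d)" using Q[of r t "(real n + 1) * d"] r Suc.prems True False by auto
    have "P r ((real n + 1) * d)" by (rule Suc.IH) (use True Qn in auto)
    moreover have "P ((real n + 1) * d) t"
     by (rule P[of "Suc n"]) (use Suc.prems False Qn in \<open>auto simp: algebra_simps\<close>)
    ultimately show ?thesis by (rule tr)
   next
    case False
    show ?thesis by (rule P[of "Suc n"]) (use Suc.prems False r in \<open>auto simp: algebra_simps\<close>)
   qed
  qed
 qed
 moreover obtain n :: nat where "t / d <= real n" using real_arch_simple by blast
 then have "t <= (real n + 1) * d" using d by (simp add: field_simps)
 ultimately show ?thesis using r by blast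
qed

locale fd_pair = A: fd G k L k0 k1 K M V I dt N a + A': fd G k L k0 k1 K M V I dt' N' a'
 for G k L k0 k1 K M V I dt N a dt' N' a'
begin

definition E :: "real => real" where
 "E t = (\<integral>x. (A.Ut t x - A'.Ut t x)^2 / (2 * k x) \<partial>m01)"

definition rho :: real where "rho = sqrt dt + sqrt dt' + (dx N + dx N')"
definition C2 :: real where "C2 = 2 * (A.C1 * (3 * M / k0 + 2 * M * K / k0^2)) + 2 * L * M * A.Ctau"

lemma rho0: "0 <= rho" using A.dt A'.dt by (simp add: rho_def less_imp_le)

lemma C20: "0 <= C2" unfolding C2_def using A.C10 A.M0 A.K0 A.k0 A.L0 A.Ctau0 by simp

lemma weighted_integrable:
 assumes [measurable]: "f \<in> borel_measurable m01" and f: "!!x. x \<in> B ==> \<bar>f x\<bar> <= C"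
 shows "integrable m01 (%x. f x / k x)"
proof (rule integrable_m01_bounded)
 show "(%x. f x / k x) \<in> borel_measurable m01" using A.k_measurable by measurable
 show "\<bar>f x / k x\<bar> <= C / k0" if "x \<in> B" for x
  using f[OF that] A.k_bounds[of x] A.k0 that by (auto simp: abs_divide intro!: frac_le)
qed

text \<open>\<open>E\<close> is quadratic in time on a common cell, so its increment is exactly its derivative at the midpoint
 \<open>tm\<close> times the length. The derivative is \<open>- \<integral> (G(u) - G(u')) (st - st')\<close> up to the errors of
 \<open>weak_flux_identity\<close>; replacing \<open>st\<close> by the later time level \<open>u\<close> costs \<open>O(sqrt dt)\<close>, and the remaining term
 has a sign because \<open>G\<close> is nondecreasing.\<close>

lemma E_cell:
 assumes t: "real n * dt <= t1" "real m * dt' <= t1" "t1 <= t2" "t2 <= (real n + 1) * dt" "t2 <= (real m + 1) * dt'"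
 shows "E t2 - E t1 <= (t2 - t1) * (C2 * rho)"
proof -
 have t0: "0 <= t1" by (rule order_trans[OF _ t(1)]) (use A.dt in simp)
 define tm where "tm = (t1 + t2) / 2"
 have tm: "real n * dt <= tm" "tm <= (real n + 1) * dt" "real m * dt' <= tm" "tm <= (real m + 1) * dt'" "0 <= tm"
  using t t0 by (auto simp: tm_def)
 define w where "w = (%x. A.st tm x - A'.st tm x)"
 define Wh where "Wh = (%x. A.Ut tm x - A'.Ut tm x)"
 define DA where "DA = (%x. (A.U (Suc n) (idx (dx N) x) - A.U n (idx (dx N) x)) / dt)"
 define DB where "DB = (%x. (A'.U (Suc m) (idx (dx N') x) - A'.U m (idx (dx N') x)) / dt')"
 have wm[measurable]: "w \<in> borel_measurable m01" unfolding w_def using A.st_measurable A'.st_measurable by measurable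
 have wb: "\<bar>w x\<bar> <= 2 * M" if "x \<in> B" for x
  using A.st_bound[OF tm(5) that] A'.st_bound[OF tm(5) that] by (auto simp: w_def)
 have ist: "integrable m01 (A.st tm)" "integrable m01 (A'.st tm)"
  by (auto intro!: integrable_m01_bounded[of _ M] A.st_bound A'.st_bound tm(5))
 have w1: "prim w 1 = 0" unfolding prim_1 w_def using ist A.st_integral A'.st_integral by simp
 have Whm[measurable]: "Wh \<in> borel_measurable m01" unfolding Wh_def using A.Ut_measurable A'.Ut_measurable by measurable
 have pw: "prim w x = prim (A.st tm) x - prim (A'.st tm) x" for x
 proof -
  have "integrable m01 (%y. indicator {..<x} y * A.st tm y)" "integrable m01 (%y. indicator {..<x} y * A'.st tm y)"
   using ist by (auto intro: dominated_integrable simp: indicator_def)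
  then show ?thesis by (simp add: prim_def w_def right_diff_distrib)
 qed
 have WhW: "\<bar>Wh x - prim w x\<bar> <= M * (dx N + dx N')" if "x \<in> B" for x
  using A.Ut_prim[OF tm(5) that] A'.Ut_prim[OF tm(5) that] unfolding pw Wh_def by (simp add: algebra_simps)
 have Whb: "\<bar>Wh x\<bar> <= 2 * M" if "x \<in> B" for x
  using A.Ut_bound[OF tm(5) that] A'.Ut_bound[OF tm(5) that] by (auto simp: Wh_def)
 have DAm[measurable]: "DA \<in> borel_measurable m01"
  unfolding DA_def by (rule measurable_m01, rule step_measurable[of "%i. (A.U (Suc n) i - A.U n i) / dt" "dx N"])
 have DBm[measurable]: "DB \<in> borel_measurable m01"
  unfolding DB_def by (rule measurable_m01, rule step_measurable[of "%i. (A'.U (Suc m) i - A'.U m i) / dt'" "dx N'"])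
 have DAb: "\<bar>DA x\<bar> <= 2 * M / dt" if "x \<in> B" for x
 proof -
  have "idx (dx N) x <= Suc N" using idx_le_N[OF that, of N] by simp
  then have "\<bar>A.U (Suc n) (idx (dx N) x) - A.U n (idx (dx N) x)\<bar> <= 2 * M"
   using A.U_bound[of "idx (dx N) x" n] A.U_bound[of "idx (dx N) x" "Suc n"] by linarith
  then show ?thesis unfolding DA_def abs_divide using A.dt by (simp add: divide_right_mono)
 qed
 have DBb: "\<bar>DB x\<bar> <= 2 * M / dt'" if "x \<in> B" for x
 proof -
  have "idx (dx N') x <= Suc N'" using idx_le_N[OF that, of N'] by simp
  then have "\<bar>A'.U (Suc m) (idx (dx N') x) - A'.U m (idx (dx N') x)\<bar> <= 2 * M"
   using A'.U_bound[of "idx (dx N') x" m] A'.U_bound[of "idx (dx N') x" "Suc m"] by linarith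
  then show ?thesis unfolding DB_def abs_divide using A'.dt by (simp add: divide_right_mono)
 qed
 \<comment> \<open>both interpolants are affine in time on the common cell\<close>
 have alg: "(A.Ut t2 x - A'.Ut t2 x)^2 - (A.Ut t1 x - A'.Ut t1 x)^2 = (t2 - t1) * (2 * ((DA x - DB x) * Wh x))" for x
 proof -
  have tA: "A.Ut t x = A.U n (idx (dx N) x) + (t - real n * dt) * DA x" if "real n * dt <= t" "t <= (real n + 1) * dt" for t
   unfolding A.Ut_cell[OF that] DA_def using A.dt by (simp add: field_simps)
  have tB: "A'.Ut t x = A'.U m (idx (dx N') x) + (t - real m * dt') * DB x" if "real m * dt' <= t" "t <= (real m + 1) * dt'" for t
   unfolding A'.Ut_cell[OF that] DB_def using A'.dt by (simp add: field_simps)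
  have "A.Ut t2 x - A'.Ut t2 x - (A.Ut t1 x - A'.Ut t1 x) = (t2 - t1) * (DA x - DB x)"
   using tA[of t1] tA[of t2] tB[of t1] tB[of t2] t by (simp add: algebra_simps)
  moreover have "A.Ut t2 x - A'.Ut t2 x + (A.Ut t1 x - A'.Ut t1 x) = 2 * Wh x"
  proof -
   have "A.Ut t1 x = A.U n (idx (dx N) x) + (t1 - real n * dt) * DA x" "A.Ut t2 x = A.U n (idx (dx N) x) + (t2 - real n * dt) * DA x"
    "A.Ut tm x = A.U n (idx (dx N) x) + (tm - real n * dt) * DA x"
    "A'.Ut t1 x = A'.U m (idx (dx N') x) + (t1 - real m * dt') * DB x" "A'.Ut t2 x = A'.U m (idx (dx N') x) + (t2 - real m * dt') * DB x"
    "A'.Ut tm x = A'.U m (idx (dx N') x) + (tm - real m * dt') * DB x"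
    using tA[of t1] tA[of t2] tA[of tm] tB[of t1] tB[of t2] tB[of tm] t tm by simp_all
   note eqs = this
   show ?thesis unfolding Wh_def eqs by (simp add: tm_def field_simps)
  qed
  moreover have "p^2 - q^2 = (p - q) * (p + q)" for p q :: real by (simp add: power2_eq_square algebra_simps)
  ultimately show ?thesis by simp
 qed
 have Ei: "integrable m01 (%x. (A.Ut t x - A'.Ut t x)^2 / (2 * k x))" if "0 <= t" for t
 proof -
  have "integrable m01 (%x. ((A.Ut t x - A'.Ut t x)^2 / 2) / k x)"
  proof (rule weighted_integrable)
   show "(%x. (A.Ut t x - A'.Ut t x)^2 / 2) \<in> borel_measurable m01" using A.Ut_measurable A'.Ut_measurable by measurable
   show "\<bar>(A.Ut t x - A'.Ut t x)^2 / 2\<bar> <= (2 * M)^2 / 2" if x: "x \<in> B" for x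
   proof -
    have "\<bar>A.Ut t x - A'.Ut t x\<bar> <= \<bar>2 * M\<bar>" using A.Ut_bound[OF \<open>0 <= t\<close> x] A'.Ut_bound[OF \<open>0 <= t\<close> x] by auto
    then show ?thesis by (simp add: abs_le_square_iff)
   qed
  qed
  then show ?thesis by simp
 qed
 have iA: "integrable m01 (%x. DA x * (Wh x / k x))"
 proof -
  have "integrable m01 (%x. (DA x * Wh x) / k x)"
  proof (rule weighted_integrable[of _ "(2 * M / dt) * (2 * M)"])
   show "\<bar>DA x * Wh x\<bar> <= (2 * M / dt) * (2 * M)" if "x \<in> B" for x
    unfolding abs_mult using DAb[OF that] Whb[OF that] by (intro mult_mono) auto
  qed measurable
  then show ?thesis by simp
 qed
 have iB: "integrable m01 (%x. DB x * (Wh x / k x))"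
 proof -
  have "integrable m01 (%x. (DB x * Wh x) / k x)"
  proof (rule weighted_integrable[of _ "(2 * M / dt') * (2 * M)"])
   show "\<bar>DB x * Wh x\<bar> <= (2 * M / dt') * (2 * M)" if "x \<in> B" for x
    unfolding abs_mult using DBb[OF that] Whb[OF that] by (intro mult_mono) auto
  qed measurable
  then show ?thesis by simp
 qed
 have "E t2 - E t1 = (\<integral>x. (A.Ut t2 x - A'.Ut t2 x)^2 / (2 * k x) - (A.Ut t1 x - A'.Ut t1 x)^2 / (2 * k x) \<partial>m01)"
  unfolding E_def using Ei[of t1] Ei[of t2] t0 t(3) by simp
 also have "... = (\<integral>x. (t2 - t1) * (DA x * (Wh x / k x) - DB x * (Wh x / k x)) \<partial>m01)"
 proof (rule lint_cong[OF refl])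
  fix x
  show "(A.Ut t2 x - A'.Ut t2 x)^2 / (2 * k x) - (A.Ut t1 x - A'.Ut t1 x)^2 / (2 * k x) = (t2 - t1) * (DA x * (Wh x / k x) - DB x * (Wh x / k x))"
   unfolding diff_divide_distrib[symmetric] alg by (cases "k x = 0") (simp_all add: field_simps)
 qed
 also have "... = (t2 - t1) * ((\<integral>x. DA x * (Wh x / k x) \<partial>m01) - (\<integral>x. DB x * (Wh x / k x) \<partial>m01))"
  using iA iB by simp
 also have "... <= (t2 - t1) * (C2 * rho)"
 proof (rule mult_left_mono)
  define err where "err = A.C1 * (3 * M / k0 + 2 * M * K / k0^2) * (dx N + dx N')"
  define gA where "gA = (\<integral>x. G (A.s (Suc n) x) * w x \<partial>m01)"
  define gB where "gB = (\<integral>x. G (A'.s (Suc m) x) * w x \<partial>m01)"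
  have le1: "A.C1 * ((M * (dx N + dx N') + 2 * M * h) / k0 + 2 * M * K * h / k0^2) <= err" if "h = dx N \<or> h = dx N'" for h
  proof -
   have h: "h <= dx N + dx N'" using that dx_pos[of N] dx_pos[of N'] by auto
   have "(M * (dx N + dx N') + 2 * M * h) / k0 + 2 * M * K * h / k0^2
    <= (M * (dx N + dx N') + 2 * M * (dx N + dx N')) / k0 + 2 * M * K * (dx N + dx N') / k0^2"
    using h A.M0 A.K0 A.k0 by (intro add_mono divide_right_mono mult_left_mono) auto
   also have "... = (3 * M / k0 + 2 * M * K / k0^2) * (dx N + dx N')"
    by (simp add: algebra_simps add_divide_distrib)
   finally show ?thesis unfolding err_def mult.assoc using A.C10 by (rule mult_left_mono)
  qed
  have 1: "\<bar>(\<integral>x. DA x * (Wh x / k x) \<partial>m01) + gA\<bar> <= err"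
   using A.weak_flux_identity[OF wm wb w1 Whm WhW, of n] le1[of "dx N"] by (simp add: DA_def gA_def)
  have 2: "\<bar>(\<integral>x. DB x * (Wh x / k x) \<partial>m01) + gB\<bar> <= err"
   using A'.weak_flux_identity[OF wm wb w1 Whm WhW, of m] le1[of "dx N'"] by (simp add: DB_def gB_def)
  have Gc: "continuous_on UNIV G" using A.lip lipschitz_on_continuous_on by blast
  have Gm[measurable]: "G \<in> borel_measurable borel" by (rule borel_measurable_continuous_onI[OF Gc])
  have GA[measurable]: "(%x. G (A.s (Suc n) x)) \<in> borel_measurable m01" "(%x. G (A'.s (Suc m) x)) \<in> borel_measurable m01"
   by (auto intro!: measurable_compose[OF A.s_measurable' Gm] measurable_compose[OF A'.s_measurable' Gm])
  have Gb: "\<bar>G y\<bar> <= \<bar>G 0\<bar> + L * M" if "\<bar>y\<bar> <= M" for y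
  proof -
   have "\<bar>G y - G 0\<bar> <= L * \<bar>y - 0\<bar>" by (rule A.G_lip)
   also have "... <= L * M" using that A.L0 by (intro mult_left_mono) auto
   finally show ?thesis by linarith
  qed
  have iG: "integrable m01 (%x. G (A.s (Suc n) x) * w x)" "integrable m01 (%x. G (A'.s (Suc m) x) * w x)"
  proof -
   have b: "\<bar>G y * w x\<bar> <= (\<bar>G 0\<bar> + L * M) * (2 * M)" if "x \<in> B" "\<bar>y\<bar> <= M" for x y
    unfolding abs_mult using Gb[OF that(2)] wb[OF that(1)] by (intro mult_mono) auto
   show "integrable m01 (%x. G (A.s (Suc n) x) * w x)"
    by (rule integrable_m01_bounded[OF borel_measurable_times[OF GA(1) wm]], rule b) (auto intro: A.s_bound)
   show "integrable m01 (%x. G (A'.s (Suc m) x) * w x)"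
    by (rule integrable_m01_bounded[OF borel_measurable_times[OF GA(2) wm]], rule b) (auto intro: A'.s_bound)
  qed
  have isA: "integrable m01 (%x. \<bar>A.s (Suc n) x - A.st tm x\<bar>)" "integrable m01 (%x. \<bar>A'.s (Suc m) x - A'.st tm x\<bar>)"
   using ist by auto
  have "gB - gA = (\<integral>x. (G (A'.s (Suc m) x) - G (A.s (Suc n) x)) * w x \<partial>m01)"
   unfolding gA_def gB_def using iG by (simp add: left_diff_distrib)
  also have "... <= (\<integral>x. 2 * L * M * (\<bar>A.s (Suc n) x - A.st tm x\<bar> + \<bar>A'.s (Suc m) x - A'.st tm x\<bar>) \<partial>m01)"
  proof (rule integral_mono)
   show "integrable m01 (%x. (G (A'.s (Suc m) x) - G (A.s (Suc n) x)) * w x)" using iG by (simp add: left_diff_distrib)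
   show "integrable m01 (%x. 2 * L * M * (\<bar>A.s (Suc n) x - A.st tm x\<bar> + \<bar>A'.s (Suc m) x - A'.st tm x\<bar>))" using isA by simp
   fix x assume "x \<in> space m01"
   then have x: "x \<in> B" by simp
   define p q p' q' where "p = A.s (Suc n) x" and "q = A'.s (Suc m) x" and "p' = A.st tm x" and "q' = A'.st tm x"
   have mon: "(G q - G p) * (p - q) <= 0"
    using monoD[OF A.mono, of p q] monoD[OF A.mono, of q p] by (cases "p <= q") (auto simp: mult_nonneg_nonpos mult_nonpos_nonneg)
   have "\<bar>G q - G p\<bar> <= L * \<bar>q - p\<bar>" by (rule A.G_lip)
   also have "... <= L * (2 * M)" using A.L0 A.s_bound[OF x, of "Suc n"] A'.s_bound[OF x, of "Suc m"] by (intro mult_left_mono) (auto simp: p_def q_def)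
   finally have Gd: "\<bar>G q - G p\<bar> <= 2 * L * M" by simp
   have "(G q - G p) * (p' - q') = (G q - G p) * (p - q) + (G q - G p) * ((p' - p) - (q' - q))" by (simp add: algebra_simps)
   also have "... <= \<bar>(G q - G p) * ((p' - p) - (q' - q))\<bar>" using mon by linarith
   also have "... <= 2 * L * M * (\<bar>p - p'\<bar> + \<bar>q - q'\<bar>)"
    unfolding abs_mult using Gd A.L0 A.M0 by (intro mult_mono) auto
   finally show "(G (A'.s (Suc m) x) - G (A.s (Suc n) x)) * w x <= 2 * L * M * (\<bar>A.s (Suc n) x - A.st tm x\<bar> + \<bar>A'.s (Suc m) x - A'.st tm x\<bar>)"
    by (simp add: p_def q_def p'_def q'_def w_def)
  qed
  also have "... = 2 * L * M * ((\<integral>x. \<bar>A.s (Suc n) x - A.st tm x\<bar> \<partial>m01) + (\<integral>x. \<bar>A'.s (Suc m) x - A'.st tm x\<bar> \<partial>m01))"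
   using isA by simp
  also have "... <= 2 * L * M * (A.Ctau * sqrt dt + A.Ctau * sqrt dt')"
   using A.L1_st(2)[OF tm(1,2)] A'.L1_st(2)[OF tm(3,4)] A.L0 A.M0 by (intro mult_left_mono add_mono) auto
  finally have 3: "gB - gA <= 2 * L * M * A.Ctau * (sqrt dt + sqrt dt')" by (simp add: algebra_simps)
  have "(\<integral>x. DA x * (Wh x / k x) \<partial>m01) - (\<integral>x. DB x * (Wh x / k x) \<partial>m01) <= 2 * err + 2 * L * M * A.Ctau * (sqrt dt + sqrt dt')"
   using 1 2 3 by linarith
  also have "... <= C2 * rho"
  proof -
   define X where "X = A.C1 * (3 * M / k0 + 2 * M * K / k0^2)"
   define Y where "Y = 2 * L * M * A.Ctau"
   define q where "q = sqrt dt + sqrt dt'"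
   define d where "d = dx N + dx N'"
   have nn: "0 <= X" "0 <= Y" "0 <= q" "0 <= d" using A.C10 A.M0 A.K0 A.k0 A.L0 A.Ctau0 A.dt A'.dt by (auto simp: X_def Y_def q_def d_def less_imp_le)
   have "2 * (X * d) + Y * q <= (2 * X + Y) * (q + d)" using nn by (simp add: algebra_simps)
   then show ?thesis by (simp add: err_def C2_def rho_def X_def Y_def q_def d_def mult.assoc)
  qed
  finally show "(\<integral>x. DA x * (Wh x / k x) \<partial>m01) - (\<integral>x. DB x * (Wh x / k x) \<partial>m01) <= C2 * rho" .
 qed (use t in simp)
 finally show ?thesis .
qed

lemma E_growth:
 assumes t: "0 <= t"
 shows "E t - E 0 <= t * (C2 * rho)"
proof -
 define P where "P = (%r t. E t - E r <= (t - r) * (C2 * rho))"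
 have tr: "P r v" if "P r t" "P t v" for r t v
  using that unfolding P_def by (simp add: algebra_simps)
 have inner: "P r t" if n: "real n * dt <= r" "t <= (real n + 1) * dt" and rt: "r <= t" and r0: "0 <= r" for n r t
 proof (rule interval_chain[where d=dt' and P=P and Q="%t. real n * dt <= t \<and> t <= (real n + 1) * dt"])
  show "P r t" if "real m * dt' <= r" "r <= t" "t <= (real m + 1) * dt'" "real n * dt <= r \<and> r <= (real n + 1) * dt"
    "real n * dt <= t \<and> t <= (real n + 1) * dt" for m r t
   unfolding P_def by (rule E_cell[of n _ m]) (use that in auto)
 qed (use A'.dt n rt r0 tr in auto)
 have "P 0 t"
 proof (rule interval_chain[where d=dt and P=P and Q="%t. 0 <= t"])
  show "P r t" if "real n * dt <= r" "r <= t" "t <= (real n + 1) * dt" "0 <= r" "0 <= t" for n r t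
   by (rule inner[of n]) (use that in auto)
 qed (use A.dt t tr in auto)
 then show ?thesis by (simp add: P_def)
qed

lemma E_0: "E 0 <= M^2 / k0 * rho"
proof -
 have h2: "dx N + dx N' <= 2" using dx_le_1[of N] dx_le_1[of N'] by simp
 have th0: "A.th 0 = 0" "A'.th 0 = 0" "idx dt 0 = 0" "idx dt' 0 = 0" by (auto simp: A.th_def A'.th_def idx_def)
 have pt: "(A.Ut 0 x - A'.Ut 0 x)^2 / (2 * k x) <= M^2 / k0 * (dx N + dx N')" if x: "x \<in> B" for x
 proof -
  have i: "idx (dx N) x <= Suc N" "idx (dx N') x <= Suc N'" using idx_le_N[OF x, of N] idx_le_N[OF x, of N'] by auto
  have e: "A.Ut 0 x - A'.Ut 0 x = I (real (idx (dx N) x) * dx N) - I (real (idx (dx N') x) * dx N')"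
   by (simp add: A.Ut_def A'.Ut_def th0 A.U_0[OF i(1)] A'.U_0[OF i(2)])
  have "\<bar>A.Ut 0 x - A'.Ut 0 x\<bar> <= M * \<bar>real (idx (dx N) x) * dx N - real (idx (dx N') x) * dx N'\<bar>"
   unfolding e by (rule A.I_lip)
  also have "... <= M * (dx N + dx N')"
   using idx_bounds[OF dx_pos, of x N] idx_bounds[OF dx_pos, of x N'] x A.M0 dx_pos[of N] dx_pos[of N'] by (intro mult_left_mono) (auto simp: algebra_simps)
  finally have "(A.Ut 0 x - A'.Ut 0 x)^2 <= (M * (dx N + dx N'))^2" by (metis abs_ge_zero power2_abs power_mono)
  also have "... = M^2 * ((dx N + dx N') * (dx N + dx N'))" by (simp add: power2_eq_square)
  also have "... <= M^2 * (2 * (dx N + dx N'))" using h2 dx_pos[of N] dx_pos[of N'] by (intro mult_left_mono mult_right_mono) auto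
  finally have "(A.Ut 0 x - A'.Ut 0 x)^2 / (2 * k x) <= M^2 * (2 * (dx N + dx N')) / (2 * k0)"
   using A.k0 A.k_bounds[of x] x dx_pos[of N] dx_pos[of N'] by (intro frac_le) (auto intro: less_imp_le)
  also have "... = M^2 / k0 * (dx N + dx N')" using A.k0 by (simp add: field_simps)
  finally show ?thesis .
 qed
 have "E 0 <= (\<integral>x. M^2 / k0 * (dx N + dx N') \<partial>m01)"
  unfolding E_def by (rule integral_mono') (use pt dx_pos[of N] dx_pos[of N'] A.k0 in \<open>auto intro: less_imp_le\<close>)
 also have "... <= M^2 / k0 * rho" unfolding integral_m01_const
  using A.k0 A.dt A'.dt by (intro mult_left_mono) (auto simp: rho_def)
 finally show ?thesis .
qed

text \<open>A bound on \<open>E\<close> bounds the primitives in \<open>L^2\<close>, hence in \<open>L\<^sup>1\<close>; interpolation bounds the functions.\<close>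

theorem L1_distance:
 assumes t: "0 <= t" "t <= T"
 shows "(\<integral>x. \<bar>A.s (idx dt t) x - A'.s (idx dt' t) x\<bar> \<partial>m01)
   <= (2 * V + 2 * M + 2) * sqrt (sqrt (2 * k1 * (M^2 / k0 + T * C2) * rho) + M * rho) + A.Ctau * rho"
proof -
 define w where "w = (%x. A.st t x - A'.st t x)"
 define Wh where "Wh = (%x. A.Ut t x - A'.Ut t x)"
 have ist: "integrable m01 (A.st t)" "integrable m01 (A'.st t)"
  by (auto intro!: integrable_m01_bounded[of _ M] A.st_bound A'.st_bound t)
 have wm[measurable]: "w \<in> borel_measurable m01" unfolding w_def using A.st_measurable A'.st_measurable by measurable
 have wb: "\<bar>w x\<bar> <= 2 * M" if "x \<in> B" for x
  using A.st_bound[OF t(1) that] A'.st_bound[OF t(1) that] by (auto simp: w_def)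
 have Whm[measurable]: "Wh \<in> borel_measurable m01" unfolding Wh_def using A.Ut_measurable A'.Ut_measurable by measurable
 have Whb: "\<bar>Wh x\<bar> <= 2 * M" if "x \<in> B" for x
  using A.Ut_bound[OF t(1) that] A'.Ut_bound[OF t(1) that] by (auto simp: Wh_def)
 have pw: "prim w x = prim (A.st t) x - prim (A'.st t) x" for x
 proof -
  have "integrable m01 (%y. indicator {..<x} y * A.st t y)" "integrable m01 (%y. indicator {..<x} y * A'.st t y)"
   using ist by (auto intro: dominated_integrable simp: indicator_def)
  then show ?thesis by (simp add: prim_def w_def right_diff_distrib)
 qed
 have WhW: "\<bar>prim w x\<bar> <= \<bar>Wh x\<bar> + M * (dx N + dx N')" if "x \<in> B" for x
  using A.Ut_prim[OF t(1) that] A'.Ut_prim[OF t(1) that] unfolding pw Wh_def by (simp add: algebra_simps)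
 have "E t <= M^2 / k0 * rho + t * (C2 * rho)" using E_growth[OF t(1)] E_0 by linarith
 also have "t * (C2 * rho) <= T * (C2 * rho)" using t C20 rho0 by (intro mult_right_mono) auto
 finally have Et: "E t <= (M^2 / k0 + T * C2) * rho" by (simp add: algebra_simps)
 have iW2: "integrable m01 (%x. (Wh x)^2)"
 proof (rule integrable_m01_bounded)
  show "\<bar>(Wh x)^2\<bar> <= (2 * M)^2" if "x \<in> B" for x
   using power_mono[OF Whb[OF that] abs_ge_zero, of 2] by simp
 qed measurable
 have iE: "integrable m01 (%x. ((Wh x)^2 / 2) / k x)"
 proof (rule weighted_integrable)
  show "\<bar>(Wh x)^2 / 2\<bar> <= (2 * M)^2 / 2" if "x \<in> B" for x
   using power_mono[OF Whb[OF that] abs_ge_zero, of 2] by simp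
 qed measurable
 have W2: "(\<integral>x. (Wh x)^2 \<partial>m01) <= 2 * k1 * E t"
 proof -
  have "(\<integral>x. (Wh x)^2 \<partial>m01) <= (\<integral>x. 2 * k1 * (((Wh x)^2 / 2) / k x) \<partial>m01)"
  proof (rule integral_mono[OF iW2])
   show "integrable m01 (%x. 2 * k1 * (((Wh x)^2 / 2) / k x))" using iE by (rule integrable_mult_right)
   fix x assume "x \<in> space m01"
   then have kx: "k0 <= k x" "k x <= k1" using A.k_bounds[of x] by auto
   have "(Wh x)^2 * 1 <= (Wh x)^2 * (k1 / k x)" using kx A.k0 by (intro mult_left_mono) auto
   then show "(Wh x)^2 <= 2 * k1 * (((Wh x)^2 / 2) / k x)" by (simp add: mult.commute)
  qed
  also have "... = 2 * k1 * E t" unfolding integral_mult_right_zero E_def Wh_def by (simp add: mult.commute)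
  finally show ?thesis .
 qed
 have W1: "(\<integral>x. \<bar>Wh x\<bar> \<partial>m01) <= sqrt (2 * k1 * (M^2 / k0 + T * C2) * rho)"
 proof -
  have "\<bar>\<integral>x. \<bar>Wh x\<bar> * 1 \<partial>m01\<bar> <= sqrt (\<integral>x. \<bar>Wh x\<bar>^2 \<partial>m01) * sqrt (\<integral>x. 1^2 \<partial>m01)"
   by (rule abs_integral_mult_le) (use iW2 in auto)
  then have "(\<integral>x. \<bar>Wh x\<bar> \<partial>m01) <= sqrt (\<integral>x. (Wh x)^2 \<partial>m01)" by simp
  also have "... <= sqrt (2 * k1 * ((M^2 / k0 + T * C2) * rho))"
   using W2 Et A.k1 by (intro real_sqrt_le_mono) (meson mult_left_mono order_trans less_imp_le mult_pos_pos zero_less_numeral)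
  finally show ?thesis by (simp add: mult.assoc)
 qed
 have "(\<integral>x. \<bar>prim w x\<bar> \<partial>m01) <= (\<integral>x. \<bar>Wh x\<bar> + M * (dx N + dx N') \<partial>m01)"
 proof (rule integral_mono)
  have [measurable]: "prim w \<in> borel_measurable borel" by (rule prim_measurable[OF wm wb])
  show "integrable m01 (%x. \<bar>prim w x\<bar>)"
   by (rule integrable_m01_bounded[of _ "2 * M"]) (use prim_bound[OF wm wb] in auto)
  show "integrable m01 (%x. \<bar>Wh x\<bar> + M * (dx N + dx N'))"
   by (intro Bochner_Integration.integrable_add integrable_m01_bounded[of "%x. \<bar>Wh x\<bar>" "2 * M"]) (use Whb in auto)
 qed (use WhW in auto)
 also have "... = (\<integral>x. \<bar>Wh x\<bar> \<partial>m01) + M * (dx N + dx N')"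
  by (subst Bochner_Integration.integral_add) (use Whb in \<open>auto intro!: integrable_m01_bounded[of "%x. \<bar>Wh x\<bar>" "2 * M"]\<close>)
 also have "... <= sqrt (2 * k1 * (M^2 / k0 + T * C2) * rho) + M * rho"
  using W1 A.M0 A.dt A'.dt by (intro add_mono mult_left_mono) (auto simp: rho_def)
 finally have prw: "(\<integral>x. \<bar>prim w x\<bar> \<partial>m01) <= sqrt (2 * k1 * (M^2 / k0 + T * C2) * rho) + M * rho" .
 have osc: "osc_bound w (2 * V)"
  using osc_bound_add[OF A.st_osc[OF t(1)] osc_bound_scale[OF A'.st_osc[OF t(1)], of "-1"]] by (simp add: w_def)
 have main: "(\<integral>x. \<bar>w x\<bar> \<partial>m01) <= (2 * V + 2 * M + 2) * sqrt (sqrt (2 * k1 * (M^2 / k0 + T * C2) * rho) + M * rho)"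
  using L1_interpolation[OF wm wb osc _ prw] A.V0 by simp
 have c1: "(\<integral>x. \<bar>A.s (idx dt t) x - A.st t x\<bar> \<partial>m01) <= A.Ctau * sqrt dt"
  using A.L1_st(1)[of "idx dt t" t] idx_bounds[OF A.dt t(1)] by simp
 have c2: "(\<integral>x. \<bar>A'.s (idx dt' t) x - A'.st t x\<bar> \<partial>m01) <= A.Ctau * sqrt dt'"
  using A'.L1_st(1)[of "idx dt' t" t] idx_bounds[OF A'.dt t(1)] by simp
 have ii: "integrable m01 (%x. \<bar>A.s (idx dt t) x - A.st t x\<bar>)" "integrable m01 (%x. \<bar>A'.s (idx dt' t) x - A'.st t x\<bar>)" "integrable m01 (%x. \<bar>w x\<bar>)"
  using ist by (auto simp: w_def)
 have "(\<integral>x. \<bar>A.s (idx dt t) x - A'.s (idx dt' t) x\<bar> \<partial>m01)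
   <= (\<integral>x. \<bar>w x\<bar> + (\<bar>A.s (idx dt t) x - A.st t x\<bar> + \<bar>A'.s (idx dt' t) x - A'.st t x\<bar>) \<partial>m01)"
  by (rule integral_mono) (use ii in \<open>auto simp: w_def\<close>)
 also have "... = (\<integral>x. \<bar>w x\<bar> \<partial>m01) + ((\<integral>x. \<bar>A.s (idx dt t) x - A.st t x\<bar> \<partial>m01) + (\<integral>x. \<bar>A'.s (idx dt' t) x - A'.st t x\<bar> \<partial>m01))"
  using ii by simp
 also have "... <= (\<integral>x. \<bar>w x\<bar> \<partial>m01) + A.Ctau * (sqrt dt + sqrt dt')"
  using c1 c2 by (simp add: distrib_left)
 also have "... <= (\<integral>x. \<bar>w x\<bar> \<partial>m01) + A.Ctau * rho"
  using A.Ctau0 dx_pos[of N] dx_pos[of N'] by (intro add_left_mono mult_left_mono) (auto simp: rho_def)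
 finally show ?thesis using main by linarith
qed

end

section \<open>Initial data\<close>

text \<open>An antiderivative of the positive part, from which hat functions with explicit primitives are built.\<close>

definition pos_sq :: "real => real" where "pos_sq y = (max 0 y)^2 / 2"
definition hat :: "real => real" where "hat y = max 0 (y + 1) - 2 * max 0 y + max 0 (y - 1)"
definition hat_int :: "real => real" where "hat_int y = pos_sq (y + 1) - 2 * pos_sq y + pos_sq (y - 1)"

lemma pos_sq_deriv: "(pos_sq has_real_derivative max 0 y) (at y)"
proof -
 consider "y < 0" | "y = 0" | "0 < y" by linarith
 then show ?thesis
 proof cases
  case 1
  have "((%_. 0) has_real_derivative max 0 y) (at y)" using 1 by simp
  moreover have "eventually (%x. pos_sq x = 0) (nhds y)"
   using eventually_nhds_in_open[of "{..<0}" y] 1 by (auto elim!: eventually_mono simp: pos_sq_def)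
  ultimately show ?thesis by (subst DERIV_cong_ev[OF refl _ refl]) auto
 next
  case 3
  have "((%x. x^2 / 2) has_real_derivative max 0 y) (at y)" using 3 by (auto intro!: derivative_eq_intros)
  moreover have "eventually (%x. pos_sq x = x^2 / 2) (nhds y)"
   using eventually_nhds_in_open[of "{0<..}" y] 3 by (auto elim!: eventually_mono simp: pos_sq_def)
  ultimately show ?thesis by (subst DERIV_cong_ev[OF refl _ refl]) auto
 next
  case 2
  have "((%h. (pos_sq (0 + h) - pos_sq 0) / h) \<longlongrightarrow> 0) (at 0)"
  proof (rule Lim_null_comparison)
   show "eventually (%h. norm ((pos_sq (0 + h) - pos_sq 0) / h) <= \<bar>h\<bar>) (at 0)"
    by (rule always_eventually) (auto simp: pos_sq_def max_def power2_eq_square abs_mult)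
   show "((%h::real. \<bar>h\<bar>) \<longlongrightarrow> 0) (at 0)" by (auto intro!: tendsto_eq_intros)
  qed
  then show ?thesis using 2 by (simp add: DERIV_def)
 qed
qed

lemma hat_int_deriv: "(hat_int has_real_derivative hat y) (at y)"
 unfolding hat_int_def hat_def
 by (auto intro!: derivative_eq_intros DERIV_chain2[OF pos_sq_deriv])

lemma hat_lip: "\<bar>hat x - hat y\<bar> <= 4 * \<bar>x - y\<bar>"
proof -
 have m: "\<bar>max 0 a - max 0 b\<bar> <= \<bar>a - b\<bar>" for a b :: real by (auto simp: max_def)
 define A A' C where "A = max 0 (x + 1) - max 0 (y + 1)" and "A' = max 0 x - max 0 y" and "C = max 0 (x - 1) - max 0 (y - 1)"
 have "\<bar>A\<bar> <= \<bar>(x + 1) - (y + 1)\<bar>" unfolding A_def by (rule m)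
 moreover have "\<bar>A'\<bar> <= \<bar>x - y\<bar>" unfolding A'_def by (rule m)
 moreover have "\<bar>C\<bar> <= \<bar>(x - 1) - (y - 1)\<bar>" unfolding C_def by (rule m)
 moreover have "hat x - hat y = A - 2 * A' + C" by (simp add: hat_def A_def A'_def C_def)
 moreover define d where "d = \<bar>x - y\<bar>"
 ultimately have "\<bar>A\<bar> <= d" "\<bar>A'\<bar> <= d" "\<bar>C\<bar> <= d" and e: "hat x - hat y = A - 2 * A' + C" by simp_all
 then have "A <= d" "- A <= d" "A' <= d" "- A' <= d" "C <= d" "- C <= d" by (simp_all only: abs_le_iff)
 then have "A - 2 * A' + C <= 4 * d" "- (A - 2 * A' + C) <= 4 * d" by linarith+
 then show ?thesis unfolding e d_def[symmetric] by (simp only: abs_le_iff)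
qed

lemma hat_zero: "1 <= \<bar>y\<bar> ==> hat y = 0" unfolding hat_def by (auto simp: max_def)

lemma hat_right: "0 <= y ==> y <= 1 ==> hat y = 1 - y" unfolding hat_def by (auto simp: max_def)
lemma hat_left: "-1 <= y ==> y <= 0 ==> hat y = 1 + y" unfolding hat_def by (auto simp: max_def)

definition pl :: "nat => (nat => real) => real => real" where
 "pl N \<sigma> x = (\<Sum>i\<le>Suc N. \<sigma> i * hat (x / dx N - real i))"

lemma pl_cell:
 assumes j: "j <= N" and x: "real j * dx N <= x" "x <= (real j + 1) * dx N"
 shows "pl N \<sigma> x = \<sigma> j + (x / dx N - real j) * (\<sigma> (Suc j) - \<sigma> j)"
proof -
 define y where "y = x / dx N"
 have y: "real j <= y" "y <= real j + 1" using x by (auto simp: y_def field_simps)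
 have "pl N \<sigma> x = (\<Sum>i\<in>{j, Suc j}. \<sigma> i * hat (y - real i))"
  unfolding pl_def y_def[symmetric]
 proof (rule sum.mono_neutral_right)
  show "\<forall>i\<in>{..Suc N} - {j, Suc j}. \<sigma> i * hat (y - real i) = 0"
  proof
   fix i assume i: "i \<in> {..Suc N} - {j, Suc j}"
   then have "i < j \<or> Suc j < i" by auto
   then have "real i + 1 <= real j \<or> real j + 2 <= real i" by linarith
   then have "1 <= \<bar>y - real i\<bar>" using y by linarith
   then show "\<sigma> i * hat (y - real i) = 0" by (simp add: hat_zero)
  qed
 qed (use j in auto)
 also have "... = \<sigma> j * (1 - (y - real j)) + \<sigma> (Suc j) * (1 + (y - real (Suc j)))"
  using y by (simp add: hat_right hat_left)
 finally show ?thesis by (simp add: y_def algebra_simps)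
qed

lemma pl_outside:
 assumes "\<sigma> 0 = 0" "\<sigma> (Suc N) = 0" "x <= 0 \<or> 1 <= x"
 shows "pl N \<sigma> x = 0"
 unfolding pl_def
proof (rule sum.neutral, rule ballI)
 fix i assume i: "i \<in> {..Suc N}"
 show "\<sigma> i * hat (x / dx N - real i) = 0"
 proof (cases "i = 0 \<or> i = Suc N")
  case True then show ?thesis using assms by auto
 next
  case False
  then have i': "1 <= real i" "real i + 1 <= real N + 1" using i by auto
  have "x / dx N <= 0 \<or> real N + 1 <= x / dx N"
  proof -
   have e: "x / dx N = x * (real N + 1)" by (simp add: dx_def)
   show ?thesis
   proof (cases "x <= 0")
    case True then show ?thesis unfolding e by (intro disjI1 mult_nonpos_nonneg) auto
   next
    case False
    then have "1 * (real N + 1) <= x * (real N + 1)" using assms(3) by (intro mult_right_mono) auto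
    then show ?thesis unfolding e by simp
   qed
  qed
  then have "1 <= \<bar>x / dx N - real i\<bar>" using i' by linarith
  then show ?thesis by (simp add: hat_zero)
 qed
qed

lemma pl_bound:
 assumes "\<sigma> 0 = 0" "\<sigma> (Suc N) = 0" "!!i. \<bar>\<sigma> i\<bar> <= 1"
 shows "\<bar>pl N \<sigma> x\<bar> <= 1"
proof (cases "x <= 0 \<or> 1 <= x")
 case True then show ?thesis using pl_outside[OF assms(1,2) True] by simp
next
 case False
 then have x: "x \<in> B" by auto
 define j where "j = idx (dx N) x"
 have j: "j <= N" unfolding j_def by (rule idx_le_N[OF x])
 have xj: "real j * dx N <= x" "x < (real j + 1) * dx N" using idx_bounds[OF dx_pos, of x N] x by (auto simp: j_def)
 define \<theta> where "\<theta> = x / dx N - real j"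
 have \<theta>: "0 <= \<theta>" "\<theta> <= 1" using xj by (auto simp: \<theta>_def field_simps)
 have "pl N \<sigma> x = (1 - \<theta>) * \<sigma> j + \<theta> * \<sigma> (Suc j)" using pl_cell[OF j, of x \<sigma>] xj by (simp add: \<theta>_def algebra_simps)
 also have "\<bar>...\<bar> <= (1 - \<theta>) * \<bar>\<sigma> j\<bar> + \<theta> * \<bar>\<sigma> (Suc j)\<bar>"
  using abs_triangle_ineq[of "(1 - \<theta>) * \<sigma> j" "\<theta> * \<sigma> (Suc j)"] \<theta> by (simp add: abs_mult)
 also have "... <= (1 - \<theta>) * 1 + \<theta> * 1" using \<theta> assms(3) by (intro add_mono mult_left_mono) auto
 finally show ?thesis by simp
qed

lemma pl_lip: assumes "!!i. \<bar>\<sigma> i\<bar> <= 1" shows "\<bar>pl N \<sigma> x - pl N \<sigma> y\<bar> <= (real N + 2) * 4 / dx N * \<bar>x - y\<bar>"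
proof -
 have "\<bar>pl N \<sigma> x - pl N \<sigma> y\<bar> <= (\<Sum>i\<le>Suc N. \<bar>\<sigma> i * hat (x / dx N - real i) - \<sigma> i * hat (y / dx N - real i)\<bar>)"
  unfolding pl_def sum_subtractf[symmetric] by (rule sum_abs)
 also have "... <= (\<Sum>i\<le>Suc N. 4 / dx N * \<bar>x - y\<bar>)"
 proof (rule sum_mono)
  fix i
  have "\<bar>\<sigma> i * hat (x / dx N - real i) - \<sigma> i * hat (y / dx N - real i)\<bar> = \<bar>\<sigma> i\<bar> * \<bar>hat (x / dx N - real i) - hat (y / dx N - real i)\<bar>"
   by (simp add: right_diff_distrib flip: abs_mult)
  also have "... <= 1 * (4 * \<bar>(x / dx N - real i) - (y / dx N - real i)\<bar>)"
   using assms hat_lip[of "x / dx N - real i" "y / dx N - real i"] by (intro mult_mono) auto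
  also have "... = 4 / dx N * \<bar>x - y\<bar>" by (simp add: abs_divide flip: diff_divide_distrib)
  finally show "\<bar>\<sigma> i * hat (x / dx N - real i) - \<sigma> i * hat (y / dx N - real i)\<bar> <= 4 / dx N * \<bar>x - y\<bar>" .
 qed
 also have "... = (real N + 2) * 4 / dx N * \<bar>x - y\<bar>" by simp
 finally show ?thesis .
qed

text \<open>Summation by parts of the averages against \<open>\<sigma>\<close> is the pairing of \<open>u0\<close> with the derivative of the
 piecewise linear function with nodal values \<open>\<sigma>\<close>. That function is neither \<open>C\<^sup>1\<close> nor compactly supported in the
 open interval, so it is contracted slightly towards the midpoint (factor \<open>1 + \<theta>\<close>) and averaged over a
 window \<open>\<epsilon>\<close>; dominated convergence recovers it. Choosing \<open>\<sigma>\<close> as the signs of the jumps bounds their sum.\<close>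

lemma BV01_average_test:
 fixes u0 ub :: "real => real" and \<sigma> :: "nat => real"
 assumes V: "!!\<phi>. (\<forall>x. \<phi> differentiable (at x)) ==> continuous_on UNIV (deriv \<phi>) ==>
       (\<exists>K. compact K \<and> K \<subseteq> B \<and> (\<forall>x. x \<notin> K --> \<phi> x = 0)) ==> (\<forall>x. \<bar>\<phi> x\<bar> <= 1)
    ==> (LINT x:{0..1}|lebesgue. u0 x * deriv \<phi> x) <= V"
  and ub: "ub \<in> borel_measurable borel" "!!x. \<bar>ub x\<bar> <= M"
  and int: "!!f. f \<in> borel_measurable borel ==> (LINT x:{0..1}|lebesgue. u0 x * f x) = (\<integral>x. ub x * f x \<partial>m01)"
  and \<sigma>: "\<sigma> 0 = 0" "\<sigma> (Suc N) = 0" "!!i. \<bar>\<sigma> i\<bar> <= 1"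
 shows "(\<Sum>i\<le>N. (\<sigma> (Suc i) - \<sigma> i) / dx N * (\<integral>x. indicator (cell N i) x * ub x \<partial>m01)) <= V"
proof -
 define \<theta> where "\<theta> = (%n::nat. 1 / real (Suc n))"
 have \<theta>: "0 < \<theta> n" "\<theta> n <= 1" for n by (auto simp: \<theta>_def)
 have \<theta>0: "\<theta> \<longlonglongrightarrow> 0" unfolding \<theta>_def using LIMSEQ_Suc[OF lim_1_over_n] by (simp add: inverse_eq_divide)
 define \<delta> where "\<delta> = (%n. \<theta> n / (2 * (1 + \<theta> n)))"
 define \<epsilon> where "\<epsilon> = (%n. \<delta> n / 2)"
 have \<delta>: "0 < \<delta> n" "\<delta> n < 1/2" for n using \<theta>[of n] by (auto simp: \<delta>_def field_simps)
 have \<epsilon>: "0 < \<epsilon> n" for n using \<delta> by (simp add: \<epsilon>_def)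
 have \<epsilon>n0 [simp]: "\<epsilon> n \<noteq> 0" for n using \<epsilon>[of n] by simp
 have \<epsilon>0: "\<epsilon> \<longlonglongrightarrow> 0"
 proof -
  have "(%n. \<theta> n / (2 * (1 + \<theta> n)) / 2) \<longlonglongrightarrow> 0 / (2 * (1 + 0)) / 2" by (intro tendsto_intros \<theta>0) auto
  then show ?thesis by (simp add: \<epsilon>_def[abs_def] \<delta>_def)
 qed
 \<comment> \<open>\<open>z\<close> maps a compact subinterval of \<open>B\<close> onto the unit interval\<close>
 define z where "z = (%n x. 1/2 + (x - 1/2) * (1 + \<theta> n))"
 define \<Psi> where "\<Psi> = (%n x. pl N \<sigma> (z n x))"
 define J where "J = (%n x. \<Sum>i\<le>Suc N. \<sigma> i * (dx N / (1 + \<theta> n) * hat_int (z n x / dx N - real i)))"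
 have J: "(J n has_real_derivative \<Psi> n x) (at x)" for n x
 proof -
  have zd: "((%x. z n x / dx N - real i) has_real_derivative (1 + \<theta> n) / dx N) (at x)" for i x
   unfolding z_def by (auto intro!: derivative_eq_intros)
  have one: "((%x. \<sigma> i * (dx N / (1 + \<theta> n) * hat_int (z n x / dx N - real i))) has_real_derivative \<sigma> i * hat (z n x / dx N - real i)) (at x)" for i
  proof -
   have "((%x. \<sigma> i * (dx N / (1 + \<theta> n) * hat_int (z n x / dx N - real i))) has_real_derivative
     \<sigma> i * (dx N / (1 + \<theta> n) * (hat (z n x / dx N - real i) * ((1 + \<theta> n) / dx N)))) (at x)"
    by (intro DERIV_cmult DERIV_chain2[OF hat_int_deriv zd])
   moreover have "1 + \<theta> n \<noteq> 0" using \<theta>[of n] by auto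
   ultimately show ?thesis by simp
  qed
  show ?thesis unfolding J_def \<Psi>_def pl_def by (rule DERIV_sum) (rule one)
 qed
 define \<phi> where "\<phi> = (%n x. (J n (x + \<epsilon> n) - J n x) / \<epsilon> n)"
 define D where "D = (%n x. (\<Psi> n (x + \<epsilon> n) - \<Psi> n x) / \<epsilon> n)"
 have \<phi>D: "(\<phi> n has_real_derivative D n x) (at x)" for n x
  unfolding \<phi>_def D_def
  by (auto intro!: derivative_eq_intros J DERIV_chain2[OF J])
 define Lp where "Lp = (real N + 2) * 4 / dx N"
 have Lp: "0 <= Lp" by (simp add: Lp_def)
 have \<Psi>lip: "\<bar>\<Psi> n x - \<Psi> n y\<bar> <= 2 * Lp * \<bar>x - y\<bar>" for n x y
 proof -
  have "\<bar>\<Psi> n x - \<Psi> n y\<bar> <= Lp * \<bar>z n x - z n y\<bar>" unfolding \<Psi>_def Lp_def by (rule pl_lip[OF \<sigma>(3)])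
  also have "\<bar>z n x - z n y\<bar> = (1 + \<theta> n) * \<bar>x - y\<bar>"
   using \<theta>[of n] by (simp add: z_def abs_mult flip: left_diff_distrib)
  also have "Lp * ... <= Lp * (2 * \<bar>x - y\<bar>)" using \<theta>[of n] Lp by (intro mult_left_mono mult_right_mono) auto
  finally show ?thesis by simp
 qed
 have \<Psi>c: "continuous_on UNIV (\<Psi> n)" for n
  by (rule lipschitz_on_continuous_on[of "2 * Lp"], rule lipschitz_onI) (use \<Psi>lip Lp in \<open>auto simp: dist_real_def\<close>)
 have Dc: "continuous_on UNIV (D n)" for n
 proof -
  have "\<epsilon> n \<noteq> 0" using \<epsilon>[of n] by simp
  then show ?thesis unfolding D_def by (intro continuous_intros continuous_on_compose2[OF \<Psi>c]) auto
 qed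
 have Db: "\<bar>D n x\<bar> <= 2 * Lp" for n x
  using \<Psi>lip[of n "x + \<epsilon> n" x] \<epsilon>[of n] by (simp add: D_def abs_divide field_simps)
 have mv: "\<exists>\<xi>. x < \<xi> \<and> \<xi> < x + \<epsilon> n \<and> \<phi> n x = \<Psi> n \<xi>" for n x
 proof -
  obtain \<xi> where "x < \<xi>" "\<xi> < x + \<epsilon> n" "J n (x + \<epsilon> n) - J n x = (x + \<epsilon> n - x) * \<Psi> n \<xi>"
   using MVT2[of x "x + \<epsilon> n" "J n" "\<Psi> n"] J \<epsilon>[of n] by auto
  then show ?thesis using \<epsilon>[of n] by (intro exI[of _ \<xi>]) (auto simp: \<phi>_def)
 qed
 have le: "(\<integral>x. ub x * D n x \<partial>m01) <= V" for n
 proof -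
  have der: "deriv (\<phi> n) = D n" using DERIV_imp_deriv[OF \<phi>D] by auto
  have "(LINT x:{0..1}|lebesgue. u0 x * deriv (\<phi> n) x) <= V"
  proof (rule V)
   show "\<forall>x. \<phi> n differentiable (at x)" using \<phi>D real_differentiable_def by blast
   show "continuous_on UNIV (deriv (\<phi> n))" using Dc der by simp
   show "\<forall>x. \<bar>\<phi> n x\<bar> <= 1"
   proof
    fix x obtain \<xi> where "\<phi> n x = \<Psi> n \<xi>" using mv by blast
    then show "\<bar>\<phi> n x\<bar> <= 1" using pl_bound[OF \<sigma>] by (simp add: \<Psi>_def)
   qed
   show "\<exists>K. compact K \<and> K \<subseteq> B \<and> (\<forall>x. x \<notin> K --> \<phi> n x = 0)"
   proof (intro exI[of _ "{\<epsilon> n..1 - \<delta> n}"] conjI allI impI)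
    show "{\<epsilon> n..1 - \<delta> n} \<subseteq> B" using \<epsilon>[of n] \<delta>[of n] by auto
    fix x assume x: "x \<notin> {\<epsilon> n..1 - \<delta> n}"
    obtain \<xi> where \<xi>: "x < \<xi>" "\<xi> < x + \<epsilon> n" "\<phi> n x = \<Psi> n \<xi>" using mv by blast
    have "\<xi> <= \<delta> n \<or> 1 - \<delta> n <= \<xi>" using x \<xi> by (auto simp: \<epsilon>_def)
    moreover have d: "\<delta> n * (1 + \<theta> n) = \<theta> n / 2" 
    proof -
     have "a / (2 * b) * b = a / 2" if "b \<noteq> 0" for a b :: real using that by simp
     then show ?thesis using \<theta>[of n] unfolding \<delta>_def by (metis add_pos_pos less_numeral_extra(1) less_numeral_extra(3))
    qed
    moreover have z1: "z n (\<delta> n) = 0" "z n (1 - \<delta> n) = 1"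
     using d by (simp_all add: z_def left_diff_distrib distrib_left)
    moreover have "z n x <= z n y" if "x <= y" for x y using that \<theta>[of n] by (auto simp: z_def intro!: mult_right_mono)
    ultimately have "z n \<xi> <= 0 \<or> 1 <= z n \<xi>" by metis
    then show "\<phi> n x = 0" unfolding \<xi>(3) \<Psi>_def by (rule pl_outside[OF \<sigma>(1,2)])
   qed simp
  qed
  also have "(LINT x:{0..1}|lebesgue. u0 x * deriv (\<phi> n) x) = (\<integral>x. ub x * D n x \<partial>m01)"
   unfolding der by (rule int) (rule borel_measurable_continuous_onI[OF Dc])
  finally show ?thesis .
 qed
 define sl where "sl = (%j. (\<sigma> (Suc j) - \<sigma> j) / dx N)"
 have Dlim: "(%n. D n x) \<longlonglongrightarrow> sl (idx (dx N) x)" if x: "x \<in> B" and nn: "!!i. x \<noteq> real i * dx N" for x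
 proof -
  define j where "j = idx (dx N) x"
  have j: "j <= N" unfolding j_def by (rule idx_le_N[OF x])
  have "real j * dx N <= x" "x < (real j + 1) * dx N" using idx_bounds[OF dx_pos, of x N] x by (auto simp: j_def)
  then have xj: "real j * dx N < x" "x < (real j + 1) * dx N" using nn[of j] by auto
  have zl: "(%n. z n x) \<longlonglongrightarrow> 1/2 + (x - 1/2) * (1 + 0)" unfolding z_def by (intro tendsto_intros \<theta>0)
  have zl': "(%n. z n (x + \<epsilon> n)) \<longlonglongrightarrow> 1/2 + (x + 0 - 1/2) * (1 + 0)" unfolding z_def by (intro tendsto_intros \<theta>0 \<epsilon>0)
  have "eventually (%n. real j * dx N < z n x \<and> z n x < (real j + 1) * dx N \<and> real j * dx N < z n (x + \<epsilon> n) \<and> z n (x + \<epsilon> n) < (real j + 1) * dx N) sequentially"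
   by (intro eventually_conj order_tendstoD[OF zl] order_tendstoD[OF zl']) (use xj in auto)
  then have "eventually (%n. (1 + \<theta> n) * sl j = D n x) sequentially"
  proof eventually_elim
   case (elim n)
   have "\<Psi> n (x + \<epsilon> n) - \<Psi> n x = (z n (x + \<epsilon> n) - z n x) / dx N * (\<sigma> (Suc j) - \<sigma> j)"
    unfolding \<Psi>_def using pl_cell[OF j, of "z n (x + \<epsilon> n)" \<sigma>] pl_cell[OF j, of "z n x" \<sigma>] elim
    by (simp add: diff_divide_distrib algebra_simps)
   also have "z n (x + \<epsilon> n) - z n x = \<epsilon> n * (1 + \<theta> n)" by (simp add: z_def algebra_simps)
   finally show ?case using \<epsilon>[of n] by (simp add: D_def sl_def)
  qed
  moreover have "(%n. (1 + \<theta> n) * sl j) \<longlonglongrightarrow> (1 + 0) * sl j" by (intro tendsto_intros \<theta>0)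
  ultimately show ?thesis unfolding j_def[symmetric] using Lim_transform_eventually by fastforce
 qed
 have nodes: "AE x in m01. \<forall>i. x \<noteq> real i * dx N"
 proof -
  have "AE x in lborel. \<forall>i. x \<noteq> real i * dx N"
   unfolding AE_all_countable by (intro allI AE_lborel_singleton)
  then show ?thesis by (subst AE_restrict_space_iff) auto
 qed
 have ub': "ub \<in> borel_measurable m01" by (rule measurable_m01[OF ub(1)])
 have M0: "0 <= M" using order_trans[OF abs_ge_zero ub(2)] .
 have lim: "(%n. \<integral>x. ub x * D n x \<partial>m01) \<longlonglongrightarrow> (\<integral>x. ub x * sl (idx (dx N) x) \<partial>m01)"
 proof (rule integral_dominated_convergence)
  show "(%x. ub x * sl (idx (dx N) x)) \<in> borel_measurable m01" by (intro borel_measurable_times ub' measurable_m01[OF step_measurable])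
  show "(%x. ub x * D n x) \<in> borel_measurable m01" for n
   by (intro borel_measurable_times ub' measurable_m01[OF borel_measurable_continuous_onI[OF Dc]])
  show "integrable m01 (%x. M * (2 * Lp))" by simp
  show "AE x in m01. (%n. ub x * D n x) \<longlonglongrightarrow> ub x * sl (idx (dx N) x)"
   using nodes AE_space by eventually_elim (intro tendsto_intros Dlim, auto)
  show "AE x in m01. norm (ub x * D n x) <= M * (2 * Lp)" for n
   using ub(2) Db M0 by (intro always_eventually allI) (auto simp: abs_mult intro!: mult_mono)
 qed
 have "(\<integral>x. ub x * sl (idx (dx N) x) \<partial>m01) <= V" by (rule LIMSEQ_le_const2[OF lim]) (use le in auto)
 moreover have "(\<integral>x. sl (idx (dx N) x) * ub x \<partial>m01) = (\<Sum>i\<le>N. sl i * (\<integral>x. indicator (cell N i) x * ub x \<partial>m01))"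
  by (rule integral_m01_cells, rule integrable_m01_bounded[OF ub' ub(2)])
 ultimately show ?thesis by (simp add: sl_def mult.commute)
qed

text \<open>Truncation at the essential bound makes the representative bounded everywhere.\<close>

lemma bounded_borel_version:
 assumes u0: "Linf_on {0..1} (u0 :: real => real)"
 obtains M ub where "0 <= M" "ub \<in> borel_measurable borel" "!!x. \<bar>ub x\<bar> <= M"
  "AE x in lebesgue. x \<in> {0..1} --> u0 x = ub x"
proof -
 obtain M where M: "AE z in lebesgue. z \<in> {0..1} --> \<bar>u0 z\<bar> <= M" and
  m: "(%x. indicator {0..1} x *\<^sub>R u0 x) \<in> borel_measurable lebesgue"
  using u0 by (auto simp: Linf_on_def set_borel_measurable_def)
 obtain g where g: "g \<in> borel_measurable lborel" "AE x in lborel. indicator {0..1} x *\<^sub>R u0 x = g x"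
  using completion_ex_borel_measurable_real[OF m] by blast
 define M' where "M' = \<bar>M\<bar>"
 define ub where "ub = (%x. max (- M') (min M' (g x)))"
 show thesis
 proof (rule that[of M' ub])
  show "ub \<in> borel_measurable borel" unfolding ub_def using g(1) by simp
  have "AE x in lebesgue. indicator {0..1} x *\<^sub>R u0 x = g x" by (rule AE_completion[OF g(2)])
  with M show "AE x in lebesgue. x \<in> {0..1} --> u0 x = ub x"
   by eventually_elim (auto simp: ub_def M'_def indicator_def)
 qed (auto simp: M'_def ub_def)
qed

lemma lebesgue_integral_borel_version:
 assumes ae: "AE x in lebesgue. x \<in> {0..1} --> u0 x = (ub x :: real)"
  and m: "(%x. f (ub x) x) \<in> borel_measurable borel" and A: "A \<in> sets borel" "A \<subseteq> {0..1}"
 shows "(LINT x:A|lebesgue. f (u0 x) x) = (\<integral>x. indicator A x * (f (ub x) x :: real) \<partial>m01)"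
proof -
 have bm: "(%x. indicator A x *\<^sub>R f (ub x) x) \<in> borel_measurable lborel" using m A by simp
 have m': "(%x. indicator A x *\<^sub>R f (ub x) x) \<in> borel_measurable lebesgue" by (rule measurable_completion[OF bm])
 have ae': "AE x in lebesgue. indicator A x *\<^sub>R f (ub x) x = indicator A x *\<^sub>R f (u0 x) x"
  using ae A(2) by (auto elim!: eventually_mono simp: indicator_def)
 have m2: "(%x. indicator A x *\<^sub>R f (u0 x) x) \<in> borel_measurable lebesgue" using borel_measurable_AE[OF m' ae'] .
 have "(LINT x:A|lebesgue. f (u0 x) x) = (\<integral>x. indicator A x *\<^sub>R f (ub x) x \<partial>lebesgue)"
  unfolding set_lebesgue_integral_def by (rule integral_cong_AE[OF m2 m']) (use ae' in \<open>auto elim: eventually_mono\<close>)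
 also have "... = (\<integral>x. indicator A x *\<^sub>R f (ub x) x \<partial>lborel)" by (rule integral_completion[OF bm])
 also have "... = (\<integral>x. indicator B x *\<^sub>R (indicator A x * f (ub x) x) \<partial>lborel)"
 proof (rule integral_cong_AE)
  have "AE x in lborel. x \<noteq> (0::real)" "AE x in lborel. x \<noteq> (1::real)" by (rule AE_lborel_singleton)+
  then show "AE x in lborel. indicator A x *\<^sub>R f (ub x) x = indicator B x *\<^sub>R (indicator A x * f (ub x) x)"
   by eventually_elim (use A(2) in \<open>auto simp: indicator_def\<close>)
  show "(%x. indicator B x *\<^sub>R (indicator A x * f (ub x) x)) \<in> borel_measurable lborel" using m A by simp
 qed (rule bm)
 also have "... = (\<integral>x. indicator A x * f (ub x) x \<partial>m01)"
  by (subst integral_restrict_space) auto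
 finally show ?thesis .
qed

theorem scheme_fd:
 fixes G k u0 ub :: "real => real"
 assumes G: "mono G" "L-lipschitz_on UNIV G"
  and k0: "0 < k0" and k_bounds: "!!x. x \<in> {0..1} ==> k0 <= k x \<and> k x <= k1"
  and k_lip: "!!x y. x \<in> {0..1} ==> y \<in> {0..1} ==> \<bar>k x - k y\<bar> <= K * \<bar>x - y\<bar>"
  and V: "!!\<phi>. (\<forall>x. \<phi> differentiable (at x)) ==> continuous_on UNIV (deriv \<phi>) ==>
       (\<exists>K. compact K \<and> K \<subseteq> B \<and> (\<forall>x. x \<notin> K --> \<phi> x = 0)) ==> (\<forall>x. \<bar>\<phi> x\<bar> <= 1)
    ==> (LINT x:{0..1}|lebesgue. u0 x * deriv \<phi> x) <= V"
  and ub: "ub \<in> borel_measurable borel" "!!x. \<bar>ub x\<bar> <= M"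
  and ae: "AE x in lebesgue. x \<in> {0..1} --> u0 x = ub x"
  and dt: "0 < dt"
 shows "fd G k L k0 k1 K M V (prim ub) dt N (%n i. scheme G k u0 N dt n (int i))"
  and "!!i. i <= N ==> scheme G k u0 N dt 0 (int i) = 1 / dx N * (\<integral>x. indicator (cell N i) x * ub x \<partial>m01)"
proof -
 let ?a = "%n i. scheme G k u0 N dt n (int i)"
 have ub': "ub \<in> borel_measurable m01" by (rule measurable_m01[OF ub(1)])
 have cont: "continuous_on UNIV G" using G(2) lipschitz_on_continuous_on by blast
 have M0: "0 <= M" using order_trans[OF abs_ge_zero ub(2)] .
 show avg: "?a 0 i = 1 / dx N * (\<integral>x. indicator (cell N i) x * ub x \<partial>m01)" if i: "i <= N" for i
 proof -
  have h1: "(real i + 1) * dx N <= 1"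
  proof -
   have "(real i + 1) * dx N <= (real N + 1) * dx N" using i by (intro mult_right_mono) auto
   then show ?thesis by (simp add: dx_mult)
  qed
  have "(LINT x:{real i * dx N..(real i + 1) * dx N}|lebesgue. u0 x) = (\<integral>x. indicator {real i * dx N..(real i + 1) * dx N} x * ub x \<partial>m01)"
  proof (rule lebesgue_integral_borel_version[OF ae, of "%u x. u"])
   show "{real i * dx N..(real i + 1) * dx N} \<subseteq> {0..1}" unfolding atLeastatMost_subset_iff by (intro disjI2 conjI h1) simp
  qed (use ub in auto)
  also have "... = (\<integral>x. indicator (cell N i) x * ub x \<partial>m01)"
  proof (rule integral_cong_AE)
   have "AE x in lborel. x \<noteq> (real i + 1) * dx N" by (rule AE_lborel_singleton)
   then have "AE x in m01. x \<noteq> (real i + 1) * dx N" by (subst AE_restrict_space_iff) auto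
   then show "AE x in m01. indicator {real i * dx N..(real i + 1) * dx N} x * ub x = indicator (cell N i) x * ub x"
    using AE_space
   proof eventually_elim
    case (elim x)
    have "x \<in> {l..r} \<longleftrightarrow> x \<in> {l..<r} - {0}" if "x \<noteq> r" "x \<noteq> 0" for l r using that by auto
    from this[OF elim(1)] show ?case using elim(2) unfolding cell_eq[OF i] by (simp add: indicator_def)
   qed
  qed (use ub in \<open>auto intro!: measurable_m01\<close>)
  finally show ?thesis by (simp add: add.commute)
 qed
 have cp: "(\<integral>x. indicator (cell N i) x * ub x \<partial>m01) = prim ub (real (Suc i) * dx N) - prim ub (real i * dx N)" if i: "i <= N" for i
 proof -
  have "prim ub (real (Suc i) * dx N) - prim ub (real i * dx N) = (\<integral>x. indicator {real i * dx N..<real (Suc i) * dx N} x * ub x \<partial>m01)"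
   by (rule prim_diff[OF ub' ub(2)]) (auto intro!: mult_right_mono)
  also have "... = (\<integral>x. indicator (cell N i) x * ub x \<partial>m01)"
   by (rule lint_cong) (use cell_eq[OF i] in \<open>auto simp: indicator_def add.commute\<close>)
  finally show ?thesis by simp
 qed
 have lipI: "\<bar>prim ub x - prim ub y\<bar> <= M * \<bar>x - y\<bar>" for x y by (rule prim_lipschitz[OF ub' ub(2)])
 show "fd G k L k0 k1 K M V (prim ub) dt N ?a"
 proof
  show "mono G" "L-lipschitz_on UNIV G" "0 < k0" "0 < dt" by (fact G k0 dt)+
  show "k0 <= k x \<and> k x <= k1" if "x \<in> {0..1}" for x by (rule k_bounds[OF that])
  show "\<bar>k x - k y\<bar> <= K * \<bar>x - y\<bar>" if "x \<in> {0..1}" "y \<in> {0..1}" for x y by (rule k_lip[OF that])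
  show "nat_step G (%i. k (real i * dx N)) N (dt / (dx N)^2) (?a n) (?a (Suc n))" for n
  proof (rule scheme_nat_step[OF G(1) cont dt])
   show "0 < k x" if "x \<in> {0..1}" for x using k_bounds[OF that] k0 by linarith
  qed
  show "\<bar>?a 0 i\<bar> <= M" if i: "i <= N" for i
  proof -
   have "\<bar>?a 0 i\<bar> = 1 / dx N * \<bar>prim ub (real (Suc i) * dx N) - prim ub (real i * dx N)\<bar>"
    unfolding avg[OF i] cp[OF i] by (simp only: abs_mult abs_divide dx_simps abs_one)
   also have "... <= 1 / dx N * (M * \<bar>real (Suc i) * dx N - real i * dx N\<bar>)" using lipI[of "real (Suc i) * dx N" "real i * dx N"] by (intro mult_left_mono) (simp_all only: zero_le_divide_1_iff dx_simps)
   also have "\<bar>real (Suc i) * dx N - real i * dx N\<bar> = dx N" by (simp add: algebra_simps)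
   finally show ?thesis by simp
  qed
  show "\<bar>prim ub x - prim ub y\<bar> <= M * \<bar>x - y\<bar>" for x y by (rule lipI)
  show "dx N * (\<Sum>l<i. ?a 0 l) = prim ub (real i * dx N)" if "i <= Suc N" for i
  proof -
   have "dx N * (\<Sum>l<i. ?a 0 l) = (\<Sum>l<i. prim ub (real (Suc l) * dx N) - prim ub (real l * dx N))"
    unfolding sum_distrib_left
   proof (rule sum.cong[OF refl])
    fix l assume "l \<in> {..<i}"
    then have l: "l <= N" using that by simp
    show "dx N * ?a 0 l = prim ub (real (Suc l) * dx N) - prim ub (real l * dx N)"
     unfolding avg[OF l] cp[OF l] by simp
   qed
   also have "... = prim ub (real i * dx N) - prim ub (real 0 * dx N)"
    by (rule sum_lessThan_telescope[of "%l. prim ub (real l * dx N)"])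
   finally show ?thesis by simp
  qed
  show "(\<Sum>i<N. \<bar>?a 0 (Suc i) - ?a 0 i\<bar>) <= V"
  proof -
   define \<sigma> where "\<sigma> = (%i. if i = 0 \<or> N < i then 0 else - sgn (?a 0 i - ?a 0 (i - 1)))"
   have int: "(LINT x:{0..1}|lebesgue. u0 x * f x) = (\<integral>x. ub x * f x \<partial>m01)" if "f \<in> borel_measurable borel" for f
   proof -
    have "(LINT x:{0..1}|lebesgue. u0 x * f x) = (\<integral>x. indicator {0..1} x * (ub x * f x) \<partial>m01)"
     by (rule lebesgue_integral_borel_version[OF ae, of "%u x. u * f x"]) (use ub that in auto)
    also have "... = (\<integral>x. ub x * f x \<partial>m01)" by (rule lint_cong) (auto simp: indicator_def)
    finally show ?thesis .
   qed
   have "(\<Sum>i\<le>N. (\<sigma> (Suc i) - \<sigma> i) / dx N * (\<integral>x. indicator (cell N i) x * ub x \<partial>m01)) <= V"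
    by (rule BV01_average_test[OF V ub int]) (auto simp: \<sigma>_def sgn_if)
   moreover have "(\<Sum>i\<le>N. (\<sigma> (Suc i) - \<sigma> i) / dx N * (\<integral>x. indicator (cell N i) x * ub x \<partial>m01)) = (\<Sum>i\<le>N. (\<sigma> (Suc i) - \<sigma> i) * ?a 0 i)"
    by (rule sum.cong[OF refl], subst avg) auto
   moreover have "... = - (\<Sum>i<N. \<sigma> (Suc i) * (?a 0 (Suc i) - ?a 0 i))"
    using summation_by_parts_aux[of \<sigma> "?a 0" N] by (simp add: \<sigma>_def)
   moreover have "... = (\<Sum>i<N. \<bar>?a 0 (Suc i) - ?a 0 i\<bar>)"
    unfolding sum_negf[symmetric] by (rule sum.cong[OF refl]) (auto simp: \<sigma>_def sgn_if abs_if)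
   ultimately show ?thesis by linarith
  qed
 qed
qed

section \<open>The limit function\<close>

lemma step2_measurable [measurable]:
 "(%z. (a (idx d (fst z)) (idx h (snd z)) :: real)) \<in> borel_measurable (borel :: (real \<times> real) measure)"
proof -
 have 1: "(%z::real\<times>real. idx d (fst z)) \<in> measurable borel (count_space UNIV)"
  by (rule measurable_compose[OF _ idx_measurable]) (auto intro!: borel_measurable_continuous_onI continuous_intros)
 have 2: "(%z::real\<times>real. idx h (snd z)) \<in> measurable borel (count_space UNIV)"
  by (rule measurable_compose[OF _ idx_measurable]) (auto intro!: borel_measurable_continuous_onI continuous_intros)
 show ?thesis
 proof (rule measurable_compose_countable[OF _ 1])
  fix n
  show "(%z::real\<times>real. a n (idx h (snd z))) \<in> borel_measurable borel"
   by (rule measurable_compose[OF 2]) simp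
 qed
qed

lemma AE_tendsto_zero_of_summable_L1:
 assumes g: "!!m. integrable M (g m)" and le: "!!m. m0 <= m ==> (\<integral>x. \<bar>g m x\<bar> \<partial>M) <= C * (1/2)^m"
 shows "AE x in M. (%m. g m x :: real) \<longlonglongrightarrow> 0"
proof -
 define f where "f = (%m x. \<bar>g (m + m0) x\<bar>)"
 have [measurable]: "g m \<in> borel_measurable M" for m using g by auto
 have "0 <= (\<integral>x. \<bar>g m0 x\<bar> \<partial>M)" by simp
 also have "... <= C * (1/2)^m0" by (rule le) simp
 finally have "0 <= C * (1/2)^m0" .
 moreover have "0 < (1/2::real)^m0" by simp
 ultimately have C: "0 <= C" by (auto simp: zero_le_mult_iff)
 have "(\<integral>\<^sup>+x. (\<Sum>m. ennreal (f m x)) \<partial>M) = (\<Sum>m. (\<integral>\<^sup>+x. ennreal (f m x) \<partial>M))"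
  unfolding f_def by (rule nn_integral_suminf) measurable
 also have "... <= (\<Sum>m. ennreal (C * (1/2)^m))"
 proof (rule suminf_le)
  fix m
  have "(\<integral>\<^sup>+x. ennreal (f m x) \<partial>M) = ennreal (\<integral>x. f m x \<partial>M)"
   unfolding f_def by (rule nn_integral_eq_integral) (use g in auto)
  also have "... <= ennreal (C * (1/2)^m)"
  proof (rule ennreal_leI)
   have "(\<integral>x. f m x \<partial>M) <= C * (1/2)^(m + m0)" unfolding f_def by (rule le) simp
   also have "... <= C * (1/2)^m" using C by (intro mult_left_mono power_decreasing) auto
   finally show "(\<integral>x. f m x \<partial>M) <= C * (1/2)^m" .
  qed
  finally show "(\<integral>\<^sup>+x. ennreal (f m x) \<partial>M) <= ennreal (C * (1/2)^m)" .
 qed auto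
 also have "... = ennreal (\<Sum>m. C * (1/2)^m)"
  by (rule suminf_ennreal2) (use C in \<open>auto intro!: summable_mult summable_geometric\<close>)
 also have "... < \<infinity>" by simp
 finally have "AE x in M. (\<Sum>m. ennreal (f m x)) \<noteq> \<infinity>"
  by (intro nn_integral_PInf_AE) (auto simp: f_def)
 then show ?thesis
 proof eventually_elim
  case (elim x)
  have "summable (%m. f m x)"
   by (rule summable_suminf_not_top) (use elim in \<open>auto simp: f_def\<close>)
  then have "(%m. f m x) \<longlonglongrightarrow> 0" by (rule summable_LIMSEQ_zero)
  then have "(%m. g (m + m0) x) \<longlonglongrightarrow> 0" unfolding f_def by (rule tendsto_rabs_zero_cancel)
  then show ?case by (rule LIMSEQ_offset)
 qed
qed

locale fd_family =
 fixes G k :: "real => real" and L k0 k1 K M V :: real and I :: "real => real" and c :: real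
  and N :: "real => nat" and A :: "real => nat => nat => real"
 assumes fd: "!!dt. 0 < dt ==> fd G k L k0 k1 K M V I dt (N dt) (A dt)"
  and c: "0 < c" "!!dt. 0 < dt ==> c <= dt / (dx (N dt))^2"
begin

definition v :: "real => real => real => real" where
 "v dt t x = A dt (idx dt t) (idx (dx (N dt)) x)"

definition Ct :: real where "Ct = fd.Ctau L k1 M V"

lemma M0: "0 <= M" and V0: "0 <= V" and L0: "0 <= L" and k01: "0 < k0" "k0 <= k1"
 using fd.M0[OF fd[of 1]] fd.V0[OF fd[of 1]] fd.L0[OF fd[of 1]] fd.k0[OF fd[of 1]] fd.k01[OF fd[of 1]] by auto

lemma Ct0: "0 <= Ct" unfolding Ct_def using fd.Ctau0[OF fd[of 1]] by simp

lemma dx_sqrt: assumes "0 < dt" shows "dx (N dt) <= sqrt dt / sqrt c"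
proof -
 have "c * (dx (N dt))^2 <= dt" using c(2)[OF assms] by (simp add: field_simps)
 then have "sqrt (c * (dx (N dt))^2) <= sqrt dt" by (rule real_sqrt_le_mono)
 then show ?thesis using c(1) by (simp add: real_sqrt_mult field_simps)
qed

lemma v_s: "0 < dt ==> v dt t = fd.s (N dt) (A dt) (idx dt t)"
 by (auto simp: v_def fd.s_def[OF fd])

lemma v_bound: "0 < dt ==> x \<in> B ==> \<bar>v dt t x\<bar> <= M"
 unfolding v_s by (rule fd.s_bound[OF fd])

lemma v_measurable [measurable]: "v dt t \<in> borel_measurable borel" unfolding v_def by measurable

lemma v_measurable' [measurable]: "v dt t \<in> borel_measurable m01" by (rule measurable_m01[OF v_measurable])

lemma v_integrable [simp]: "0 < dt ==> integrable m01 (v dt t)"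
 by (rule integrable_m01_bounded[OF v_measurable' v_bound])

text \<open>The bound of \<open>L1_distance\<close> tends to zero with \<open>rho\<close>, and \<open>c <= dt / dx^2\<close> bounds the mesh sizes by
 \<open>sqrt dt\<close>.\<close>

lemma v_Cauchy:
 assumes e: "0 < e"
 shows "\<exists>\<delta>>0. \<forall>dt dt' t. 0 < dt \<and> dt < \<delta> \<and> 0 < dt' \<and> dt' < \<delta> \<and> 0 <= t \<and> t <= T -->
   (\<integral>x. \<bar>v dt t x - v dt' t x\<bar> \<partial>m01) <= e"
proof -
 define C2 where "C2 = fd_pair.C2 L k0 k1 K M V"
 define F where "F = (%r. (2 * V + 2 * M + 2) * sqrt (sqrt (2 * k1 * (M^2 / k0 + T * C2) * r) + M * r) + Ct * r)"
 have "isCont F 0" unfolding F_def by (intro continuous_intros)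
 then have "(F \<longlongrightarrow> F 0) (at 0)" by (simp add: isCont_def)
 moreover have "F 0 = 0" by (simp add: F_def)
 ultimately have "eventually (%r. F r < e) (at 0)" using e by (auto intro: order_tendstoD)
 then obtain r0 where r0: "0 < r0" "!!r. r \<noteq> 0 ==> \<bar>r\<bar> < r0 ==> F r < e"
  by (auto simp: eventually_at dist_real_def)
 define q where "q = 2 + 2 / sqrt c"
 have q: "0 < q" using c(1) by (simp add: q_def add_pos_pos)
 define \<delta> where "\<delta> = (r0 / q)^2"
 show ?thesis
 proof (intro exI[of _ \<delta>] conjI allI impI)
  show "0 < \<delta>" using r0 q by (simp add: \<delta>_def)
  fix dt dt' t assume a: "0 < dt \<and> dt < \<delta> \<and> 0 < dt' \<and> dt' < \<delta> \<and> 0 <= t \<and> t <= T"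
  interpret p: fd_pair G k L k0 k1 K M V I dt "N dt" "A dt" dt' "N dt'" "A dt'"
   unfolding fd_pair_def using fd a by auto
  have s\<delta>: "sqrt \<delta> = r0 / q" using r0(1) q by (simp add: \<delta>_def)
  have s: "sqrt dt < r0 / q" "sqrt dt' < r0 / q" using a unfolding s\<delta>[symmetric] by auto
  have "p.rho <= sqrt dt + sqrt dt' + (sqrt dt / sqrt c + sqrt dt' / sqrt c)"
   unfolding p.rho_def using dx_sqrt[of dt] dx_sqrt[of dt'] a by (intro add_mono) auto
  also have "... < r0 / q + r0 / q + (r0 / q / sqrt c + r0 / q / sqrt c)"
   using s c(1) by (intro add_strict_mono divide_strict_right_mono) auto
  also have "... = (r0 / q) * q"
  proof -
   have "y + y + (y / w + y / w) = y * (2 + 2 / w)" for y w :: real by (simp add: distrib_left)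
   then show ?thesis by (simp only: q_def)
  qed
  also have "... = r0" using q by simp
  finally have rho: "p.rho < r0" .
  have rp: "0 < p.rho" unfolding p.rho_def using a by (intro add_pos_pos) auto
  have "(\<integral>x. \<bar>v dt t x - v dt' t x\<bar> \<partial>m01) <= F p.rho"
   using p.L1_distance[of t T] a unfolding F_def C2_def Ct_def v_s by (simp add: v_s)
  also have "... < e" using r0(2)[of p.rho] rho rp by simp
  finally show "(\<integral>x. \<bar>v dt t x - v dt' t x\<bar> \<partial>m01) <= e" by simp
 qed
qed

definition \<delta> :: "nat => real" where
 "\<delta> m = (SOME \<delta>. 0 < \<delta> \<and> (\<forall>dt dt' t. 0 < dt \<and> dt < \<delta> \<and> 0 < dt' \<and> dt' < \<delta> \<and> 0 <= t \<and> t <= real m -->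
   (\<integral>x. \<bar>v dt t x - v dt' t x\<bar> \<partial>m01) <= (1/2)^m))"

lemma \<delta>: "0 < \<delta> m"
  "0 < dt ==> dt < \<delta> m ==> 0 < dt' ==> dt' < \<delta> m ==> 0 <= t ==> t <= real m ==>
   (\<integral>x. \<bar>v dt t x - v dt' t x\<bar> \<partial>m01) <= (1/2)^m"
proof -
 have "\<exists>\<delta>. 0 < \<delta> \<and> (\<forall>dt dt' t. 0 < dt \<and> dt < \<delta> \<and> 0 < dt' \<and> dt' < \<delta> \<and> 0 <= t \<and> t <= real m -->
   (\<integral>x. \<bar>v dt t x - v dt' t x\<bar> \<partial>m01) <= (1/2)^m)"
  by (rule v_Cauchy) simp
 from someI_ex[OF this]
 show "0 < \<delta> m"
  "0 < dt ==> dt < \<delta> m ==> 0 < dt' ==> dt' < \<delta> m ==> 0 <= t ==> t <= real m ==>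
   (\<integral>x. \<bar>v dt t x - v dt' t x\<bar> \<partial>m01) <= (1/2)^m"
  unfolding \<delta>_def by blast+
qed

text \<open>Time steps so small that consecutive approximations are \<open>(1/2)\<^sup>m\<close> apart; the summable rate yields
 almost everywhere convergence for every time, along one sequence.\<close>

definition d :: "nat => real" where "d m = min ((1/16)^m) (Min (\<delta> ` {..m}) / 2)"

lemma d: "0 < d m" "d m <= (1/16)^m" "m <= l ==> d l < \<delta> m"
proof -
 have "0 < Min (\<delta> ` {..m})" for m using \<delta>(1) by (subst Min_gr_iff) auto
 note mp = this
 show "0 < d m" "d m <= (1/16)^m" using mp[of m] by (auto simp: d_def)
 assume "m <= l"
 then have "Min (\<delta> ` {..l}) <= \<delta> m" by (intro Min_le) auto
 then have "Min (\<delta> ` {..l}) / 2 < \<delta> m" using mp[of l] by linarith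
 then show "d l < \<delta> m" unfolding d_def by linarith
qed

lemma sqrt_d: "sqrt (d m) <= (1/2)^m" "sqrt (d m) <= (1/4)^m"
proof -
 have "(1/16::real)^m = ((1/4)^m)^2" by (simp add: power2_eq_square flip: power_mult_distrib)
 then have "d m <= ((1/4)^m)^2" using d(2)[of m] by (simp only:)
 then have "sqrt (d m) <= sqrt (((1/4)^m)^2)" by (rule real_sqrt_le_mono)
 also have "sqrt (((1/4::real)^m)^2) = (1/4)^m" by (simp only: real_sqrt_abs) simp
 finally show "sqrt (d m) <= (1/4)^m" .
 also have "(1/4::real)^m <= (1/2)^m" by (rule power_mono) auto
 finally show "sqrt (d m) <= (1/2)^m" .
qed

lemma d_tendsto: "d \<longlonglongrightarrow> 0"
proof (rule tendsto_sandwich[OF _ _ tendsto_const])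
 show "(%m. (1/16::real)^m) \<longlonglongrightarrow> 0" by (rule LIMSEQ_power_zero) simp
qed (use d in \<open>auto intro!: always_eventually intro: less_imp_le\<close>)

abbreviation "h m \<equiv> dx (N (d m))"

lemma h_le: "h m <= (1 / sqrt c) * (1/2)^m"
 using order_trans[OF dx_sqrt[OF d(1)] divide_right_mono[OF sqrt_d(1)]] c(1) by simp

lemma h_tendsto: "h \<longlonglongrightarrow> 0"
proof (rule tendsto_sandwich[OF _ _ tendsto_const])
 have "(%m. (1 / sqrt c) * (1/2::real)^m) \<longlonglongrightarrow> (1 / sqrt c) * 0" by (intro tendsto_intros LIMSEQ_power_zero) simp
 then show "(%m. (1 / sqrt c) * (1/2::real)^m) \<longlonglongrightarrow> 0" by simp
qed (use h_le in auto)

text \<open>The pointwise limit, truncated so that it is bounded everywhere, also where the limit does not exist.\<close>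

definition u :: "real \<times> real => real" where
 "u z = max (- M) (min M (lim (%m. v (d m) (fst z) (snd z))))"

lemma u_measurable [measurable]: "u \<in> borel_measurable borel"
proof -
 have "(%z. v (d m) (fst z) (snd z)) \<in> borel_measurable borel" for m
  unfolding v_def by (rule step2_measurable)
 then have "(%z. lim (%m. v (d m) (fst z) (snd z))) \<in> borel_measurable borel"
  by (rule borel_measurable_lim_metric)
 then show ?thesis unfolding u_def by measurable
qed

lemma u_slice_measurable [measurable]: "(%x. u (t, x)) \<in> borel_measurable borel"
 by (rule measurable_compose[OF _ u_measurable]) (auto intro!: borel_measurable_continuous_onI continuous_intros)

lemma u_slice_measurable' [measurable]: "(%x. u (t, x)) \<in> borel_measurable m01"
 by (rule measurable_m01[OF u_slice_measurable])

lemma u_bound: "\<bar>u z\<bar> <= M" using M0 by (auto simp: u_def)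

lemma u_integrable [simp]: "integrable m01 (%x. u (t, x))"
 by (rule integrable_m01_bounded[OF u_slice_measurable' u_bound])

lemma v_AE: assumes t: "0 <= t" shows "AE x in m01. (%m. v (d m) t x) \<longlonglongrightarrow> u (t, x)"
proof -
 define m0 where "m0 = nat \<lceil>t\<rceil>"
 have m0: "t <= real m" if "m0 <= m" for m using that unfolding m0_def by linarith
 have "AE x in m01. summable (%m. v (d (Suc m)) t x - v (d m) t x)"
 proof -
  have "AE x in m01. (%m. 2^m * 0 :: real) \<longlonglongrightarrow> 0" by simp
  define g where "g = (%m x. v (d (Suc m)) t x - v (d m) t x)"
  have gi: "integrable m01 (g m)" for m unfolding g_def using d(1) by simp
  have gm[measurable]: "g m \<in> borel_measurable m01" for m using gi by auto
  have le: "(\<integral>x. \<bar>g m x\<bar> \<partial>m01) <= (1/2)^m" if "m0 <= m" for m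
   unfolding g_def by (rule \<delta>(2)[OF d(1) d(3) d(1) d(3) t m0[OF that]]) auto
  have "(\<integral>\<^sup>+x. (\<Sum>m. ennreal \<bar>g (m + m0) x\<bar>) \<partial>m01) = (\<Sum>m. (\<integral>\<^sup>+x. ennreal \<bar>g (m + m0) x\<bar> \<partial>m01))"
   by (rule nn_integral_suminf) measurable
  also have "... <= (\<Sum>m. ennreal ((1/2)^m))"
  proof (rule suminf_le)
   fix m
   have "(\<integral>\<^sup>+x. ennreal \<bar>g (m + m0) x\<bar> \<partial>m01) = ennreal (\<integral>x. \<bar>g (m + m0) x\<bar> \<partial>m01)"
    by (rule nn_integral_eq_integral) (use gi in auto)
   also have "... <= ennreal ((1/2)^(m + m0))" by (intro ennreal_leI le) simp
   also have "... <= ennreal ((1/2)^m)" by (intro ennreal_leI power_decreasing) auto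
   finally show "(\<integral>\<^sup>+x. ennreal \<bar>g (m + m0) x\<bar> \<partial>m01) <= ennreal ((1/2)^m)" .
  qed auto
  also have "... = ennreal (\<Sum>m. (1/2)^m)" by (rule suminf_ennreal2) (auto intro: summable_geometric)
  also have "... < \<infinity>" by simp
  finally have "AE x in m01. (\<Sum>m. ennreal \<bar>g (m + m0) x\<bar>) \<noteq> \<infinity>"
   by (intro nn_integral_PInf_AE) auto
  then show ?thesis
  proof eventually_elim
   case (elim x)
   have "summable (%m. \<bar>g (m + m0) x\<bar>)"
    by (rule summable_suminf_not_top) (use elim in auto)
   then have "summable (%m. g (m + m0) x)" by (rule summable_rabs_cancel)
   then have "summable (%m. g m x)" by (rule summable_iff_shift[THEN iffD1])
   then show ?case by (simp add: g_def)
  qed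
 qed
 then show ?thesis using AE_space
 proof eventually_elim
  case (elim x)
  have "convergent (%n. \<Sum>m<n. v (d (Suc m)) t x - v (d m) t x)" using elim(1) by (simp add: summable_iff_convergent)
  then have "convergent (%n. v (d n) t x - v (d 0) t x)" by (simp only: sum_lessThan_telescope[of "%m. v (d m) t x"])
  then have "convergent (%n. (v (d n) t x - v (d 0) t x) + v (d 0) t x)" by (intro convergent_add convergent_const)
  then have conv: "convergent (%n. v (d n) t x)" by simp
  then have l: "(%n. v (d n) t x) \<longlonglongrightarrow> lim (%n. v (d n) t x)" by (simp add: convergent_LIMSEQ_iff)
  have b: "\<bar>v (d n) t x\<bar> <= M" for n using v_bound[OF d(1)] elim(2) by simp
  have "lim (%n. v (d n) t x) <= M" by (rule LIMSEQ_le_const2[OF l]) (use b in \<open>auto simp: abs_le_iff\<close>)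
  moreover have "- M <= lim (%n. v (d n) t x)" by (rule LIMSEQ_le_const[OF l]) (use b in \<open>auto simp: abs_le_iff minus_le_iff\<close>)
  ultimately have "u (t, x) = lim (%n. v (d n) t x)" by (simp add: u_def)
  then show ?case using l by simp
 qed
qed

lemma v_u_distance:
 assumes dt: "0 < dt" "dt < \<delta> m" and t: "0 <= t" "t <= real m"
 shows "(\<integral>x. \<bar>v dt t x - u (t, x)\<bar> \<partial>m01) <= (1/2)^m"
proof -
 have lim: "(%l. \<integral>x. \<bar>v dt t x - v (d l) t x\<bar> \<partial>m01) \<longlonglongrightarrow> (\<integral>x. \<bar>v dt t x - u (t, x)\<bar> \<partial>m01)"
 proof (rule integral_dominated_convergence[where w="%_. 2 * M"])
  show "AE x in m01. (%l. \<bar>v dt t x - v (d l) t x\<bar>) \<longlonglongrightarrow> \<bar>v dt t x - u (t, x)\<bar>"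
   using v_AE[OF t(1)] by eventually_elim (intro tendsto_intros)
  show "AE x in m01. norm \<bar>v dt t x - v (d l) t x\<bar> <= 2 * M" for l
   using AE_space
  proof eventually_elim
   case (elim x)
   then show ?case using v_bound[OF dt(1), of x t] v_bound[OF d(1)[of l], of x t] by auto
  qed
 qed auto
 show ?thesis
  by (rule LIMSEQ_le_const2[OF lim]) (intro exI[of _ m] allI impI \<delta>(2)[OF dt d(1) d(3) t])
qed

lemma v_uniform_limit:
 assumes "0 < T"
 shows "uniform_limit {0..T} (%dt t. \<integral>x. \<bar>v dt t x - u (t, x)\<bar> \<partial>m01) (%t. 0) (at_right 0)"
proof (rule uniform_limitI)
 fix e :: real assume e: "0 < e"
 obtain m1 where m1: "(1/2::real)^m1 < e" using real_arch_pow_inv[OF e, of "1/2"] by auto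
 define m where "m = max m1 (nat \<lceil>T\<rceil>)"
 have mT: "T <= real m" unfolding m_def by linarith
 have me: "(1/2::real)^m < e"
 proof -
  have "(1/2::real)^m <= (1/2)^m1" by (rule power_decreasing) (auto simp: m_def)
  then show ?thesis using m1 by linarith
 qed
 have "eventually (%dt. dt \<in> {0<..<\<delta> m}) (at_right 0)"
  by (rule eventually_at_right_real[OF \<delta>(1)])
 then show "\<forall>\<^sub>F dt in at_right 0. \<forall>t\<in>{0..T}. dist (\<integral>x. \<bar>v dt t x - u (t, x)\<bar> \<partial>m01) 0 < e"
 proof eventually_elim
  case (elim dt)
  show ?case
  proof
   fix t assume "t \<in> {0..T}"
   then have "(\<integral>x. \<bar>v dt t x - u (t, x)\<bar> \<partial>m01) <= (1/2)^m"
    using elim mT by (intro v_u_distance) auto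
   then show "dist (\<integral>x. \<bar>v dt t x - u (t, x)\<bar> \<partial>m01) 0 < e" using me by (simp add: dist_real_def)
  qed
 qed
qed

lemma v_time:
 assumes dt: "0 < dt" and st: "0 <= s" "s <= t"
 shows "(\<integral>x. \<bar>v dt t x - v dt s x\<bar> \<partial>m01) <= Ct * sqrt (t - s + dt)"
proof -
 have le: "idx dt s <= idx dt t" by (rule idx_mono[OF dt st(2)])
 have "(\<integral>x. \<bar>v dt t x - v dt s x\<bar> \<partial>m01) <= Ct * sqrt (real (idx dt t - idx dt s) * dt)"
  using fd.L1_time[OF fd[OF dt] le] unfolding v_s[OF dt] Ct_def fd.Ctau_def[OF fd[OF dt]] by (simp add: real_sqrt_mult mult.assoc)
 also have "... <= Ct * sqrt (t - s + dt)"
 proof (intro mult_left_mono real_sqrt_le_mono Ct0)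
  show "real (idx dt t - idx dt s) * dt <= t - s + dt"
   using idx_bounds(1)[OF dt, of t] idx_bounds(2)[OF dt, of s] st le by (simp add: of_nat_diff algebra_simps)
 qed
 finally show ?thesis .
qed

lemma u_time:
 assumes st: "0 <= s" "s <= t"
 shows "(\<integral>x. \<bar>u (t, x) - u (s, x)\<bar> \<partial>m01) <= Ct * sqrt (t - s)"
proof -
 have t: "0 <= t" using st by simp
 have lim: "(%l. \<integral>x. \<bar>v (d l) t x - v (d l) s x\<bar> \<partial>m01) \<longlonglongrightarrow> (\<integral>x. \<bar>u (t, x) - u (s, x)\<bar> \<partial>m01)"
 proof (rule integral_dominated_convergence[where w="%_. 2 * M"])
  show "AE x in m01. (%l. \<bar>v (d l) t x - v (d l) s x\<bar>) \<longlonglongrightarrow> \<bar>u (t, x) - u (s, x)\<bar>"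
   using v_AE[OF t] v_AE[OF st(1)] by eventually_elim (intro tendsto_intros)
  show "AE x in m01. norm \<bar>v (d l) t x - v (d l) s x\<bar> <= 2 * M" for l
   using AE_space
  proof eventually_elim
   case (elim x)
   then show ?case using v_bound[OF d(1)[of l], of x t] v_bound[OF d(1)[of l], of x s] by auto
  qed
 qed auto
 have "(%l. Ct * sqrt (t - s + d l)) \<longlonglongrightarrow> Ct * sqrt (t - s + 0)" by (intro tendsto_intros d_tendsto)
 then show ?thesis
  using LIMSEQ_le[OF lim] v_time[OF d(1) st] by auto
qed

lemma u_C_L1: "C_L1 u"
 unfolding C_L1_def
proof (intro conjI allI impI)
 fix t :: real assume t: "0 <= t"
 show "set_integrable lebesgue B (%x. u (t, x))"
  unfolding set_integrable_def
 proof (rule integrable_completion[THEN iffD2])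
  show "integrable lborel (%x. indicator B x *\<^sub>R u (t, x))"
   by (rule integrable_restrict_space[THEN iffD1, OF _ u_integrable]) simp
 qed (auto simp: u_slice_measurable)
 have eq: "(LINT x:B|lebesgue. \<bar>u (s, x) - u (t, x)\<bar>) = (\<integral>x. \<bar>u (s, x) - u (t, x)\<bar> \<partial>m01)" for s :: real
  by (rule integral_m01_eq_lebesgue) measurable
 have "((%s. Ct * sqrt \<bar>s - t\<bar>) \<longlongrightarrow> Ct * sqrt \<bar>t - t\<bar>) (at t within {0..})" by (intro tendsto_intros)
 then have z: "((%s. Ct * sqrt \<bar>s - t\<bar>) \<longlongrightarrow> 0) (at t within {0..})" by simp
 show "((%s. LINT x:B|lebesgue. \<bar>u (s, x) - u (t, x)\<bar>) \<longlongrightarrow> 0) (at t within {0..})"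
  unfolding eq
 proof (rule Lim_null_comparison[OF _ z])
  show "\<forall>\<^sub>F s in at t within {0..}. norm (\<integral>x. \<bar>u (s, x) - u (t, x)\<bar> \<partial>m01) <= Ct * sqrt \<bar>s - t\<bar>"
   unfolding eventually_at_filter
  proof (rule always_eventually, intro allI impI)
   fix s :: real assume s: "s \<in> {0..}"
   show "norm (\<integral>x. \<bar>u (s, x) - u (t, x)\<bar> \<partial>m01) <= Ct * sqrt \<bar>s - t\<bar>"
    using u_time[of s t] u_time[of t s] s t by (cases "s <= t") (simp_all add: abs_minus_commute)
  qed
 qed
qed

text \<open>Applied to the approximations shifted by one step in time, and also by one cell in space; the slicewise
 bounds give convergence on almost every point of space-time by Fubini.\<close>

lemma perturbed_AE:
 assumes f: "!!m. f m \<in> borel_measurable (borel :: (real \<times> real) measure)"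
  and fb: "!!m t x. 0 <= t ==> x \<in> B ==> \<bar>f m (t, x)\<bar> <= C'"
  and le: "!!m t. 0 <= t ==> (\<integral>x. \<bar>f m (t, x) - v (d m) t x\<bar> \<partial>m01) <= C * (1/2)^m"
 shows "AE z in restrict_space lborel Om. (%m. f m z) \<longlonglongrightarrow> u z"
proof -
 have Om: "Om \<in> sets borel" unfolding Om_def by (intro borel_Times) auto
 have sl: "(%x. f m (t, x)) \<in> borel_measurable borel" for m t
  by (rule measurable_compose[OF _ f]) (auto intro!: borel_measurable_continuous_onI continuous_intros)
 have slice: "AE x in m01. (%m. f m (t, x)) \<longlonglongrightarrow> u (t, x)" if t: "0 <= t" for t
 proof -
  have "AE x in m01. (%m. f m (t, x) - v (d m) t x) \<longlonglongrightarrow> 0"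
  proof (rule AE_tendsto_zero_of_summable_L1[OF _ le[OF t]])
   show "integrable m01 (%x. f m (t, x) - v (d m) t x)" for m
    using d(1)[of m] by (intro Bochner_Integration.integrable_diff integrable_m01_bounded[OF measurable_m01[OF sl] fb[OF t]]) auto
  qed
  then show ?thesis using v_AE[OF t]
  proof eventually_elim
   case (elim x)
   from tendsto_add[OF elim] show ?case by simp
  qed
 qed
 define P where "P = (%z. z \<in> Om --> (\<forall>k::nat. \<exists>n::nat. \<forall>m::nat\<in>{n..}. \<bar>f m z - u z\<bar> < 1 / real (Suc k)))"
 have Plim: "(\<forall>k::nat. \<exists>n::nat. \<forall>m::nat\<in>{n..}. \<bar>f m z - u z\<bar> < 1 / real (Suc k)) \<longleftrightarrow> (%m. f m z) \<longlonglongrightarrow> u z" for z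
 proof
  assume a: "\<forall>k::nat. \<exists>n::nat. \<forall>m::nat\<in>{n..}. \<bar>f m z - u z\<bar> < 1 / real (Suc k)"
  show "(%m. f m z) \<longlonglongrightarrow> u z"
  proof (rule LIMSEQ_I)
   fix r :: real assume "0 < r"
   then obtain k :: nat where k: "1 / real (Suc k) < r" using nat_approx_posE by blast
   obtain n where "\<forall>m\<in>{n..}. \<bar>f m z - u z\<bar> < 1 / real (Suc k)" using a by blast
   then show "\<exists>n. \<forall>m\<ge>n. norm (f m z - u z) < r" using k by (intro exI[of _ n]) force
  qed
 next
  assume a: "(%m. f m z) \<longlonglongrightarrow> u z"
  show "\<forall>k::nat. \<exists>n::nat. \<forall>m::nat\<in>{n..}. \<bar>f m z - u z\<bar> < 1 / real (Suc k)"
  proof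
   fix k
   have "0 < 1 / real (Suc k)" by simp
   from LIMSEQ_D[OF a this] show "\<exists>n::nat. \<forall>m::nat\<in>{n..}. \<bar>f m z - u z\<bar> < 1 / real (Suc k)" by auto
  qed
 qed
 have [measurable]: "f m \<in> borel_measurable (lborel \<Otimes>\<^sub>M lborel)" for m using f by (simp add: lborel_prod)
 have [measurable]: "u \<in> borel_measurable (lborel \<Otimes>\<^sub>M lborel)" by (simp add: lborel_prod)
 have "sets (lborel \<Otimes>\<^sub>M lborel) = sets (borel :: (real \<times> real) measure)" by (metis lborel_prod sets_lborel)
 then have [measurable]: "Om \<in> sets (lborel \<Otimes>\<^sub>M lborel)" using Om by (simp only:)
 have "AE z in (lborel \<Otimes>\<^sub>M lborel). P z"
 proof (rule lborel_pair.AE_pair_measure)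
  show "{z \<in> space (lborel \<Otimes>\<^sub>M lborel). P z} \<in> sets (lborel \<Otimes>\<^sub>M lborel)"
   unfolding P_def by measurable
  show "AE x in lborel. AE y in lborel. P (x, y)"
  proof (rule AE_I2)
   fix t :: real
   show "AE x in lborel. P (t, x)"
   proof (cases "0 <= t")
    case True
    have "AE x in lborel. x \<in> B --> (%m. f m (t, x)) \<longlonglongrightarrow> u (t, x)"
     using slice[OF True] by (subst (asm) AE_restrict_space_iff) auto
    then show ?thesis unfolding P_def Plim by eventually_elim (auto simp: Om_def)
   next
    case False then show ?thesis by (simp add: P_def Om_def)
   qed
  qed
 qed
 then have "AE z in lborel. P z" unfolding lborel_prod .
 then show ?thesis using Om unfolding P_def Plim by (subst AE_restrict_space_iff) auto
qed

end

section \<open>The discrete entropy inequality\<close>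

context fd
begin

definition quot :: "(real => real) => nat => nat => real" where
 "quot g n i = (if i = 0 \<or> N < i then 0 else (g (a n i) - g (a n (i - 1))) / h)"

text \<open>Summation by parts against \<open>\<phi> \<eta>'(b)\<close> for the new level \<open>b\<close>. The discrete product rule splits the
 increment of \<open>\<phi> \<eta>'(b)\<close>; the part with \<open>\<eta>'\<close> contributes \<open>\<phi> m \<Delta>b \<Delta>G(b)\<close>, which dominates the square of the jump
 of \<open>g\<close>. The hypotheses on \<open>\<phi>\<close> allow any sign if \<open>\<eta>\<close> is affine.\<close>

lemma discrete_entropy_step:
 fixes \<phi> m :: "nat => real" and \<eta> \<eta>' g :: "real => real"
 assumes g: "!!a b. (g b - g a)^2 <= (b - a) * (G b - G a)"
  and E1: "!!i. i <= N ==> \<phi> i * (\<eta> (a (Suc n) i) - \<eta> (a n i)) <= \<phi> i * \<eta>' (a (Suc n) i) * (a (Suc n) i - a n i)"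
  and E2: "!!i. 1 <= i ==> i <= N ==> \<eta>' (a (Suc n) i) - \<eta>' (a (Suc n) (i - 1)) = m i * (a (Suc n) i - a (Suc n) (i - 1))"
  and E3: "!!i. 1 <= i ==> i <= N ==> 0 <= \<phi> i * m i"
 shows "h * (\<Sum>i\<le>N. \<phi> i * (\<eta> (a (Suc n) i) - \<eta> (a n i)))
   + dt * h * (\<Sum>i\<le>N. k (real i * h) * \<eta>' (a (Suc n) (i - 1)) * ((\<phi> i - \<phi> (i - 1)) / h) * quot G (Suc n) i)
   + dt * h * (\<Sum>i\<le>N. k (real i * h) * \<phi> i * m i * (quot g (Suc n) i)^2) <= 0"
proof -
 define b where "b = a (Suc n)"
 define r where "r = (%i. \<phi> i * \<eta>' (b i))"
 define T where "T = (%i. k (real i * h) * \<eta>' (b (i - 1)) * ((\<phi> i - \<phi> (i - 1)) / h) * quot G (Suc n) i + k (real i * h) * \<phi> i * m i * (quot g (Suc n) i)^2)"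
 have T0: "T 0 = 0" by (simp add: T_def quot_def)
 have le: "h * h * T (Suc i) <= fl (Suc n) (Suc i) * (r (Suc i) - r i)" if i: "i < N" for i
 proof -
  define \<kappa> where "\<kappa> = k (real (Suc i) * h)"
  have \<kappa>: "0 < \<kappa>" unfolding \<kappa>_def using \<kappa>_pos[of "Suc i"] i by simp
  define dG where "dG = G (b (Suc i)) - G (b i)"
  define dg where "dg = g (b (Suc i)) - g (b i)"
  define db where "db = b (Suc i) - b i"
  define c where "c = \<phi> (Suc i) * m (Suc i)"
  have c0: "0 <= c" unfolding c_def using E3[of "Suc i"] i by simp
  have gg: "dg^2 <= db * dG" unfolding dg_def db_def dG_def by (rule g)
  have fl: "fl (Suc n) (Suc i) = \<kappa> * dG" using fl_Suc[OF i, of "Suc n"] by (simp add: \<kappa>_def dG_def b_def)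
  have "r (Suc i) - r i = \<phi> (Suc i) * (\<eta>' (b (Suc i)) - \<eta>' (b i)) + \<eta>' (b i) * (\<phi> (Suc i) - \<phi> i)"
   by (simp add: r_def algebra_simps)
  also have "\<eta>' (b (Suc i)) - \<eta>' (b i) = m (Suc i) * db" using E2[of "Suc i"] i by (simp add: b_def db_def)
  finally have rr: "r (Suc i) - r i = c * db + \<eta>' (b i) * (\<phi> (Suc i) - \<phi> i)" by (simp add: c_def)
  have q: "quot G (Suc n) (Suc i) = dG / h" "quot g (Suc n) (Suc i) = dg / h"
   using i by (auto simp: quot_def dG_def dg_def b_def)
  have "h * h * T (Suc i) = \<kappa> * \<eta>' (b i) * (\<phi> (Suc i) - \<phi> i) * dG + \<kappa> * c * dg^2"
   unfolding T_def q \<kappa>_def[symmetric] by (simp add: c_def power_divide field_simps power2_eq_square)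
  also have "\<kappa> * c * dg^2 <= \<kappa> * c * (db * dG)" using gg \<kappa> c0 by (intro mult_left_mono) auto
  also have "\<kappa> * \<eta>' (b i) * (\<phi> (Suc i) - \<phi> i) * dG + \<kappa> * c * (db * dG) = fl (Suc n) (Suc i) * (r (Suc i) - r i)"
   unfolding fl rr by (simp add: algebra_simps)
  finally show ?thesis by simp
 qed
 have "(\<Sum>i\<le>N. \<phi> i * (\<eta> (b i) - \<eta> (a n i))) <= (\<Sum>i\<le>N. (b i - a n i) * r i)"
  using E1 by (intro sum_mono) (auto simp: r_def b_def mult_ac)
 also have "... = - (dt / h^2) * (\<Sum>i<N. fl (Suc n) (Suc i) * (r (Suc i) - r i))"
  unfolding fl_def b_def by (rule nat_step_sum[OF step])
 finally have 1: "h * (\<Sum>i\<le>N. \<phi> i * (\<eta> (b i) - \<eta> (a n i))) <= h * (- (dt / h^2) * (\<Sum>i<N. fl (Suc n) (Suc i) * (r (Suc i) - r i)))"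
  by (rule mult_left_mono) simp
 have "h * h * (\<Sum>i\<le>N. T i) = (\<Sum>i<N. h * h * T (Suc i))"
  unfolding lessThan_Suc_atMost[symmetric] sum.lessThan_Suc_shift by (simp add: T0 sum_distrib_left)
 also have "... <= (\<Sum>i<N. fl (Suc n) (Suc i) * (r (Suc i) - r i))" using le by (intro sum_mono) auto
 finally have "(dt / h) * (h * h * (\<Sum>i\<le>N. T i)) <= (dt / h) * (\<Sum>i<N. fl (Suc n) (Suc i) * (r (Suc i) - r i))"
  using dt by (intro mult_left_mono) auto
 then have 2: "dt * h * (\<Sum>i\<le>N. T i) <= (dt / h) * (\<Sum>i<N. fl (Suc n) (Suc i) * (r (Suc i) - r i))" by simp
 have "h * (- (dt / h^2) * X) = - ((dt / h) * X)" for X by (simp add: power2_eq_square)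
 with 1 2 have "h * (\<Sum>i\<le>N. \<phi> i * (\<eta> (b i) - \<eta> (a n i))) + dt * h * (\<Sum>i\<le>N. T i) <= 0" by (simp only:)
 then show ?thesis unfolding T_def sum.distrib b_def by (simp add: distrib_left)
qed

lemma discrete_entropy:
 fixes \<phi> m :: "nat => nat => real" and \<eta> \<eta>' g :: "real => real"
 assumes g: "!!a b. (g b - g a)^2 <= (b - a) * (G b - G a)"
  and E1: "!!n i. i <= N ==> \<phi> n i * (\<eta> (a (Suc n) i) - \<eta> (a n i)) <= \<phi> n i * \<eta>' (a (Suc n) i) * (a (Suc n) i - a n i)"
  and E2: "!!n i. 1 <= i ==> i <= N ==> \<eta>' (a (Suc n) i) - \<eta>' (a (Suc n) (i - 1)) = m n i * (a (Suc n) i - a (Suc n) (i - 1))"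
  and E3: "!!n i. 1 <= i ==> i <= N ==> 0 <= \<phi> n i * m n i"
 shows "h * (\<Sum>i\<le>N. \<phi> J i * \<eta> (a J i)) - h * (\<Sum>i\<le>N. \<phi> 0 i * \<eta> (a 0 i))
   - dt * h * (\<Sum>n<J. \<Sum>i\<le>N. \<eta> (a (Suc n) i) * ((\<phi> (Suc n) i - \<phi> n i) / dt))
   + dt * h * (\<Sum>n<J. \<Sum>i\<le>N. k (real i * h) * \<eta>' (a (Suc n) (i - 1)) * ((\<phi> n i - \<phi> n (i - 1)) / h) * quot G (Suc n) i)
   + dt * h * (\<Sum>n<J. \<Sum>i\<le>N. k (real i * h) * \<phi> n i * m n i * (quot g (Suc n) i)^2) <= 0"
proof (induction J)
 case 0 then show ?case by simp
next
 case (Suc J)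
 let ?X = "\<Sum>i\<le>N. \<phi> J i * (\<eta> (a (Suc J) i) - \<eta> (a J i))"
 let ?Y = "\<Sum>i\<le>N. k (real i * h) * \<eta>' (a (Suc J) (i - 1)) * ((\<phi> J i - \<phi> J (i - 1)) / h) * quot G (Suc J) i"
 let ?Z = "\<Sum>i\<le>N. k (real i * h) * \<phi> J i * m J i * (quot g (Suc J) i)^2"
 let ?W = "\<Sum>i\<le>N. \<eta> (a (Suc J) i) * ((\<phi> (Suc J) i - \<phi> J i) / dt)"
 have s: "h * ?X + dt * h * ?Y + dt * h * ?Z <= 0"
  by (rule discrete_entropy_step[where \<phi>="\<phi> J" and m="m J" and n=J]) (use g E1 E2 E3 in auto)
 have "dt * ?W = (\<Sum>i\<le>N. \<eta> (a (Suc J) i) * (\<phi> (Suc J) i - \<phi> J i))"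
  unfolding sum_distrib_left using dt by (intro sum.cong) auto
 then have "?X = (\<Sum>i\<le>N. \<phi> (Suc J) i * \<eta> (a (Suc J) i)) - (\<Sum>i\<le>N. \<phi> J i * \<eta> (a J i)) - dt * ?W"
  by (simp add: sum_subtractf algebra_simps)
 then have "h * ?X = h * (\<Sum>i\<le>N. \<phi> (Suc J) i * \<eta> (a (Suc J) i)) - h * (\<Sum>i\<le>N. \<phi> J i * \<eta> (a J i)) - dt * h * ?W"
  by (simp only: right_diff_distrib mult.assoc mult.left_commute)
 then show ?case using Suc.IH s by (simp only: sum.lessThan_Suc distrib_left)
qed

lemma sum_a_sq: "h * (\<Sum>i\<le>N. (a n i)^2 / 2) <= M^2 / 2"
proof -
 have "(\<Sum>i\<le>N. (a n i)^2 / 2) <= (\<Sum>i\<le>N. M^2 / 2)"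
 proof (rule sum_mono)
  fix i assume "i \<in> {..N}"
  then have "\<bar>a n i\<bar> <= \<bar>M\<bar>" using a_bound[of i n] M0 by simp
  then show "(a n i)^2 / 2 <= M^2 / 2" by (simp add: abs_le_square_iff)
 qed
 also have "... = (real N + 1) * (M^2 / 2)" by simp
 finally have "h * (\<Sum>i\<le>N. (a n i)^2 / 2) <= h * ((real N + 1) * (M^2 / 2))" by (rule mult_left_mono) simp
 also have "... = ((real N + 1) * h) * (M^2 / 2)" by (simp only: mult_ac)
 finally show ?thesis by (simp only: dx_mult mult_1)
qed

text \<open>The entropy inequality for \<open>\<eta>(y) = y^2/2\<close>, where \<open>\<phi> = 1\<close> and \<open>m = 1\<close>.\<close>

lemma quot_L2_bound:
 assumes g: "!!a b. (g b - g a)^2 <= (b - a) * (G b - G a)"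
 shows "dt * h * (\<Sum>n<J. \<Sum>i\<le>N. (quot g (Suc n) i)^2) <= M^2 / (2 * k0)"
proof -
 have e: "h * (\<Sum>i\<le>N. 1 * ((a J i)^2 / 2)) - h * (\<Sum>i\<le>N. 1 * ((a 0 i)^2 / 2))
   - dt * h * (\<Sum>n<J. \<Sum>i\<le>N. ((a (Suc n) i)^2 / 2) * ((1 - 1) / dt))
   + dt * h * (\<Sum>n<J. \<Sum>i\<le>N. k (real i * h) * (a (Suc n) (i - 1)) * ((1 - 1) / h) * quot G (Suc n) i)
   + dt * h * (\<Sum>n<J. \<Sum>i\<le>N. k (real i * h) * 1 * 1 * (quot g (Suc n) i)^2) <= 0"
 proof (rule discrete_entropy[where \<phi>="%_ _. 1" and m="%_ _. 1" and \<eta>="%u. u^2 / 2" and \<eta>'="%u. u", OF g])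
  fix n i
  have "0 <= (a (Suc n) i - a n i)^2" by simp
  then show "1 * ((a (Suc n) i)^2 / 2 - (a n i)^2 / 2) <= 1 * a (Suc n) i * (a (Suc n) i - a n i)"
   by (simp add: power2_eq_square algebra_simps)
 qed auto
 have "k0 * (\<Sum>n<J. \<Sum>i\<le>N. (quot g (Suc n) i)^2) <= (\<Sum>n<J. \<Sum>i\<le>N. k (real i * h) * (quot g (Suc n) i)^2)"
  unfolding sum_distrib_left
 proof (intro sum_mono mult_right_mono)
  fix i assume "i \<in> {..N}"
  then show "k0 <= k (real i * h)" using k_bounds[OF node_in, of i] by simp
 qed simp
 then have "dt * h * (k0 * (\<Sum>n<J. \<Sum>i\<le>N. (quot g (Suc n) i)^2)) <= dt * h * (\<Sum>n<J. \<Sum>i\<le>N. k (real i * h) * (quot g (Suc n) i)^2)"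
  using dt by (intro mult_left_mono) auto
 also have "... <= h * (\<Sum>i\<le>N. (a 0 i)^2 / 2)"
 proof -
  have "0 <= h * (\<Sum>i\<le>N. (a J i)^2 / 2)" by (intro mult_nonneg_nonneg sum_nonneg) auto
  moreover from e have "h * (\<Sum>i\<le>N. (a J i)^2 / 2) - h * (\<Sum>i\<le>N. (a 0 i)^2 / 2)
    + dt * h * (\<Sum>n<J. \<Sum>i\<le>N. k (real i * h) * (quot g (Suc n) i)^2) <= 0" by simp
  ultimately show ?thesis by linarith
 qed
 also have "... <= M^2 / 2" by (rule sum_a_sq)
 finally show ?thesis using k0 by (simp add: field_simps)
qed

end

section \<open>Step functions in space-time\<close>

abbreviation MO :: "(real \<times> real) measure" where "MO \<equiv> restrict_space lborel Om"

lemma Om_borel [measurable]: "Om \<in> sets borel" unfolding Om_def by (intro borel_Times) auto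

lemma space_MO [simp]: "space MO = Om" by (simp add: space_restrict_space)

lemma measurable_MO: "f \<in> borel_measurable borel ==> f \<in> borel_measurable MO"
 by (rule measurable_restrict_space1) simp

definition rect :: "nat => real => nat => nat => (real \<times> real) set" where
 "rect N dt n i = {real n * dt..<(real n + 1) * dt} \<times> cell N i"

lemma rect_iff: "0 < dt ==> z \<in> rect N dt n i \<longleftrightarrow> z \<in> Om \<and> idx dt (fst z) = n \<and> idx (dx N) (snd z) = i"
proof -
 assume dt: "0 < dt"
 have "real n * dt <= t \<and> t < (real n + 1) * dt \<longleftrightarrow> 0 <= t \<and> idx dt t = n" for t
 proof (cases "0 <= t")
  case True then show ?thesis using idx_eq_iff[OF dt True] by blast
 next
  case False
  have "0 <= real n * dt" using dt by simp
  then show ?thesis using False by linarith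
 qed
 then show ?thesis by (cases z) (auto simp: rect_def Om_def cell_def)
qed

lemma rect_borel [measurable]: "rect N dt n i \<in> sets borel"
 unfolding rect_def by (intro borel_Times) auto

lemma emeasure_rect: assumes "0 < dt" "i <= N" shows "emeasure MO (rect N dt n i) = ennreal (dt * dx N)"
proof -
 have "emeasure MO (rect N dt n i) = emeasure lborel (rect N dt n i)"
  by (rule emeasure_restrict_space) (use rect_iff[OF assms(1)] in auto)
 also have "... = emeasure (lborel \<Otimes>\<^sub>M lborel) ({real n * dt..<(real n + 1) * dt} \<times> cell N i)"
  by (simp add: rect_def lborel_prod)
 also have "... = emeasure lborel {real n * dt..<(real n + 1) * dt} * emeasure lborel (cell N i)"
  by (rule lborel.emeasure_pair_measure_Times) auto
 also have "emeasure lborel {real n * dt..<(real n + 1) * dt} = ennreal dt"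
  using assms(1) by (simp add: algebra_simps)
 also have "emeasure lborel (cell N i) = ennreal (dx N)"
 proof -
  have "emeasure lborel (cell N i) <= emeasure lborel B" by (intro emeasure_mono) (auto simp: cell_def)
  then have "emeasure lborel (cell N i) \<noteq> \<infinity>" by (auto simp: top_unique)
  then show ?thesis using measure_cell[OF assms(2)] by (simp add: emeasure_eq_ennreal_measure)
 qed
 finally show ?thesis using assms(1) by (simp add: ennreal_mult)
qed

lemma rect_MO: "0 < dt ==> rect N dt n i \<in> sets MO"
 using rect_iff rect_borel by (subst sets_restrict_space_iff) auto

lemma step_decomposition:
 assumes dt: "0 < dt" and z: "z \<in> Om"
 shows "(if idx dt (fst z) < J then b (idx dt (fst z)) (idx (dx N) (snd z)) else (0::real))
  = (\<Sum>n<J. \<Sum>i\<le>N. b n i * indicator (rect N dt n i) z)"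
proof -
 have i: "idx (dx N) (snd z) <= N" using z by (intro idx_le_N) (auto simp: Om_def)
 have ind: "b n i * indicator (rect N dt n i) z = (if i = idx (dx N) (snd z) then if n = idx dt (fst z) then b n i else 0 else 0)" for n i
  using rect_iff[OF dt, of z N n i] z by (auto simp: indicator_def)
 have "(\<Sum>i\<le>N. b n i * indicator (rect N dt n i) z) = (if n = idx dt (fst z) then b n (idx (dx N) (snd z)) else 0)" for n
  unfolding ind using i by simp
 then show ?thesis by simp
qed

lemma integral_MO_step:
 assumes dt: "0 < dt"
 shows "integrable MO (%z. if idx dt (fst z) < J then b (idx dt (fst z)) (idx (dx N) (snd z)) else (0::real))"
  and "(\<integral>z. (if idx dt (fst z) < J then b (idx dt (fst z)) (idx (dx N) (snd z)) else 0) \<partial>MO) = dt * dx N * (\<Sum>n<J. \<Sum>i\<le>N. b n i)"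
proof -
 have ii: "integrable MO (%z. b n i * indicator (rect N dt n i) z)" if "i <= N" for n i
  using rect_MO[OF dt] emeasure_rect[OF dt that] by (intro integrable_mult_right) (simp add: integrable_real_indicator)
 have int: "(\<integral>z. indicat_real (rect N dt n i) z \<partial>MO) = dt * dx N" if "i <= N" for n i
 proof -
  have "rect N dt n i \<subseteq> space MO" using rect_iff[OF dt] by auto
  then have "(\<integral>z. indicat_real (rect N dt n i) z \<partial>MO) = measure MO (rect N dt n i)"
   by (simp add: Int_absorb2)
  also have "... = dt * dx N" using emeasure_rect[OF dt that, of n] dt by (simp add: measure_def)
  finally show ?thesis .
 qed
 have eq: "(if idx dt (fst z) < J then b (idx dt (fst z)) (idx (dx N) (snd z)) else 0) = (\<Sum>n<J. \<Sum>i\<le>N. b n i * indicator (rect N dt n i) z)"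
  if "z \<in> space MO" for z using step_decomposition[OF dt, of z J b N] that by simp
 show "integrable MO (%z. if idx dt (fst z) < J then b (idx dt (fst z)) (idx (dx N) (snd z)) else (0::real))"
 proof (rule iffD2[OF Bochner_Integration.integrable_cong[OF refl eq]])
  show "integrable MO (%z. \<Sum>n<J. \<Sum>i\<le>N. b n i * indicator (rect N dt n i) z)"
   by (intro Bochner_Integration.integrable_sum ii) simp
 qed
 have "(\<integral>z. (if idx dt (fst z) < J then b (idx dt (fst z)) (idx (dx N) (snd z)) else 0) \<partial>MO)
   = (\<integral>z. (\<Sum>n<J. \<Sum>i\<le>N. b n i * indicator (rect N dt n i) z) \<partial>MO)"
  by (rule lint_cong[OF refl eq])
 also have "... = (\<Sum>n<J. \<integral>z. (\<Sum>i\<le>N. b n i * indicator (rect N dt n i) z) \<partial>MO)"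
  by (rule Bochner_Integration.integral_sum, intro Bochner_Integration.integrable_sum ii) simp
 also have "... = (\<Sum>n<J. \<Sum>i\<le>N. b n i * (dt * dx N))"
 proof (rule sum.cong[OF refl])
  fix n
  have "(\<integral>z. (\<Sum>i\<le>N. b n i * indicator (rect N dt n i) z) \<partial>MO) = (\<Sum>i\<le>N. \<integral>z. b n i * indicator (rect N dt n i) z \<partial>MO)"
   by (rule Bochner_Integration.integral_sum, intro ii) simp
  also have "... = (\<Sum>i\<le>N. b n i * (dt * dx N))"
   by (rule sum.cong[OF refl], subst integral_mult_right_zero, subst int) auto
  finally show "(\<integral>z. (\<Sum>i\<le>N. b n i * indicator (rect N dt n i) z) \<partial>MO) = (\<Sum>i\<le>N. b n i * (dt * dx N))" .
 qed
 also have "... = dt * dx N * (\<Sum>n<J. \<Sum>i\<le>N. b n i)" by (simp add: sum_distrib_left mult.commute)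
 finally show "(\<integral>z. (if idx dt (fst z) < J then b (idx dt (fst z)) (idx (dx N) (snd z)) else 0) \<partial>MO) = dt * dx N * (\<Sum>n<J. \<Sum>i\<le>N. b n i)" .
qed

lemma step_MO_bound:
 assumes dt: "0 < dt" and b: "!!n i. 0 <= (b n i :: real)" and C: "!!J. dt * dx N * (\<Sum>n<J. \<Sum>i\<le>N. b n i) <= C"
 shows "integrable MO (%z. b (idx dt (fst z)) (idx (dx N) (snd z)))"
  and "(\<integral>z. b (idx dt (fst z)) (idx (dx N) (snd z)) \<partial>MO) <= C"
proof -
 define f where "f = (%z. b (idx dt (fst z)) (idx (dx N) (snd z)))"
 define F where "F = (%J z. if idx dt (fst z) < J then f z else 0)"
 have f0: "0 <= f z" for z using b by (simp add: f_def)
 have fm[measurable]: "f \<in> borel_measurable MO" unfolding f_def by (rule measurable_MO[OF step2_measurable])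
 have Fi: "integrable MO (F J)" and Fle: "(\<integral>z. F J z \<partial>MO) <= C" for J
  unfolding F_def f_def using integral_MO_step[OF dt, of J b N] C[of J] by (simp_all only:)
 have Flim: "(%J. F J z) \<longlonglongrightarrow> f z" for z
  by (rule tendsto_eventually, rule eventually_sequentiallyI[of "Suc (idx dt (fst z))"]) (auto simp: F_def)
 have "(\<integral>\<^sup>+z. ennreal (f z) \<partial>MO) = (\<integral>\<^sup>+z. liminf (%J. ennreal (F J z)) \<partial>MO)"
 proof (rule nn_integral_cong)
  fix z
  have "(%J. ennreal (F J z)) \<longlonglongrightarrow> ennreal (f z)" by (intro tendsto_ennrealI Flim)
  then show "ennreal (f z) = liminf (%J. ennreal (F J z))" using lim_imp_Liminf[OF sequentially_bot] by fastforce
 qed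
 also have "... <= liminf (%J. (\<integral>\<^sup>+z. ennreal (F J z) \<partial>MO))"
  by (rule nn_integral_liminf) (use Fi in auto)
 also have "... <= ennreal C"
 proof (rule Liminf_le)
  show "eventually (%J. (\<integral>\<^sup>+z. ennreal (F J z) \<partial>MO) <= ennreal C) sequentially"
  proof (rule always_eventually, rule allI)
   fix J
   have "(\<integral>\<^sup>+z. ennreal (F J z) \<partial>MO) = ennreal (\<integral>z. F J z \<partial>MO)"
    by (rule nn_integral_eq_integral[OF Fi]) (use f0 in \<open>auto simp: F_def\<close>)
   then show "(\<integral>\<^sup>+z. ennreal (F J z) \<partial>MO) <= ennreal C" using Fle by (simp add: ennreal_leI)
  qed
 qed simp
 finally have nn: "(\<integral>\<^sup>+z. ennreal (f z) \<partial>MO) <= ennreal C" .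
 have fi: "integrable MO f"
  by (rule integrableI_nonneg) (use nn f0 in \<open>auto simp: le_less_trans\<close>)
 then show "integrable MO (%z. b (idx dt (fst z)) (idx (dx N) (snd z)))" by (simp add: f_def)
 have C0: "0 <= C" using C[of 0] by simp
 have "ennreal (\<integral>z. f z \<partial>MO) <= ennreal C" using nn nn_integral_eq_integral[OF fi] f0 by simp
 then show "(\<integral>z. b (idx dt (fst z)) (idx (dx N) (snd z)) \<partial>MO) <= C" using C0 by (simp add: f_def)
qed

section \<open>Passage to the limit\<close>

lemma strip_dominated:
 fixes f :: "nat => real \<times> real => real"
 assumes fm[measurable]: "!!n. f n \<in> borel_measurable MO" "f' \<in> borel_measurable MO"
  and fb: "!!n z. z \<in> Om ==> \<bar>f n z\<bar> <= (if fst z <= T1 then C else 0)"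
  and fb': "!!z. z \<in> Om ==> \<bar>f' z\<bar> <= (if fst z <= T1 then C else 0)"
  and lim: "AE z in MO. (%n. f n z) \<longlonglongrightarrow> f' z"
 shows "L2 MO (f n)" "L2 MO f'" "(%n. \<integral>z. (f n z - f' z)^2 \<partial>MO) \<longlonglongrightarrow> 0"
  "integrable MO (f n)" "integrable MO f'" "(%n. \<integral>z. f n z \<partial>MO) \<longlonglongrightarrow> (\<integral>z. f' z \<partial>MO)"
proof -
 define S where "S = {z \<in> Om. fst z <= T1}"
 have S: "S = Om \<inter> ({..T1} \<times> UNIV)" by (auto simp: S_def)
 have Sb: "S \<in> sets borel" unfolding S by (intro sets.Int Om_borel borel_Times) auto
 have SMO: "S \<in> sets MO" 
 proof -
  have "S \<subseteq> Om" by (auto simp: S_def)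
  then show ?thesis using Sb by (subst sets_restrict_space_iff) auto
 qed
 have Sc: "S \<subseteq> cbox (0,0) (T1, 1)" 
 proof
  fix z assume "z \<in> S"
  then have "0 <= fst z" "fst z <= T1" "0 <= snd z" "snd z <= 1" by (auto simp: S_def Om_def)
  then show "z \<in> cbox (0,0) (T1, 1)" unfolding cbox_Pair_eq by (cases z) (simp add: mem_Times_iff)
 qed
 have "emeasure lborel S <= emeasure lborel (cbox (0::real,0::real) (T1, 1))" by (rule emeasure_mono[OF Sc]) simp
 also have "... < \<infinity>" by (rule emeasure_lborel_cbox_finite)
 finally have "emeasure lborel S < \<infinity>" .
 then have "emeasure MO S < \<infinity>" 
 proof -
  have "emeasure MO S = emeasure lborel S" by (rule emeasure_restrict_space) (simp, use S in blast)
  then show ?thesis using \<open>emeasure lborel S < \<infinity>\<close> by simp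
 qed
 then have Si: "integrable MO (%z. D * indicator S z)" for D :: real
  using SMO by (intro integrable_mult_right) (simp add: integrable_real_indicator)
 have C0: "0 <= \<bar>C\<bar>" by simp
 have b: "\<bar>f n z\<bar> <= \<bar>C\<bar> * indicator S z" "\<bar>f' z\<bar> <= \<bar>C\<bar> * indicator S z" if "z \<in> Om" for n z
  using fb[OF that, of n] fb'[OF that] that by (auto simp: S_def indicator_def split: if_splits)
 have b2: "(f n z)^2 <= C^2 * indicator S z" "(f' z)^2 <= C^2 * indicator S z" "(f n z - f' z)^2 <= (2 * C)^2 * indicator S z" if "z \<in> Om" for n z
 proof -
  have sq: "y^2 <= D^2 * indicator S z" if "\<bar>y\<bar> <= \<bar>D\<bar> * indicator S z" for y D :: real
   using that abs_le_square_iff[of y D] by (cases "z \<in> S") auto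
  show "(f n z)^2 <= C^2 * indicator S z" by (rule sq[OF b(1)[OF that]])
  show "(f' z)^2 <= C^2 * indicator S z" by (rule sq[OF b(2)[OF that]])
  have "\<bar>f n z - f' z\<bar> <= \<bar>2 * C\<bar> * indicator S z" using b(1)[OF that, of n] b(2)[OF that] by (simp add: abs_mult)
  then show "(f n z - f' z)^2 <= (2 * C)^2 * indicator S z" by (rule sq)
 qed
 have ae: "AE z in MO. z \<in> Om" using AE_space[of MO] by simp
 show "integrable MO (f n)" by (rule dominated_integrable[OF Si[of "\<bar>C\<bar>"]]) (use b ae in \<open>auto elim!: eventually_mono\<close>)
 show "integrable MO f'" by (rule dominated_integrable[OF Si[of "\<bar>C\<bar>"]]) (use b ae in \<open>auto elim!: eventually_mono\<close>)
 have "integrable MO (%z. (f n z)^2)" by (rule dominated_integrable[OF Si[of "C^2"]]) (use b2 ae in \<open>auto elim!: eventually_mono\<close>)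
 then show "L2 MO (f n)" by (simp add: L2_real)
 have "integrable MO (%z. (f' z)^2)" by (rule dominated_integrable[OF Si[of "C^2"]]) (use b2 ae in \<open>auto elim!: eventually_mono\<close>)
 then show "L2 MO f'" by (simp add: L2_real)
 show "(%n. \<integral>z. f n z \<partial>MO) \<longlonglongrightarrow> (\<integral>z. f' z \<partial>MO)"
  by (rule integral_dominated_convergence[OF _ _ Si[of "\<bar>C\<bar>"] lim]) (use b ae in \<open>auto elim!: eventually_mono\<close>)
 have "(%n. \<integral>z. (f n z - f' z)^2 \<partial>MO) \<longlonglongrightarrow> (\<integral>z. 0 \<partial>MO)"
 proof (rule integral_dominated_convergence[OF _ _ Si[of "(2 * C)^2"]])
  show "AE z in MO. (%n. (f n z - f' z)^2) \<longlonglongrightarrow> 0"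
   using lim
  proof eventually_elim
   case (elim z)
   have "(%n. (f n z - f' z)^2) \<longlonglongrightarrow> (f' z - f' z)^2" by (intro tendsto_intros elim)
   then show ?case by simp
  qed
 qed (use b2 ae in \<open>auto elim!: eventually_mono\<close>)
 then show "(%n. \<integral>z. (f n z - f' z)^2 \<partial>MO) \<longlonglongrightarrow> 0" by simp
qed

text \<open>Continuity of the partial derivatives is required only at the point: in the layer test functions below
 the derivative in \<open>x\<close> jumps across a null set.\<close>

definition C1_near :: "(real \<times> real => real) => (real \<times> real => real) => (real \<times> real => real) => real \<times> real => bool" where
 "C1_near \<phi> \<phi>t \<phi>x z \<longleftrightarrow> isCont \<phi>t z \<and> isCont \<phi>x z \<and>
   (\<exists>r>0. \<forall>z'. dist z' z < r --> ((%s. \<phi> (s, snd z')) has_real_derivative \<phi>t z') (at (fst z')) \<and>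
     ((%y. \<phi> (fst z', y)) has_real_derivative \<phi>x z') (at (snd z')))"

lemma C1_near_time_quotient:
 assumes z: "C1_near \<phi> \<phi>t \<phi>x (t, x)" and s: "s \<longlonglongrightarrow> t" and y: "y \<longlonglongrightarrow> x" and e: "e \<longlonglongrightarrow> 0" "!!m::nat. 0 < e m"
 shows "(%m. (\<phi> (s m + e m, y m) - \<phi> (s m, y m)) / e m) \<longlonglongrightarrow> \<phi>t (t, x)"
proof (rule LIMSEQ_I)
 fix r' :: real assume r': "0 < r'"
 obtain r where r: "0 < r" "!!z'. dist z' (t, x) < r ==> ((%s. \<phi> (s, snd z')) has_real_derivative \<phi>t z') (at (fst z'))"
  using z unfolding C1_near_def by meson
 have "isCont \<phi>t (t, x)" using z by (simp add: C1_near_def)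
 then obtain \<delta> where \<delta>: "0 < \<delta>" "!!z'. dist z' (t, x) < \<delta> ==> dist (\<phi>t z') (\<phi>t (t, x)) < r'"
  using r' unfolding continuous_at_eps_delta by blast
 have "(%m. dist (s m, y m) (t, x) + e m) \<longlonglongrightarrow> dist (t, x) (t, x) + 0" by (intro tendsto_intros s y e)
 then have "eventually (%m. dist (s m, y m) (t, x) + e m < min r \<delta>) sequentially"
  using r \<delta> by (intro order_tendstoD(2)) auto
 then obtain m0 where m0: "!!m. m0 <= m ==> dist (s m, y m) (t, x) + e m < min r \<delta>" by (auto simp: eventually_sequentially)
 show "\<exists>no. \<forall>m\<ge>no. norm ((\<phi> (s m + e m, y m) - \<phi> (s m, y m)) / e m - \<phi>t (t, x)) < r'"
 proof (intro exI[of _ m0] allI impI)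
  fix m assume m: "m0 <= m"
  have near: "dist (\<xi>, y m) (t, x) < min r \<delta>" if "s m <= \<xi>" "\<xi> <= s m + e m" for \<xi>
  proof -
   have "dist (\<xi>, y m) (t, x) <= dist (\<xi>, y m) (s m, y m) + dist (s m, y m) (t, x)" by (rule dist_triangle)
   also have "dist (\<xi>, y m) (s m, y m) <= e m" using that by (simp add: dist_Pair_Pair dist_real_def)
   finally show ?thesis using m0[OF m] by linarith
  qed
  obtain \<xi> where \<xi>: "s m < \<xi>" "\<xi> < s m + e m" "\<phi> (s m + e m, y m) - \<phi> (s m, y m) = (s m + e m - s m) * \<phi>t (\<xi>, y m)"
   using MVT2[of "s m" "s m + e m" "%s. \<phi> (s, y m)" "%s. \<phi>t (s, y m)"] e(2)[of m] r(2)[of "(_, y m)"] near by auto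
  have "(\<phi> (s m + e m, y m) - \<phi> (s m, y m)) / e m = \<phi>t (\<xi>, y m)" using \<xi>(3) e(2)[of m] by simp
  then show "norm ((\<phi> (s m + e m, y m) - \<phi> (s m, y m)) / e m - \<phi>t (t, x)) < r'"
   using \<delta>(2)[of "(\<xi>, y m)"] near[of \<xi>] \<xi> by (simp add: dist_norm)
 qed
qed

lemma C1_near_space_quotient:
 assumes z: "C1_near \<phi> \<phi>t \<phi>x (t, x)" and s: "s \<longlonglongrightarrow> t" and y: "y \<longlonglongrightarrow> x" and e: "e \<longlonglongrightarrow> 0" "!!m::nat. 0 < e m"
 shows "(%m. (\<phi> (s m, y m + e m) - \<phi> (s m, y m)) / e m) \<longlonglongrightarrow> \<phi>x (t, x)"
proof -
 have p: "dist (b, a) (d, c) = dist (a, b) (c, d)" for a b c d :: real by (simp add: dist_Pair_Pair add.commute)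
 have "C1_near (%z. \<phi> (snd z, fst z)) (%z. \<phi>x (snd z, fst z)) (%z. \<phi>t (snd z, fst z)) (x, t)"
  unfolding C1_near_def
 proof (intro conjI)
  have c: "isCont (%z. (snd z, fst z)) (x, t)" by (intro continuous_intros)
  show "isCont (%z. \<phi>x (snd z, fst z)) (x, t)" "isCont (%z. \<phi>t (snd z, fst z)) (x, t)"
   by (rule isCont_o2[OF c], use z in \<open>simp add: C1_near_def\<close>)+
  obtain r where r: "0 < r" "!!z'. dist z' (t, x) < r ==> ((%s. \<phi> (s, snd z')) has_real_derivative \<phi>t z') (at (fst z')) \<and>
     ((%y. \<phi> (fst z', y)) has_real_derivative \<phi>x z') (at (snd z'))"
   using z unfolding C1_near_def by meson
  show "\<exists>r>0. \<forall>z'. dist z' (x, t) < r -->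
      ((%s. \<phi> (snd (s, snd z'), fst (s, snd z'))) has_real_derivative \<phi>x (snd z', fst z')) (at (fst z')) \<and>
      ((%y. \<phi> (snd (fst z', y), fst (fst z', y))) has_real_derivative \<phi>t (snd z', fst z')) (at (snd z'))"
  proof (intro exI[of _ r] conjI allI impI)
   fix z' assume "dist z' (x, t) < r"
   then have "dist (snd z', fst z') (t, x) < r" by (cases z') (simp add: p)
   from r(2)[OF this]
   show "((%s. \<phi> (snd (s, snd z'), fst (s, snd z'))) has_real_derivative \<phi>x (snd z', fst z')) (at (fst z'))"
    "((%y. \<phi> (snd (fst z', y), fst (fst z', y))) has_real_derivative \<phi>t (snd z', fst z')) (at (snd z'))" by auto
  qed (rule r)
 qed
 from C1_near_time_quotient[OF this y s e] show ?thesis by simp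
qed

text \<open>Lipschitz test functions that are \<open>C\<^sup>1\<close> near almost every point and vanish for late times, with no
 condition at the lateral boundary.\<close>

definition admissible :: "(real \<times> real => real) => (real \<times> real => real) => (real \<times> real => real) => real => real => bool" where
 "admissible \<phi> \<phi>t \<phi>x \<Lambda> T0 \<longleftrightarrow> 0 <= \<Lambda> \<and> 0 <= T0 \<and>
   (\<forall>t s x. \<bar>\<phi> (t, x) - \<phi> (s, x)\<bar> <= \<Lambda> * \<bar>t - s\<bar>) \<and> (\<forall>t x y. \<bar>\<phi> (t, x) - \<phi> (t, y)\<bar> <= \<Lambda> * \<bar>x - y\<bar>) \<and>
   (\<forall>t x. T0 <= t --> \<phi> (t, x) = 0) \<and> \<phi>t \<in> borel_measurable borel \<and> \<phi>x \<in> borel_measurable borel \<and>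
   (\<forall>z. \<bar>\<phi>t z\<bar> <= \<Lambda> \<and> \<bar>\<phi>x z\<bar> <= \<Lambda>) \<and> (AE z in MO. C1_near \<phi> \<phi>t \<phi>x z)"

lemma admissible_bound:
 assumes "admissible \<phi> \<phi>t \<phi>x \<Lambda> T0" "0 <= t"
 shows "\<bar>\<phi> (t, x)\<bar> <= \<Lambda> * T0"
proof (cases "t <= T0")
 case True
 have a: "\<forall>t s x. \<bar>\<phi> (t, x) - \<phi> (s, x)\<bar> <= \<Lambda> * \<bar>t - s\<bar>" "\<forall>t x. T0 <= t --> \<phi> (t, x) = 0"
  using assms(1) unfolding admissible_def by blast+
 have "\<phi> (T0, x) = 0" using a(2) by blast
 moreover have "\<bar>\<phi> (t, x) - \<phi> (T0, x)\<bar> <= \<Lambda> * \<bar>t - T0\<bar>" using a(1) by blast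
 moreover have "\<Lambda> * \<bar>t - T0\<bar> <= \<Lambda> * T0" using assms True by (intro mult_left_mono) (auto simp: admissible_def)
 ultimately show ?thesis by simp
next
 case False then show ?thesis using assms by (simp add: admissible_def)
qed

lemma admissible_lip:
 assumes "admissible \<phi> \<phi>t \<phi>x \<Lambda> T0"
 shows "\<bar>\<phi> (t, x) - \<phi> (s, y)\<bar> <= \<Lambda> * \<bar>t - s\<bar> + \<Lambda> * \<bar>x - y\<bar>"
proof -
 have "\<bar>\<phi> (t, x) - \<phi> (s, x)\<bar> <= \<Lambda> * \<bar>t - s\<bar>" "\<bar>\<phi> (s, x) - \<phi> (s, y)\<bar> <= \<Lambda> * \<bar>x - y\<bar>"
  using assms by (auto simp: admissible_def)
 then show ?thesis by linarith
qed

lemma admissible_tendsto: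
 assumes "admissible \<phi> \<phi>t \<phi>x \<Lambda> T0" "s \<longlonglongrightarrow> t" "y \<longlonglongrightarrow> x"
 shows "(%m. \<phi> (s m, y m)) \<longlonglongrightarrow> \<phi> (t, x)"
proof (rule LIM_zero_cancel, rule Lim_null_comparison)
 show "eventually (%m. norm (\<phi> (s m, y m) - \<phi> (t, x)) <= \<Lambda> * \<bar>s m - t\<bar> + \<Lambda> * \<bar>y m - x\<bar>) sequentially"
  using admissible_lip[OF assms(1)] by (intro always_eventually allI) auto
 have "(%m. \<Lambda> * \<bar>s m - t\<bar> + \<Lambda> * \<bar>y m - x\<bar>) \<longlonglongrightarrow> \<Lambda> * \<bar>t - t\<bar> + \<Lambda> * \<bar>x - x\<bar>" by (intro tendsto_intros assms)
 then show "(%m. \<Lambda> * \<bar>s m - t\<bar> + \<Lambda> * \<bar>y m - x\<bar>) \<longlonglongrightarrow> 0" by simp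
qed

lemma admissible_measurable:
 assumes "admissible \<phi> \<phi>t \<phi>x \<Lambda> T0"
 shows "\<phi> \<in> borel_measurable borel"
proof (rule borel_measurable_continuous_onI, rule lipschitz_on_continuous_on[of "2 * \<Lambda>"], rule lipschitz_onI)
 show L: "0 <= 2 * \<Lambda>" using assms by (simp add: admissible_def)
 fix z w :: "real \<times> real"
 obtain t x s y where zw: "z = (t, x)" "w = (s, y)" by (cases z; cases w)
 have "\<bar>t - s\<bar> <= dist z w" "\<bar>x - y\<bar> <= dist z w"
  using dist_fst_le[of z w] dist_snd_le[of z w] by (simp_all add: zw dist_real_def)
 then have "\<Lambda> * \<bar>t - s\<bar> + \<Lambda> * \<bar>x - y\<bar> <= \<Lambda> * dist z w + \<Lambda> * dist z w" using L by (intro add_mono mult_left_mono) auto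
 then show "dist (\<phi> z) (\<phi> w) <= 2 * \<Lambda> * dist z w"
  using admissible_lip[OF assms, of t x s y] by (simp add: zw dist_real_def)
qed

locale fd_limit = fd_family G k L k0 k1 K M V I c N A
 for G k L k0 k1 K M V I c N A +
 fixes ub g :: "real => real"
 assumes ub: "ub \<in> borel_measurable borel" "!!x. \<bar>ub x\<bar> <= M"
  and avg: "!!dt i. 0 < dt ==> i <= N dt ==> A dt 0 i = 1 / dx (N dt) * (\<integral>x. indicator (cell (N dt) i) x * ub x \<partial>m01)"
  and g: "!!a b. (g b - g a)^2 <= (b - a) * (G b - G a)" and g_cont: "continuous_on UNIV g"
begin

abbreviation "NN m \<equiv> N (d m)"
abbreviation "AA m \<equiv> A (d m)"
definition ud :: "nat => real \<times> real => real" where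
 "ud m z = AA m (Suc (idx (d m) (fst z))) (idx (h m) (snd z))"
definition ul :: "nat => real \<times> real => real" where
 "ul m z = AA m (Suc (idx (d m) (fst z))) (idx (h m) (snd z) - 1)"
definition X :: "(real => real) => nat => real \<times> real => real" where
 "X f m z = fd.quot (NN m) (AA m) f (Suc (idx (d m) (fst z))) (idx (h m) (snd z))"

lemmas fdm = fd[OF d(1)]

lemma ud_measurable: "ud m \<in> borel_measurable borel"
 unfolding ud_def by (rule step2_measurable[of "%n i. AA m (Suc n) i"])
lemma ul_measurable: "ul m \<in> borel_measurable borel"
 unfolding ul_def by (rule step2_measurable[of "%n i. AA m (Suc n) (i - 1)"])

lemma A_bound: "i <= NN m ==> \<bar>AA m n i\<bar> <= M" by (rule fd.a_bound[OF fdm])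

lemma ud_bound: "x \<in> B ==> \<bar>ud m (t, x)\<bar> <= M"
 unfolding ud_def using idx_le_N[of x "NN m"] by (intro A_bound) simp
lemma ul_bound: "x \<in> B ==> \<bar>ul m (t, x)\<bar> <= M"
 unfolding ul_def using idx_le_N[of x "NN m"] by (intro A_bound) simp

lemma ud_slice: "(%x. ud m (t, x)) = fd.s (NN m) (AA m) (Suc (idx (d m) t))"
 by (auto simp: ud_def fd.s_def[OF fdm])

lemma ud_L1: "(\<integral>x. \<bar>ud m (t, x) - v (d m) t x\<bar> \<partial>m01) <= Ct * (1/2)^m"
proof -
 have "(\<integral>x. \<bar>ud m (t, x) - v (d m) t x\<bar> \<partial>m01) <= Ct * sqrt (d m)"
  using fd.L1_step[OF fdm, of m "idx (d m) t"] unfolding v_s[OF d(1)] Ct_def ud_slice[symmetric] by simp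
 also have "... <= Ct * (1/2)^m" using sqrt_d(1) Ct0 by (rule mult_left_mono)
 finally show ?thesis .
qed

lemma ud_slice_measurable: "(%x. ud m (t, x)) \<in> borel_measurable m01"
 unfolding ud_slice by (rule fd.s_measurable'[OF fdm])

lemma ul_slice_measurable: "(%x. ul m (t, x)) \<in> borel_measurable m01"
 unfolding ul_def by (rule measurable_m01) (use step_measurable[of "%i. AA m (Suc (idx (d m) t)) (i - 1)"] in simp)

lemma ul_L1: "(\<integral>x. \<bar>ul m (t, x) - v (d m) t x\<bar> \<partial>m01) <= (Ct + V / sqrt c) * (1/2)^m"
proof -
 define n where "n = Suc (idx (d m) t)"
 have i: "integrable m01 (%x. \<bar>ul m (t, x) - ud m (t, x)\<bar>)" "integrable m01 (%x. \<bar>ud m (t, x) - v (d m) t x\<bar>)"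
  "integrable m01 (%x. \<bar>ul m (t, x) - v (d m) t x\<bar>)"
  using integrable_m01_bounded[OF ud_slice_measurable ud_bound] integrable_m01_bounded[OF ul_slice_measurable ul_bound] v_integrable[OF d(1)] by auto
 have "(\<integral>x. \<bar>ul m (t, x) - ud m (t, x)\<bar> \<partial>m01) = (\<integral>x. (%i. \<bar>AA m n (i - 1) - AA m n i\<bar>) (idx (h m) x) \<partial>m01)"
  by (simp add: ul_def ud_def n_def)
 also have "... = h m * (\<Sum>i\<le>NN m. \<bar>AA m n (i - 1) - AA m n i\<bar>)" by (rule integral_step)
 also have "(\<Sum>i\<le>NN m. \<bar>AA m n (i - 1) - AA m n i\<bar>) = (\<Sum>i<NN m. \<bar>AA m n (Suc i) - AA m n i\<bar>)"
  unfolding lessThan_Suc_atMost[symmetric] sum.lessThan_Suc_shift by (simp add: abs_minus_commute)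
 also have "h m * ... <= h m * V" using fd.a_tv[OF fdm] by (intro mult_left_mono) auto
 also have "... <= ((1 / sqrt c) * (1/2)^m) * V" using h_le V0 by (rule mult_right_mono)
 finally have 1: "(\<integral>x. \<bar>ul m (t, x) - ud m (t, x)\<bar> \<partial>m01) <= V / sqrt c * (1/2)^m" by (simp add: mult_ac)
 have "(\<integral>x. \<bar>ul m (t, x) - v (d m) t x\<bar> \<partial>m01) <= (\<integral>x. \<bar>ul m (t, x) - ud m (t, x)\<bar> + \<bar>ud m (t, x) - v (d m) t x\<bar> \<partial>m01)"
  using i by (intro integral_mono) auto
 also have "... = (\<integral>x. \<bar>ul m (t, x) - ud m (t, x)\<bar> \<partial>m01) + (\<integral>x. \<bar>ud m (t, x) - v (d m) t x\<bar> \<partial>m01)"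
  using i by simp
 also have "... <= (Ct + V / sqrt c) * (1/2)^m" using 1 ud_L1[of m t] by (simp only: distrib_right)
 finally show ?thesis .
qed

lemma ud_AE: "AE z in MO. (%m. ud m z) \<longlonglongrightarrow> u z"
 by (rule perturbed_AE[OF ud_measurable ud_bound ud_L1])
lemma ul_AE: "AE z in MO. (%m. ul m z) \<longlonglongrightarrow> u z"
 by (rule perturbed_AE[OF ul_measurable ul_bound ul_L1])

definition CX :: real where "CX = (L + 1) * (M^2 / (2 * k0))"

lemma X_measurable: "X f m \<in> borel_measurable MO"
 unfolding X_def by (rule measurable_MO[OF step2_measurable[of "%n i. fd.quot (NN m) (AA m) f (Suc n) i"]])

lemma X_bound:
 assumes f: "!!a b. (f b - f a)^2 <= (b - a) * (G b - G a)"
 shows "L2 MO (X f m)" "(\<integral>z. (X f m z)^2 \<partial>MO) <= M^2 / (2 * k0)"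
proof -
 have "integrable MO (%z. (%n i. (fd.quot (NN m) (AA m) f (Suc n) i)^2) (idx (d m) (fst z)) (idx (h m) (snd z)))"
  by (rule step_MO_bound(1)[OF d(1) _ fd.quot_L2_bound[OF fdm f]]) simp
 then show "L2 MO (X f m)"
  unfolding L2_real using X_measurable by (simp add: X_def)
 have "(\<integral>z. (%n i. (fd.quot (NN m) (AA m) f (Suc n) i)^2) (idx (d m) (fst z)) (idx (h m) (snd z)) \<partial>MO) <= M^2 / (2 * k0)"
  by (rule step_MO_bound(2)[OF d(1) _ fd.quot_L2_bound[OF fdm f]]) simp
 then show "(\<integral>z. (X f m z)^2 \<partial>MO) <= M^2 / (2 * k0)" by (simp add: X_def)
qed

lemma X_G_bound: "L2 MO (X G m)" "(\<integral>z. (X G m z)^2 \<partial>MO) <= CX"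
proof -
 define f where "f = (%x. G x / sqrt (L + 1))"
 have L1: "0 < L + 1" using L0 by simp
 have f: "(f b - f a)^2 <= (b - a) * (G b - G a)" for a b
 proof -
  have ab: "\<bar>G b - G a\<bar> <= (L + 1) * \<bar>b - a\<bar>"
   using fd.G_lip[OF fdm, of b a] mult_right_mono[of L "L + 1" "\<bar>b - a\<bar>"] by simp
  have nn: "0 <= (b - a) * (G b - G a)"
   using monoD[OF fd.mono[OF fdm], of a b] monoD[OF fd.mono[OF fdm], of b a] by (cases "a <= b") (auto simp: mult_nonpos_nonpos)
  have "(f b - f a)^2 = (G b - G a)^2 / (L + 1)"
   using L1 by (simp add: f_def power_divide flip: diff_divide_distrib)
  also have "(G b - G a)^2 = \<bar>G b - G a\<bar> * \<bar>G b - G a\<bar>" by (simp add: power2_eq_square)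
  also have "\<bar>G b - G a\<bar> * \<bar>G b - G a\<bar> <= ((L + 1) * \<bar>b - a\<bar>) * \<bar>G b - G a\<bar>" using ab by (intro mult_right_mono) auto
  also have "... = (L + 1) * ((b - a) * (G b - G a))" using nn by (simp add: mult.assoc flip: abs_mult)
  finally show ?thesis using L1 by (simp add: divide_right_mono)
 qed
 have eq: "X G m z = sqrt (L + 1) * X f m z" for z
  unfolding X_def fd.quot_def[OF fdm] f_def using L1 by (simp add: diff_divide_distrib[symmetric])
 show "L2 MO (X G m)"
  using L2_scaleR[OF X_bound(1)[OF f], of "sqrt (L + 1)" m] by (simp add: eq[abs_def])
 have "(\<integral>z. (X G m z)^2 \<partial>MO) = (L + 1) * (\<integral>z. (X f m z)^2 \<partial>MO)"
  unfolding eq power_mult_distrib using L1 by simp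
 also have "... <= CX" unfolding CX_def using X_bound(2)[OF f] L1 by (intro mult_left_mono) auto
 finally show "(\<integral>z. (X G m z)^2 \<partial>MO) <= CX" .
qed

text \<open>\<open>q\<close> and \<open>p\<close> are limits of the quotients of \<open>G(u)\<close> and \<open>g(u)\<close> in the only sense that is used: linear and
 weighted quadratic inequalities pass to them.\<close>

definition weak_lim :: "(real \<times> real => real) => (real \<times> real => real) => bool" where
 "weak_lim q p \<longleftrightarrow> L2 MO q \<and> L2 MO p \<and>
  (\<forall>\<psi>n \<psi> \<theta>n \<theta> wn w W an a.
   (\<forall>n. L2 MO (\<psi>n n)) --> L2 MO \<psi> --> (%n. \<integral>x. (\<psi>n n x - \<psi> x)^2 \<partial>MO) \<longlonglongrightarrow> 0 -->
   (\<forall>n. L2 MO (\<theta>n n)) --> L2 MO \<theta> --> (%n. \<integral>x. (\<theta>n n x - \<theta> x)^2 \<partial>MO) \<longlonglongrightarrow> 0 -->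
   (\<forall>n. wn n \<in> borel_measurable MO) --> w \<in> borel_measurable MO --> (\<forall>n x. 0 <= wn n x) --> (\<forall>n x. wn n x <= W) -->
   (\<forall>x. 0 <= w x) --> (\<forall>x. w x <= W) --> (AE x in MO. (%n. wn n x) \<longlonglongrightarrow> w x) --> an \<longlonglongrightarrow> a -->
   eventually (%n. (\<integral>x. wn n x * (X g n x)^2 \<partial>MO) + (\<integral>x. \<psi>n n x * X G n x \<partial>MO) + (\<integral>x. \<theta>n n x * X g n x \<partial>MO) <= an n) sequentially
   --> (\<integral>x. w x * (p x)^2 \<partial>MO) + (\<integral>x. \<psi> x * q x \<partial>MO) + (\<integral>x. \<theta> x * p x \<partial>MO) <= a)"

lemma weak_lim_exists: "\<exists>q p. weak_lim q p"
proof -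
 have "M^2 / (2 * k0) <= CX"
  unfolding CX_def using mult_right_mono[of 1 "L + 1" "M^2 / (2 * k0)"] L0 k01 by simp
 then have pC: "(\<integral>z. (X g m z)^2 \<partial>MO) <= CX" for m using X_bound(2)[OF g] by (meson order_trans)
 show ?thesis
  apply (rule weak_limit_exists[of MO "X G" "X g" CX, OF X_G_bound(1) X_bound(1)[OF g] X_G_bound(2) pC])
  subgoal for q p
   unfolding weak_lim_def by (intro exI[of _ q] exI[of _ p] conjI allI impI) blast+
  done
qed

end

lemma idx_times_tendsto:
 assumes e: "e \<longlonglongrightarrow> 0" "!!m::nat. 0 < e m" and x: "0 <= x"
 shows "(%m. real (idx (e m) x) * e m) \<longlonglongrightarrow> x"
proof (rule LIM_zero_cancel, rule Lim_null_comparison[OF _ e(1)])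
 show "eventually (%m. norm (real (idx (e m) x) * e m - x) <= e m) sequentially"
 proof (rule always_eventually, rule allI)
  fix m
  show "norm (real (idx (e m) x) * e m - x) <= e m"
   using idx_bounds[OF e(2)[of m] x] by (simp add: algebra_simps abs_le_iff)
 qed
qed

lemma idx_pos_eventually:
 assumes e: "e \<longlonglongrightarrow> 0" "!!m::nat. 0 < e m" and x: "0 < x"
 shows "eventually (%m. 1 <= idx (e m) x) sequentially"
proof -
 have "eventually (%m. e m < x) sequentially" using e(1) x by (intro order_tendstoD(2)) auto
 then show ?thesis
 proof eventually_elim
  case (elim m)
  show ?case
  proof (rule ccontr)
   assume "\<not> 1 <= idx (e m) x"
   then have "idx (e m) x = 0" by simp
   then show False using idx_bounds(2)[OF e(2)[of m], of x] x elim by simp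
  qed
 qed
qed

context fd_limit
begin

lemma k_MO: "(%z. k (snd z)) \<in> borel_measurable MO"
proof -
 have "k \<in> borel_measurable m01" using fd.k_measurable[OF fdm[of 0]] .
 then have "(%x. indicator B x *\<^sub>R k x) \<in> borel_measurable lborel"
  by (subst (asm) borel_measurable_restrict_space_iff) auto
 then have "(%x. indicator B x *\<^sub>R k x) \<in> borel_measurable borel" by simp
 then have "(%z::real \<times> real. indicator B (snd z) *\<^sub>R k (snd z)) \<in> borel_measurable borel"
  by (rule measurable_compose[rotated]) (auto intro!: borel_measurable_continuous_onI continuous_intros)
 then have "(%z::real \<times> real. indicator B (snd z) *\<^sub>R k (snd z)) \<in> borel_measurable MO" by (rule measurable_MO)
 moreover have "indicator B (snd z) *\<^sub>R k (snd z) = k (snd z)" if "z \<in> space MO" for z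
 proof -
  have "z \<in> Om" using that by simp
  then have "snd z \<in> B" by (auto simp: Om_def)
  then show ?thesis by simp
 qed
 ultimately show ?thesis by (subst measurable_cong[symmetric]) auto
qed

lemma k_tendsto:
 assumes "x \<in> B" "y \<longlonglongrightarrow> x" "!!m. y m \<in> {0..1}"
 shows "(%m. k (y m)) \<longlonglongrightarrow> k x"
proof (rule LIM_zero_cancel, rule Lim_null_comparison)
 show "eventually (%m. norm (k (y m) - k x) <= K * \<bar>y m - x\<bar>) sequentially"
  using fd.k_lip[OF fdm[of 0]] assms(1,3) by (intro always_eventually allI) auto
 have "(%m. K * \<bar>y m - x\<bar>) \<longlonglongrightarrow> K * \<bar>x - x\<bar>" by (intro tendsto_intros assms)
 then show "(%m. K * \<bar>y m - x\<bar>) \<longlonglongrightarrow> 0" by simp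
qed

text \<open>The discrete entropy inequality with the nodal values of \<open>\<phi>\<close>, rewritten as integrals of step functions
 in space-time, has the form required by \<open>weak_lim\<close>. All coefficients converge almost everywhere; the second
 difference of \<open>\<eta>\<close> is \<open>\<eta>''\<close> at an intermediate value \<open>\<Xi>\<close> between neighbouring cells. The hypotheses
 \<open>H1\<close>, \<open>H2\<close> are convexity of \<open>\<phi> \<eta>\<close>, and hold for affine \<open>\<eta>\<close> and \<open>\<phi>\<close> of any sign.\<close>

theorem limit_inequality:
 assumes wl: "weak_lim q p" and adm: "admissible \<phi> \<phi>t \<phi>x \<Lambda> T0" and T: "0 < T"
  and e1: "!!x. (\<eta> has_real_derivative \<eta>' x) (at x)" and e2: "!!x. (\<eta>' has_real_derivative \<eta>'' x) (at x)"
  and e3: "continuous_on UNIV \<eta>''"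
  and H1: "!!a b t x. 0 <= t ==> x \<in> {0..1} ==> \<phi> (t, x) * (\<eta> a - \<eta> b) <= \<phi> (t, x) * \<eta>' a * (a - b)"
  and H2: "!!a t x. 0 <= t ==> x \<in> {0..1} ==> 0 <= \<phi> (t, x) * \<eta>'' a"
 shows "(\<integral>z. (if fst z < T then k (snd z) * \<phi> z * \<eta>'' (u z) else 0) * (p z)^2 \<partial>MO)
   + (\<integral>z. (if fst z < T then k (snd z) * \<eta>' (u z) * \<phi>x z else 0) * q z \<partial>MO)
  <= (\<integral>z. (if fst z < T then \<eta> (u z) * \<phi>t z else 0) \<partial>MO)
   + (\<integral>x. \<phi> (0, x) * \<eta> (ub x) \<partial>m01) - (\<integral>x. \<phi> (T, x) * \<eta> (u (T, x)) \<partial>m01)"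
proof -
 have \<Lambda>: "0 <= \<Lambda>" "0 <= T0" using adm by (auto simp: admissible_def)
 define \<Phi> where "\<Phi> = \<Lambda> * T0"
 have \<Phi>: "0 <= t ==> \<bar>\<phi> (t, x)\<bar> <= \<Phi>" for t x unfolding \<Phi>_def by (rule admissible_bound[OF adm])
 have \<Phi>0: "0 <= \<Phi>" using \<Lambda> by (simp add: \<Phi>_def)
 have cont: "continuous_on UNIV \<eta>" "continuous_on UNIV \<eta>'"
  by (auto intro!: continuous_at_imp_continuous_on DERIV_isCont e1 e2)
 have \<eta>m[measurable]: "\<eta> \<in> borel_measurable borel" "\<eta>' \<in> borel_measurable borel" "\<eta>'' \<in> borel_measurable borel"
  using cont e3 by (auto intro: borel_measurable_continuous_onI)
 have ic: "isCont \<eta> y" "isCont \<eta>' y" "isCont \<eta>'' y" for y using cont e3 by (auto simp: continuous_on_eq_continuous_at)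
 have "\<exists>C. \<forall>y\<in>{-M..M}. \<bar>f y\<bar> <= C" if "continuous_on UNIV f" for f :: "real => real"
 proof -
  have "compact (f ` {-M..M})" by (rule compact_continuous_image[OF continuous_on_subset[OF that]]) auto
  then have "bounded (f ` {-M..M})" by (rule compact_imp_bounded)
  then show ?thesis by (auto simp: bounded_iff)
 qed
 from this[OF cont(1)] this[OF cont(2)] this[OF e3]
 obtain Ca Cb Cc where "\<forall>y\<in>{-M..M}. \<bar>\<eta> y\<bar> <= Ca" "\<forall>y\<in>{-M..M}. \<bar>\<eta>' y\<bar> <= Cb" "\<forall>y\<in>{-M..M}. \<bar>\<eta>'' y\<bar> <= Cc" by blast
 then have cb: "\<bar>y\<bar> <= M ==> \<bar>\<eta> y\<bar> <= Ca" "\<bar>y\<bar> <= M ==> \<bar>\<eta>' y\<bar> <= Cb" "\<bar>y\<bar> <= M ==> \<bar>\<eta>'' y\<bar> <= Cc" for y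
  by (auto simp: abs_le_iff)
 have C0: "0 <= Ca" "0 <= Cb" "0 <= Cc" using cb[of 0] M0 by auto
 have "\<exists>\<xi>. min a b <= \<xi> \<and> \<xi> <= max a b \<and> \<eta>' b - \<eta>' a = \<eta>'' \<xi> * (b - a)" for a b
 proof -
  consider "a = b" | "a < b" | "b < a" by linarith
  then show ?thesis
  proof cases
   case 2
   then obtain \<xi> where "a < \<xi>" "\<xi> < b" "\<eta>' b - \<eta>' a = (b - a) * \<eta>'' \<xi>" using MVT2[OF 2, of \<eta>' \<eta>''] e2 by blast
   then show ?thesis by (intro exI[of _ \<xi>]) auto
  next
   case 3
   then obtain \<xi> where "b < \<xi>" "\<xi> < a" "\<eta>' a - \<eta>' b = (a - b) * \<eta>'' \<xi>" using MVT2[OF 3, of \<eta>' \<eta>''] e2 by blast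
   then show ?thesis by (intro exI[of _ \<xi>]) (auto simp: algebra_simps)
  qed auto
 qed
 then obtain \<Xi> where \<Xi>: "!!a b. min a b <= \<Xi> a b" "!!a b. \<Xi> a b <= max a b" "!!a b. \<eta>' b - \<eta>' a = \<eta>'' (\<Xi> a b) * (b - a)"
  by metis
 define \<phi>n where "\<phi>n = (%m n i. \<phi> (real n * d m, real i * h m))"
 define mm where "mm = (%m n i. \<eta>'' (\<Xi> (AA m (Suc n) (i - 1)) (AA m (Suc n) i)))"
 define J where "J = (%m. idx (d m) T)"
 \<comment> \<open>off the nodes \<open>1 <= i <= NN m\<close> the quotients vanish, and setting the coefficients to zero there keeps them bounded\<close>
 define WN where "WN = (%m n i. if n < J m \<and> 1 <= i \<and> i <= NN m then k (real i * h m) * \<phi>n m n i * mm m n i else 0)"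
 define PS where "PS = (%m n i. if n < J m \<and> 1 <= i \<and> i <= NN m then k (real i * h m) * \<eta>' (AA m (Suc n) (i - 1)) * ((\<phi>n m n i - \<phi>n m n (i - 1)) / h m) else 0)"
 define ET where "ET = (%m n i. if n < J m then \<eta> (AA m (Suc n) i) * ((\<phi>n m (Suc n) i - \<phi>n m n i) / d m) else 0)"
 define wn where "wn = (%m z. WN m (idx (d m) (fst z)) (idx (h m) (snd z)))"
 define \<psi>n where "\<psi>n = (%m z. PS m (idx (d m) (fst z)) (idx (h m) (snd z)))"
 define \<eta>n where "\<eta>n = (%m z. ET m (idx (d m) (fst z)) (idx (h m) (snd z)))"
 define w where "w = (%z. if z \<in> Om \<and> fst z < T then k (snd z) * \<phi> z * \<eta>'' (u z) else 0)"
 define \<psi> where "\<psi> = (%z. if fst z < T then k (snd z) * \<eta>' (u z) * \<phi>x z else 0)"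
 define \<eta>l where "\<eta>l = (%z. if fst z < T then \<eta> (u z) * \<phi>t z else 0)"
 have [measurable]: "wn m \<in> borel_measurable MO" "\<psi>n m \<in> borel_measurable MO" "\<eta>n m \<in> borel_measurable MO" for m
  unfolding wn_def \<psi>n_def \<eta>n_def by (rule measurable_MO[OF step2_measurable])+
 have [measurable]: "\<phi>t \<in> borel_measurable borel" "\<phi>x \<in> borel_measurable borel" using adm by (auto simp: admissible_def)
 have \<phi>m[measurable]: "\<phi> \<in> borel_measurable borel" by (rule admissible_measurable[OF adm])
 have [measurable]: "(%z::real\<times>real. fst z) \<in> borel_measurable MO" by (rule measurable_MO) (auto intro!: borel_measurable_continuous_onI continuous_intros)
 have uM[measurable]: "u \<in> borel_measurable MO" "\<phi>t \<in> borel_measurable MO" "\<phi>x \<in> borel_measurable MO" "\<phi> \<in> borel_measurable MO"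
  using adm by (auto simp: admissible_def intro: measurable_MO u_measurable \<phi>m)
 have [measurable]: "(%z. \<eta> (u z)) \<in> borel_measurable MO" "(%z. \<eta>' (u z)) \<in> borel_measurable MO" "(%z. \<eta>'' (u z)) \<in> borel_measurable MO"
  by (rule measurable_compose[OF uM(1)], rule \<eta>m)+
 note [measurable] = k_MO
 have OmM[measurable]: "Measurable.pred MO (%z. z \<in> Om)"
  using sets.top[of MO] unfolding pred_def space_MO by simp
 have [measurable]: "w \<in> borel_measurable MO" "\<psi> \<in> borel_measurable MO" "\<eta>l \<in> borel_measurable MO"
  unfolding w_def \<psi>_def \<eta>l_def by measurable
 have kb: "0 <= k x" "k x <= k1" if "x \<in> {0..1}" for x
  using fd.k_bounds[OF fdm[of 0] that] fd.k0[OF fdm[of 0]] by auto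
 have k1: "0 <= k1" using kb[of 0] by simp
 have node: "real i * h m \<in> {0..1}" if "i <= NN m" for i m using fd.node_in[OF fdm, of i m] that by simp
 have Jlt: "fst z < T" if "idx (d m) (fst z) < J m" "0 <= fst z" for m z
  using that idx_mono[OF d(1)[of m], of T "fst z"] unfolding J_def by (meson not_less)
 have \<phi>nb: "\<bar>\<phi>n m n i\<bar> <= \<Phi>" for m n i unfolding \<phi>n_def using d(1)[of m] by (intro \<Phi>) simp
 have mmb: "\<bar>mm m n i\<bar> <= Cc" if "i <= NN m" for m n i
 proof -
  have "\<bar>AA m (Suc n) (i - 1)\<bar> <= M" "\<bar>AA m (Suc n) i\<bar> <= M" using A_bound that by auto
  then have "\<bar>\<Xi> (AA m (Suc n) (i - 1)) (AA m (Suc n) i)\<bar> <= M"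
   using \<Xi>(1,2)[of "AA m (Suc n) (i - 1)" "AA m (Suc n) i"] by (auto simp: abs_le_iff min_def max_def split: if_splits)
  then show ?thesis unfolding mm_def by (rule cb(3))
 qed
 have E3: "0 <= \<phi>n m n i * mm m n i" if "i <= NN m" for m n i
  unfolding \<phi>n_def mm_def using d(1)[of m] node[OF that] by (intro H2) auto
 define W where "W = k1 * \<Phi> * Cc"
 have W0: "0 <= W" unfolding W_def using k1 \<Phi>0 C0 by simp
 have WNb: "0 <= WN m n i \<and> WN m n i <= W" for m n i
 proof (cases "n < J m \<and> 1 <= i \<and> i <= NN m")
  case True
  then have i: "i <= NN m" by simp
  have "0 <= k (real i * h m) * (\<phi>n m n i * mm m n i)" using kb(1)[OF node[OF i]] E3[OF i, of n] by (rule mult_nonneg_nonneg)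
  moreover have "k (real i * h m) * \<bar>\<phi>n m n i\<bar> * \<bar>mm m n i\<bar> <= W"
   unfolding W_def using kb[OF node[OF i]] \<phi>nb[of m n i] mmb[OF i, of n] k1 \<Phi>0 by (intro mult_mono) auto
  then have "\<bar>k (real i * h m) * \<phi>n m n i * mm m n i\<bar> <= W" using kb(1)[OF node[OF i]] by (simp add: abs_mult)
  ultimately show ?thesis using True by (simp add: WN_def mult.assoc)
 next
  case False then show ?thesis using W0 unfolding WN_def by auto
 qed
 have lipx: "\<bar>(\<phi>n m n i - \<phi>n m n (i - 1)) / h m\<bar> <= \<Lambda>" if "1 <= i" for m n i
 proof -
  have "\<bar>\<phi>n m n i - \<phi>n m n (i - 1)\<bar> <= \<Lambda> * \<bar>real i * h m - real (i - 1) * h m\<bar>"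
   using adm unfolding \<phi>n_def admissible_def by blast
  also have "\<bar>real i * h m - real (i - 1) * h m\<bar> = h m" using that by (simp add: of_nat_diff algebra_simps)
  finally show ?thesis by (simp add: abs_divide pos_divide_le_eq)
 qed
 have lipt: "\<bar>(\<phi>n m (Suc n) i - \<phi>n m n i) / d m\<bar> <= \<Lambda>" for m n i
 proof -
  have "\<bar>\<phi>n m (Suc n) i - \<phi>n m n i\<bar> <= \<Lambda> * \<bar>real (Suc n) * d m - real n * d m\<bar>"
   using adm unfolding \<phi>n_def admissible_def by blast
  also have "\<bar>real (Suc n) * d m - real n * d m\<bar> = d m" using d(1)[of m] by (simp add: algebra_simps)
  finally show ?thesis using d(1)[of m] by (simp add: abs_divide pos_divide_le_eq)
 qed
 have PSb: "\<bar>\<psi>n m z\<bar> <= (if fst z <= T then k1 * Cb * \<Lambda> else 0)" if z: "z \<in> Om" for m z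
 proof -
  let ?n = "idx (d m) (fst z)" and ?i = "idx (h m) (snd z)"
  have K0: "0 <= k1 * Cb * \<Lambda>" using k1 C0 \<Lambda> by simp
  show ?thesis
  proof (cases "?n < J m \<and> 1 <= ?i \<and> ?i <= NN m")
   case True
   then have "fst z < T" using Jlt[of m z] z by (auto simp: Om_def)
   moreover have "\<bar>k (real ?i * h m) * \<eta>' (AA m (Suc ?n) (?i - 1)) * ((\<phi>n m ?n ?i - \<phi>n m ?n (?i - 1)) / h m)\<bar> <= k1 * Cb * \<Lambda>"
    unfolding abs_mult
   proof (intro mult_mono)
    show "\<bar>k (real ?i * h m)\<bar> <= k1" using kb[OF node, of ?i m] True by simp
    show "\<bar>\<eta>' (AA m (Suc ?n) (?i - 1))\<bar> <= Cb" using True by (intro cb A_bound) auto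
    show "\<bar>(\<phi>n m ?n ?i - \<phi>n m ?n (?i - 1)) / h m\<bar> <= \<Lambda>" using True by (intro lipx) simp
   qed (use k1 C0 in auto)
   ultimately show ?thesis using True by (simp add: \<psi>n_def PS_def)
  next
   case False then show ?thesis using K0 unfolding \<psi>n_def PS_def by auto
  qed
 qed
 have ETb: "\<bar>\<eta>n m z\<bar> <= (if fst z <= T then Ca * \<Lambda> else 0)" if z: "z \<in> Om" for m z
 proof -
  let ?n = "idx (d m) (fst z)" and ?i = "idx (h m) (snd z)"
  have iN: "?i <= NN m" using z by (intro idx_le_N) (auto simp: Om_def)
  have K0: "0 <= Ca * \<Lambda>" using C0 \<Lambda> by simp
  show ?thesis
  proof (cases "?n < J m")
   case True
   then have "fst z < T" using Jlt[of m z] z by (auto simp: Om_def)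
   moreover have "\<bar>\<eta> (AA m (Suc ?n) ?i) * ((\<phi>n m (Suc ?n) ?i - \<phi>n m ?n ?i) / d m)\<bar> <= Ca * \<Lambda>"
    unfolding abs_mult using lipt[of m ?n ?i] cb(1)[OF A_bound[OF iN]] C0 by (intro mult_mono) auto
   ultimately show ?thesis using True by (simp add: \<eta>n_def ET_def)
  next
   case False then show ?thesis using K0 unfolding \<eta>n_def ET_def by auto
  qed
 qed
 have \<phi>tx: "\<bar>\<phi>t z\<bar> <= \<Lambda>" "\<bar>\<phi>x z\<bar> <= \<Lambda>" for z using adm unfolding admissible_def by blast+
 have \<psi>b: "\<bar>\<psi> z\<bar> <= (if fst z <= T then k1 * Cb * \<Lambda> else 0)" if z: "z \<in> Om" for z
 proof -
  have "snd z \<in> {0..1}" using z by (auto simp: Om_def)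
  then have "\<bar>k (snd z) * \<eta>' (u z) * \<phi>x z\<bar> <= k1 * Cb * \<Lambda>"
   unfolding abs_mult using kb[of "snd z"] cb(2)[OF u_bound] \<phi>tx k1 C0 by (intro mult_mono) auto
  then show ?thesis using k1 C0 \<Lambda> by (auto simp: \<psi>_def)
 qed
 have \<eta>lb: "\<bar>\<eta>l z\<bar> <= (if fst z <= T then Ca * \<Lambda> else 0)" if z: "z \<in> Om" for z
 proof -
  have "\<bar>\<eta> (u z) * \<phi>t z\<bar> <= Ca * \<Lambda>"
   unfolding abs_mult using cb(1)[OF u_bound] \<phi>tx C0 by (intro mult_mono) auto
  then show ?thesis using C0 \<Lambda> by (auto simp: \<eta>l_def)
 qed
 have wb: "0 <= w z \<and> w z <= W" for z
 proof (cases "z \<in> Om \<and> fst z < T")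
  case True
  then obtain t x where z: "z = (t, x)" "0 <= t" "x \<in> {0..1}" by (cases z) (auto simp: Om_def)
  have "0 <= k (snd z) * (\<phi> z * \<eta>'' (u z))" unfolding z(1) using kb(1)[OF z(3)] H2[OF z(2,3)] by simp
  moreover have "k (snd z) * \<bar>\<phi> z\<bar> * \<bar>\<eta>'' (u z)\<bar> <= W"
   unfolding W_def z(1) using kb[OF z(3)] \<Phi>[OF z(2), of x] cb(3)[OF u_bound] k1 \<Phi>0 by (intro mult_mono) auto
  then have "\<bar>k (snd z) * \<phi> z * \<eta>'' (u z)\<bar> <= W" using kb(1)[OF z(3)] by (simp add: abs_mult z)
  ultimately show ?thesis using True by (simp add: w_def mult.assoc)
 next
  case False then show ?thesis using W0 unfolding w_def by auto
 qed
 have good: "AE z in MO. C1_near \<phi> \<phi>t \<phi>x z" using adm by (simp add: admissible_def)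
 have lims: "AE z in MO. (%m. wn m z) \<longlonglongrightarrow> w z \<and> (%m. \<psi>n m z) \<longlonglongrightarrow> \<psi> z \<and> (%m. \<eta>n m z) \<longlonglongrightarrow> \<eta>l z"
  using good ud_AE ul_AE AE_space
 proof eventually_elim
  case (elim z)
  obtain t x where z: "z = (t, x)" by (cases z)
  have zO: "z \<in> Om" using elim(4) by simp
  have t: "0 <= t" and x: "x \<in> B" using zO by (auto simp: z Om_def)
  define n where "n = (%m. idx (d m) t)"
  define i where "i = (%m. idx (h m) x)"
  have nm: "idx (d m) t = n m" and im: "idx (h m) x = i m" for m by (simp_all add: n_def i_def)
  have i: "i m <= NN m" for m unfolding i_def by (rule idx_le_N[OF x])
  have ud': "(%m. AA m (Suc (n m)) (i m)) \<longlonglongrightarrow> u z" and ul': "(%m. AA m (Suc (n m)) (i m - 1)) \<longlonglongrightarrow> u z"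
   using elim(2,3) by (simp_all add: z ud_def ul_def n_def i_def)
  have nt: "(%m. real (n m) * d m) \<longlonglongrightarrow> t" unfolding n_def by (rule idx_times_tendsto[OF d_tendsto d(1) t])
  have ix: "(%m. real (i m) * h m) \<longlonglongrightarrow> x" unfolding i_def by (rule idx_times_tendsto[OF h_tendsto dx_pos]) (use x in simp)
  have i1: "eventually (%m. 1 <= i m) sequentially" unfolding i_def by (rule idx_pos_eventually[OF h_tendsto dx_pos]) (use x in simp)
  show ?case
  proof (cases "t < T")
   case False
   have "\<not> n m < J m" for m using Jlt[of m z] t False by (auto simp: z n_def)
   then show ?thesis using False unfolding wn_def \<psi>n_def \<eta>n_def WN_def PS_def ET_def w_def \<psi>_def \<eta>l_def by (simp add: z nm)
  next
   case True
   have "eventually (%m. d m < T - t) sequentially" using d_tendsto True by (intro order_tendstoD(2)) auto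
   then have nJ: "eventually (%m. n m < J m) sequentially"
   proof eventually_elim
    case (elim m)
    have "real (Suc (n m)) * d m <= T" using idx_bounds(1)[OF d(1)[of m] t] elim by (simp add: n_def algebra_simps)
    moreover have "idx (d m) (real (Suc (n m)) * d m) = Suc (n m)" using d(1)[of m] by (subst idx_eq_iff) auto
    ultimately show ?case using idx_mono[OF d(1)[of m], of "real (Suc (n m)) * d m" T] by (simp add: J_def)
   qed
   have kx: "(%m. k (real (i m) * h m)) \<longlonglongrightarrow> k x" by (rule k_tendsto[OF x ix node[OF i]])
   have ph: "(%m. \<phi>n m (n m) (i m)) \<longlonglongrightarrow> \<phi> z" unfolding \<phi>n_def z by (rule admissible_tendsto[OF adm nt ix])
   have xi: "(%m. \<Xi> (AA m (Suc (n m)) (i m - 1)) (AA m (Suc (n m)) (i m))) \<longlonglongrightarrow> u z"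
   proof (rule tendsto_sandwich)
    show "(%m. min (AA m (Suc (n m)) (i m - 1)) (AA m (Suc (n m)) (i m))) \<longlonglongrightarrow> u z"
     using tendsto_min[OF ul' ud'] by simp
    show "(%m. max (AA m (Suc (n m)) (i m - 1)) (AA m (Suc (n m)) (i m))) \<longlonglongrightarrow> u z"
     using tendsto_max[OF ul' ud'] by simp
   qed (use \<Xi> in auto)
   have mmx: "(%m. mm m (n m) (i m)) \<longlonglongrightarrow> \<eta>'' (u z)" unfolding mm_def by (rule isCont_tendsto_compose[OF ic(3) xi])
   have c1: "C1_near \<phi> \<phi>t \<phi>x (t, x)" using elim(1) z by simp
   have qt: "(%m. (\<phi>n m (Suc (n m)) (i m) - \<phi>n m (n m) (i m)) / d m) \<longlonglongrightarrow> \<phi>t z"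
    using C1_near_time_quotient[OF c1 nt ix d_tendsto d(1)] by (simp add: \<phi>n_def z distrib_right add.commute)
   have ix': "(%m. real (i m) * h m - h m) \<longlonglongrightarrow> x - 0" by (intro tendsto_intros ix h_tendsto)
   have qx: "(%m. (\<phi>n m (n m) (i m) - \<phi>n m (n m) (i m - 1)) / h m) \<longlonglongrightarrow> \<phi>x z"
   proof (rule Lim_transform_eventually)
    show "(%m. (\<phi> (real (n m) * d m, (real (i m) * h m - h m) + h m) - \<phi> (real (n m) * d m, real (i m) * h m - h m)) / h m) \<longlonglongrightarrow> \<phi>x z"
     unfolding z by (rule C1_near_space_quotient[OF c1 nt _ h_tendsto dx_pos]) (use ix' in simp)
    show "eventually (%m. (\<phi> (real (n m) * d m, (real (i m) * h m - h m) + h m) - \<phi> (real (n m) * d m, real (i m) * h m - h m)) / h m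
      = (\<phi>n m (n m) (i m) - \<phi>n m (n m) (i m - 1)) / h m) sequentially"
     using i1
    proof eventually_elim
     case (elim m)
     then have "real (i m - 1) * h m = real (i m) * h m - h m" by (simp add: of_nat_diff algebra_simps)
     then show ?case by (simp add: \<phi>n_def)
    qed
   qed
   have 1: "(%m. k (real (i m) * h m) * \<phi>n m (n m) (i m) * mm m (n m) (i m)) \<longlonglongrightarrow> w z"
    using tendsto_mult[OF tendsto_mult[OF kx ph] mmx] zO True by (simp add: w_def z)
   have 2: "(%m. k (real (i m) * h m) * \<eta>' (AA m (Suc (n m)) (i m - 1)) * ((\<phi>n m (n m) (i m) - \<phi>n m (n m) (i m - 1)) / h m)) \<longlonglongrightarrow> \<psi> z"
    using tendsto_mult[OF tendsto_mult[OF kx isCont_tendsto_compose[OF ic(2) ul']] qx] True by (simp add: \<psi>_def z)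
   have 3: "(%m. \<eta> (AA m (Suc (n m)) (i m)) * ((\<phi>n m (Suc (n m)) (i m) - \<phi>n m (n m) (i m)) / d m)) \<longlonglongrightarrow> \<eta>l z"
    using tendsto_mult[OF isCont_tendsto_compose[OF ic(1) ud'] qt] True by (simp add: \<eta>l_def z)
   have "(%m. wn m z) \<longlonglongrightarrow> w z"
    by (rule Lim_transform_eventually[OF 1]) (use nJ i1 in eventually_elim, use i in \<open>simp add: wn_def WN_def z nm im\<close>)
   moreover have "(%m. \<psi>n m z) \<longlonglongrightarrow> \<psi> z"
    by (rule Lim_transform_eventually[OF 2]) (use nJ i1 in eventually_elim, use i in \<open>simp add: \<psi>n_def PS_def z nm im\<close>)
   moreover have "(%m. \<eta>n m z) \<longlonglongrightarrow> \<eta>l z"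
    by (rule Lim_transform_eventually[OF 3]) (use nJ in eventually_elim, simp add: \<eta>n_def ET_def z nm im)
   ultimately show ?thesis by blast
  qed
 qed
 then have limw: "AE z in MO. (%m. wn m z) \<longlonglongrightarrow> w z" and lim\<psi>: "AE z in MO. (%m. \<psi>n m z) \<longlonglongrightarrow> \<psi> z" and lim\<eta>: "AE z in MO. (%m. \<eta>n m z) \<longlonglongrightarrow> \<eta>l z"
  by (auto elim: eventually_mono)
 note \<psi>dom = strip_dominated[of \<psi>n \<psi> T "k1 * Cb * \<Lambda>", OF _ _ PSb \<psi>b lim\<psi>]
 note \<eta>dom = strip_dominated[of \<eta>n \<eta>l T "Ca * \<Lambda>", OF _ _ ETb \<eta>lb lim\<eta>]
 define I0 where "I0 = (%m. \<integral>x. \<phi>n m 0 (idx (h m) x) * \<eta> (ub x) \<partial>m01)"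
 define IT where "IT = (%m. \<integral>x. \<phi>n m (J m) (idx (h m) x) * \<eta> (AA m (J m) (idx (h m) x)) \<partial>m01)"
 have I0lim: "I0 \<longlonglongrightarrow> (\<integral>x. \<phi> (0, x) * \<eta> (ub x) \<partial>m01)"
  unfolding I0_def
 proof (rule integral_dominated_convergence[where w="%_. \<Phi> * Ca"])
  show "(%x. \<phi> (0, x) * \<eta> (ub x)) \<in> borel_measurable m01"
   by (intro measurable_m01 borel_measurable_times measurable_compose[OF ub(1) \<eta>m(1)] measurable_compose[OF _ \<phi>m])
     (auto intro!: borel_measurable_continuous_onI continuous_intros)
  show "(%x. \<phi>n m 0 (idx (h m) x) * \<eta> (ub x)) \<in> borel_measurable m01" for m
   by (intro measurable_m01 borel_measurable_times measurable_compose[OF ub(1) \<eta>m(1)] step_measurable)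
  show "AE x in m01. (%m. \<phi>n m 0 (idx (h m) x) * \<eta> (ub x)) \<longlonglongrightarrow> \<phi> (0, x) * \<eta> (ub x)"
   using AE_space
  proof eventually_elim
   case (elim x)
   have "(%m. real (idx (h m) x) * h m) \<longlonglongrightarrow> x" by (rule idx_times_tendsto[OF h_tendsto dx_pos]) (use elim in simp)
   then show ?case unfolding \<phi>n_def by (intro tendsto_mult tendsto_const admissible_tendsto[OF adm]) auto
  qed
  show "AE x in m01. norm (\<phi>n m 0 (idx (h m) x) * \<eta> (ub x)) <= \<Phi> * Ca" for m
   by (rule always_eventually) (use \<phi>nb cb(1)[OF ub(2)] \<Phi>0 in \<open>auto simp: abs_mult intro!: mult_mono\<close>)
 qed simp
 have ITlim: "IT \<longlonglongrightarrow> (\<integral>x. \<phi> (T, x) * \<eta> (u (T, x)) \<partial>m01)"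
  unfolding IT_def
 proof (rule integral_dominated_convergence[where w="%_. \<Phi> * Ca"])
  show "(%x. \<phi> (T, x) * \<eta> (u (T, x))) \<in> borel_measurable m01"
   by (intro measurable_m01 borel_measurable_times measurable_compose[OF u_slice_measurable \<eta>m(1)] measurable_compose[OF _ \<phi>m])
     (auto intro!: borel_measurable_continuous_onI continuous_intros)
  show "(%x. \<phi>n m (J m) (idx (h m) x) * \<eta> (AA m (J m) (idx (h m) x))) \<in> borel_measurable m01" for m
   by (rule measurable_m01, rule step_measurable[of "%i. \<phi>n m (J m) i * \<eta> (AA m (J m) i)"])
  have Tt: "(%m. real (J m) * d m) \<longlonglongrightarrow> T" unfolding J_def by (rule idx_times_tendsto[OF d_tendsto d(1)]) (use T in simp)
  show "AE x in m01. (%m. \<phi>n m (J m) (idx (h m) x) * \<eta> (AA m (J m) (idx (h m) x))) \<longlonglongrightarrow> \<phi> (T, x) * \<eta> (u (T, x))"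
   using AE_space v_AE[OF less_imp_le[OF T]]
  proof eventually_elim
   case (elim x)
   have "(%m. real (idx (h m) x) * h m) \<longlonglongrightarrow> x" by (rule idx_times_tendsto[OF h_tendsto dx_pos]) (use elim in simp)
   moreover have "(%m. AA m (J m) (idx (h m) x)) \<longlonglongrightarrow> u (T, x)" using elim(2) by (simp add: v_def J_def)
   ultimately show ?case unfolding \<phi>n_def
    by (intro tendsto_mult admissible_tendsto[OF adm Tt] isCont_tendsto_compose[OF ic(1)])
  qed
  show "AE x in m01. norm (\<phi>n m (J m) (idx (h m) x) * \<eta> (AA m (J m) (idx (h m) x))) <= \<Phi> * Ca" for m
   using AE_space
  proof eventually_elim
   case (elim x)
   then have "\<bar>AA m (J m) (idx (h m) x)\<bar> <= M" using idx_le_N[of x "NN m"] by (intro A_bound) simp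
   then show ?case using \<phi>nb[of m "J m"] cb(1) \<Phi>0 by (auto simp: abs_mult intro!: mult_mono)
  qed
 qed simp
 define an where "an = (%m. (\<integral>z. \<eta>n m z \<partial>MO) + I0 m - IT m)"
 have anlim: "an \<longlonglongrightarrow> (\<integral>z. \<eta>l z \<partial>MO) + (\<integral>x. \<phi> (0, x) * \<eta> (ub x) \<partial>m01) - (\<integral>x. \<phi> (T, x) * \<eta> (u (T, x)) \<partial>m01)"
  unfolding an_def by (intro tendsto_intros I0lim ITlim \<eta>dom(6)) measurable
 have ineq: "(\<integral>z. wn m z * (X g m z)^2 \<partial>MO) + (\<integral>z. \<psi>n m z * X G m z \<partial>MO) + (\<integral>z. 0 * X g m z \<partial>MO) <= an m" for m
 proof -
  let ?q = "%f n i. fd.quot (NN m) (AA m) f (Suc n) i"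
  have de: "h m * (\<Sum>i\<le>NN m. \<phi>n m (J m) i * \<eta> (AA m (J m) i)) - h m * (\<Sum>i\<le>NN m. \<phi>n m 0 i * \<eta> (AA m 0 i))
   - d m * h m * (\<Sum>n<J m. \<Sum>i\<le>NN m. \<eta> (AA m (Suc n) i) * ((\<phi>n m (Suc n) i - \<phi>n m n i) / d m))
   + d m * h m * (\<Sum>n<J m. \<Sum>i\<le>NN m. k (real i * h m) * \<eta>' (AA m (Suc n) (i - 1)) * ((\<phi>n m n i - \<phi>n m n (i - 1)) / h m) * ?q G n i)
   + d m * h m * (\<Sum>n<J m. \<Sum>i\<le>NN m. k (real i * h m) * \<phi>n m n i * mm m n i * (?q g n i)^2) <= 0"
  proof (rule fd.discrete_entropy[OF fdm, where \<eta>'=\<eta>' and \<phi>="\<phi>n m" and m="mm m", OF g])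
   fix n i
   show "\<phi>n m n i * (\<eta> (AA m (Suc n) i) - \<eta> (AA m n i)) <= \<phi>n m n i * \<eta>' (AA m (Suc n) i) * (AA m (Suc n) i - AA m n i)" if "i <= NN m"
    unfolding \<phi>n_def using d(1)[of m] node[OF that] by (intro H1) auto
   show "\<eta>' (AA m (Suc n) i) - \<eta>' (AA m (Suc n) (i - 1)) = mm m n i * (AA m (Suc n) i - AA m (Suc n) (i - 1))"
    unfolding mm_def by (rule \<Xi>(3))
   show "0 <= \<phi>n m n i * mm m n i" if "i <= NN m" by (rule E3[OF that])
  qed
  have q0: "?q f n i = 0" if "\<not> (1 <= i \<and> i <= NN m)" for f n i using that by (auto simp: fd.quot_def[OF fdm])
  have 1: "(\<integral>z. wn m z * (X g m z)^2 \<partial>MO) = d m * h m * (\<Sum>n<J m. \<Sum>i\<le>NN m. k (real i * h m) * \<phi>n m n i * mm m n i * (?q g n i)^2)"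
  proof -
   have "wn m z * (X g m z)^2 = (if idx (d m) (fst z) < J m then (%n i. k (real i * h m) * \<phi>n m n i * mm m n i * (?q g n i)^2) (idx (d m) (fst z)) (idx (h m) (snd z)) else 0)" for z
    using q0[of "idx (h m) (snd z)" g "idx (d m) (fst z)"] by (auto simp: wn_def WN_def X_def)
   then show ?thesis using integral_MO_step(2)[OF d(1)[of m], of "J m" "%n i. k (real i * h m) * \<phi>n m n i * mm m n i * (?q g n i)^2" "NN m"] by (simp only:)
  qed
  have 2: "(\<integral>z. \<psi>n m z * X G m z \<partial>MO) = d m * h m * (\<Sum>n<J m. \<Sum>i\<le>NN m. k (real i * h m) * \<eta>' (AA m (Suc n) (i - 1)) * ((\<phi>n m n i - \<phi>n m n (i - 1)) / h m) * ?q G n i)"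
  proof -
   have "\<psi>n m z * X G m z = (if idx (d m) (fst z) < J m then (%n i. k (real i * h m) * \<eta>' (AA m (Suc n) (i - 1)) * ((\<phi>n m n i - \<phi>n m n (i - 1)) / h m) * ?q G n i) (idx (d m) (fst z)) (idx (h m) (snd z)) else 0)" for z
    using q0[of "idx (h m) (snd z)" G "idx (d m) (fst z)"] by (auto simp: \<psi>n_def PS_def X_def)
   then show ?thesis using integral_MO_step(2)[OF d(1)[of m], of "J m" "%n i. k (real i * h m) * \<eta>' (AA m (Suc n) (i - 1)) * ((\<phi>n m n i - \<phi>n m n (i - 1)) / h m) * ?q G n i" "NN m"] by (simp only:)
  qed
  have 3: "(\<integral>z. \<eta>n m z \<partial>MO) = d m * h m * (\<Sum>n<J m. \<Sum>i\<le>NN m. \<eta> (AA m (Suc n) i) * ((\<phi>n m (Suc n) i - \<phi>n m n i) / d m))"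
   using integral_MO_step(2)[OF d(1)[of m], of "J m" "%n i. \<eta> (AA m (Suc n) i) * ((\<phi>n m (Suc n) i - \<phi>n m n i) / d m)" "NN m"]
   unfolding \<eta>n_def ET_def by (simp only:)
  have 4: "IT m = h m * (\<Sum>i\<le>NN m. \<phi>n m (J m) i * \<eta> (AA m (J m) i))"
   unfolding IT_def by (rule integral_step[of "%i. \<phi>n m (J m) i * \<eta> (AA m (J m) i)"])
  \<comment> \<open>Jensen on each cell, as the initial values are averages: the tangent at the average integrates to zero\<close>
  have 5: "h m * (\<Sum>i\<le>NN m. \<phi>n m 0 i * \<eta> (AA m 0 i)) <= I0 m"
  proof -
   have iu: "integrable m01 ub" by (rule integrable_m01_bounded[OF measurable_m01[OF ub(1)] ub(2)])
   have i\<eta>: "integrable m01 (%x. \<eta> (ub x))"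
    by (rule integrable_m01_bounded[OF measurable_m01[OF measurable_compose[OF ub(1) \<eta>m(1)]] cb(1)[OF ub(2)]])
   have cellI: "integrable m01 (%x. indicator (cell (NN m) i) x * f x)" if "integrable m01 f" for f :: "real => real" and i
    by (rule dominated_integrable[OF that]) (use that in \<open>auto simp: indicator_def\<close>)
   have ci: "integrable m01 (indicat_real (cell (NN m) i))" for i by (rule integrable_m01_bounded[of _ 1]) auto
   have "I0 m = (\<Sum>i\<le>NN m. \<phi>n m 0 i * (\<integral>x. indicator (cell (NN m) i) x * \<eta> (ub x) \<partial>m01))"
    unfolding I0_def by (rule integral_m01_cells[OF i\<eta>])
   moreover have "h m * (\<Sum>i\<le>NN m. \<phi>n m 0 i * \<eta> (AA m 0 i)) <= (\<Sum>i\<le>NN m. \<phi>n m 0 i * (\<integral>x. indicator (cell (NN m) i) x * \<eta> (ub x) \<partial>m01))"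
    unfolding sum_distrib_left
   proof (rule sum_mono)
    fix i assume "i \<in> {..NN m}"
    then have i: "i <= NN m" by simp
    define a where "a = AA m 0 i"
    define f where "f = \<phi>n m 0 i"
    let ?c = "%x. indicat_real (cell (NN m) i) x"
    have a: "(\<integral>x. ?c x * ub x \<partial>m01) = h m * a" unfolding a_def avg[OF d(1) i] by simp
    have ih: "(\<integral>x. ?c x \<partial>m01) = h m" by (rule integral_cell[OF i])
    have "(\<integral>x. f * \<eta> a * ?c x - f * (?c x * \<eta> (ub x)) \<partial>m01) <= (\<integral>x. f * \<eta>' a * a * ?c x - f * \<eta>' a * (?c x * ub x) \<partial>m01)"
    proof (rule integral_mono)
     show "integrable m01 (%x. f * \<eta> a * ?c x - f * (?c x * \<eta> (ub x)))"
      by (intro Bochner_Integration.integrable_diff integrable_mult_right ci cellI i\<eta>)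
     show "integrable m01 (%x. f * \<eta>' a * a * ?c x - f * \<eta>' a * (?c x * ub x))"
      by (intro Bochner_Integration.integrable_diff integrable_mult_right ci cellI iu)
     fix x
     have "f * (\<eta> a - \<eta> (ub x)) <= f * \<eta>' a * (a - ub x)"
      unfolding f_def \<phi>n_def using node[OF i] by (intro H1) auto
     then have "?c x * (f * (\<eta> a - \<eta> (ub x))) <= ?c x * (f * \<eta>' a * (a - ub x))" by (intro mult_left_mono) auto
     then show "f * \<eta> a * ?c x - f * (?c x * \<eta> (ub x)) <= f * \<eta>' a * a * ?c x - f * \<eta>' a * (?c x * ub x)" by (simp add: algebra_simps)
    qed
    also have "... = f * \<eta>' a * a * h m - f * \<eta>' a * (h m * a)"
     by (subst Bochner_Integration.integral_diff, intro integrable_mult_right ci, intro integrable_mult_right cellI iu)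
       (simp only: integral_mult_right_zero ih a)
    also have "... = 0" by simp
    also have "(\<integral>x. f * \<eta> a * ?c x - f * (?c x * \<eta> (ub x)) \<partial>m01) = f * \<eta> a * h m - f * (\<integral>x. ?c x * \<eta> (ub x) \<partial>m01)"
     by (subst Bochner_Integration.integral_diff, intro integrable_mult_right ci, intro integrable_mult_right cellI i\<eta>)
       (simp only: integral_mult_right_zero ih)
    finally show "h m * (\<phi>n m 0 i * \<eta> (AA m 0 i)) <= \<phi>n m 0 i * (\<integral>x. ?c x * \<eta> (ub x) \<partial>m01)"
     by (simp add: f_def a_def mult_ac)
   qed
   ultimately show ?thesis by simp
  qed
  have z: "(\<integral>z. 0 * X g m z \<partial>MO) = 0" by simp
  show ?thesis unfolding 1 2 z an_def 3 4 using de 5 by linarith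
 qed
 have sq0: "L2 MO (%_. 0::real)" by (simp add: L2_real)
 note wl' = wl[unfolded weak_lim_def, THEN conjunct2, THEN conjunct2]
 have "(\<integral>z. w z * (p z)^2 \<partial>MO) + (\<integral>z. \<psi> z * q z \<partial>MO) + (\<integral>z. 0 * p z \<partial>MO)
   <= (\<integral>z. \<eta>l z \<partial>MO) + (\<integral>x. \<phi> (0, x) * \<eta> (ub x) \<partial>m01) - (\<integral>x. \<phi> (T, x) * \<eta> (u (T, x)) \<partial>m01)"
 proof (rule wl'[rule_format, of \<psi>n \<psi> "%_ _. 0" "%_. 0" wn w W an])
  show "L2 MO (\<psi>n n)" for n by (rule \<psi>dom(1)) measurable
  show "L2 MO \<psi>" by (rule \<psi>dom(2)) measurable
  show "(%n. \<integral>x. (\<psi>n n x - \<psi> x)^2 \<partial>MO) \<longlonglongrightarrow> 0" by (rule \<psi>dom(3)) measurable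
  show "0 <= wn n x" "wn n x <= W" for n x using WNb by (auto simp: wn_def)
  show "0 <= w x" "w x <= W" for x using wb by auto
  show "eventually (%n. (\<integral>x. wn n x * (X g n x)^2 \<partial>MO) + (\<integral>x. \<psi>n n x * X G n x \<partial>MO) + (\<integral>x. 0 * X g n x \<partial>MO) <= an n) sequentially"
   by (rule always_eventually) (use ineq in blast)
 qed (use sq0 limw anlim in \<open>auto\<close>)
 moreover have "(\<integral>z. w z * (p z)^2 \<partial>MO) = (\<integral>z. (if fst z < T then k (snd z) * \<phi> z * \<eta>'' (u z) else 0) * (p z)^2 \<partial>MO)"
  by (rule lint_cong) (auto simp: w_def)
 ultimately show ?thesis unfolding \<psi>_def \<eta>l_def by simp
qed

end

section \<open>Test functions\<close>

lemma smooth2D: "smooth2 \<phi> ==> \<phi> differentiable (at z)" "smooth2 \<phi> ==> smooth2 (Dt \<phi>)" "smooth2 \<phi> ==> smooth2 (Dx \<phi>)"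
 by (auto elim: smooth2.cases)

lemma smooth2_continuous: "smooth2 \<phi> ==> continuous_on UNIV \<phi>"
 by (auto intro!: continuous_at_imp_continuous_on differentiable_imp_continuous_within smooth2D)

lemma smooth2_partials:
 assumes "smooth2 \<phi>"
 shows "((%s. \<phi> (s, x)) has_real_derivative Dt \<phi> (t, x)) (at t)" "((%y. \<phi> (t, y)) has_real_derivative Dx \<phi> (t, x)) (at x)"
proof -
 have 1: "(%s. (s, x)) differentiable (at t)" and 2: "(%y. (t, y)) differentiable (at x)"
  unfolding differentiable_def by (auto intro!: derivative_eq_intros)
 have "(%s. \<phi> (s, x)) differentiable (at t)" "(%y. \<phi> (t, y)) differentiable (at x)"
  using differentiable_chain_at[OF 1 smooth2D(1)[OF assms]] differentiable_chain_at[OF 2 smooth2D(1)[OF assms]]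
  by (simp_all add: o_def)
 then show "((%s. \<phi> (s, x)) has_real_derivative Dt \<phi> (t, x)) (at t)" "((%y. \<phi> (t, y)) has_real_derivative Dx \<phi> (t, x)) (at x)"
  by (simp_all add: Dt_def Dx_def DERIV_deriv_iff_real_differentiable)
qed

lemma test_on_partials_support:
 assumes "smooth2 \<phi>" "closed K" "!!z. z \<notin> K ==> \<phi> z = 0" "z \<notin> K"
 shows "Dt \<phi> z = 0" "Dx \<phi> z = 0"
proof -
 obtain t x where z: "z = (t, x)" by (cases z)
 have "open (- K)" using assms(2) by (simp add: open_Compl)
 then obtain r where r: "0 < r" "ball z r \<subseteq> - K" using assms(4) by (auto simp: open_contains_ball)
 then have zero: "\<phi> z' = 0" if "dist z' z < r" for z' using that assms(3)[of z'] by (auto simp: dist_commute)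
 have "((%s. \<phi> (s, x)) has_real_derivative 0) (at t)"
 proof (rule has_field_derivative_transform_within_open[of "%_. 0" _ _ "ball t r"])
  show "0 = \<phi> (s, x)" if "s \<in> ball t r" for s
   using that zero[of "(s, x)"] by (simp add: z dist_Pair_Pair dist_commute)
 qed (use r in auto)
 then show "Dt \<phi> z = 0" using DERIV_unique[OF smooth2_partials(1)[OF assms(1)]] z by auto
 have "((%y. \<phi> (t, y)) has_real_derivative 0) (at x)"
 proof (rule has_field_derivative_transform_within_open[of "%_. 0" _ _ "ball x r"])
  show "0 = \<phi> (t, y)" if "y \<in> ball x r" for y
   using that zero[of "(t, y)"] by (simp add: z dist_Pair_Pair dist_commute)
 qed (use r in auto)
 then show "Dx \<phi> z = 0" using DERIV_unique[OF smooth2_partials(2)[OF assms(1)]] z by auto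
qed

lemma bounded_of_compact_support:
 fixes f :: "'a::t2_space => real"
 assumes "continuous_on UNIV f" "compact K" "!!z. z \<notin> K ==> f z = 0"
 obtains C where "0 <= C" "!!z. \<bar>f z\<bar> <= C"
proof -
 have "bounded (f ` K)" using compact_continuous_image[OF continuous_on_subset[OF assms(1)] assms(2)] by (auto intro: compact_imp_bounded)
 then obtain C where "0 < C" "!!z. z \<in> K ==> \<bar>f z\<bar> <= C" by (auto simp: bounded_pos)
 then show thesis using that[of C] assms(3) by (metis abs_zero less_imp_le)
qed

lemma lipschitz_of_derivative_bound:
 assumes "!!x. (f has_real_derivative f' x) (at x)" "!!x. \<bar>f' x\<bar> <= C"
 shows "\<bar>f x - f y\<bar> <= C * \<bar>x - y\<bar>"
 using field_differentiable_bound[of UNIV f f' C x y] assms by simp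

lemma test_on_admissible:
 assumes "test_on W \<phi>"
 obtains \<Lambda> T0 where "admissible \<phi> (Dt \<phi>) (Dx \<phi>) \<Lambda> T0"
  "!!z. T0 <= fst z ==> Dt \<phi> z = 0 \<and> Dx \<phi> z = 0" "!!z. z \<notin> W ==> \<phi> z = 0"
proof -
 obtain K where s: "smooth2 \<phi>" and K: "compact K" "K \<subseteq> W" "!!z. z \<notin> K ==> \<phi> z = 0"
  using assms by (auto simp: test_on_def)
 have cK: "closed K" using K(1) by (rule compact_imp_closed)
 have supp: "z \<notin> K ==> Dt \<phi> z = 0" "z \<notin> K ==> Dx \<phi> z = 0" for z
  using test_on_partials_support[OF s cK K(3)] by auto
 have cont: "continuous_on UNIV (Dt \<phi>)" "continuous_on UNIV (Dx \<phi>)" using s by (auto intro: smooth2_continuous smooth2D)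
 obtain C1 where C1: "0 <= C1" "!!z. \<bar>Dt \<phi> z\<bar> <= C1" using bounded_of_compact_support[OF cont(1) K(1) supp(1)] by blast
 obtain C2 where C2: "0 <= C2" "!!z. \<bar>Dx \<phi> z\<bar> <= C2" using bounded_of_compact_support[OF cont(2) K(1) supp(2)] by blast
 obtain R where R: "0 < R" "!!z. z \<in> K ==> norm z <= R" using compact_imp_bounded[OF K(1)] by (auto simp: bounded_pos)
 have out: "z \<notin> K" if "R + 1 <= fst z" for z
  using R(2)[of z] norm_fst_le[of "fst z" "snd z"] that by (auto simp: abs_le_iff)
 have b: "\<bar>Dt \<phi> z\<bar> <= max C1 C2" "\<bar>Dx \<phi> z\<bar> <= max C1 C2" for z using C1(2)[of z] C2(2)[of z] by auto
 have "admissible \<phi> (Dt \<phi>) (Dx \<phi>) (max C1 C2) (R + 1)"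
  unfolding admissible_def
 proof (intro conjI allI impI)
  show "\<bar>\<phi> (t, x) - \<phi> (s', x)\<bar> <= max C1 C2 * \<bar>t - s'\<bar>" for t s' x
   by (rule lipschitz_of_derivative_bound[of "%s. \<phi> (s, x)", OF smooth2_partials(1)[OF s] b(1)])
  show "\<bar>\<phi> (t, x) - \<phi> (t, y)\<bar> <= max C1 C2 * \<bar>x - y\<bar>" for t x y
   by (rule lipschitz_of_derivative_bound[of "%y. \<phi> (t, y)", OF smooth2_partials(2)[OF s] b(2)])
  show "\<phi> (t, x) = 0" if "R + 1 <= t" for t x using K(3) out[of "(t, x)"] that by simp
  show "AE z in MO. C1_near \<phi> (Dt \<phi>) (Dx \<phi>) z"
  proof (rule AE_I2)
   fix z
   have "isCont (Dt \<phi>) z" "isCont (Dx \<phi>) z" using cont continuous_on_eq_continuous_at[OF open_UNIV] by blast+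
   moreover have "((%s. \<phi> (s, snd z')) has_real_derivative Dt \<phi> z') (at (fst z'))"
    "((%y. \<phi> (fst z', y)) has_real_derivative Dx \<phi> z') (at (snd z'))" for z'
    using smooth2_partials(1)[OF s, of "snd z'" "fst z'"] smooth2_partials(2)[OF s, of "fst z'" "snd z'"] by simp_all
   ultimately show "C1_near \<phi> (Dt \<phi>) (Dx \<phi>) z" unfolding C1_near_def using zero_less_one by blast
  qed
 qed (use C1 C2 R b cont in \<open>auto intro: borel_measurable_continuous_onI\<close>)
 then show thesis using that supp out K(2,3) by blast
qed

section \<open>Integrals over space-time\<close>

lemma MO_indicator_measurable:
 "f \<in> borel_measurable MO ==> (%z. indicator Om z *\<^sub>R (f z :: real)) \<in> borel_measurable lborel"
 by (subst (asm) borel_measurable_restrict_space_iff) auto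

lemma integral_MO_eq_lebesgue:
 assumes "f \<in> borel_measurable MO"
 shows "(LINT z:Om|lebesgue. f z) = (\<integral>z. (f z :: real) \<partial>MO)"
proof -
 have "(\<integral>z. f z \<partial>MO) = (LINT z:Om|lborel. f z)"
  by (subst integral_restrict_space) (auto simp: set_lebesgue_integral_def)
 also have "... = (LINT z:Om|lebesgue. f z)"
  unfolding set_lebesgue_integral_def using integral_completion[OF MO_indicator_measurable[OF assms]] by simp
 finally show ?thesis by simp
qed

lemma set_integrable_lebesgue_Om:
 assumes "integrable MO f"
 shows "set_integrable lebesgue Om (f :: _ => real)"
proof -
 have "integrable lborel (%z. indicator Om z *\<^sub>R f z)" using assms by (subst (asm) integrable_restrict_space) auto
 then show ?thesis unfolding set_integrable_def by (subst integrable_completion) auto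
qed

lemma AE_MO_off_line: "AE z in MO. fst z \<noteq> T" "AE z in MO. snd z \<noteq> a"
proof -
 have "emeasure lborel ({T} \<times> (UNIV :: real set)) = emeasure lborel {T} * emeasure lborel (UNIV :: real set)"
  unfolding lborel_prod[symmetric] by (rule lborel.emeasure_pair_measure_Times) auto
 then have "AE z in lborel. z \<notin> {T} \<times> (UNIV :: real set)"
  by (intro AE_not_in null_setsI) (auto simp: borel_Times)
 then show "AE z in MO. fst z \<noteq> T" by (subst AE_restrict_space_iff) (auto elim!: eventually_mono)
 have "emeasure lborel ((UNIV :: real set) \<times> {a}) = emeasure lborel (UNIV :: real set) * emeasure lborel {a}"
  unfolding lborel_prod[symmetric] by (rule lborel.emeasure_pair_measure_Times) auto
 then have "AE z in lborel. z \<notin> (UNIV :: real set) \<times> {a}"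
  by (intro AE_not_in null_setsI) (auto simp: borel_Times)
 then show "AE z in MO. snd z \<noteq> a" by (subst AE_restrict_space_iff) (auto elim!: eventually_mono)
qed

lemma fst_MO [measurable]: "fst \<in> borel_measurable MO" and snd_MO [measurable]: "snd \<in> borel_measurable MO"
 by (auto intro!: measurable_MO borel_measurable_continuous_onI continuous_intros)

text \<open>The line \<open>t = T\<close> is a null set, which reconciles the closed time interval of \<^const>\<open>OmT\<close> with the
 half-open intervals of the scheme.\<close>

lemma integral_OmT_eq_lebesgue:
 assumes f[measurable]: "f \<in> borel_measurable MO"
 shows "(LINT z:OmT T|lebesgue. f z) = (\<integral>z. (if fst z < T then f z else (0::real)) \<partial>MO)"
proof -
 have "(LINT z:OmT T|lebesgue. f z) = (LINT z:Om|lebesgue. (if fst z <= T then f z else 0))"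
  unfolding set_lebesgue_integral_def by (rule lint_cong) (auto simp: OmT_def Om_def indicator_def)
 also have "... = (\<integral>z. (if fst z <= T then f z else 0) \<partial>MO)"
  by (rule integral_MO_eq_lebesgue) measurable
 also have "... = (\<integral>z. (if fst z < T then f z else 0) \<partial>MO)"
  by (rule integral_cong_AE, measurable) (use AE_MO_off_line(1)[of T] in \<open>auto elim!: eventually_mono\<close>)
 finally show ?thesis .
qed

lemma L2_on_OmT:
 assumes "L2 MO f"
 shows "L2_on (OmT T) f"
proof -
 have f: "f \<in> borel_measurable MO" "integrable MO (%z. (f z)^2)" using assms by (auto simp: L2_real)
 have T: "OmT T \<in> sets lebesgue" and sub: "OmT T \<subseteq> Om"
 proof -
  have "OmT T \<in> sets borel" unfolding OmT_def by (intro borel_Times) auto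
  then show "OmT T \<in> sets lebesgue" by (simp add: sets_completionI_sets)
 qed (auto simp: OmT_def Om_def)
 have "(%z. indicator (OmT T) z * (indicator Om z *\<^sub>R f z)) \<in> borel_measurable lebesgue"
  using measurable_completion[OF MO_indicator_measurable[OF f(1)]] T by (intro borel_measurable_times borel_measurable_indicator)
 moreover have "(%z. indicator (OmT T) z * (indicator Om z *\<^sub>R f z)) = (%z. indicator (OmT T) z *\<^sub>R f z)"
  using sub by (auto simp: indicator_def fun_eq_iff)
 ultimately have "set_borel_measurable lebesgue (OmT T) f" by (simp add: set_borel_measurable_def)
 then show ?thesis unfolding L2_on_def using set_integrable_subset[OF set_integrable_lebesgue_Om[OF f(2)] T sub] by blast
qed

lemma L2_strip:
 assumes [measurable]: "f \<in> borel_measurable MO" and "!!z. z \<in> Om ==> \<bar>f z\<bar> <= (if fst z <= T then C else (0::real))"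
 shows "L2 MO f" "integrable MO f"
 using strip_dominated(2,5)[of "%_. f" f T C] assms by auto

lemma L1loc_strip_L2:
 assumes [measurable]: "f \<in> borel_measurable MO" and f: "!!T. L2 MO (%z. if fst z <= T then f z else (0::real))"
 shows "L1loc_on ({0<..} \<times> B) f"
 unfolding L1loc_on_def
proof (intro allI impI)
 fix K :: "(real \<times> real) set" assume K: "compact K \<and> K \<subseteq> {0<..} \<times> B"
 then obtain R where R: "!!z. z \<in> K ==> norm z <= R" using compact_imp_bounded[of K] by (auto simp: bounded_iff)
 have out: "fst z <= R" if "z \<in> K" for z
  using R[OF that] norm_fst_le[of "fst z" "snd z"] by (auto simp: abs_le_iff)
 let ?i = "%z. if fst z <= R then 1 else (0::real)"
 have "L2 MO ?i"
  by (rule L2_strip[of _ R 1]) auto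
 then have "integrable MO (%z. ?i z * (if fst z <= R then f z else 0))"
  using f[of R] by (intro integrable_mult_of_squares) (auto simp: L2_real)
 then have "set_integrable lebesgue Om (%z. ?i z * (if fst z <= R then f z else 0))" by (rule set_integrable_lebesgue_Om)
 then have "set_integrable lebesgue K (%z. ?i z * (if fst z <= R then f z else 0))"
  by (rule set_integrable_subset) (use K in \<open>auto simp: Om_def intro!: sets_completionI_sets borel_compact\<close>)
 then show "set_integrable lebesgue K f"
  unfolding set_integrable_def
  by (rule Bochner_Integration.integrable_cong[THEN iffD1, rotated 2]) (use out in \<open>auto simp: indicator_def\<close>)
qed

section \<open>Weak derivatives and the weak formulation\<close>

lemma summation_by_parts_zero:
 fixes f H :: "nat => real"
 shows "(\<Sum>i\<le>N. if i = 0 then 0 else f i * (H i - H (i - 1))) = f (Suc N) * H N - f 0 * H 0 - (\<Sum>i\<le>N. H i * (f (Suc i) - f i))"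
 by (induction N) (simp_all add: algebra_simps)

context fd_limit
begin

lemma weak_lim_square: assumes "weak_lim q p" shows "L2 MO q" "L2 MO p"
 using assms by (auto simp: weak_lim_def)

lemma weak_lim_integral:
 assumes wl: "weak_lim q p" and s: "!!n. L2 MO (\<psi>n n)" "L2 MO \<psi>"
  and conv: "(%n. \<integral>x. (\<psi>n n x - \<psi> x)^2 \<partial>MO) \<longlonglongrightarrow> 0"
 shows "(%n. \<integral>x. \<psi>n n x * X G n x \<partial>MO) \<longlonglongrightarrow> a ==> (\<integral>x. \<psi> x * q x \<partial>MO) = a"
  and "(%n. \<integral>x. \<psi>n n x * X g n x \<partial>MO) \<longlonglongrightarrow> a ==> (\<integral>x. \<psi> x * p x \<partial>MO) = a"
proof -
 note wl' = wl[unfolded weak_lim_def, THEN conjunct2, THEN conjunct2]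
 have sq0: "L2 MO (%_. 0::real)" by (simp add: L2_real)
 have sc: "L2 MO (%x. r * \<psi>n n x)" "L2 MO (%x. r * \<psi> x)" for r :: real and n
  using L2_scaleR[OF s(1)] L2_scaleR[OF s(2)] by simp_all
 have cc: "(%n. \<integral>x. (r * \<psi>n n x - r * \<psi> x)^2 \<partial>MO) \<longlonglongrightarrow> 0" for r
 proof -
  have "(%n. r^2 * (\<integral>x. (\<psi>n n x - \<psi> x)^2 \<partial>MO)) \<longlonglongrightarrow> r^2 * 0" by (intro tendsto_intros conv)
  then show ?thesis by (simp add: power_mult_distrib flip: right_diff_distrib)
 qed
 have both: "y = a" if "1 * y <= 1 * a" "(-1) * y <= (-1) * a" for y a :: real using that by simp
 show "(\<integral>x. \<psi> x * q x \<partial>MO) = a" if lim: "(%n. \<integral>x. \<psi>n n x * X G n x \<partial>MO) \<longlonglongrightarrow> a"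
 proof -
  have "r * (\<integral>x. \<psi> x * q x \<partial>MO) <= r * a" for r
  proof -
   have "(\<integral>x. 0 * (p x)^2 \<partial>MO) + (\<integral>x. (r * \<psi> x) * q x \<partial>MO) + (\<integral>x. 0 * p x \<partial>MO) <= r * a"
    by (rule wl'[rule_format, of "%n x. r * \<psi>n n x" "%x. r * \<psi> x" "%_ _. 0" "%_. 0" "%_ _. 0" "%_. 0" 0 "%n. r * (\<integral>x. \<psi>n n x * X G n x \<partial>MO)"])
      (use sc cc sq0 tendsto_mult_left[OF lim] in \<open>auto simp: mult.assoc\<close>)
   then show ?thesis by (simp add: mult.assoc)
  qed
  then show ?thesis by (intro both)
 qed
 show "(\<integral>x. \<psi> x * p x \<partial>MO) = a" if lim: "(%n. \<integral>x. \<psi>n n x * X g n x \<partial>MO) \<longlonglongrightarrow> a"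
 proof -
  have "r * (\<integral>x. \<psi> x * p x \<partial>MO) <= r * a" for r
  proof -
   have "(\<integral>x. 0 * (p x)^2 \<partial>MO) + (\<integral>x. 0 * q x \<partial>MO) + (\<integral>x. (r * \<psi> x) * p x \<partial>MO) <= r * a"
    by (rule wl'[rule_format, of "%_ _. 0" "%_. 0" "%n x. r * \<psi>n n x" "%x. r * \<psi> x" "%_ _. 0" "%_. 0" 0 "%n. r * (\<integral>x. \<psi>n n x * X g n x \<partial>MO)"])
      (use sc cc sq0 tendsto_mult_left[OF lim] in \<open>auto simp: mult.assoc\<close>)
   then show ?thesis by (simp add: mult.assoc)
  qed
  then show ?thesis by (intro both)
 qed
qed

lemma u_MO [measurable]: "u \<in> borel_measurable MO" by (rule measurable_MO[OF u_measurable])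

lemma continuous_bounded_range:
 assumes "continuous_on UNIV H"
 obtains C where "0 <= C" "!!y. \<bar>y\<bar> <= M ==> \<bar>H y\<bar> <= (C::real)"
proof -
 have "compact (H ` {-M..M})" by (rule compact_continuous_image[OF continuous_on_subset[OF assms]]) auto
 then obtain C where C: "0 < C" "\<forall>z\<in>H ` {-M..M}. norm z <= C" using compact_imp_bounded bounded_pos by blast
 show thesis by (rule that[of C]) (use C in \<open>auto simp: abs_le_iff\<close>)
qed

text \<open>\<open>\<phi>\<close> is replaced by the step function \<open>\<psi>n\<close> of its nodal values, for which summation by parts in \<open>x\<close> is
 exact; the boundary terms vanish with \<open>\<phi>\<close>.\<close>

lemma weak_derivative:
 assumes wl: "weak_lim q p" and adm: "admissible \<phi> \<phi>t \<phi>x \<Lambda> T0" and bd: "!!t x. x \<notin> B ==> \<phi> (t, x) = 0"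
 shows "(\<integral>z. \<phi> z * q z \<partial>MO) = - (\<integral>z. G (u z) * \<phi>x z \<partial>MO)" "(\<integral>z. \<phi> z * p z \<partial>MO) = - (\<integral>z. g (u z) * \<phi>x z \<partial>MO)"
proof -
 have \<Lambda>: "0 <= \<Lambda>" "0 <= T0" and good: "AE z in MO. C1_near \<phi> \<phi>t \<phi>x z" and lip: "!!t x y. \<bar>\<phi> (t, x) - \<phi> (t, y)\<bar> <= \<Lambda> * \<bar>x - y\<bar>"
  and van: "!!t x. T0 <= t ==> \<phi> (t, x) = 0" and xm[measurable]: "\<phi>x \<in> borel_measurable borel" and xb: "!!z. \<bar>\<phi>x z\<bar> <= \<Lambda>"
  using adm unfolding admissible_def by blast+
 have d1: "d m <= 1" for m using d(2)[of m] by (rule order_trans) (simp add: power_le_one)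
 define \<phi>n where "\<phi>n = (%m n i. \<phi> (real n * d m, real i * h m))"
 define \<psi>n where "\<psi>n = (%m z. \<phi>n m (idx (d m) (fst z)) (idx (h m) (snd z)))"
 define Q where "Q = (%m n i. (\<phi>n m n (Suc i) - \<phi>n m n i) / h m)"
 have late: "\<phi>n m (idx (d m) (fst z)) i = 0" if "z \<in> Om" "\<not> fst z <= T0 + 1" for m z i
 proof -
  have "0 <= fst z" using that by (auto simp: Om_def)
  then have "fst z < real (idx (d m) (fst z)) * d m + d m" using idx_bounds(2)[OF d(1)[of m]] by (simp add: distrib_right)
  then show ?thesis unfolding \<phi>n_def using d1[of m] that(2) by (intro van) linarith
 qed
 have \<psi>n0: "\<bar>\<psi>n m z\<bar> <= (if fst z <= T0 + 1 then \<Lambda> * T0 else 0)" if "z \<in> Om" for m z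
  using late[OF that] d(1)[of m] by (auto simp: \<psi>n_def) (auto simp: \<phi>n_def intro!: admissible_bound[OF adm])
 have \<phi>0: "\<bar>\<phi> z\<bar> <= (if fst z <= T0 + 1 then \<Lambda> * T0 else 0)" if "z \<in> Om" for z
  using that admissible_bound[OF adm, of "fst z" "snd z"] van[of "fst z" "snd z"] by (auto simp: Om_def)
 have Qb: "\<bar>Q m n i\<bar> <= \<Lambda>" for m n i
 proof -
  have "\<bar>\<phi>n m n (Suc i) - \<phi>n m n i\<bar> <= \<Lambda> * \<bar>real (Suc i) * h m - real i * h m\<bar>" unfolding \<phi>n_def by (rule lip)
  also have "\<bar>real (Suc i) * h m - real i * h m\<bar> = h m" by (simp add: algebra_simps)
  finally show ?thesis by (simp add: Q_def abs_divide pos_divide_le_eq)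
 qed
 have nodes: "(%m. real (idx (d m) (fst z)) * d m) \<longlonglongrightarrow> fst z" "(%m. real (idx (h m) (snd z)) * h m) \<longlonglongrightarrow> snd z" if "z \<in> Om" for z
  using that by (auto simp: Om_def intro!: idx_times_tendsto d_tendsto h_tendsto d(1))
 have OmAE: "AE z in MO. z \<in> Om" using AE_space[of MO] by simp
 have \<phi>m: "\<phi> \<in> borel_measurable MO" by (rule measurable_MO[OF admissible_measurable[OF adm]])
 have \<psi>m: "\<psi>n m \<in> borel_measurable MO" for m unfolding \<psi>n_def by (rule measurable_MO[OF step2_measurable])
 have \<psi>lim: "AE z in MO. (%m. \<psi>n m z) \<longlonglongrightarrow> \<phi> z"
  using OmAE
 proof eventually_elim
  case (elim z)
  then show ?case using admissible_tendsto[OF adm nodes[OF elim]] by (simp add: \<psi>n_def \<phi>n_def)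
 qed
 note dom = strip_dominated[OF \<psi>m \<phi>m \<psi>n0 \<phi>0 \<psi>lim]
 have key: "(%m. \<integral>z. \<psi>n m z * X H m z \<partial>MO) \<longlonglongrightarrow> - (\<integral>z. H (u z) * \<phi>x z \<partial>MO)" if H: "continuous_on UNIV H" for H
 proof -
  have Hm[measurable]: "H \<in> borel_measurable borel" by (rule borel_measurable_continuous_onI[OF H])
  obtain C where C: "0 <= C" "!!y. \<bar>y\<bar> <= M ==> \<bar>H y\<bar> <= C" by (rule continuous_bounded_range[OF H]) blast
  define R where "R = (%m n i. H (AA m (Suc n) i) * Q m n i)"
  define r where "r = (%m z. R m (idx (d m) (fst z)) (idx (h m) (snd z)))"
  have rm: "r m \<in> borel_measurable MO" for m unfolding r_def by (rule measurable_MO[OF step2_measurable])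
  have lm: "(%z. if fst z <= T0 + 1 then H (u z) * \<phi>x z else 0) \<in> borel_measurable MO"
   using measurable_MO[OF xm] by measurable
  have rb: "\<bar>r m z\<bar> <= (if fst z <= T0 + 1 then C * \<Lambda> else 0)" if z: "z \<in> Om" for m z
  proof (cases "fst z <= T0 + 1")
   case True
   have "\<bar>ud m z\<bar> <= M" using ud_bound[of "snd z" m "fst z"] z by (auto simp: Om_def)
   then have "\<bar>H (ud m z)\<bar> * \<bar>Q m (idx (d m) (fst z)) (idx (h m) (snd z))\<bar> <= C * \<Lambda>"
    using C Qb by (intro mult_mono) auto
   then show ?thesis using True by (simp add: r_def R_def ud_def abs_mult)
  next
   case False then show ?thesis using late[OF z] by (simp add: r_def R_def Q_def)
  qed
  have lb: "\<bar>if fst z <= T0 + 1 then H (u z) * \<phi>x z else 0\<bar> <= (if fst z <= T0 + 1 then C * \<Lambda> else 0)" for z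
   using C xb[of z] u_bound[of z] by (auto simp: abs_mult intro!: mult_mono)
  have \<phi>x0: "\<phi>x z = 0" if "C1_near \<phi> \<phi>t \<phi>x z" "\<not> fst z <= T0 + 1" for z
  proof -
   have "((%y. \<phi> (fst z, y)) has_real_derivative \<phi>x z) (at (snd z))"
    using that(1) unfolding C1_near_def by (metis dist_self)
   moreover have "(%y. \<phi> (fst z, y)) = (%_. 0)" using that(2) van by auto
   ultimately show ?thesis using DERIV_unique DERIV_const by metis
  qed
  have rlim: "AE z in MO. (%m. r m z) \<longlonglongrightarrow> (if fst z <= T0 + 1 then H (u z) * \<phi>x z else 0)"
   using OmAE good ud_AE
  proof eventually_elim
   case (elim z)
   have "(%m. (\<phi> (real (idx (d m) (fst z)) * d m, real (idx (h m) (snd z)) * h m + h m)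
     - \<phi> (real (idx (d m) (fst z)) * d m, real (idx (h m) (snd z)) * h m)) / h m) \<longlonglongrightarrow> \<phi>x (fst z, snd z)"
    by (rule C1_near_space_quotient[OF _ nodes[OF elim(1)] h_tendsto dx_pos]) (use elim in simp)
   then have "(%m. Q m (idx (d m) (fst z)) (idx (h m) (snd z))) \<longlonglongrightarrow> \<phi>x z"
    by (simp add: Q_def \<phi>n_def distrib_right add.commute)
   moreover have "(%m. H (ud m z)) \<longlonglongrightarrow> H (u z)"
    by (rule continuous_on_tendsto_compose[OF H elim(3)]) auto
   ultimately have "(%m. r m z) \<longlonglongrightarrow> H (u z) * \<phi>x z" unfolding r_def R_def ud_def by (intro tendsto_mult)
   then show ?case using \<phi>x0[OF elim(2)] by auto
  qed
  have lim: "(%m. - (\<integral>z. r m z \<partial>MO)) \<longlonglongrightarrow> - (\<integral>z. (if fst z <= T0 + 1 then H (u z) * \<phi>x z else 0) \<partial>MO)"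
   by (intro tendsto_minus strip_dominated(6)[OF rm lm rb lb rlim])
  have eq: "(\<integral>z. (if fst z <= T0 + 1 then H (u z) * \<phi>x z else 0) \<partial>MO) = (\<integral>z. H (u z) * \<phi>x z \<partial>MO)"
  proof (rule integral_cong_AE[OF lm])
   show "(%z. H (u z) * \<phi>x z) \<in> borel_measurable MO" using measurable_MO[OF xm] by measurable
   show "AE z in MO. (if fst z <= T0 + 1 then H (u z) * \<phi>x z else 0) = H (u z) * \<phi>x z"
    using good by eventually_elim (use \<phi>x0 in auto)
  qed
  have "(\<integral>z. \<psi>n m z * X H m z \<partial>MO) = - (\<integral>z. r m z \<partial>MO)" for m
  proof -
   define J where "J = Suc (idx (d m) T0)"
   have J: "\<phi>n m n i = 0" if "\<not> n < J" for n i
   proof -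
    have "T0 < (real (idx (d m) T0) + 1) * d m" by (rule idx_bounds(2)[OF d(1) \<Lambda>(2)])
    also have "... <= real n * d m" using that d(1)[of m] by (intro mult_right_mono) (auto simp: J_def)
    finally show ?thesis unfolding \<phi>n_def by (intro van) simp
   qed
   let ?q = "%n i. fd.quot (NN m) (AA m) H (Suc n) i"
   have parts: "(\<Sum>i\<le>NN m. \<phi>n m n i * ?q n i) = (\<Sum>i\<le>NN m. - R m n i)" for n
   proof -
    let ?H = "%i. H (AA m (Suc n) i)"
    have e0: "\<phi>n m n 0 = 0" "\<phi>n m n (Suc (NN m)) = 0" using dx_mult[of "NN m"] by (auto simp: \<phi>n_def bd add.commute)
    have "(\<Sum>i\<le>NN m. \<phi>n m n i * ?q n i) = (\<Sum>i\<le>NN m. (if i = 0 then 0 else \<phi>n m n i * (?H i - ?H (i - 1)))) / h m"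
     unfolding sum_divide_distrib by (intro sum.cong) (auto simp: fd.quot_def[OF fdm])
    also have "... = (\<Sum>i\<le>NN m. - R m n i)"
     unfolding summation_by_parts_zero[of "\<phi>n m n" ?H] e0 by (simp add: R_def Q_def sum_negf sum_divide_distrib)
    finally show ?thesis .
   qed
   have "(\<integral>z. \<psi>n m z * X H m z \<partial>MO) = (\<integral>z. (if idx (d m) (fst z) < J then (%n i. \<phi>n m n i * ?q n i) (idx (d m) (fst z)) (idx (h m) (snd z)) else 0) \<partial>MO)"
    by (rule lint_cong) (auto simp: \<psi>n_def X_def J)
   also have "... = d m * h m * (\<Sum>n<J. \<Sum>i\<le>NN m. \<phi>n m n i * ?q n i)" by (rule integral_MO_step(2)[OF d(1)])
   also have "... = d m * h m * (\<Sum>n<J. \<Sum>i\<le>NN m. - R m n i)" by (simp only: parts)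
   also have "... = - (d m * h m * (\<Sum>n<J. \<Sum>i\<le>NN m. R m n i))" by (simp add: sum_negf)
   also have "d m * h m * (\<Sum>n<J. \<Sum>i\<le>NN m. R m n i) = (\<integral>z. (if idx (d m) (fst z) < J then R m (idx (d m) (fst z)) (idx (h m) (snd z)) else 0) \<partial>MO)"
    by (rule integral_MO_step(2)[OF d(1), symmetric])
   also have "... = (\<integral>z. r m z \<partial>MO)"
    by (rule lint_cong) (auto simp: r_def R_def Q_def J)
   finally show ?thesis .
  qed
  then show ?thesis using lim unfolding eq by simp
 qed
 show "(\<integral>z. \<phi> z * q z \<partial>MO) = - (\<integral>z. G (u z) * \<phi>x z \<partial>MO)"
  by (rule weak_lim_integral(1)[OF wl dom(1-3) key]) (use lipschitz_on_continuous_on[OF fd.lip[OF fdm[of 0]]] in auto)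
 show "(\<integral>z. \<phi> z * p z \<partial>MO) = - (\<integral>z. g (u z) * \<phi>x z \<partial>MO)"
  by (rule weak_lim_integral(2)[OF wl dom(1-3) key[OF g_cont]]) auto
qed

text \<open>\<open>limit_inequality\<close> for \<open>\<eta>(y) = r y\<close> is linear in \<open>r\<close>, so \<open>r = \<plusminus>1\<close> give equality.\<close>

lemma weak_identity:
 assumes wl: "weak_lim q p" and adm: "admissible \<phi> \<phi>t \<phi>x \<Lambda> T0"
  and late: "!!z. T0 <= fst z ==> \<phi>t z = 0 \<and> \<phi>x z = 0"
 shows "(\<integral>z. k (snd z) * \<phi>x z * q z \<partial>MO) = (\<integral>z. u z * \<phi>t z \<partial>MO) + (\<integral>x. \<phi> (0, x) * ub x \<partial>m01)"
proof -
 have T0: "0 <= T0" "\<phi> (T0 + 1, x) = 0" for x using adm by (auto simp: admissible_def)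
 have le: "r * (\<integral>z. k (snd z) * \<phi>x z * q z \<partial>MO) <= r * ((\<integral>z. u z * \<phi>t z \<partial>MO) + (\<integral>x. \<phi> (0, x) * ub x \<partial>m01))" for r
 proof -
  have "(\<integral>z. (if fst z < T0 + 1 then k (snd z) * \<phi> z * (%_. 0) (u z) else 0) * (p z)^2 \<partial>MO)
    + (\<integral>z. (if fst z < T0 + 1 then k (snd z) * (%_. r) (u z) * \<phi>x z else 0) * q z \<partial>MO)
   <= (\<integral>z. (if fst z < T0 + 1 then (%y. r * y) (u z) * \<phi>t z else 0) \<partial>MO)
    + (\<integral>x. \<phi> (0, x) * (%y. r * y) (ub x) \<partial>m01) - (\<integral>x. \<phi> (T0 + 1, x) * (%y. r * y) (u (T0 + 1, x)) \<partial>m01)"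
   by (rule limit_inequality[OF wl adm]) (use T0(1) in \<open>auto intro!: derivative_eq_intros simp: algebra_simps\<close>)
  moreover have "(if fst z < T0 + 1 then k (snd z) * r * \<phi>x z else 0) * q z = r * (k (snd z) * \<phi>x z * q z)"
   "(if fst z < T0 + 1 then r * u z * \<phi>t z else 0) = r * (u z * \<phi>t z)" for z using late[of z] by auto
  moreover have "(if fst z < T0 + 1 then k (snd z) * \<phi> z * 0 else 0) * (p z)^2 = 0" for z by simp
  moreover have "\<phi> (0, x) * (r * ub x) = r * (\<phi> (0, x) * ub x)" for x by simp
  ultimately show ?thesis by (simp only: integral_mult_right_zero T0(2)) (simp add: distrib_left)
 qed
 from le[of 1] le[of "-1"] show ?thesis by simp
qed

end

section \<open>The trace of the flux\<close>

lemma emeasure_layer: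
 assumes "0 <= R" "0 < \<epsilon>"
 shows "{z \<in> Om. fst z <= R \<and> \<bar>snd z - a\<bar> < \<epsilon>} \<in> sets MO"
  and "measure MO {z \<in> Om. fst z <= R \<and> \<bar>snd z - a\<bar> < \<epsilon>} <= 2 * \<epsilon> * R"
  and "emeasure MO {z \<in> Om. fst z <= R \<and> \<bar>snd z - a\<bar> < \<epsilon>} < \<infinity>"
proof -
 let ?S = "{z \<in> Om. fst z <= R \<and> \<bar>snd z - a\<bar> < \<epsilon>}"
 have S: "?S = Om \<inter> ({..R} \<times> {a - \<epsilon><..<a + \<epsilon>})"
  by (rule set_eqI) (simp add: mem_Times_iff abs_less_iff, linarith)
 have Sb: "?S \<in> sets borel" unfolding S by (intro sets.Int Om_borel borel_Times) auto
 have "A \<in> sets MO" if "A \<in> sets borel" "A \<subseteq> Om" for A using that by (subst sets_restrict_space_iff) auto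
 from this[OF Sb] show "?S \<in> sets MO" by blast
 have sub: "?S \<subseteq> {0..R} \<times> {a - \<epsilon>..a + \<epsilon>}"
 proof
  fix z assume "z \<in> ?S"
  then have "0 <= fst z" "fst z <= R" "\<bar>snd z - a\<bar> < \<epsilon>" by (simp_all add: Om_def mem_Times_iff)
  then show "z \<in> {0..R} \<times> {a - \<epsilon>..a + \<epsilon>}" by (simp add: mem_Times_iff abs_less_iff)
 qed
 have "emeasure MO ?S = emeasure lborel ?S" by (rule emeasure_restrict_space) (simp, blast)
 also have "... <= emeasure lborel ({0..R} \<times> {a - \<epsilon>..a + \<epsilon>})" by (rule emeasure_mono[OF sub]) (auto intro: borel_Times)
 also have "... = emeasure lborel {0..R} * emeasure lborel {a - \<epsilon>..a + \<epsilon>}"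
  unfolding lborel_prod[symmetric] by (rule lborel.emeasure_pair_measure_Times) auto
 also have "... = ennreal (2 * \<epsilon> * R)" using assms by (simp add: mult_ac flip: ennreal_mult')
 finally have le: "emeasure MO ?S <= ennreal (2 * \<epsilon> * R)" .
 then show "emeasure MO ?S < \<infinity>" by (simp add: le_less_trans)
 have "enn2real (emeasure MO ?S) <= enn2real (ennreal (2 * \<epsilon> * R))" by (rule enn2real_mono[OF le]) simp
 then show "measure MO ?S <= 2 * \<epsilon> * R" using assms by (simp add: measure_def)
qed

lemma test_timeE:
 assumes "test_time \<psi>"
 obtains C R where "0 <= C" "0 <= R" "!!t. (\<psi> has_real_derivative deriv \<psi> t) (at t)" "continuous_on UNIV (deriv \<psi>)"
  "!!t. \<bar>\<psi> t\<bar> <= C" "!!t. \<bar>deriv \<psi> t\<bar> <= C" "!!t. R <= t ==> \<psi> t = 0 \<and> deriv \<psi> t = 0" "\<psi> 0 = 0"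
proof -
 obtain K where K: "compact K" "K \<subseteq> {0<..}" "!!t. t \<notin> K ==> \<psi> t = 0"
  and D: "!!n t. ((deriv ^^ n) \<psi>) differentiable (at t)"
  using assms by (auto simp: test_time_def)
 have D0: "(\<psi> has_real_derivative deriv \<psi> t) (at t)" for t using D[of 0 t] by (simp add: DERIV_deriv_iff_real_differentiable)
 have c0: "continuous_on UNIV \<psi>" using D[of 0] by (auto intro!: continuous_at_imp_continuous_on differentiable_imp_continuous_within)
 have c1: "continuous_on UNIV (deriv \<psi>)" using D[of 1] by (auto intro!: continuous_at_imp_continuous_on differentiable_imp_continuous_within)
 have out: "deriv \<psi> t = 0" if "t \<notin> K" for t
 proof -
  have "open (- K)" using K(1) by (simp add: compact_imp_closed open_Compl)
  then have "(\<psi> has_real_derivative 0) (at t)"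
   by (rule has_field_derivative_transform_within_open[of "%_. 0", rotated]) (use that K(3) in auto)
  then show ?thesis by (rule DERIV_imp_deriv)
 qed
 obtain C1 where C1: "0 <= C1" "!!t. \<bar>\<psi> t\<bar> <= C1" using bounded_of_compact_support[OF c0 K(1,3)] by blast
 obtain C2 where C2: "0 <= C2" "!!t. \<bar>deriv \<psi> t\<bar> <= C2" using bounded_of_compact_support[OF c1 K(1) out] by blast
 obtain R where R: "0 < R" "!!t. t \<in> K ==> norm t <= R" using compact_imp_bounded[OF K(1)] by (auto simp: bounded_pos)
 show thesis
 proof (rule that[of "max C1 C2" "R + 1"])
  show "\<psi> t = 0 \<and> deriv \<psi> t = 0" if "R + 1 <= t" for t
  proof -
   have "t \<notin> K" using R(2)[of t] that by auto
   then show ?thesis using K(3) out by blast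
  qed
  show "\<psi> 0 = 0" using K(2,3) by force
  show "\<bar>\<psi> t\<bar> <= max C1 C2" "\<bar>deriv \<psi> t\<bar> <= max C1 C2" for t using C1(2)[of t] C2(2)[of t] by auto
 qed (use C1 R D0 c1 in auto)
qed

text \<open>The flux through a boundary layer is tested with the hat function of height and half-width
 \<open>\<epsilon>\<close> over the endpoint, whose slope is \<open>\<plusminus>1\<close> in the layer.\<close>

lemma hat_admissible:
 assumes \<psi>: "!!t. (\<psi> has_real_derivative \<psi>' t) (at t)" "continuous_on UNIV \<psi>'"
  "!!t. \<bar>\<psi> t\<bar> <= C" "!!t. \<bar>\<psi>' t\<bar> <= C" "!!t. R <= t ==> \<psi> t = 0"
  and C: "0 <= C" "0 <= R" and \<epsilon>: "0 < \<epsilon>" "\<epsilon> < 1"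
 shows "admissible (%z. \<psi> (fst z) * max (\<epsilon> - \<bar>snd z - a\<bar>) 0) (%z. \<psi>' (fst z) * max (\<epsilon> - \<bar>snd z - a\<bar>) 0)
  (%z. \<psi> (fst z) * (if \<bar>snd z - a\<bar> < \<epsilon> then - sgn (snd z - a) else 0)) C R"
proof -
 define \<beta> where "\<beta> = (%x. max (\<epsilon> - \<bar>x - a\<bar>) 0)"
 define \<kappa> where "\<kappa> = (%x. if \<bar>x - a\<bar> < \<epsilon> then - sgn (x - a) else 0)"
 have \<beta>: "\<bar>\<beta> x\<bar> <= 1" "\<bar>\<beta> x - \<beta> y\<bar> <= \<bar>x - y\<bar>" and \<kappa>: "\<bar>\<kappa> x\<bar> <= 1" for x y
  using \<epsilon> by (auto simp: \<beta>_def \<kappa>_def sgn_if)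
 have cont: "continuous_on UNIV \<psi>" using \<psi>(1) by (auto intro!: continuous_at_imp_continuous_on DERIV_isCont)
 have c\<beta>: "continuous_on UNIV (%z::real\<times>real. \<psi>' (fst z) * \<beta> (snd z))"
  unfolding \<beta>_def by (intro continuous_intros continuous_on_compose2[OF \<psi>(2)]) auto
 have c\<psi>: "continuous_on UNIV (%z::real\<times>real. \<psi> (fst z) * c)" for c
  by (intro continuous_intros continuous_on_compose2[OF cont]) auto
 have near: "C1_near (%z. \<psi> (fst z) * \<beta> (snd z)) (%z. \<psi>' (fst z) * \<beta> (snd z)) (%z. \<psi> (fst z) * \<kappa> (snd z)) z"
  if z: "snd z \<noteq> a" "snd z \<noteq> a + \<epsilon>" "snd z \<noteq> a - \<epsilon>" for z
 proof -
  \<comment> \<open>within distance \<open>r\<close> no kink of the hat is crossed\<close>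
  define r where "r = min (\<bar>snd z - a\<bar>) (\<bar>\<epsilon> - \<bar>snd z - a\<bar>\<bar>)"
  have r: "0 < r" using z by (auto simp: r_def abs_if)
  have loc: "\<kappa> y = \<kappa> (snd z) \<and> \<beta> y = \<beta> (snd z) + \<kappa> (snd z) * (y - snd z)" if y: "\<bar>y - snd z\<bar> < r" for y
  proof -
   define x where "x = snd z"
   have y': "\<bar>y - x\<bar> < \<bar>x - a\<bar>" "\<bar>y - x\<bar> < \<bar>\<epsilon> - \<bar>x - a\<bar>\<bar>" using y by (auto simp: r_def x_def)
   consider "a < x" "x < a + \<epsilon>" | "a + \<epsilon> < x" | "x < a" "a - \<epsilon> < x" | "x < a - \<epsilon>"
    using z unfolding x_def by linarith
   then have "\<kappa> y = \<kappa> x \<and> \<beta> y = \<beta> x + \<kappa> x * (y - x)"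
   proof cases
    case 1
    then have "a < y" "y < a + \<epsilon>" using y' by linarith+
    then show ?thesis using 1 by (simp add: \<kappa>_def \<beta>_def)
   next
    case 2
    then have "a + \<epsilon> < y" using y' \<epsilon> by linarith
    then show ?thesis using 2 \<epsilon> by (simp add: \<kappa>_def \<beta>_def)
   next
    case 3
    then have "y < a" "a - \<epsilon> < y" using y' by linarith+
    then show ?thesis using 3 by (simp add: \<kappa>_def \<beta>_def)
   next
    case 4
    then have "y < a - \<epsilon>" using y' \<epsilon> by linarith
    then show ?thesis using 4 \<epsilon> by (simp add: \<kappa>_def \<beta>_def)
   qed
   then show ?thesis by (simp add: x_def)
  qed
  have "isCont (%z. \<psi>' (fst z) * \<beta> (snd z)) z" using c\<beta> continuous_on_eq_continuous_at[OF open_UNIV] by blast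
  moreover have "isCont (%z. \<psi> (fst z) * \<kappa> (snd z)) z"
  proof -
   have "eventually (%z'. dist z' z < r) (nhds z)" using r by (auto simp: eventually_nhds_metric)
   then have ev: "eventually (%z'. \<psi> (fst z') * \<kappa> (snd z') = \<psi> (fst z') * \<kappa> (snd z)) (nhds z)"
   proof eventually_elim
    case (elim z')
    then show ?case using loc[of "snd z'"] dist_snd_le[of z' z] by (simp add: dist_real_def)
   qed
   have "isCont (%z'. \<psi> (fst z') * \<kappa> (snd z)) z" using c\<psi> continuous_on_eq_continuous_at[OF open_UNIV] by blast
   then show ?thesis by (rule isCont_cong[OF ev, THEN iffD2])
  qed
  moreover have "((%s. \<psi> (fst (s, snd z')) * \<beta> (snd (s, snd z'))) has_real_derivative \<psi>' (fst z') * \<beta> (snd z')) (at (fst z'))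
    \<and> ((%y. \<psi> (fst (fst z', y)) * \<beta> (snd (fst z', y))) has_real_derivative \<psi> (fst z') * \<kappa> (snd z')) (at (snd z'))"
   if "dist z' z < r" for z'
  proof
   show "((%s. \<psi> (fst (s, snd z')) * \<beta> (snd (s, snd z'))) has_real_derivative \<psi>' (fst z') * \<beta> (snd z')) (at (fst z'))"
    by (auto intro!: derivative_eq_intros \<psi>(1))
   have y: "\<bar>snd z' - snd z\<bar> < r" using dist_snd_le[of z' z] that by (simp add: dist_real_def)
   have "((%y. \<psi> (fst z') * (\<beta> (snd z) + \<kappa> (snd z) * (y - snd z))) has_real_derivative \<psi> (fst z') * \<kappa> (snd z)) (at (snd z'))"
    by (auto intro!: derivative_eq_intros)
   then have "((%y. \<psi> (fst z') * \<beta> y) has_real_derivative \<psi> (fst z') * \<kappa> (snd z)) (at (snd z'))"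
   proof (rule has_field_derivative_transform_within_open[where S="ball (snd z) r"])
    show "snd z' \<in> ball (snd z) r" using y by (simp add: dist_real_def abs_minus_commute)
    fix x assume "x \<in> ball (snd z) r"
    then have "\<bar>x - snd z\<bar> < r" by (simp add: dist_real_def abs_minus_commute)
    from loc[OF this] show "\<psi> (fst z') * (\<beta> (snd z) + \<kappa> (snd z) * (x - snd z)) = \<psi> (fst z') * \<beta> x" by (simp only:)
   qed auto
   then show "((%y. \<psi> (fst (fst z', y)) * \<beta> (snd (fst z', y))) has_real_derivative \<psi> (fst z') * \<kappa> (snd z')) (at (snd z'))"
    using loc[OF y] by simp
  qed
  ultimately show ?thesis unfolding C1_near_def using r by blast
 qed
 have "admissible (%z. \<psi> (fst z) * \<beta> (snd z)) (%z. \<psi>' (fst z) * \<beta> (snd z)) (%z. \<psi> (fst z) * \<kappa> (snd z)) C R"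
  unfolding admissible_def fst_conv snd_conv
 proof (intro conjI allI impI)
  fix t s x y
  have "\<bar>\<psi> t - \<psi> s\<bar> * \<bar>\<beta> x\<bar> <= (C * \<bar>t - s\<bar>) * 1"
   by (intro mult_mono lipschitz_of_derivative_bound[OF \<psi>(1,4)] \<beta>) (use C in auto)
  then show "\<bar>\<psi> t * \<beta> x - \<psi> s * \<beta> x\<bar> <= C * \<bar>t - s\<bar>" by (simp add: abs_mult flip: left_diff_distrib)
  have "\<bar>\<psi> t\<bar> * \<bar>\<beta> x - \<beta> y\<bar> <= C * \<bar>x - y\<bar>" by (intro mult_mono \<beta> \<psi>) (use C in auto)
  then show "\<bar>\<psi> t * \<beta> x - \<psi> t * \<beta> y\<bar> <= C * \<bar>x - y\<bar>" by (simp add: abs_mult flip: right_diff_distrib)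
 next
  show "(%z. \<psi>' (fst z) * \<beta> (snd z)) \<in> borel_measurable borel" by (rule borel_measurable_continuous_onI[OF c\<beta>])
  have k1: "\<kappa> \<in> borel_measurable borel" unfolding \<kappa>_def by measurable
  have k2: "(%z::real\<times>real. \<kappa> (snd z)) \<in> borel_measurable borel"
   by (rule measurable_compose[OF _ k1]) (auto intro!: borel_measurable_continuous_onI continuous_intros)
  have k3: "(%z::real\<times>real. \<psi> (fst z)) \<in> borel_measurable borel" using borel_measurable_continuous_onI[OF c\<psi>[of 1]] by simp
  show "(%z. \<psi> (fst z) * \<kappa> (snd z)) \<in> borel_measurable borel" by (rule borel_measurable_times[OF k3 k2])
  show "\<bar>\<psi>' (fst z) * \<beta> (snd z)\<bar> <= C" for z
   using mult_mono[OF \<psi>(4)[of "fst z"] \<beta>(1)[of "snd z"]] C by (simp add: abs_mult)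
  show "\<bar>\<psi> (fst z) * \<kappa> (snd z)\<bar> <= C" for z
   using mult_mono[OF \<psi>(3)[of "fst z"] \<kappa>[of "snd z"]] C by (simp add: abs_mult)
  show "AE z in MO. C1_near (%z. \<psi> (fst z) * \<beta> (snd z)) (%z. \<psi>' (fst z) * \<beta> (snd z)) (%z. \<psi> (fst z) * \<kappa> (snd z)) z"
   using AE_MO_off_line(2)[of a] AE_MO_off_line(2)[of "a + \<epsilon>"] AE_MO_off_line(2)[of "a - \<epsilon>"]
   by eventually_elim (rule near)
 qed (use C \<psi> in auto)
 then show ?thesis by (simp add: \<beta>_def \<kappa>_def)
qed

context fd_limit
begin

text \<open>With the hat function as test function, the derivative in \<open>x\<close> equals \<open>\<plusminus>\<psi>\<close> on the layer and the other side
 of the weak identity is an integral of \<open>u \<psi>'\<close> times a function of size \<open>\<epsilon>\<close> over a layer of width \<open>\<epsilon>\<close>.\<close>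

lemma layer_flux_bound:
 assumes wl: "weak_lim q p"
  and \<psi>: "!!t. (\<psi> has_real_derivative deriv \<psi> t) (at t)" "continuous_on UNIV (deriv \<psi>)"
  "!!t. \<bar>\<psi> t\<bar> <= C" "!!t. \<bar>deriv \<psi> t\<bar> <= C" "!!t. R <= t ==> \<psi> t = 0 \<and> deriv \<psi> t = 0" "\<psi> 0 = 0"
  and C: "0 <= C" "0 <= R" and \<epsilon>: "0 < \<epsilon>" "\<epsilon> < 1" and a: "a = 0 \<or> a = 1"
 shows "\<bar>LINT z:{0..} \<times> (B \<inter> ball a \<epsilon>)|lebesgue. k (snd z) * q z * \<psi> (fst z)\<bar> <= 2 * M * C * R * \<epsilon>^2"
proof -
 let ?\<beta> = "%z::real\<times>real. max (\<epsilon> - \<bar>snd z - a\<bar>) 0"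
 let ?\<kappa> = "%z::real\<times>real. if \<bar>snd z - a\<bar> < \<epsilon> then - sgn (snd z - a) else 0"
 define \<sigma> where "\<sigma> = (if a = 0 then -1 else 1 :: real)"
 have \<sigma>: "\<bar>\<sigma>\<bar> = 1" by (simp add: \<sigma>_def)
 have [measurable]: "\<psi> \<in> borel_measurable borel" "deriv \<psi> \<in> borel_measurable borel" "q \<in> borel_measurable MO"
  using \<psi>(1,2) weak_lim_square(1)[OF wl]
  by (auto simp: L2_real intro!: borel_measurable_continuous_onI continuous_at_imp_continuous_on DERIV_isCont)
 note [measurable] = k_MO
 let ?f = "%z. if \<bar>snd z - a\<bar> < \<epsilon> then k (snd z) * q z * \<psi> (fst z) else 0"
 have \<psi>5: "!!t. R <= t ==> \<psi> t = 0" using \<psi>(5) by blast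
 have wi: "(\<integral>z. k (snd z) * (\<psi> (fst z) * ?\<kappa> z) * q z \<partial>MO) = (\<integral>z. u z * (deriv \<psi> (fst z) * ?\<beta> z) \<partial>MO)"
 proof -
  have "(\<integral>z. k (snd z) * (\<psi> (fst z) * ?\<kappa> z) * q z \<partial>MO) = (\<integral>z. u z * (deriv \<psi> (fst z) * ?\<beta> z) \<partial>MO)
   + (\<integral>x. \<psi> (fst (0::real, x)) * ?\<beta> (0, x) * ub x \<partial>m01)"
   by (rule weak_identity[OF wl hat_admissible[OF \<psi>(1-4) \<psi>5 C \<epsilon>]]) (use \<psi>(5) in \<open>simp_all\<close>)
  then show ?thesis using \<psi>(6) by simp
 qed
 have "(LINT z:{0..} \<times> (B \<inter> ball a \<epsilon>)|lebesgue. k (snd z) * q z * \<psi> (fst z)) = (LINT z:Om|lebesgue. ?f z)"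
  unfolding set_lebesgue_integral_def by (rule lint_cong) (auto simp: Om_def indicator_def dist_real_def)
 also have "... = (\<integral>z. ?f z \<partial>MO)" by (rule integral_MO_eq_lebesgue) measurable
 also have "... = (\<integral>z. \<sigma> * (k (snd z) * (\<psi> (fst z) * ?\<kappa> z) * q z) \<partial>MO)"
 proof (rule lint_cong[OF refl])
  fix z assume "z \<in> space MO"
  then have "z \<in> Om" by simp
  then have "sgn (snd z - a) = - \<sigma>" using a by (auto simp: Om_def \<sigma>_def)
  moreover have "\<sigma> * \<sigma> = 1" by (simp add: \<sigma>_def)
  ultimately show "?f z = \<sigma> * (k (snd z) * (\<psi> (fst z) * ?\<kappa> z) * q z)" by simp
 qed
 also have "... = \<sigma> * (\<integral>z. u z * (deriv \<psi> (fst z) * ?\<beta> z) \<partial>MO)"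
  by (simp only: integral_mult_right_zero wi)
 finally have e0: "(LINT z:{0..} \<times> (B \<inter> ball a \<epsilon>)|lebesgue. k (snd z) * q z * \<psi> (fst z))
  = \<sigma> * (\<integral>z. u z * (deriv \<psi> (fst z) * ?\<beta> z) \<partial>MO)" .
 have eq: "\<bar>LINT z:{0..} \<times> (B \<inter> ball a \<epsilon>)|lebesgue. k (snd z) * q z * \<psi> (fst z)\<bar>
  = \<bar>\<integral>z. u z * (deriv \<psi> (fst z) * ?\<beta> z) \<partial>MO\<bar>" unfolding e0 abs_mult \<sigma> by (rule mult_1_left)
 define S where "S = {z \<in> Om. fst z <= R \<and> \<bar>snd z - a\<bar> < \<epsilon>}"
 note S = emeasure_layer[OF C(2) \<epsilon>(1), of a, folded S_def]
 have Si: "integrable MO (%z. (M * C * \<epsilon>) * indicator S z)"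
  by (intro integrable_mult_right integrable_real_indicator S(1,3))
 have b: "\<bar>u z * (deriv \<psi> (fst z) * ?\<beta> z)\<bar> <= (M * C * \<epsilon>) * indicator S z" if z: "z \<in> Om" for z
 proof (cases "z \<in> S")
  case True
  have "\<bar>u z\<bar> * (\<bar>deriv \<psi> (fst z)\<bar> * \<bar>?\<beta> z\<bar>) <= M * (C * \<epsilon>)"
   using M0 C \<epsilon> by (intro mult_mono u_bound \<psi>) auto
  then show ?thesis using True by (simp add: abs_mult mult.assoc)
 next
  case False then have "deriv \<psi> (fst z) * ?\<beta> z = 0" using \<psi>(5)[of "fst z"] z by (cases "fst z <= R") (simp_all add: S_def)
  then show ?thesis using False by simp
 qed
 have "\<bar>\<integral>z. u z * (deriv \<psi> (fst z) * ?\<beta> z) \<partial>MO\<bar> <= (\<integral>z. \<bar>u z * (deriv \<psi> (fst z) * ?\<beta> z)\<bar> \<partial>MO)"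
  by (rule integral_abs_bound)
 also have "... <= (\<integral>z. (M * C * \<epsilon>) * indicator S z \<partial>MO)"
  by (rule Bochner_Integration.integral_mono_AE'[OF Si]) (use b M0 C \<epsilon> in \<open>auto intro!: AE_I2\<close>)
 also have "... = (M * C * \<epsilon>) * measure MO S"
 proof -
  have "S \<inter> space MO = S" unfolding space_MO by (auto simp only: S_def)
  then show ?thesis by simp
 qed
 also have "... <= (M * C * \<epsilon>) * (2 * \<epsilon> * R)" using S(2) M0 C \<epsilon> by (intro mult_left_mono) auto
 finally show ?thesis unfolding eq by (simp add: power2_eq_square mult_ac)
qed

lemma zero_trace:
 assumes wl: "weak_lim q p" and a: "a = 0 \<or> a = 1"
 shows "has_trace (%z. k (snd z) * q z) a (%_. 0)"
 unfolding has_trace_def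
proof (intro conjI allI impI)
 show "L1loc_on {0<..} (%_. 0 :: real)" by (simp add: L1loc_on_def set_integrable_def)
 fix \<psi> assume "test_time \<psi>"
 then obtain C R where C: "0 <= C" "0 <= R" and
  \<psi>: "!!t. (\<psi> has_real_derivative deriv \<psi> t) (at t)" "continuous_on UNIV (deriv \<psi>)"
  "!!t. \<bar>\<psi> t\<bar> <= C" "!!t. \<bar>deriv \<psi> t\<bar> <= C" "!!t. R <= t ==> \<psi> t = 0 \<and> deriv \<psi> t = 0" "\<psi> 0 = 0"
  by (rule test_timeE) blast
 let ?I = "%\<epsilon>. LINT z:{0..} \<times> (B \<inter> ball a \<epsilon>)|lebesgue. k (snd z) * q z * \<psi> (fst z)"
 have "((%\<epsilon>. 1 / \<epsilon> * ?I \<epsilon>) \<longlongrightarrow> 0) (at_right 0)"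
 proof (rule Lim_null_comparison)
  have "eventually (%\<epsilon>::real. 0 < \<epsilon> \<and> \<epsilon> < 1) (at_right 0)"
   using eventually_at_right_less eventually_at_rightI[of 0 "1::real" "%\<epsilon>. 0 < \<epsilon> \<and> \<epsilon> < 1"] by auto
  then show "eventually (%\<epsilon>. norm (1 / \<epsilon> * ?I \<epsilon>) <= 2 * M * C * R * \<epsilon>) (at_right 0)"
  proof eventually_elim
   case (elim \<epsilon>)
   then have "\<bar>?I \<epsilon>\<bar> <= 2 * M * C * R * \<epsilon>^2" using layer_flux_bound[OF wl \<psi> C _ _ a] by blast
   then have "\<bar>?I \<epsilon>\<bar> / \<epsilon> <= 2 * M * C * R * \<epsilon>^2 / \<epsilon>" using elim by (intro divide_right_mono) auto
   then show ?case using elim by (simp add: abs_mult power2_eq_square)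
  qed
  have "((%\<epsilon>. 2 * M * C * R * \<epsilon>) \<longlongrightarrow> 2 * M * C * R * 0) (at_right 0)" by (intro tendsto_intros)
  then show "((%\<epsilon>. 2 * M * C * R * \<epsilon>) \<longlongrightarrow> 0) (at_right 0)" by simp
 qed
 then show "((%\<epsilon>. 1 / \<epsilon> * ?I \<epsilon>) \<longlongrightarrow> (LINT t:{0..}|lebesgue. 0 * \<psi> t)) (at_right 0)"
  by (simp add: set_lebesgue_integral_def)
qed

end

section \<open>The entropy solution\<close>

context fd_limit
begin

lemma L1loc_continuous_u:
 assumes H: "continuous_on UNIV H"
 shows "L1loc_on ({0<..} \<times> B) (%z. H (u z))"
proof (rule L1loc_strip_L2)
 have Hm: "H \<in> borel_measurable borel" by (rule borel_measurable_continuous_onI[OF H])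
 obtain C where C: "0 <= C" "!!y. \<bar>y\<bar> <= M ==> \<bar>H y\<bar> <= C" by (rule continuous_bounded_range[OF H]) blast
 show [measurable]: "(%z. H (u z)) \<in> borel_measurable MO" by (rule measurable_compose[OF u_MO Hm])
 show "L2 MO (%z. if fst z <= T then H (u z) else 0)" for T
 proof (rule L2_strip(1)[of _ T C])
  show "\<bar>if fst z <= T then H (u z) else 0\<bar> <= (if fst z <= T then C else 0)" for z
   using C(2)[OF u_bound[of z]] by simp
 qed measurable
qed

lemma L1loc_of_L2:
 assumes "L2 MO f"
 shows "L1loc_on ({0<..} \<times> B) f"
proof (rule L1loc_strip_L2)
 have f[measurable]: "f \<in> borel_measurable MO" and i: "integrable MO (%z. (f z)^2)" using assms by (auto simp: L2_real)
 show "f \<in> borel_measurable MO" by (rule f)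
 show "L2 MO (%z. if fst z <= T then f z else 0)" for T
  unfolding L2_real
 proof
  show "integrable MO (%z. (if fst z <= T then f z else 0)^2)"
   by (rule dominated_integrable[OF i]) auto
 qed measurable
qed

lemma weak_Dx_limit:
 assumes wl: "weak_lim q p"
 shows "weak_Dx (%z. G (u z)) q" "weak_Dx (%z. g (u z)) p"
proof -
 note sq = weak_lim_square[OF wl]
 have [measurable]: "q \<in> borel_measurable MO" "p \<in> borel_measurable MO" using sq by (auto simp: L2_real)
 have Gc: "continuous_on UNIV G" by (rule lipschitz_on_continuous_on[OF fd.lip[OF fdm[of 0]]])
 have [measurable]: "G \<in> borel_measurable borel" "g \<in> borel_measurable borel"
  using Gc g_cont by (auto intro: borel_measurable_continuous_onI)
 have "(LINT z:Om|lebesgue. G (u z) * Dx \<phi> z) = - (LINT z:Om|lebesgue. q z * \<phi> z)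
   \<and> (LINT z:Om|lebesgue. g (u z) * Dx \<phi> z) = - (LINT z:Om|lebesgue. p z * \<phi> z)"
  if t: "test_on ({0<..} \<times> B) \<phi>" for \<phi>
 proof -
  obtain \<Lambda> T0 where adm: "admissible \<phi> (Dt \<phi>) (Dx \<phi>) \<Lambda> T0" and zero: "!!z. z \<notin> {0<..} \<times> B ==> \<phi> z = 0"
   by (rule test_on_admissible[OF t]) blast
  have [measurable]: "\<phi> \<in> borel_measurable MO" "Dx \<phi> \<in> borel_measurable MO"
   using adm admissible_measurable[OF adm] by (auto simp: admissible_def intro: measurable_MO)
  have "(\<integral>z. \<phi> z * q z \<partial>MO) = - (\<integral>z. G (u z) * Dx \<phi> z \<partial>MO)" "(\<integral>z. \<phi> z * p z \<partial>MO) = - (\<integral>z. g (u z) * Dx \<phi> z \<partial>MO)"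
   by (rule weak_derivative[OF wl adm], use zero in auto)+
  then show ?thesis by (simp add: integral_MO_eq_lebesgue mult.commute[of _ "\<phi> _"])
 qed
 then show "weak_Dx (%z. G (u z)) q" "weak_Dx (%z. g (u z)) p"
  unfolding weak_Dx_def using L1loc_continuous_u[OF Gc] L1loc_continuous_u[OF g_cont] L1loc_of_L2 sq by blast+
qed

lemma initial_integral:
 fixes \<eta> :: "real => real" and \<phi> :: "real \<times> real => real"
 assumes ae: "AE x in lebesgue. x \<in> {0..1} --> u0 x = ub x"
  and m: "\<eta> \<in> borel_measurable borel" "\<phi> \<in> borel_measurable borel"
 shows "(LINT x:B|lebesgue. \<eta> (u0 x) * \<phi> (0, x)) = (\<integral>x. \<phi> (0::real, x) * \<eta> (ub x) \<partial>m01)"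
proof -
 have "(%x. \<eta> (ub x) * \<phi> (0, x)) \<in> borel_measurable borel"
  by (intro borel_measurable_times measurable_compose[OF ub(1) m(1)] measurable_compose[OF _ m(2)])
    (auto intro!: borel_measurable_continuous_onI continuous_intros)
 then have "(LINT x:B|lebesgue. \<eta> (u0 x) * \<phi> (0, x)) = (\<integral>x. indicator B x * (\<eta> (ub x) * \<phi> (0, x)) \<partial>m01)"
  by (rule lebesgue_integral_borel_version[OF ae, of "%y x. \<eta> y * \<phi> (0, x)"]) auto
 also have "... = (\<integral>x. \<phi> (0, x) * \<eta> (ub x) \<partial>m01)" by (rule lint_cong) auto
 finally show ?thesis .
qed

lemma k_bounded: "z \<in> Om ==> \<bar>k (snd z)\<bar> <= k1"
 using fd.k_bounds[OF fdm[of 0], of "snd z"] k01 by (auto simp: Om_def)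

lemma weak_solution_limit:
 assumes wl: "weak_lim q p" and ae: "AE x in lebesgue. x \<in> {0..1} --> u0 x = ub x"
 shows "weak_solution_with G k u0 u q"
 unfolding weak_solution_with_def
proof (intro conjI allI impI)
 note sq = weak_lim_square[OF wl]
 have qm[measurable]: "q \<in> borel_measurable MO" and qi: "integrable MO (%z. (q z)^2)" using sq by (auto simp: L2_real)
 note [measurable] = k_MO
 have "set_borel_measurable lebesgue Om u"
  unfolding set_borel_measurable_def by (rule measurable_completion[OF MO_indicator_measurable[OF u_MO]])
 then show "Linf_on Om u" unfolding Linf_on_def by (intro conjI exI[of _ M]) (use u_bound in auto)
 show "\<forall>a\<in>{0, 1}. \<exists>\<tau>. has_trace (%z. k (snd z) * q z) a \<tau> \<and> (AE t in lebesgue. 0 < t --> \<tau> t = 0)"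
  using zero_trace[OF wl] by (intro ballI exI[of _ "%_. 0"]) auto
 fix \<phi> assume "test_Om \<phi>"
 then obtain \<Lambda> T0 where adm: "admissible \<phi> (Dt \<phi>) (Dx \<phi>) \<Lambda> T0" and late: "!!z. T0 <= fst z ==> Dt \<phi> z = 0 \<and> Dx \<phi> z = 0"
  by (rule test_on_admissible) blast
 have \<Lambda>: "0 <= \<Lambda>" "!!z. \<bar>Dt \<phi> z\<bar> <= \<Lambda>" "!!z. \<bar>Dx \<phi> z\<bar> <= \<Lambda>" using adm unfolding admissible_def by blast+
 have [measurable]: "Dt \<phi> \<in> borel_measurable MO" "Dx \<phi> \<in> borel_measurable MO"
  using adm by (auto simp: admissible_def intro: measurable_MO)
 have i1: "integrable MO (%z. u z * Dt \<phi> z)"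
 proof (rule L2_strip(2)[of _ T0 "M * \<Lambda>"])
  show "\<bar>u z * Dt \<phi> z\<bar> <= (if fst z <= T0 then M * \<Lambda> else 0)" for z
   using late[of z] mult_mono[OF u_bound[of z] \<Lambda>(2)[of z]] M0 by (simp add: abs_mult)
 qed measurable
 have "L2 MO (%z. k (snd z) * Dx \<phi> z)"
 proof (rule L2_strip(1)[of _ T0 "k1 * \<Lambda>"])
  show "\<bar>k (snd z) * Dx \<phi> z\<bar> <= (if fst z <= T0 then k1 * \<Lambda> else 0)" if "z \<in> Om" for z
   using late[of z] mult_mono[OF k_bounded[OF that] \<Lambda>(3)[of z]] k01 by (simp add: abs_mult)
 qed measurable
 then have i2: "integrable MO (%z. k (snd z) * Dx \<phi> z * q z)"
  using qi by (intro integrable_mult_of_squares) (auto simp: L2_real)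
 have "(LINT z:Om|lebesgue. u z * Dt \<phi> z - k (snd z) * q z * Dx \<phi> z) = (\<integral>z. u z * Dt \<phi> z - k (snd z) * q z * Dx \<phi> z \<partial>MO)"
  by (rule integral_MO_eq_lebesgue) measurable
 also have "... = (\<integral>z. u z * Dt \<phi> z - k (snd z) * Dx \<phi> z * q z \<partial>MO)" by (simp add: mult_ac)
 also have "... = (\<integral>z. u z * Dt \<phi> z \<partial>MO) - (\<integral>z. k (snd z) * Dx \<phi> z * q z \<partial>MO)"
  by (rule Bochner_Integration.integral_diff[OF i1 i2])
 finally show "(LINT z:Om|lebesgue. u z * Dt \<phi> z - k (snd z) * q z * Dx \<phi> z) + (LINT x:B|lebesgue. u0 x * \<phi> (0, x)) = 0"
  using weak_identity[OF wl adm late] initial_integral[OF ae, of "%y. y" \<phi>] admissible_measurable[OF adm] by simp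
qed (use u_C_L1 weak_Dx_limit(1)[OF wl] L2_on_OmT weak_lim_square[OF wl] in auto)

lemma entropy_inequality_limit:
 assumes wl: "weak_lim q p" and ae: "AE x in lebesgue. x \<in> {0..1} --> u0 x = ub x"
  and \<eta>: "C2 \<eta>" "convex_on UNIV \<eta>" and \<phi>: "test_Om \<phi>" "\<forall>z\<in>Om. 0 <= \<phi> z" and T: "0 < T"
 shows "(LINT z:OmT T|lebesgue. \<eta> (u z) * Dt \<phi> z - deriv \<eta> (u z) * k (snd z) * q z * Dx \<phi> z)
      - (LINT x:B|lebesgue. \<eta> (u (T, x)) * \<phi> (T, x)) + (LINT x:B|lebesgue. \<eta> (u0 x) * \<phi> (0, x))
      \<ge> (LINT z:OmT T|lebesgue. deriv (deriv \<eta>) (u z) * k (snd z) * (p z)^2 * \<phi> z)"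
proof -
 note sq = weak_lim_square[OF wl]
 have qm[measurable]: "q \<in> borel_measurable MO" "p \<in> borel_measurable MO" and qi: "integrable MO (%z. (q z)^2)"
  using sq by (auto simp: L2_real)
 note [measurable] = k_MO
 obtain \<Lambda> T0 where adm: "admissible \<phi> (Dt \<phi>) (Dx \<phi>) \<Lambda> T0" and zero: "!!z. z \<notin> UNIV \<times> B ==> \<phi> z = 0"
  using \<phi>(1) by (rule test_on_admissible) blast
 have \<Lambda>: "0 <= \<Lambda>" "!!z. \<bar>Dt \<phi> z\<bar> <= \<Lambda>" "!!z. \<bar>Dx \<phi> z\<bar> <= \<Lambda>" using adm unfolding admissible_def by blast+
 have \<phi>b: "\<phi> \<in> borel_measurable borel" by (rule admissible_measurable[OF adm])
 have [measurable]: "Dt \<phi> \<in> borel_measurable MO" "Dx \<phi> \<in> borel_measurable MO" "\<phi> \<in> borel_measurable MO"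
  using adm \<phi>b by (auto simp: admissible_def intro: measurable_MO)
 have \<phi>0: "0 <= \<phi> (t, x)" if "0 <= t" for t x
  using \<phi>(2) zero[of "(t, x)"] that by (cases "x \<in> B") (auto simp: Om_def)
 have e1: "(\<eta> has_real_derivative deriv \<eta> x) (at x)" and e2: "(deriv \<eta> has_real_derivative deriv (deriv \<eta>) x) (at x)"
  and e3: "continuous_on UNIV (deriv (deriv \<eta>))" for x
  using \<eta>(1) by (auto simp: C2_def DERIV_deriv_iff_real_differentiable)
 have tang: "deriv \<eta> a * (b - a) <= \<eta> b - \<eta> a" for a b
  using convex_on_imp_above_tangent[OF \<eta>(2), of a b "deriv \<eta> a"] e1[of a] by simp
 have "mono_on UNIV (deriv \<eta>)"
 proof (rule mono_onI)
  fix a b :: real assume ab: "a <= b"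
  have "deriv \<eta> a * (b - a) <= deriv \<eta> b * (b - a)" using tang[of a b] tang[of b a] by (simp add: algebra_simps)
  then show "deriv \<eta> a <= deriv \<eta> b" using ab by (cases "a = b") auto
 qed
 then have e2_nonneg: "0 <= deriv (deriv \<eta>) a" for a
  by (rule mono_on_imp_deriv_nonneg[OF _ e2]) simp
 have cont: "continuous_on UNIV \<eta>" "continuous_on UNIV (deriv \<eta>)"
  by (auto intro!: continuous_at_imp_continuous_on DERIV_isCont e1 e2)
 have \<eta>m[measurable]: "\<eta> \<in> borel_measurable borel" "deriv \<eta> \<in> borel_measurable borel" "deriv (deriv \<eta>) \<in> borel_measurable borel"
  using cont e3 by (auto intro: borel_measurable_continuous_onI)
 have main: "(\<integral>z. (if fst z < T then k (snd z) * \<phi> z * deriv (deriv \<eta>) (u z) else 0) * (p z)^2 \<partial>MO)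
   + (\<integral>z. (if fst z < T then k (snd z) * deriv \<eta> (u z) * Dx \<phi> z else 0) * q z \<partial>MO)
  <= (\<integral>z. (if fst z < T then \<eta> (u z) * Dt \<phi> z else 0) \<partial>MO)
   + (\<integral>x. \<phi> (0, x) * \<eta> (ub x) \<partial>m01) - (\<integral>x. \<phi> (T, x) * \<eta> (u (T, x)) \<partial>m01)"
 proof (rule limit_inequality[OF wl adm T e1 e2 e3])
  fix a b t x :: real assume t: "0 <= t"
  have "\<eta> a - \<eta> b <= deriv \<eta> a * (a - b)" using tang[of a b] by (simp add: algebra_simps)
  then show "\<phi> (t, x) * (\<eta> a - \<eta> b) <= \<phi> (t, x) * deriv \<eta> a * (a - b)"
   unfolding mult.assoc using \<phi>0[OF t] by (rule mult_left_mono)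
  show "0 <= \<phi> (t, x) * deriv (deriv \<eta>) a" using \<phi>0[OF t] e2_nonneg by simp
 qed
 obtain Ca where Ca: "0 <= Ca" "!!y. \<bar>y\<bar> <= M ==> \<bar>\<eta> y\<bar> <= Ca" by (rule continuous_bounded_range[OF cont(1)]) blast
 obtain Cb where Cb: "0 <= Cb" "!!y. \<bar>y\<bar> <= M ==> \<bar>deriv \<eta> y\<bar> <= Cb" by (rule continuous_bounded_range[OF cont(2)]) blast
 have i1: "integrable MO (%z. if fst z < T then \<eta> (u z) * Dt \<phi> z else 0)"
 proof (rule L2_strip(2)[of _ T "Ca * \<Lambda>"])
  show "\<bar>if fst z < T then \<eta> (u z) * Dt \<phi> z else 0\<bar> <= (if fst z <= T then Ca * \<Lambda> else 0)" for z
   using mult_mono[OF Ca(2)[OF u_bound[of z]] \<Lambda>(2)[of z]] Ca(1) \<Lambda>(1) by (simp add: abs_mult)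
 qed measurable
 have "L2 MO (%z. if fst z < T then k (snd z) * deriv \<eta> (u z) * Dx \<phi> z else 0)"
 proof (rule L2_strip(1)[of _ T "k1 * Cb * \<Lambda>"])
  show "\<bar>if fst z < T then k (snd z) * deriv \<eta> (u z) * Dx \<phi> z else 0\<bar> <= (if fst z <= T then k1 * Cb * \<Lambda> else 0)" if "z \<in> Om" for z
   using mult_mono[OF mult_mono[OF k_bounded[OF that] Cb(2)[OF u_bound[of z]]] \<Lambda>(3)[of z]] Cb(1) \<Lambda>(1) k01 by (simp add: abs_mult)
 qed measurable
 then have i2: "integrable MO (%z. (if fst z < T then k (snd z) * deriv \<eta> (u z) * Dx \<phi> z else 0) * q z)"
  using qi by (intro integrable_mult_of_squares) (auto simp: L2_real)
 have 1: "(LINT z:OmT T|lebesgue. \<eta> (u z) * Dt \<phi> z - deriv \<eta> (u z) * k (snd z) * q z * Dx \<phi> z)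
  = (\<integral>z. (if fst z < T then \<eta> (u z) * Dt \<phi> z else 0) \<partial>MO) - (\<integral>z. (if fst z < T then k (snd z) * deriv \<eta> (u z) * Dx \<phi> z else 0) * q z \<partial>MO)"
  unfolding Bochner_Integration.integral_diff[OF i1 i2, symmetric]
  by (subst integral_OmT_eq_lebesgue, measurable) (rule lint_cong, auto)
 have 2: "(LINT z:OmT T|lebesgue. deriv (deriv \<eta>) (u z) * k (snd z) * (p z)^2 * \<phi> z)
  = (\<integral>z. (if fst z < T then k (snd z) * \<phi> z * deriv (deriv \<eta>) (u z) else 0) * (p z)^2 \<partial>MO)"
  by (subst integral_OmT_eq_lebesgue, measurable) (rule lint_cong, auto)
 have 3: "(LINT x:B|lebesgue. \<eta> (u (T, x)) * \<phi> (T, x)) = (\<integral>x. \<phi> (T, x) * \<eta> (u (T, x)) \<partial>m01)"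
 proof -
  have "(%x. \<phi> (T, x)) \<in> borel_measurable m01"
   by (intro measurable_m01 measurable_compose[OF _ \<phi>b]) (auto intro!: borel_measurable_continuous_onI continuous_intros)
  then have "(LINT x:B|lebesgue. \<eta> (u (T, x)) * \<phi> (T, x)) = (\<integral>x. \<eta> (u (T, x)) * \<phi> (T, x) \<partial>m01)"
   by (intro integral_m01_eq_lebesgue borel_measurable_times measurable_compose[OF u_slice_measurable' \<eta>m(1)])
  then show ?thesis by (simp add: mult.commute)
 qed
 show ?thesis unfolding 1 2 3 initial_integral[OF ae \<eta>m(1) \<phi>b] using main by linarith
qed

end

lemma C1_01_bounds:
 assumes k: "C1_01 k" and pos: "\<forall>x\<in>{0..1}. 0 < k x"
 obtains k0 k1 K where "0 < k0" "!!x. x \<in> {0..1} ==> k0 <= k x \<and> k x <= k1"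
  "!!x y. x \<in> {0..1} ==> y \<in> {0..1} ==> \<bar>k x - k y\<bar> <= K * \<bar>x - y\<bar>"
proof -
 obtain k' where k': "!!x. x \<in> {0..1} ==> (k has_real_derivative k' x) (at x within {0..1})" and c': "continuous_on {0..1} k'"
  using k unfolding C1_01_def by blast
 have c: "continuous_on {0..1} k" using k' by (rule DERIV_continuous_on)
 obtain x0 where x0: "x0 \<in> {0..1}" "!!x. x \<in> {0..1} ==> k x0 <= k x"
  using continuous_attains_inf[OF _ _ c] by auto
 obtain x1 where x1: "x1 \<in> {0..1}" "!!x. x \<in> {0..1} ==> k x <= k x1"
  using continuous_attains_sup[OF _ _ c] by auto
 have "bounded (k' ` {0..1})" by (rule compact_imp_bounded[OF compact_continuous_image[OF c']]) simp
 then obtain K where K: "!!x. x \<in> {0..1} ==> norm (k' x) <= K" unfolding bounded_iff by blast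
 show thesis
 proof (rule that[of "k x0" "k x1" K])
  show "\<bar>k x - k y\<bar> <= K * \<bar>x - y\<bar>" if "x \<in> {0..1}" "y \<in> {0..1}" for x y
   using field_differentiable_bound[of "{0..1}" k k' K x y] k' K that by simp
 qed (use x0 x1 pos in auto)
qed

theorem theorem4p2:
  fixes G k u0 :: "real \<Rightarrow> real" and N :: "real \<Rightarrow> nat" and c :: real
  assumes "mono G" and "\<exists>L. L-lipschitz_on UNIV G"
    and "C1_01 k" and "\<forall>x\<in>{0..1}. 0 < k x"
    and "BV01 u0" and "Linf_on {0..1} u0"
    and "\<forall>dt>0. 1 \<le> N dt"
    and "0 < c" and "\<forall>dt>0. c \<le> dt / (dx (N dt))\<^sup>2"
  shows "\<exists>u. entropy_solution G k u0 u \<and>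
    (\<forall>T>0. uniform_limit {0..T}
       (\<lambda>dt t. LINT x:B|lebesgue. \<bar>u_dt G k u0 (N dt) dt (t, x) - u (t, x)\<bar>) (\<lambda>t. 0) (at_right 0))"
proof -
 obtain L where L: "L-lipschitz_on UNIV G" using assms(2) by blast
 obtain k0 k1 K where k: "0 < k0" "!!x. x \<in> {0..1} ==> k0 <= k x \<and> k x <= k1"
  "!!x y. x \<in> {0..1} ==> y \<in> {0..1} ==> \<bar>k x - k y\<bar> <= K * \<bar>x - y\<bar>"
  by (rule C1_01_bounds[OF assms(3,4)]) blast
 obtain M ub where ub: "0 <= M" "ub \<in> borel_measurable borel" "!!x. \<bar>ub x\<bar> <= M"
  and ae: "AE x in lebesgue. x \<in> {0..1} --> u0 x = ub x"
  by (rule bounded_borel_version[OF assms(6)]) blast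
 obtain V where V0: "\<forall>\<phi>. (\<forall>x. \<phi> differentiable (at x)) \<and> continuous_on UNIV (deriv \<phi>) \<and>
   (\<exists>K. compact K \<and> K \<subseteq> B \<and> (\<forall>x. x \<notin> K --> \<phi> x = 0)) \<and> (\<forall>x. \<bar>\<phi> x\<bar> <= 1)
   --> (LINT x:{0..1}|lebesgue. u0 x * deriv \<phi> x) <= V"
  using assms(5)[unfolded BV01_def, THEN conjunct2] by (rule exE)
 note V = V0[THEN spec, THEN mp, OF conjI[OF _ conjI[OF _ conjI]]]
 define A where "A = (%dt n i. scheme G k u0 (N dt) dt n (int i))"
 note inst = scheme_fd[OF assms(1) L k V ub(2,3) ae]
 interpret F: fd_limit G k L k0 k1 K M V "prim ub" c N A ub "gfun G"
 proof (rule fd_limit.intro, rule fd_family.intro, rule_tac [4] fd_limit_axioms.intro)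
  show "fd G k L k0 k1 K M V (prim ub) dt (N dt) (A dt)" if "0 < dt" for dt
   unfolding A_def by (rule inst(1), assumption+, rule that)
  show "A dt 0 i = 1 / dx (N dt) * (\<integral>x. indicator (cell (N dt) i) x * ub x \<partial>m01)" if "0 < dt" "i <= N dt" for dt i
   unfolding A_def by (rule inst(2), assumption+, rule that(1), rule that(2))
 qed (use assms(8,9) ub gfun_diff_square_le[OF assms(1) L] continuous_on_gfun[OF assms(1) L] in auto)
 obtain q p where wl: "F.weak_lim q p" using F.weak_lim_exists by blast
 have "entropy_solution G k u0 F.u"
  unfolding entropy_solution_def
  using F.weak_solution_limit[OF wl ae] F.weak_Dx_limit(2)[OF wl] L2_on_OmT[OF F.weak_lim_square(2)[OF wl]]
   F.entropy_inequality_limit[OF wl ae] by blast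
 moreover have "uniform_limit {0..T} (%dt t. LINT x:B|lebesgue. \<bar>u_dt G k u0 (N dt) dt (t, x) - F.u (t, x)\<bar>) (%t. 0) (at_right 0)"
  if T: "0 < T" for T
 proof -
  have eq: "(\<integral>x. \<bar>F.v dt t x - F.u (t, x)\<bar> \<partial>m01) = (LINT x:B|lebesgue. \<bar>u_dt G k u0 (N dt) dt (t, x) - F.u (t, x)\<bar>)"
   if "0 < dt" for dt t
  proof -
   have "(\<integral>x. \<bar>F.v dt t x - F.u (t, x)\<bar> \<partial>m01) = (LINT x:B|lebesgue. \<bar>F.v dt t x - F.u (t, x)\<bar>)"
    by (rule integral_m01_eq_lebesgue[symmetric]) measurable
   also have "... = (LINT x:B|lebesgue. \<bar>u_dt G k u0 (N dt) dt (t, x) - F.u (t, x)\<bar>)"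
    unfolding set_lebesgue_integral_def
   proof (rule lint_cong[OF refl])
    fix x :: real
    show "indicator B x *\<^sub>R \<bar>F.v dt t x - F.u (t, x)\<bar> = indicator B x *\<^sub>R \<bar>u_dt G k u0 (N dt) dt (t, x) - F.u (t, x)\<bar>"
    proof (cases "x \<in> B")
     case True
     then have "0 <= \<lfloor>x / dx (N dt)\<rfloor>" by (simp add: less_imp_le)
     then have "F.v dt t x = u_dt G k u0 (N dt) dt (t, x)"
      unfolding F.v_def by (simp add: A_def u_dt_def idx_def)
     then show ?thesis by simp
    qed simp
   qed
   finally show ?thesis .
  qed
  show ?thesis
   by (rule uniform_limit_cong[THEN iffD1, OF _ _ F.v_uniform_limit[OF T]])
     (use eq in \<open>auto simp: eventually_at_filter\<close>)
 qed
 ultimately show ?thesis by blast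
qed

end
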